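(* Let $\mathbb{K}$ be a field, let $q\in\mathbb{K}$ be a nonzero element having a square root $q^{1/2}$ in $\mathbb{K}$, and let $n,s,t$ be integers with $1\leq s\leq t\leq n-2$. Then the quantum Schubert cell of the Grassmannian $\mathrm{Gr}(2,n)$ associated to the partition $(t,s)$ is a quantum cluster algebra of type $A_{s-1}$.
   Context: Quantum Schubert cell. The quantum matrix algebra $\mathbb{K}_{q}[\mathrm{M}(2,n-2)]$ is the $\mathbb{K}$-algebra generated by $X_{ij}$ ($1\leq i\leq 2$, $1\leq j\leq n-2$) such that for every $2\times 2$ submatrix $\begin{pmatrix} a & b\\ c& d\end{pmatrix}$ of $(X_{ij})$ one has $ab=qba$, $ac=qca$, $bc=cb$, $bd=qdb$, $cd=qdc$, $ad-da=(q-q^{-1})bc$. The quantum Schubert cell of $\mathrm{Gr}(2,n)$ associated to the partition $(t,s)$ is the $\mathbb{K}$-subalgebra of $\mathbb{K}_{q}[\mathrm{M}(2,n-2)]$ generated by $X_{1j}$ with $1\leq j\leq t$ and $X_{2j}$ with $1\leq j\leq s$. Quantum seeds. Let $\mathcal{F}$ be a skew-field containing $\mathbb{K}$ in its centre. A quantum seed in $\mathcal{F}$ is a triple $(\underline{y},B,L)$ where: $\underline{y}=(Y_1,\dots,Y_r)$ is a tuple (the quantum cluster) of nonzero elements of $\mathcal{F}$ generating $\mathcal{F}$ as a skew-field, whose Laurent monomials $Y_1^{a_1}\cdots Y_r^{a_r}$ ($a\in\mathbb{Z}^r$) are linearly independent over $\mathbb{K}$; a subset of the positions $\{1,\dots,r\}$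 is declared mutable and the elements in the remaining positions are called coefficients; $B=(b_{ij})$ (the exchange matrix) is an integer matrix with rows indexed by all positions and columns indexed by the mutable positions, whose square submatrix on the mutable rows (the principal part) is skew-symmetric; $L=(l_{ij})$ (the quasi-commutation matrix) is an $r\times r$ skew-symmetric integer matrix with $Y_iY_j=q^{l_{ij}}Y_jY_i$ for all $i,j$; and $B$ and $L$ are compatible: for each mutable $k$, $(B^TL)_{kj}=0$ for $j\neq k$ and $(B^TL)_{kk}$ is a positive integer. Mutation. For $a\in\mathbb{Z}^r$ put $M(a_1,\dots,a_r)=q^{\frac12\sum_{i<j}a_ia_jl_{ji}}Y_1^{a_1}\cdots Y_r^{a_r}$, and let $\boldsymbol{e}_i$ be the standard basis vectors. The mutation $\mu_k$ at a mutable position $k$ replaces $Y_k$ by $Y_k'=M(-\boldsymbol{e}_k+\sum_{b_{ik}>0}b_{ik}\boldsymbol{e}_i)+M(-\boldsymbol{e}_k-\sum_{b_{ik}<0}b_{ik}\boldsymbol{e}_i)$ and leaves the other cluster elements unchanged; replaces $B$ by $\mu_k(B)$ with $(\mu_k(B))_{ij}=-b_{ij}$ if $i=k$ or $j=k$, and $b_{ij}+\frac{|b_{ik}|b_{kj}+b_{ik}|b_{kj}|}{2}$ otherwise; and replaces $L$ by the skew-symmetric matrix $L'$ with $l'_{ij}=l_{ij}$ for $i,j\neq k$ and $l'_{jk}=-l_{jk}+\sum_{b_{ik}>0}b_{ik}l_{ji}$ for $j\neq k$. The result is again a quantum seed. Quantum cluster algebra. A $\mathbb{K}$-algebra $\mathcal{A}$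 that is a noetherian domain with skew-field of fractions $\mathcal{F}$ is a quantum cluster algebra if there is a quantum seed in $\mathcal{F}$ (the initial seed) such that the $\mathbb{K}$-subalgebra of $\mathcal{F}$ generated by all cluster variables (that is, all elements, mutable ones and coefficients, of all quantum clusters obtained from the initial seed by finite sequences of mutations; coefficients are not inverted) is equal to $\mathcal{A}$. It is of (finite) type $X_m$, for a Dynkin diagram $X_m$, if the quiver of the principal part of the exchange matrix (with $b_{ij}$ arrows $i\to j$ whenever $b_{ij}>0$) is mutation-equivalent to an orientation of $X_m$. Type $A_0$ means that there are no mutable positions.
   Formalization: For n = 3 there are no 2×2 submatrices, so the literal presentation gives a free algebra, which is not noetherian; the relation X_{1j}X_{2j} = q X_{2j}X_{1j} is therefore imposed in every column (redundant for n ≥ 4). *)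

theory Defs
  imports "HOL-Algebra.Module" "HOL-Algebra.QuotRing"
begin

section \<open>Algebras over a field\<close>

text \<open>
  The library locale \<open>algebra\<close> only covers commutative algebras; the following is its
  associative unital, not necessarily commutative, counterpart.
\<close>

locale assoc_algebra = K?: field K + module K A + A?: ring A for K (structure) and A (structure) +
  assumes smult_mult_left:
      "\<lbrakk>c \<in> carrier K; x \<in> carrier A; y \<in> carrier A\<rbrakk>
        \<Longrightarrow> (c \<odot>\<^bsub>A\<^esub> x) \<otimes>\<^bsub>A\<^esub> y = c \<odot>\<^bsub>A\<^esub> (x \<otimes>\<^bsub>A\<^esub> y)"
    and smult_mult_right:
      "\<lbrakk>c \<in> carrier K; x \<in> carrier A; y \<in> carrier A\<rbrakk>
        \<Longrightarrow> x \<otimes>\<^bsub>A\<^esub> (c \<odot>\<^bsub>A\<^esub> y) = c \<odot>\<^bsub>A\<^esub> (x \<otimes>\<^bsub>A\<^esub> y)"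

definition algebra_hom ::
  "('k, 'm) ring_scheme \<Rightarrow> ('k, 'a, 'n) module_scheme \<Rightarrow> ('k, 'b, 'p) module_scheme \<Rightarrow> ('a \<Rightarrow> 'b) set" where
  "algebra_hom K A B =
     {f \<in> ring_hom A B. \<forall>c\<in>carrier K. \<forall>x\<in>carrier A. f (c \<odot>\<^bsub>A\<^esub> x) = c \<odot>\<^bsub>B\<^esub> f x}"

inductive_set generated_algebra ::
  "('k, 'm) ring_scheme \<Rightarrow> ('k, 'a, 'n) module_scheme \<Rightarrow> 'a set \<Rightarrow> 'a set"
  for K and A and S where
  incl: "x \<in> S \<Longrightarrow> x \<in> generated_algebra K A S"
| one: "\<one>\<^bsub>A\<^esub> \<in> generated_algebra K A S"
| add: "\<lbrakk>x \<in> generated_algebra K A S; y \<in> generated_algebra K A S\<rbrakk>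
    \<Longrightarrow> x \<oplus>\<^bsub>A\<^esub> y \<in> generated_algebra K A S"
| mult: "\<lbrakk>x \<in> generated_algebra K A S; y \<in> generated_algebra K A S\<rbrakk>
    \<Longrightarrow> x \<otimes>\<^bsub>A\<^esub> y \<in> generated_algebra K A S"
| smult: "\<lbrakk>c \<in> carrier K; x \<in> generated_algebra K A S\<rbrakk>
    \<Longrightarrow> c \<odot>\<^bsub>A\<^esub> x \<in> generated_algebra K A S"

text \<open>
  Generation as a skew-field is understood over the ground field, so scalars are always included.
\<close>

inductive_set generated_skew_field ::
  "('k, 'm) ring_scheme \<Rightarrow> ('k, 'a, 'n) module_scheme \<Rightarrow> 'a set \<Rightarrow> 'a set"
  for K and F and S where
  incl: "x \<in> S \<Longrightarrow> x \<in> generated_skew_field K F S"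
| one: "\<one>\<^bsub>F\<^esub> \<in> generated_skew_field K F S"
| add: "\<lbrakk>x \<in> generated_skew_field K F S; y \<in> generated_skew_field K F S\<rbrakk>
    \<Longrightarrow> x \<oplus>\<^bsub>F\<^esub> y \<in> generated_skew_field K F S"
| mult: "\<lbrakk>x \<in> generated_skew_field K F S; y \<in> generated_skew_field K F S\<rbrakk>
    \<Longrightarrow> x \<otimes>\<^bsub>F\<^esub> y \<in> generated_skew_field K F S"
| smult: "\<lbrakk>c \<in> carrier K; x \<in> generated_skew_field K F S\<rbrakk>
    \<Longrightarrow> c \<odot>\<^bsub>F\<^esub> x \<in> generated_skew_field K F S"
| inverse: "\<lbrakk>x \<in> generated_skew_field K F S; x \<noteq> \<zero>\<^bsub>F\<^esub>\<rbrakk>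
    \<Longrightarrow> inv\<^bsub>F\<^esub> x \<in> generated_skew_field K F S"


section \<open>Noetherian domains and skew-fields of fractions\<close>

definition left_ideal :: "('a, 'm) ring_scheme \<Rightarrow> 'a set \<Rightarrow> bool" where
  "left_ideal R I \<longleftrightarrow> additive_subgroup I R \<and> (\<forall>a\<in>carrier R. \<forall>x\<in>I. a \<otimes>\<^bsub>R\<^esub> x \<in> I)"

definition right_ideal :: "('a, 'm) ring_scheme \<Rightarrow> 'a set \<Rightarrow> bool" where
  "right_ideal R I \<longleftrightarrow> additive_subgroup I R \<and> (\<forall>a\<in>carrier R. \<forall>x\<in>I. x \<otimes>\<^bsub>R\<^esub> a \<in> I)"

text \<open>
  The library locale \<open>noetherian_ring\<close> speaks about two-sided ideals and \<open>domain\<close>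
  requires commutativity, so neither can be used for noncommutative rings. Noetherian means
  noetherian on both sides.
\<close>

definition noetherian :: "('a, 'm) ring_scheme \<Rightarrow> bool" where
  "noetherian R \<longleftrightarrow>
     (\<forall>I. left_ideal R I \<longrightarrow>
        (\<exists>G. finite G \<and> G \<subseteq> carrier R \<and> I = \<Inter>{J. left_ideal R J \<and> G \<subseteq> J})) \<and>
     (\<forall>I. right_ideal R I \<longrightarrow>
        (\<exists>G. finite G \<and> G \<subseteq> carrier R \<and> I = \<Inter>{J. right_ideal R J \<and> G \<subseteq> J}))"

definition noncomm_domain :: "('a, 'm) ring_scheme \<Rightarrow> bool" where
  "noncomm_domain R \<longleftrightarrow> ring R \<and> \<one>\<^bsub>R\<^esub> \<noteq> \<zero>\<^bsub>R\<^esub> \<and>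
     (\<forall>a\<in>carrier R. \<forall>b\<in>carrier R. a \<otimes>\<^bsub>R\<^esub> b = \<zero>\<^bsub>R\<^esub> \<longrightarrow> a = \<zero>\<^bsub>R\<^esub> \<or> b = \<zero>\<^bsub>R\<^esub>)"

definition skew_field :: "('a, 'm) ring_scheme \<Rightarrow> bool" where
  "skew_field F \<longleftrightarrow> ring F \<and> \<one>\<^bsub>F\<^esub> \<noteq> \<zero>\<^bsub>F\<^esub> \<and> Units F = carrier F - {\<zero>\<^bsub>F\<^esub>}"

text \<open>
  An embedding \<open>\<iota>\<close> of \<open>A\<close> in a skew-field \<open>F\<close> all of whose elements are right fractions and
  left fractions of elements of \<open>A\<close>.
\<close>

definition skew_field_of_fractions ::
  "('k, 'm) ring_scheme \<Rightarrow> ('k, 'a, 'n) module_scheme \<Rightarrow> ('k, 'f, 'p) module_scheme \<Rightarrow> ('a \<Rightarrow> 'f) \<Rightarrow> bool"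
where
  "skew_field_of_fractions K A F \<iota> \<longleftrightarrow>
     assoc_algebra K F \<and> skew_field F \<and> \<iota> \<in> algebra_hom K A F \<and> inj_on \<iota> (carrier A) \<and>
     (\<forall>x\<in>carrier F. \<exists>a\<in>carrier A. \<exists>b\<in>carrier A - {\<zero>\<^bsub>A\<^esub>}. x = \<iota> a \<otimes>\<^bsub>F\<^esub> inv\<^bsub>F\<^esub> (\<iota> b)) \<and>
     (\<forall>x\<in>carrier F. \<exists>a\<in>carrier A. \<exists>b\<in>carrier A - {\<zero>\<^bsub>A\<^esub>}. x = inv\<^bsub>F\<^esub> (\<iota> b) \<otimes>\<^bsub>F\<^esub> \<iota> a)"


section \<open>Algebras given by generators and relations\<close>

text \<open>
  Elements of the free algebra on a set \<open>G\<close> of letters are finitely supported coefficient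
  functions on words over \<open>G\<close>; words multiply by concatenation.
\<close>

definition free_algebra :: "('k, 'm) ring_scheme \<Rightarrow> 'g set \<Rightarrow> ('k, 'g list \<Rightarrow> 'k) module" where
  "free_algebra K G =
     \<lparr>carrier = {f. (\<forall>w. f w \<in> carrier K) \<and> finite {w. f w \<noteq> \<zero>\<^bsub>K\<^esub>} \<and>
                    {w. f w \<noteq> \<zero>\<^bsub>K\<^esub>} \<subseteq> lists G},
      monoid.mult = (\<lambda>f g w. \<Oplus>\<^bsub>K\<^esub>i\<in>{..length w}. f (take i w) \<otimes>\<^bsub>K\<^esub> g (drop i w)),
      monoid.one = (\<lambda>w. if w = [] then \<one>\<^bsub>K\<^esub> else \<zero>\<^bsub>K\<^esub>),
      ring.zero = (\<lambda>w. \<zero>\<^bsub>K\<^esub>),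
      ring.add = (\<lambda>f g w. f w \<oplus>\<^bsub>K\<^esub> g w),
      smult = (\<lambda>c f w. c \<otimes>\<^bsub>K\<^esub> f w)\<rparr>"

definition free_gen :: "('k, 'm) ring_scheme \<Rightarrow> 'g \<Rightarrow> 'g list \<Rightarrow> 'k" where
  "free_gen K x = (\<lambda>w. if w = [x] then \<one>\<^bsub>K\<^esub> else \<zero>\<^bsub>K\<^esub>)"

definition quotient_algebra :: "('k, 'a, 'm) module_scheme \<Rightarrow> 'a set \<Rightarrow> ('k, 'a set) module" where
  "quotient_algebra A I =
     ring.extend (A Quot I) (module.fields (\<lambda>c X. \<Union>x\<in>X. I +>\<^bsub>A\<^esub> (c \<odot>\<^bsub>A\<^esub> x)))"

text \<open>A pair \<open>(u, v)\<close> in the set of relations imposes \<open>u = v\<close>.\<close>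

definition relation_ideal :: "('k, 'a, 'm) module_scheme \<Rightarrow> ('a \<times> 'a) set \<Rightarrow> 'a set" where
  "relation_ideal A R = Idl\<^bsub>A\<^esub> {u \<ominus>\<^bsub>A\<^esub> v | u v. (u, v) \<in> R}"


section \<open>Quantum matrices and quantum Schubert cells\<close>

definition qmat_free :: "('k, 'm) ring_scheme \<Rightarrow> nat \<Rightarrow> ('k, (nat \<times> nat) list \<Rightarrow> 'k) module" where
  "qmat_free K m = free_algebra K ({1..2} \<times> {1..m})"

text \<open>
  The second set lists the relations of all \<open>2 \<times> 2\<close> submatrices. The first one repeats the
  relations between the two entries of a column; it only adds something for \<open>m = 1\<close>, where there
  are no \<open>2 \<times> 2\<close> submatrices and the quantum matrix algebra is, by the usual convention, the
  quantum plane.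
\<close>

definition qmat_relations ::
  "('k, 'm) ring_scheme \<Rightarrow> 'k \<Rightarrow> nat \<Rightarrow> (((nat \<times> nat) list \<Rightarrow> 'k) \<times> ((nat \<times> nat) list \<Rightarrow> 'k)) set"
where
  "qmat_relations K q m =
     (let P = qmat_free K m; X = (\<lambda>i j. free_gen K (i, j)) in
        (\<Union>j\<in>{1..m}. {(X 1 j \<otimes>\<^bsub>P\<^esub> X 2 j, q \<odot>\<^bsub>P\<^esub> (X 2 j \<otimes>\<^bsub>P\<^esub> X 1 j))}) \<union>
        (\<Union>(j, l)\<in>{(j, l). 1 \<le> j \<and> j < l \<and> l \<le> m}.
           let a = X 1 j; b = X 1 l; c = X 2 j; d = X 2 l in
             {(a \<otimes>\<^bsub>P\<^esub> b, q \<odot>\<^bsub>P\<^esub> (b \<otimes>\<^bsub>P\<^esub> a)),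
              (a \<otimes>\<^bsub>P\<^esub> c, q \<odot>\<^bsub>P\<^esub> (c \<otimes>\<^bsub>P\<^esub> a)),
              (b \<otimes>\<^bsub>P\<^esub> c, c \<otimes>\<^bsub>P\<^esub> b),
              (b \<otimes>\<^bsub>P\<^esub> d, q \<odot>\<^bsub>P\<^esub> (d \<otimes>\<^bsub>P\<^esub> b)),
              (c \<otimes>\<^bsub>P\<^esub> d, q \<odot>\<^bsub>P\<^esub> (d \<otimes>\<^bsub>P\<^esub> c)),
              ((a \<otimes>\<^bsub>P\<^esub> d) \<ominus>\<^bsub>P\<^esub> (d \<otimes>\<^bsub>P\<^esub> a), (q \<ominus>\<^bsub>K\<^esub> inv\<^bsub>K\<^esub> q) \<odot>\<^bsub>P\<^esub> (b \<otimes>\<^bsub>P\<^esub> c))}))"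

definition qmat_ideal :: "('k, 'm) ring_scheme \<Rightarrow> 'k \<Rightarrow> nat \<Rightarrow> ((nat \<times> nat) list \<Rightarrow> 'k) set" where
  "qmat_ideal K q m = relation_ideal (qmat_free K m) (qmat_relations K q m)"

definition quantum_matrix_algebra ::
  "('k, 'm) ring_scheme \<Rightarrow> 'k \<Rightarrow> nat \<Rightarrow> ('k, ((nat \<times> nat) list \<Rightarrow> 'k) set) module" where
  "quantum_matrix_algebra K q m = quotient_algebra (qmat_free K m) (qmat_ideal K q m)"

definition qmat_gen ::
  "('k, 'm) ring_scheme \<Rightarrow> 'k \<Rightarrow> nat \<Rightarrow> nat \<Rightarrow> nat \<Rightarrow> ((nat \<times> nat) list \<Rightarrow> 'k) set" where
  "qmat_gen K q m i j = qmat_ideal K q m +>\<^bsub>qmat_free K m\<^esub> free_gen K (i, j)"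

definition quantum_schubert_cell ::
  "('k, 'm) ring_scheme \<Rightarrow> 'k \<Rightarrow> nat \<Rightarrow> nat \<times> nat \<Rightarrow> ('k, ((nat \<times> nat) list \<Rightarrow> 'k) set) module" where
  "quantum_schubert_cell K q n = (\<lambda>(t, s).
     let A = quantum_matrix_algebra K q (n - 2); X = qmat_gen K q (n - 2) in
       A\<lparr>carrier := generated_algebra K A ((\<lambda>j. X 1 j) ` {1..t} \<union> (\<lambda>j. X 2 j) ` {1..s})\<rparr>)"


section \<open>Quantum seeds\<close>

text \<open>
  Positions are \<open>{1..sd_rank S}\<close>; the values of the cluster and of the matrices outside the
  relevant positions are irrelevant.
\<close>

record 'f seed =
  sd_rank :: nat
  sd_mutable :: "nat set"
  sd_cluster :: "nat \<Rightarrow> 'f"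
  sd_exch :: "nat \<Rightarrow> nat \<Rightarrow> int"
  sd_quasi :: "nat \<Rightarrow> nat \<Rightarrow> int"

definition positions :: "'f seed \<Rightarrow> nat set" where
  "positions S = {1..sd_rank S}"

text \<open>The ordered product \<open>Y\<^sub>1\<^bsup>a 1\<^esup> \<cdots> Y\<^sub>r\<^bsup>a r\<^esup>\<close>.\<close>

definition laurent_monomial :: "('f, 'm) ring_scheme \<Rightarrow> 'f seed \<Rightarrow> (nat \<Rightarrow> int) \<Rightarrow> 'f" where
  "laurent_monomial F S a =
     foldr (\<lambda>i z. (sd_cluster S i [^]\<^bsub>F\<^esub> a i) \<otimes>\<^bsub>F\<^esub> z) [1..<Suc (sd_rank S)] \<one>\<^bsub>F\<^esub>"

definition exponents :: "'f seed \<Rightarrow> (nat \<Rightarrow> int) set" where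
  "exponents S = {a. \<forall>i. i \<notin> positions S \<longrightarrow> a i = 0}"

definition laurent_independent ::
  "('k, 'm) ring_scheme \<Rightarrow> ('k, 'f, 'n) module_scheme \<Rightarrow> 'f seed \<Rightarrow> bool" where
  "laurent_independent K F S \<longleftrightarrow>
     (\<forall>T c. finite T \<and> T \<subseteq> exponents S \<and> c \<in> T \<rightarrow> carrier K \<and>
        (\<Oplus>\<^bsub>F\<^esub>a\<in>T. c a \<odot>\<^bsub>F\<^esub> laurent_monomial F S a) = \<zero>\<^bsub>F\<^esub> \<longrightarrow> (\<forall>a\<in>T. c a = \<zero>\<^bsub>K\<^esub>))"

definition compatible :: "'f seed \<Rightarrow> bool" where
  "compatible S \<longleftrightarrow>
     (\<forall>k\<in>sd_mutable S. \<forall>j\<in>positions S.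
        (j \<noteq> k \<longrightarrow> (\<Sum>i\<in>positions S. sd_exch S i k * sd_quasi S i j) = 0) \<and>
        (j = k \<longrightarrow> (\<Sum>i\<in>positions S. sd_exch S i k * sd_quasi S i j) > 0))"

definition quantum_seed ::
  "('k, 'm) ring_scheme \<Rightarrow> 'k \<Rightarrow> ('k, 'f, 'n) module_scheme \<Rightarrow> 'f seed \<Rightarrow> bool" where
  "quantum_seed K q F S \<longleftrightarrow>
     sd_cluster S ` positions S \<subseteq> carrier F - {\<zero>\<^bsub>F\<^esub>} \<and>
     generated_skew_field K F (sd_cluster S ` positions S) = carrier F \<and>
     laurent_independent K F S \<and>
     sd_mutable S \<subseteq> positions S \<and>
     (\<forall>i\<in>sd_mutable S. \<forall>j\<in>sd_mutable S. sd_exch S i j = - sd_exch S j i) \<and>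
     (\<forall>i\<in>positions S. \<forall>j\<in>positions S. sd_quasi S i j = - sd_quasi S j i) \<and>
     (\<forall>i\<in>positions S. \<forall>j\<in>positions S.
        sd_cluster S i \<otimes>\<^bsub>F\<^esub> sd_cluster S j =
        (q [^]\<^bsub>K\<^esub> sd_quasi S i j) \<odot>\<^bsub>F\<^esub> (sd_cluster S j \<otimes>\<^bsub>F\<^esub> sd_cluster S i)) \<and>
     compatible S"


section \<open>Mutation\<close>

text \<open>The argument \<open>h\<close> is the chosen square root of \<open>q\<close>.\<close>

definition normalized_monomial ::
  "('k, 'm) ring_scheme \<Rightarrow> 'k \<Rightarrow> ('k, 'f, 'n) module_scheme \<Rightarrow> 'f seed \<Rightarrow> (nat \<Rightarrow> int) \<Rightarrow> 'f" where
  "normalized_monomial K h F S a =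
     (h [^]\<^bsub>K\<^esub> (\<Sum>j\<in>positions S. \<Sum>i\<in>{i\<in>positions S. i < j}. a i * a j * sd_quasi S j i))
       \<odot>\<^bsub>F\<^esub> laurent_monomial F S a"

definition mutate_variable ::
  "('k, 'm) ring_scheme \<Rightarrow> 'k \<Rightarrow> ('k, 'f, 'n) module_scheme \<Rightarrow> nat \<Rightarrow> 'f seed \<Rightarrow> 'f" where
  "mutate_variable K h F k S =
     (let b = sd_exch S; e = (\<lambda>i. if i = k then 1 else 0) in
        normalized_monomial K h F S (\<lambda>i. - e i + (if b i k > 0 then b i k else 0))
        \<oplus>\<^bsub>F\<^esub> normalized_monomial K h F S (\<lambda>i. - e i - (if b i k < 0 then b i k else 0)))"

text \<open>The division is exact: the numerator is \<open>0\<close> or \<open>\<plusminus> 2 * b i k * b k j\<close>.\<close>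

definition mutate_exch :: "nat \<Rightarrow> (nat \<Rightarrow> nat \<Rightarrow> int) \<Rightarrow> nat \<Rightarrow> nat \<Rightarrow> int" where
  "mutate_exch k b = (\<lambda>i j.
     if i = k \<or> j = k then - b i j
     else b i j + (\<bar>b i k\<bar> * b k j + b i k * \<bar>b k j\<bar>) div 2)"

definition mutate_quasi :: "nat \<Rightarrow> 'f seed \<Rightarrow> nat \<Rightarrow> nat \<Rightarrow> int" where
  "mutate_quasi k S =
     (let b = sd_exch S; l = sd_quasi S;
          l' = (\<lambda>j. - l j k + (\<Sum>i\<in>{i\<in>positions S. b i k > 0}. b i k * l j i)) in
      (\<lambda>i j. if i = k \<and> j = k then 0
              else if j = k then l' i
              else if i = k then - l' j
              else l i j))"

definition mutate ::
  "('k, 'm) ring_scheme \<Rightarrow> 'k \<Rightarrow> ('k, 'f, 'n) module_scheme \<Rightarrow> nat \<Rightarrow> 'f seed \<Rightarrow> 'f seed" where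
  "mutate K h F k S =
     \<lparr>sd_rank = sd_rank S,
      sd_mutable = sd_mutable S,
      sd_cluster = (sd_cluster S)(k := mutate_variable K h F k S),
      sd_exch = mutate_exch k (sd_exch S),
      sd_quasi = mutate_quasi k S\<rparr>"

inductive_set mutation_class ::
  "('k, 'm) ring_scheme \<Rightarrow> 'k \<Rightarrow> ('k, 'f, 'n) module_scheme \<Rightarrow> 'f seed \<Rightarrow> 'f seed set"
  for K and h and F and S where
  initial: "S \<in> mutation_class K h F S"
| step: "\<lbrakk>T \<in> mutation_class K h F S; k \<in> sd_mutable T\<rbrakk>
    \<Longrightarrow> mutate K h F k T \<in> mutation_class K h F S"

definition cluster_variables ::
  "('k, 'm) ring_scheme \<Rightarrow> 'k \<Rightarrow> ('k, 'f, 'n) module_scheme \<Rightarrow> 'f seed \<Rightarrow> 'f set" where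
  "cluster_variables K h F S = (\<Union>T\<in>mutation_class K h F S. sd_cluster T ` positions T)"


section \<open>Cluster type\<close>

inductive_set exch_mutation_class ::
  "nat set \<Rightarrow> (nat \<Rightarrow> nat \<Rightarrow> int) \<Rightarrow> (nat \<Rightarrow> nat \<Rightarrow> int) set"
  for V and b where
  initial: "b \<in> exch_mutation_class V b"
| step: "\<lbrakk>b' \<in> exch_mutation_class V b; k \<in> V\<rbrakk> \<Longrightarrow> mutate_exch k b' \<in> exch_mutation_class V b"

text \<open>The number of arrows \<open>i \<rightarrow> j\<close> in the quiver of a skew-symmetric matrix.\<close>

definition arrows :: "(nat \<Rightarrow> nat \<Rightarrow> int) \<Rightarrow> nat \<Rightarrow> nat \<Rightarrow> nat" where
  "arrows b i j = (if b i j > 0 then nat (b i j) else 0)"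

text \<open>
  A simply laced diagram is given by the number \<open>m\<close> of its vertices \<open>{1..m}\<close> and its adjacency
  relation. The quiver of \<open>b\<close> on \<open>V\<close> is an orientation of it if, after relabelling the vertices
  along \<open>\<sigma>\<close>, there is exactly one arrow between adjacent vertices, in one of the two directions,
  and none between non-adjacent ones.
\<close>

definition is_orientation ::
  "nat set \<Rightarrow> (nat \<Rightarrow> nat \<Rightarrow> int) \<Rightarrow> nat \<Rightarrow> (nat \<Rightarrow> nat \<Rightarrow> bool) \<Rightarrow> bool" where
  "is_orientation V b m adj \<longleftrightarrow>
     (\<exists>\<sigma>. bij_betw \<sigma> {1..m} V \<and>
        (\<forall>i\<in>{1..m}. \<forall>j\<in>{1..m}.
           arrows b (\<sigma> i) (\<sigma> j) + arrows b (\<sigma> j) (\<sigma> i) = (if adj i j then 1 else 0)))"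

definition has_cluster_type :: "'f seed \<Rightarrow> nat \<Rightarrow> (nat \<Rightarrow> nat \<Rightarrow> bool) \<Rightarrow> bool" where
  "has_cluster_type S m adj \<longleftrightarrow>
     (\<exists>b\<in>exch_mutation_class (sd_mutable S) (sd_exch S). is_orientation (sd_mutable S) b m adj)"

text \<open>Adjacency in the Dynkin diagrams of type A: a path \<open>1 - 2 - \<cdots> - m\<close>.\<close>

definition dynkin_A :: "nat \<Rightarrow> nat \<Rightarrow> bool" where
  "dynkin_A i j \<longleftrightarrow> j = Suc i \<or> i = Suc j"


section \<open>Quantum cluster algebras\<close>

text \<open>
  The skew-field of fractions is unique up to isomorphism, so asking for one realisation loses
  nothing; part of the claim is that it exists. An element \<open>x\<close> of it is determined by the set of
  all pairs \<open>(a, b)\<close> with \<open>x = a b\<^sup>-\<^sup>1\<close>, hence it can always be realised on the type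
  \<open>('a \<times> 'a) set\<close>.
\<close>

definition quantum_cluster_algebra_of_type ::
  "('k, 'm) ring_scheme \<Rightarrow> 'k \<Rightarrow> 'k \<Rightarrow> ('k, 'a) module \<Rightarrow> nat \<Rightarrow> (nat \<Rightarrow> nat \<Rightarrow> bool) \<Rightarrow> bool" where
  "quantum_cluster_algebra_of_type K q h A m adj \<longleftrightarrow>
     assoc_algebra K A \<and> noncomm_domain A \<and> noetherian A \<and>
     (\<exists>(F :: ('k, ('a \<times> 'a) set) module) \<iota> S.
        skew_field_of_fractions K A F \<iota> \<and>
        quantum_seed K q F S \<and>
        generated_algebra K F (cluster_variables K h F S) = \<iota> ` carrier A \<and>
        has_cluster_type S m adj)"

end

theory Submission
  imports Defs "HOL-Library.Poly_Mapping" "HOL-Library.Multiset" "HOL-Algebra.Subrings"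
begin

text \<open>
  The quantum matrix algebra maps to a quantum torus: \<open>X\<^bsub>1j\<^esub>\<close> goes to a monomial and \<open>X\<^bsub>2l\<^esub>\<close> to a
  sum of \<open>l\<close> monomials with distinct leading exponents. Straightening shows that ordered monomials
  span the cell, and their images have distinct leading exponents, so the map is injective on the
  cell and the leading exponent is a valuation on it. By Dickson's lemma the cell is therefore a
  noetherian domain, hence an Ore domain.

  Under this map the quantum minors, also those involving an extra first column \<open>(1, 0)\<close> and an extra
  last column \<open>(0, 1)\<close>, have explicit expressions and satisfy three-term exchange relations.
  The seeds are indexed by the triangulations of a polygon with \<open>s + 2\<close> vertices: the extra columns and
  the first \<open>s\<close> columns. Mutation is a flip of a diagonal, and the exchange relation is the quantum
  Pluecker relation of the surrounding quadrilateral. The initial seed is the fan at the last vertex; its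
  cluster consists of monomials of the torus. Flipping it to the fan at the first vertex produces the
  second row of the matrix.
\<close>

section \<open>Generalities on associative algebras and on monoid algebras twisted by a
  cocycle\<close>

section \<open>Algebras\<close>

text \<open>The ratio of the two rows is built up column by column: passing from column
  \<open>k - 1\<close> to column \<open>k\<close> adds the minor of these columns divided by their
  two first-row entries, which is the monomial \<open>M (U k)\<close>. Hence the minor of columns
  \<open>j < l\<close> is, up to a scalar, the sum of the \<open>M (U k)\<close> with
  \<open>j < k \<le> l\<close> times the first-row entries \<open>j\<close> and \<open>l\<close>,
  and the Pluecker relations reduce to cutting such sums into blocks. Since \<open>q\<close> may be
  a root of unity or \<open>1\<close>, quasi-commutation exponents cannot be recovered from the
  elements. They are carried along as integers: every label has a leading exponent
  \<open>gg\<close>, and the matrix \<open>L\<close> of every seed is the form \<open>Lam\<close> on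
  these exponents, so that the mutation rules for \<open>B\<close> and \<open>L\<close> become
  identities about labels. As coefficients are not inverted, generation has two halves inside the
  cell itself: every label gives a minor, hence a polynomial in the generators, and every generator
  occurs, up to a scalar, in the initial seed or in one of the seeds met while the fan is being
  flipped.\<close>

lemma assoc_algebraI:
  assumes "field K" "ring A"
    and "\<And>c x. c \<in> carrier K \<Longrightarrow> x \<in> carrier A \<Longrightarrow> c \<odot>\<^bsub>A\<^esub> x \<in> carrier A"
    and "\<And>c d x. c \<in> carrier K \<Longrightarrow> d \<in> carrier K \<Longrightarrow> x \<in> carrier A \<Longrightarrow>
           (c \<oplus>\<^bsub>K\<^esub> d) \<odot>\<^bsub>A\<^esub> x = c \<odot>\<^bsub>A\<^esub> x \<oplus>\<^bsub>A\<^esub> d \<odot>\<^bsub>A\<^esub> x"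
    and "\<And>c x y. c \<in> carrier K \<Longrightarrow> x \<in> carrier A \<Longrightarrow> y \<in> carrier A \<Longrightarrow>
           c \<odot>\<^bsub>A\<^esub> (x \<oplus>\<^bsub>A\<^esub> y) = c \<odot>\<^bsub>A\<^esub> x \<oplus>\<^bsub>A\<^esub> c \<odot>\<^bsub>A\<^esub> y"
    and "\<And>c d x. c \<in> carrier K \<Longrightarrow> d \<in> carrier K \<Longrightarrow> x \<in> carrier A \<Longrightarrow>
           (c \<otimes>\<^bsub>K\<^esub> d) \<odot>\<^bsub>A\<^esub> x = c \<odot>\<^bsub>A\<^esub> (d \<odot>\<^bsub>A\<^esub> x)"
    and "\<And>x. x \<in> carrier A \<Longrightarrow> \<one>\<^bsub>K\<^esub> \<odot>\<^bsub>A\<^esub> x = x"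
    and "\<And>c x y. c \<in> carrier K \<Longrightarrow> x \<in> carrier A \<Longrightarrow> y \<in> carrier A \<Longrightarrow>
           (c \<odot>\<^bsub>A\<^esub> x) \<otimes>\<^bsub>A\<^esub> y = c \<odot>\<^bsub>A\<^esub> (x \<otimes>\<^bsub>A\<^esub> y)"
    and "\<And>c x y. c \<in> carrier K \<Longrightarrow> x \<in> carrier A \<Longrightarrow> y \<in> carrier A \<Longrightarrow>
           x \<otimes>\<^bsub>A\<^esub> (c \<odot>\<^bsub>A\<^esub> y) = c \<odot>\<^bsub>A\<^esub> (x \<otimes>\<^bsub>A\<^esub> y)"
  shows "assoc_algebra K A"
proof -
  interpret field K by fact
  interpret A: ring A by fact
  have "Module.module K A"
    using assms by (intro moduleI) (auto intro: is_cring A.is_abelian_group)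
  then show ?thesis
    using assms by (intro assoc_algebra.intro assoc_algebra_axioms.intro) auto
qed

context assoc_algebra
begin

lemma generated_algebra_closed:
  assumes "S \<subseteq> carrier A"
  shows "generated_algebra K A S \<subseteq> carrier A"
proof
  fix x assume "x \<in> generated_algebra K A S"
  then show "x \<in> carrier A"
    by induction (use assms in auto)
qed

text \<open>The generation rules have no clause for negatives; they come from the scalar
  \<open>-1\<close>, and with them the generated set is a subring.\<close>

lemma generated_algebra_uminus:
  assumes "S \<subseteq> carrier A" "x \<in> generated_algebra K A S"
  shows "\<ominus>\<^bsub>A\<^esub> x \<in> generated_algebra K A S"
proof -
  have "x \<in> carrier A"
    using assms generated_algebra_closed by blast
  then have "\<ominus>\<^bsub>A\<^esub> x = (\<ominus>\<^bsub>K\<^esub> \<one>\<^bsub>K\<^esub>) \<odot>\<^bsub>A\<^esub> x"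
    by (simp add: smult_l_minus)
  then show ?thesis
    using assms generated_algebra.smult[of "\<ominus>\<^bsub>K\<^esub> \<one>\<^bsub>K\<^esub>" K x A S] by simp
qed

lemma generated_algebra_subring:
  assumes "S \<subseteq> carrier A"
  shows "subring (generated_algebra K A S) A"
  using assms generated_algebra_closed[OF assms]
  by (intro A.subringI)
     (auto intro: generated_algebra.intros generated_algebra_uminus)

lemma assoc_algebra_generated:
  assumes "S \<subseteq> carrier A"
  shows "assoc_algebra K (A\<lparr>carrier := generated_algebra K A S\<rparr>)"
proof -
  have sub: "\<And>x. x \<in> generated_algebra K A S \<Longrightarrow> x \<in> carrier A"
    using generated_algebra_closed[OF assms] by blast
  show ?thesis
    by (intro assoc_algebraI A.subring_is_ring generated_algebra_subring assms field_axioms)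
       (auto simp: sub smult_l_distr smult_r_distr smult_assoc1 smult_mult_left smult_mult_right
             intro: generated_algebra.intros)
qed

lemma generated_algebra_mono_closed:
  assumes "S \<subseteq> generated_algebra K A S'"
  shows "generated_algebra K A S \<subseteq> generated_algebra K A S'"
proof
  fix x assume "x \<in> generated_algebra K A S"
  then show "x \<in> generated_algebra K A S'"
    by induction (use assms in \<open>auto intro: generated_algebra.intros\<close>)
qed

end

lemma algebra_homD:
  assumes "f \<in> algebra_hom K A B"
  shows "\<And>x. x \<in> carrier A \<Longrightarrow> f x \<in> carrier B"
    and "\<And>x y. x \<in> carrier A \<Longrightarrow> y \<in> carrier A \<Longrightarrow> f (x \<otimes>\<^bsub>A\<^esub> y) = f x \<otimes>\<^bsub>B\<^esub> f y"
    and "\<And>x y. x \<in> carrier A \<Longrightarrow> y \<in> carrier A \<Longrightarrow> f (x \<oplus>\<^bsub>A\<^esub> y) = f x \<oplus>\<^bsub>B\<^esub> f y"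
    and "f \<one>\<^bsub>A\<^esub> = \<one>\<^bsub>B\<^esub>"
    and "\<And>c x. c \<in> carrier K \<Longrightarrow> x \<in> carrier A \<Longrightarrow> f (c \<odot>\<^bsub>A\<^esub> x) = c \<odot>\<^bsub>B\<^esub> f x"
  using assms by (auto simp: algebra_hom_def ring_hom_def)

lemma algebra_homI:
  assumes "\<And>x. x \<in> carrier A \<Longrightarrow> f x \<in> carrier B"
    and "\<And>x y. x \<in> carrier A \<Longrightarrow> y \<in> carrier A \<Longrightarrow> f (x \<otimes>\<^bsub>A\<^esub> y) = f x \<otimes>\<^bsub>B\<^esub> f y"
    and "\<And>x y. x \<in> carrier A \<Longrightarrow> y \<in> carrier A \<Longrightarrow> f (x \<oplus>\<^bsub>A\<^esub> y) = f x \<oplus>\<^bsub>B\<^esub> f y"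
    and "f \<one>\<^bsub>A\<^esub> = \<one>\<^bsub>B\<^esub>"
    and "\<And>c x. c \<in> carrier K \<Longrightarrow> x \<in> carrier A \<Longrightarrow> f (c \<odot>\<^bsub>A\<^esub> x) = c \<odot>\<^bsub>B\<^esub> f x"
  shows "f \<in> algebra_hom K A B"
  using assms by (auto simp: algebra_hom_def ring_hom_def)

lemma algebra_hom_comp:
  assumes "f \<in> algebra_hom K A B" "g \<in> algebra_hom K B C"
  shows "g \<circ> f \<in> algebra_hom K A C"
  using assms by (intro algebra_homI) (simp_all add: algebra_homD)

locale algebra_morphism = A: assoc_algebra K A + B: assoc_algebra K B
  for K (structure) and A (structure) and B (structure) +
  fixes f assumes hom: "f \<in> algebra_hom K A B"
begin

lemmas hom_simps = algebra_homD[OF hom]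

lemma hom_zero: "f \<zero>\<^bsub>A\<^esub> = \<zero>\<^bsub>B\<^esub>"
proof -
  have "f \<zero>\<^bsub>A\<^esub> = f (\<zero>\<^bsub>K\<^esub> \<odot>\<^bsub>A\<^esub> \<zero>\<^bsub>A\<^esub>)"
    by simp
  also have "\<dots> = \<zero>\<^bsub>K\<^esub> \<odot>\<^bsub>B\<^esub> f \<zero>\<^bsub>A\<^esub>"
    by (rule hom_simps) auto
  finally show ?thesis
    by (simp add: hom_simps)
qed

lemma hom_uminus: "x \<in> carrier A \<Longrightarrow> f (\<ominus>\<^bsub>A\<^esub> x) = \<ominus>\<^bsub>B\<^esub> f x"
  using hom_simps(3)[of "\<ominus>\<^bsub>A\<^esub> x" x]
  by (metis A.M.a_inv_closed A.M.l_neg B.M.minus_equality hom_simps(1) hom_zero)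

lemma hom_minus: "x \<in> carrier A \<Longrightarrow> y \<in> carrier A \<Longrightarrow> f (x \<ominus>\<^bsub>A\<^esub> y) = f x \<ominus>\<^bsub>B\<^esub> f y"
  by (simp add: a_minus_def hom_simps hom_uminus)

lemma hom_finsum:
  assumes "finite E" "g \<in> E \<rightarrow> carrier A"
  shows "f (finsum A g E) = finsum B (\<lambda>i. f (g i)) E"
  using assms
proof (induction E)
  case (insert x E)
  then have "f (finsum A g (insert x E)) = f (g x \<oplus>\<^bsub>A\<^esub> finsum A g E)"
    by (subst A.M.finsum_insert) auto
  also have "\<dots> = f (g x) \<oplus>\<^bsub>B\<^esub> finsum B (\<lambda>i. f (g i)) E"
    using insert by (subst hom_simps) auto
  also have "\<dots> = finsum B (\<lambda>i. f (g i)) (insert x E)"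
    using insert by (subst B.M.finsum_insert) (auto simp: hom_simps Pi_iff)
  finally show ?case .
qed (simp add: hom_zero)

text \<open>Applied to \<open>psi\<close> and then to the embedding of the torus in its skew field,
  this describes the image of the cell by the images of its generators.\<close>

lemma hom_generated_algebra:
  assumes "S \<subseteq> carrier A"
  shows "f ` generated_algebra K A S = generated_algebra K B (f ` S)"
proof
  note sub = subsetD[OF A.generated_algebra_closed[OF assms]]
  show "f ` generated_algebra K A S \<subseteq> generated_algebra K B (f ` S)"
  proof
    fix y assume "y \<in> f ` generated_algebra K A S"
    then obtain x where "x \<in> generated_algebra K A S" "y = f x"
      by blast
    then show "y \<in> generated_algebra K B (f ` S)"
    proof (induction arbitrary: y)
      case (incl x)
      then show ?case by (auto intro: generated_algebra.incl)
    qed (use sub in \<open>auto simp: hom_simps intro: generated_algebra.intros\<close>)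
  qed
  show "generated_algebra K B (f ` S) \<subseteq> f ` generated_algebra K A S"
  proof
    fix y assume "y \<in> generated_algebra K B (f ` S)"
    then show "y \<in> f ` generated_algebra K A S"
    proof induction
      case one
      then show ?case using hom_simps(4) generated_algebra.one by (metis image_eqI)
    next
      case (add x y)
      then show ?case using sub by (auto simp flip: hom_simps intro!: imageI intro: generated_algebra.add)
    next
      case (mult x y)
      then show ?case using sub by (auto simp flip: hom_simps intro!: imageI intro: generated_algebra.mult)
    next
      case (smult c x)
      then show ?case using sub by (auto simp flip: hom_simps intro!: imageI intro: generated_algebra.smult)
    qed (auto intro: generated_algebra.incl)
  qed
qed

end

section \<open>Twisted monoid algebras\<close>

text \<open>One construction for the free algebra (words, trivial twist) and for quantum tori
  (exponents, twisted by powers of \<open>h\<close>). The product sums over pairs from the supports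
  because an exponent has infinitely many decompositions. \<open>H\<close> only restricts the
  carrier, so a torus and its subtori share their operations.\<close>

definition twisted_algebra ::
  "('k, 'm) ring_scheme \<Rightarrow> ('w \<Rightarrow> 'w \<Rightarrow> 'w) \<Rightarrow> 'w \<Rightarrow> ('w \<Rightarrow> 'w \<Rightarrow> 'k) \<Rightarrow> 'w set \<Rightarrow> ('k, 'w \<Rightarrow> 'k) module"
where
  "twisted_algebra K m e \<tau> H =
     \<lparr>carrier = {f. (\<forall>w. f w \<in> carrier K) \<and> finite {w. f w \<noteq> \<zero>\<^bsub>K\<^esub>} \<and> {w. f w \<noteq> \<zero>\<^bsub>K\<^esub>} \<subseteq> H},
      monoid.mult = (\<lambda>f g w. \<Oplus>\<^bsub>K\<^esub>p\<in>{p. f (fst p) \<noteq> \<zero>\<^bsub>K\<^esub> \<and> g (snd p) \<noteq> \<zero>\<^bsub>K\<^esub> \<and> m (fst p) (snd p) = w}.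
                       \<tau> (fst p) (snd p) \<otimes>\<^bsub>K\<^esub> (f (fst p) \<otimes>\<^bsub>K\<^esub> g (snd p))),
      monoid.one = (\<lambda>w. if w = e then \<one>\<^bsub>K\<^esub> else \<zero>\<^bsub>K\<^esub>),
      ring.zero = (\<lambda>w. \<zero>\<^bsub>K\<^esub>),
      ring.add = (\<lambda>f g w. f w \<oplus>\<^bsub>K\<^esub> g w),
      smult = (\<lambda>c f w. c \<otimes>\<^bsub>K\<^esub> f w)\<rparr>"

locale twisted_monoid = K?: field K for K (structure) +
  fixes m :: "'w \<Rightarrow> 'w \<Rightarrow> 'w" and e :: 'w and \<tau> :: "'w \<Rightarrow> 'w \<Rightarrow> 'a" and H :: "'w set"
  assumes e_in: "e \<in> H" and m_in: "\<And>a b. a \<in> H \<Longrightarrow> b \<in> H \<Longrightarrow> m a b \<in> H"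
    and m_assoc: "\<And>a b c. m (m a b) c = m a (m b c)"
    and m_e: "\<And>a. m a e = a" "\<And>a. m e a = a"
    and \<tau>_in [simp]: "\<And>a b. \<tau> a b \<in> carrier K"
    and \<tau>_e: "\<And>a. \<tau> a e = \<one>" "\<And>a. \<tau> e a = \<one>"
    and cocycle: "\<And>a b c. \<tau> a b \<otimes> \<tau> (m a b) c = \<tau> b c \<otimes> \<tau> a (m b c)"
begin

definition T where "T = twisted_algebra K m e \<tau> H"

definition supp :: "('w \<Rightarrow> 'a) \<Rightarrow> 'w set" where "supp f = {w. f w \<noteq> \<zero>}"

definition delta :: "'w \<Rightarrow> 'w \<Rightarrow> 'a" where
  "delta a = (\<lambda>w. if w = a then \<one> else \<zero>)"

lemma carrier_T: "f \<in> carrier T \<longleftrightarrow> (\<forall>w. f w \<in> carrier K) \<and> finite (supp f) \<and> supp f \<subseteq> H"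
  by (simp add: T_def twisted_algebra_def supp_def)

lemma T_ops: "\<one>\<^bsub>T\<^esub> = delta e" "\<zero>\<^bsub>T\<^esub> = (\<lambda>w. \<zero>)" "f \<oplus>\<^bsub>T\<^esub> g = (\<lambda>w. f w \<oplus> g w)"
  "c \<odot>\<^bsub>T\<^esub> f = (\<lambda>w. c \<otimes> f w)"
  by (auto simp: T_def twisted_algebra_def delta_def)

lemma carrier_TD [simp]: "f \<in> carrier T \<Longrightarrow> f w \<in> carrier K"
  by (simp add: carrier_T)

text \<open>The index set of the defining sum depends on both supports. Enlarging it by zero terms
  to any finite box lets products with different factors be compared term by term.\<close>

lemma mult_T:
  assumes "f \<in> carrier T" "g \<in> carrier T" "finite A" "finite B" "supp f \<subseteq> A" "supp g \<subseteq> B"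
  shows "(f \<otimes>\<^bsub>T\<^esub> g) w =
    (\<Oplus>p\<in>A \<times> B. if m (fst p) (snd p) = w then \<tau> (fst p) (snd p) \<otimes> (f (fst p) \<otimes> g (snd p)) else \<zero>)"
proof -
  let ?S = "{p. f (fst p) \<noteq> \<zero> \<and> g (snd p) \<noteq> \<zero> \<and> m (fst p) (snd p) = w}"
  have S: "?S \<subseteq> A \<times> B"
    using assms by (auto simp: supp_def)
  have "(\<Oplus>p\<in>?S. \<tau> (fst p) (snd p) \<otimes> (f (fst p) \<otimes> g (snd p))) =
    (\<Oplus>p\<in>A \<times> B. if m (fst p) (snd p) = w then \<tau> (fst p) (snd p) \<otimes> (f (fst p) \<otimes> g (snd p)) else \<zero>)"
  proof (rule add.finprod_mono_neutral_cong_left)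
    show "finite (A \<times> B)"
      using assms by simp
    show "?S \<subseteq> A \<times> B" by (rule S)
    have zero: "\<tau> a b \<otimes> (f a \<otimes> g b) = \<zero>" if "f a = \<zero> \<or> g b = \<zero>" for a b
      using that assms(1,2)[THEN carrier_TD] by auto
    then show "(if m (fst p) (snd p) = w
        then \<tau> (fst p) (snd p) \<otimes> (f (fst p) \<otimes> g (snd p)) else \<zero>) = \<zero>" if "p \<in> A \<times> B - ?S" for p
      using that by auto
    show "(\<lambda>p. if m (fst p) (snd p) = w
        then \<tau> (fst p) (snd p) \<otimes> (f (fst p) \<otimes> g (snd p)) else \<zero>) \<in> A \<times> B \<rightarrow> carrier K"
      using assms(1,2) by simp
  qed simp
  moreover have "(f \<otimes>\<^bsub>T\<^esub> g) w = (\<Oplus>p\<in>?S. \<tau> (fst p) (snd p) \<otimes> (f (fst p) \<otimes> g (snd p)))"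
    unfolding T_def twisted_algebra_def monoid.simps ..
  ultimately show ?thesis
    by (rule trans[rotated])
qed

lemma delta_closed [simp]: "a \<in> H \<Longrightarrow> delta a \<in> carrier T"
  by (auto simp: carrier_T supp_def delta_def)

lemma supp_add: "f \<in> carrier T \<Longrightarrow> g \<in> carrier T \<Longrightarrow> supp (\<lambda>w. f w \<oplus> g w) \<subseteq> supp f \<union> supp g"
  by (auto simp: supp_def)

lemma supp_smult: "c \<in> carrier K \<Longrightarrow> supp (\<lambda>w. c \<otimes> f w) \<subseteq> supp f"
  by (auto simp: supp_def)

lemma T_add_closed: "f \<in> carrier T \<Longrightarrow> g \<in> carrier T \<Longrightarrow> f \<oplus>\<^bsub>T\<^esub> g \<in> carrier T"
  using supp_add[of f g] by (auto simp: carrier_T T_ops intro: finite_subset)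

lemma T_smult_closed: "c \<in> carrier K \<Longrightarrow> f \<in> carrier T \<Longrightarrow> c \<odot>\<^bsub>T\<^esub> f \<in> carrier T"
  using supp_smult[of c f] by (auto simp: carrier_T T_ops intro: finite_subset)

lemma T_zero_closed: "\<zero>\<^bsub>T\<^esub> \<in> carrier T"
  by (auto simp: carrier_T T_ops supp_def)

lemma T_abelian_group: "abelian_group T"
proof (rule abelian_groupI)
  fix f assume f: "f \<in> carrier T"
  have "supp (\<lambda>w. \<ominus> f w) = supp f"
    using f by (auto simp: supp_def)
  then have "(\<lambda>w. \<ominus> f w) \<in> carrier T"
    using f by (simp add: carrier_T)
  then show "\<exists>g\<in>carrier T. g \<oplus>\<^bsub>T\<^esub> f = \<zero>\<^bsub>T\<^esub>"
    using f by (intro bexI[of _ "\<lambda>w. \<ominus> f w"]) (auto simp: T_ops l_neg)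
qed (simp_all add: T_add_closed T_zero_closed, auto simp: T_ops a_ac)

lemma T_mult_closed:
  assumes f: "f \<in> carrier T" and g: "g \<in> carrier T"
  shows "f \<otimes>\<^bsub>T\<^esub> g \<in> carrier T"
proof -
  have fin: "finite (supp f)" "finite (supp g)"
    using f g by (auto simp: carrier_T)
  note eq = mult_T[OF f g fin subset_refl subset_refl]
  have "supp (f \<otimes>\<^bsub>T\<^esub> g) \<subseteq> (\<lambda>p. m (fst p) (snd p)) ` (supp f \<times> supp g)"
  proof
    fix w assume w: "w \<in> supp (f \<otimes>\<^bsub>T\<^esub> g)"
    show "w \<in> (\<lambda>p. m (fst p) (snd p)) ` (supp f \<times> supp g)"
    proof (rule ccontr)
      assume "\<not> ?thesis"
      then have "(f \<otimes>\<^bsub>T\<^esub> g) w = \<zero>"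
        unfolding eq by (intro add.finprod_one_eqI) auto
      then show False
        using w by (simp add: supp_def)
    qed
  qed
  moreover have "\<dots> \<subseteq> H"
    using f g by (force simp: carrier_T intro: m_in)
  moreover have "(f \<otimes>\<^bsub>T\<^esub> g) w \<in> carrier K" for w
    unfolding eq using f g by (intro finsum_closed) auto
  ultimately show ?thesis
    using fin unfolding carrier_T by (meson finite_SigmaI finite_imageI finite_subset subset_trans)
qed

lemma T_l_distr:
  assumes f: "f \<in> carrier T" and f': "f' \<in> carrier T" and g: "g \<in> carrier T"
  shows "(f \<oplus>\<^bsub>T\<^esub> f') \<otimes>\<^bsub>T\<^esub> g = f \<otimes>\<^bsub>T\<^esub> g \<oplus>\<^bsub>T\<^esub> f' \<otimes>\<^bsub>T\<^esub> g"
proof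
  fix w
  let ?A = "supp f \<union> supp f'" and ?B = "supp g"
  have fin: "finite ?A" "finite ?B"
    using assms by (auto simp: carrier_T)
  have "supp (f \<oplus>\<^bsub>T\<^esub> f') \<subseteq> ?A"
    using supp_add[OF f f'] by (simp add: T_ops)
  then have "((f \<oplus>\<^bsub>T\<^esub> f') \<otimes>\<^bsub>T\<^esub> g) w =
     (\<Oplus>p\<in>?A \<times> ?B. if m (fst p) (snd p) = w then \<tau> (fst p) (snd p) \<otimes> ((f \<oplus>\<^bsub>T\<^esub> f') (fst p) \<otimes> g (snd p)) else \<zero>)"
    by (intro mult_T T_add_closed assms fin) auto
  also have "\<dots> = (\<Oplus>p\<in>?A \<times> ?B. (if m (fst p) (snd p) = w then \<tau> (fst p) (snd p) \<otimes> (f (fst p) \<otimes> g (snd p)) else \<zero>)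
       \<oplus> (if m (fst p) (snd p) = w then \<tau> (fst p) (snd p) \<otimes> (f' (fst p) \<otimes> g (snd p)) else \<zero>))"
    by (intro add.finprod_cong') (use assms in \<open>auto simp: T_ops l_distr r_distr\<close>)
  also have "\<dots> = (f \<otimes>\<^bsub>T\<^esub> g) w \<oplus> (f' \<otimes>\<^bsub>T\<^esub> g) w"
    using assms
    by (subst finsum_addf) (auto simp: mult_T[OF f g fin] mult_T[OF f' g fin])
  finally show "((f \<oplus>\<^bsub>T\<^esub> f') \<otimes>\<^bsub>T\<^esub> g) w = (f \<otimes>\<^bsub>T\<^esub> g \<oplus>\<^bsub>T\<^esub> f' \<otimes>\<^bsub>T\<^esub> g) w"
    by (simp add: T_ops)
qed

lemma T_r_distr:
  assumes f: "f \<in> carrier T" and f': "f' \<in> carrier T" and g: "g \<in> carrier T"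
  shows "g \<otimes>\<^bsub>T\<^esub> (f \<oplus>\<^bsub>T\<^esub> f') = g \<otimes>\<^bsub>T\<^esub> f \<oplus>\<^bsub>T\<^esub> g \<otimes>\<^bsub>T\<^esub> f'"
proof
  fix w
  let ?A = "supp f \<union> supp f'" and ?B = "supp g"
  have fin: "finite ?A" "finite ?B"
    using assms by (auto simp: carrier_T)
  have "supp (f \<oplus>\<^bsub>T\<^esub> f') \<subseteq> ?A"
    using supp_add[OF f f'] by (simp add: T_ops)
  then have "(g \<otimes>\<^bsub>T\<^esub> (f \<oplus>\<^bsub>T\<^esub> f')) w =
     (\<Oplus>p\<in>?B \<times> ?A. if m (fst p) (snd p) = w then \<tau> (fst p) (snd p) \<otimes> (g (fst p) \<otimes> (f \<oplus>\<^bsub>T\<^esub> f') (snd p)) else \<zero>)"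
    by (intro mult_T T_add_closed assms fin) auto
  also have "\<dots> = (\<Oplus>p\<in>?B \<times> ?A. (if m (fst p) (snd p) = w then \<tau> (fst p) (snd p) \<otimes> (g (fst p) \<otimes> f (snd p)) else \<zero>)
       \<oplus> (if m (fst p) (snd p) = w then \<tau> (fst p) (snd p) \<otimes> (g (fst p) \<otimes> f' (snd p)) else \<zero>))"
    by (intro add.finprod_cong') (use assms in \<open>auto simp: T_ops l_distr r_distr\<close>)
  also have "\<dots> = (g \<otimes>\<^bsub>T\<^esub> f) w \<oplus> (g \<otimes>\<^bsub>T\<^esub> f') w"
    using assms
    by (subst finsum_addf) (auto simp: mult_T[OF g f fin(2,1)] mult_T[OF g f' fin(2,1)])
  finally show "(g \<otimes>\<^bsub>T\<^esub> (f \<oplus>\<^bsub>T\<^esub> f')) w = (g \<otimes>\<^bsub>T\<^esub> f \<oplus>\<^bsub>T\<^esub> g \<otimes>\<^bsub>T\<^esub> f') w"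
    by (simp add: T_ops)
qed

lemma T_smult_mult:
  assumes c: "c \<in> carrier K" and f: "f \<in> carrier T" and g: "g \<in> carrier T"
  shows "(c \<odot>\<^bsub>T\<^esub> f) \<otimes>\<^bsub>T\<^esub> g = c \<odot>\<^bsub>T\<^esub> (f \<otimes>\<^bsub>T\<^esub> g)"
    and "f \<otimes>\<^bsub>T\<^esub> (c \<odot>\<^bsub>T\<^esub> g) = c \<odot>\<^bsub>T\<^esub> (f \<otimes>\<^bsub>T\<^esub> g)"
proof -
  let ?A = "supp f" and ?B = "supp g"
  have fin: "finite ?A" "finite ?B"
    using assms by (auto simp: carrier_T)
  have eq: "c \<otimes> (f \<otimes>\<^bsub>T\<^esub> g) w =
     (\<Oplus>p\<in>?A \<times> ?B. c \<otimes> (if m (fst p) (snd p) = w then \<tau> (fst p) (snd p) \<otimes> (f (fst p) \<otimes> g (snd p)) else \<zero>))" for w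
    using assms fin by (subst mult_T[OF f g fin]) (auto intro!: finsum_rdistr)
  have "((c \<odot>\<^bsub>T\<^esub> f) \<otimes>\<^bsub>T\<^esub> g) w = c \<otimes> (f \<otimes>\<^bsub>T\<^esub> g) w" for w
    unfolding eq
    by (subst mult_T[OF T_smult_closed[OF c f] g fin])
       (use assms supp_smult[OF c, of f] in \<open>auto simp: T_ops m_ac intro!: add.finprod_cong'\<close>)
  then show "(c \<odot>\<^bsub>T\<^esub> f) \<otimes>\<^bsub>T\<^esub> g = c \<odot>\<^bsub>T\<^esub> (f \<otimes>\<^bsub>T\<^esub> g)"
    by (auto simp: T_ops(4))
  have "(f \<otimes>\<^bsub>T\<^esub> (c \<odot>\<^bsub>T\<^esub> g)) w = c \<otimes> (f \<otimes>\<^bsub>T\<^esub> g) w" for w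
    unfolding eq
    by (subst mult_T[OF f T_smult_closed[OF c g] fin])
       (use assms supp_smult[OF c, of g] in \<open>auto simp: T_ops m_ac intro!: add.finprod_cong'\<close>)
  then show "f \<otimes>\<^bsub>T\<^esub> (c \<odot>\<^bsub>T\<^esub> g) = c \<odot>\<^bsub>T\<^esub> (f \<otimes>\<^bsub>T\<^esub> g)"
    by (auto simp: T_ops(4))
qed

lemma supp_delta: "supp (delta a) = {a}"
  by (auto simp: supp_def delta_def)

lemma delta_mult:
  assumes "a \<in> H" "b \<in> H"
  shows "delta a \<otimes>\<^bsub>T\<^esub> delta b = \<tau> a b \<odot>\<^bsub>T\<^esub> delta (m a b)"
proof
  fix w
  have "(delta a \<otimes>\<^bsub>T\<^esub> delta b) w = (\<Oplus>p\<in>{a} \<times> {b}. if m (fst p) (snd p) = w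
      then \<tau> (fst p) (snd p) \<otimes> (delta a (fst p) \<otimes> delta b (snd p)) else \<zero>)"
    by (intro mult_T) (use assms in \<open>auto simp: supp_delta\<close>)
  also have "\<dots> = (\<tau> a b \<odot>\<^bsub>T\<^esub> delta (m a b)) w"
    by (simp add: finsum_insert delta_def T_ops)
  finally show "(delta a \<otimes>\<^bsub>T\<^esub> delta b) w = (\<tau> a b \<odot>\<^bsub>T\<^esub> delta (m a b)) w" .
qed

text \<open>Elements are linear combinations of the \<open>delta a\<close>, so multilinear
  identities need only be checked there. The induction runs over a finite set containing the
  support, from which one point is split off at a time.\<close>

lemma T_induct [consumes 1, case_names zero delta add]:
  assumes f: "f \<in> carrier T" and P0: "P \<zero>\<^bsub>T\<^esub>"
    and Pd: "\<And>c a. c \<in> carrier K \<Longrightarrow> a \<in> H \<Longrightarrow> P (c \<odot>\<^bsub>T\<^esub> delta a)"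
    and Pa: "\<And>f g. f \<in> carrier T \<Longrightarrow> g \<in> carrier T \<Longrightarrow> P f \<Longrightarrow> P g \<Longrightarrow> P (f \<oplus>\<^bsub>T\<^esub> g)"
  shows "P f"
proof -
  have "\<forall>f\<in>carrier T. supp f \<subseteq> E \<longrightarrow> P f" if "finite E" for E
    using that
  proof (induction E)
    case empty
    have "f = \<zero>\<^bsub>T\<^esub>" if "supp f \<subseteq> {}" for f
      using that by (auto simp: supp_def T_ops)
    then show ?case using P0 by blast
  next
    case (insert a E)
    show ?case
    proof (intro ballI impI)
      fix f assume f: "f \<in> carrier T" and sf: "supp f \<subseteq> insert a E"
      let ?g = "\<lambda>w. if w = a then \<zero> else f w"
      have g: "?g \<in> carrier T" "supp ?g \<subseteq> E"
        using f sf by (auto simp: carrier_T supp_def intro: rev_finite_subset)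
      show "P f"
      proof (cases "a \<in> H")
        case True
        have eq: "f = (f a \<odot>\<^bsub>T\<^esub> delta a) \<oplus>\<^bsub>T\<^esub> ?g"
          using f by (auto simp: T_ops delta_def)
        have fa: "f a \<in> carrier K"
          using f by simp
        have "P ?g"
          using insert.IH g by blast
        then have "P ((f a \<odot>\<^bsub>T\<^esub> delta a) \<oplus>\<^bsub>T\<^esub> ?g)"
          by (intro Pa Pd T_smult_closed delta_closed fa True g(1))
        then show ?thesis
          by (rule ssubst[OF eq])
      next
        case False
        then have "f a = \<zero>"
          using f by (auto simp: carrier_T supp_def)
        then have "supp f \<subseteq> E"
          using sf by (auto simp: supp_def)
        then show ?thesis
          using insert.IH f by blast
      qed
    qed
  qed
  from this[of "supp f"] show ?thesis
    using f by (auto simp: carrier_T)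
qed

lemma T_smult_assoc:
  "c \<in> carrier K \<Longrightarrow> d \<in> carrier K \<Longrightarrow> f \<in> carrier T \<Longrightarrow> (c \<otimes> d) \<odot>\<^bsub>T\<^esub> f = c \<odot>\<^bsub>T\<^esub> (d \<odot>\<^bsub>T\<^esub> f)"
  by (auto simp: T_ops m_assoc K.m_assoc)

lemma T_zero_mult: "f \<in> carrier T \<Longrightarrow> \<zero>\<^bsub>T\<^esub> \<otimes>\<^bsub>T\<^esub> f = \<zero>\<^bsub>T\<^esub>" "f \<in> carrier T \<Longrightarrow> f \<otimes>\<^bsub>T\<^esub> \<zero>\<^bsub>T\<^esub> = \<zero>\<^bsub>T\<^esub>"
proof -
  have z: "\<zero> \<odot>\<^bsub>T\<^esub> g = \<zero>\<^bsub>T\<^esub>" if "g \<in> carrier T" for g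
    using that by (auto simp: T_ops)
  show "f \<in> carrier T \<Longrightarrow> \<zero>\<^bsub>T\<^esub> \<otimes>\<^bsub>T\<^esub> f = \<zero>\<^bsub>T\<^esub>"
    using T_smult_mult(1)[of \<zero> "\<zero>\<^bsub>T\<^esub>" f] by (simp add: z T_zero_closed T_mult_closed)
  show "f \<in> carrier T \<Longrightarrow> f \<otimes>\<^bsub>T\<^esub> \<zero>\<^bsub>T\<^esub> = \<zero>\<^bsub>T\<^esub>"
    using T_smult_mult(2)[of \<zero> f "\<zero>\<^bsub>T\<^esub>"] by (simp add: z T_zero_closed T_mult_closed)
qed

text \<open>Induction in each of the three arguments leaves basis elements, where associativity is
  \<open>cocycle\<close>.\<close>

lemma T_assoc:
  assumes f: "f \<in> carrier T" and g: "g \<in> carrier T" and k: "k \<in> carrier T"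
  shows "(f \<otimes>\<^bsub>T\<^esub> g) \<otimes>\<^bsub>T\<^esub> k = f \<otimes>\<^bsub>T\<^esub> (g \<otimes>\<^bsub>T\<^esub> k)"
  using f
proof (induction rule: T_induct)
  case zero
  then show ?case by (simp add: T_zero_mult g k T_mult_closed)
next
  case (add f f')
  then show ?case by (simp add: T_l_distr T_mult_closed g k)
next
  case f: (delta c a)
  show ?case using g
  proof (induction rule: T_induct)
    case zero
    then show ?case by (simp add: T_zero_mult f k T_mult_closed T_smult_closed)
  next
    case (add g g')
    then show ?case by (simp add: T_l_distr T_r_distr T_mult_closed f k T_smult_closed)
  next
    case g: (delta d b)
    show ?case using k
    proof (induction rule: T_induct)
      case zero
      then show ?case by (simp add: T_zero_mult f g T_mult_closed T_smult_closed)
    next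
      case (add k k')
      then show ?case by (simp add: T_r_distr T_mult_closed f g T_smult_closed)
    next
      case k: (delta r w)
      have "(delta a \<otimes>\<^bsub>T\<^esub> delta b) \<otimes>\<^bsub>T\<^esub> delta w = delta a \<otimes>\<^bsub>T\<^esub> (delta b \<otimes>\<^bsub>T\<^esub> delta w)"
        using f g k
        by (simp add: delta_mult T_smult_mult m_in flip: T_smult_assoc)
           (simp add: cocycle m_assoc)
      then show ?case
        using f g k by (simp add: T_smult_mult T_smult_closed T_mult_closed)
    qed
  qed
qed

lemma T_one_mult:
  assumes f: "f \<in> carrier T"
  shows "\<one>\<^bsub>T\<^esub> \<otimes>\<^bsub>T\<^esub> f = f" "f \<otimes>\<^bsub>T\<^esub> \<one>\<^bsub>T\<^esub> = f"
proof -
  have one: "\<one> \<odot>\<^bsub>T\<^esub> g = g" if "g \<in> carrier T" for g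
    using that by (auto simp: T_ops)
  show "\<one>\<^bsub>T\<^esub> \<otimes>\<^bsub>T\<^esub> f = f" using f
    by (induction rule: T_induct)
       (simp_all add: T_zero_mult T_r_distr T_ops(1) e_in T_smult_mult delta_mult m_e \<tau>_e one)
  show "f \<otimes>\<^bsub>T\<^esub> \<one>\<^bsub>T\<^esub> = f" using f
    by (induction rule: T_induct)
       (simp_all add: T_zero_mult T_l_distr T_ops(1) e_in T_smult_mult delta_mult m_e \<tau>_e one)
qed

lemma T_algebra: "assoc_algebra K T"
proof (rule assoc_algebraI)
  show "ring T"
  proof (rule ringI)
    show "Group.monoid T"
      by (rule monoidI) (simp_all add: T_mult_closed T_assoc T_one_mult e_in T_ops(1)[symmetric],
          simp add: T_ops(1) e_in)
  qed (simp_all add: T_abelian_group T_l_distr T_r_distr)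
qed (auto simp: T_smult_closed T_smult_mult K.field_axioms, auto simp: T_ops l_distr r_distr K.m_assoc)

end

sublocale twisted_monoid \<subseteq> T?: assoc_algebra K T
  by (rule T_algebra)

context twisted_monoid
begin

lemma finsum_T_apply:
  assumes "finite E" "g \<in> E \<rightarrow> carrier T"
  shows "finsum T g E w = (\<Oplus>i\<in>E. g i w)"
  using assms
proof (induction E)
  case (insert x E)
  then have "finsum T g (insert x E) w = (g x \<oplus>\<^bsub>T\<^esub> finsum T g E) w"
    by (subst T.M.finsum_insert) auto
  also have "\<dots> = g x w \<oplus> (\<Oplus>i\<in>E. g i w)"
    using insert by (auto simp: T_ops)
  also have "\<dots> = (\<Oplus>i\<in>insert x E. g i w)"
    using insert by (subst K.finsum_insert) (auto simp: Pi_iff)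
  finally show ?case .
qed (simp add: T_ops)

text \<open>A family multiplying with the same twist extends linearly; the extension is
  multiplicative because both sides are bilinear and agree on basis elements.\<close>

lemma T_hom:
  assumes B: "assoc_algebra K B"
    and p: "\<And>a. a \<in> H \<Longrightarrow> p a \<in> carrier B"
    and pm: "\<And>a b. a \<in> H \<Longrightarrow> b \<in> H \<Longrightarrow> p a \<otimes>\<^bsub>B\<^esub> p b = \<tau> a b \<odot>\<^bsub>B\<^esub> p (m a b)"
    and p1: "p e = \<one>\<^bsub>B\<^esub>"
  obtains \<phi> where "\<phi> \<in> algebra_hom K T B" "\<And>a. a \<in> H \<Longrightarrow> \<phi> (delta a) = p a"
proof -
  interpret B: assoc_algebra K B by fact
  define \<phi> where "\<phi> f = finsum B (\<lambda>a. f a \<odot>\<^bsub>B\<^esub> p a) (supp f)" for f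
  have eq: "\<phi> f = finsum B (\<lambda>a. f a \<odot>\<^bsub>B\<^esub> p a) E"
    if "f \<in> carrier T" "finite E" "supp f \<subseteq> E" "E \<subseteq> H" for f E
    unfolding \<phi>_def using that p
    by (intro B.M.add.finprod_mono_neutral_cong_left) (auto simp: supp_def subset_iff)
  have closed: "\<phi> f \<in> carrier B" if "f \<in> carrier T" for f
    unfolding \<phi>_def using that p by (intro B.M.finsum_closed) (auto simp: carrier_T)
  have sm: "\<phi> (c \<odot>\<^bsub>T\<^esub> f) = c \<odot>\<^bsub>B\<^esub> \<phi> f" if "c \<in> carrier K" "f \<in> carrier T" for c f
  proof -
    have fin: "finite (supp f)" "supp f \<subseteq> H" "supp (c \<odot>\<^bsub>T\<^esub> f) \<subseteq> supp f"
      using that supp_smult[OF that(1), of f] by (auto simp: carrier_T T_ops)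
    have "\<phi> (c \<odot>\<^bsub>T\<^esub> f) = finsum B (\<lambda>a. (c \<odot>\<^bsub>T\<^esub> f) a \<odot>\<^bsub>B\<^esub> p a) (supp f)"
      using that fin by (intro eq) (auto)
    also have "\<dots> = finsum B (\<lambda>a. c \<odot>\<^bsub>B\<^esub> (f a \<odot>\<^bsub>B\<^esub> p a)) (supp f)"
      using that fin p by (intro B.M.add.finprod_cong') (auto simp: T_ops B.smult_assoc1)
    also have "\<dots> = c \<odot>\<^bsub>B\<^esub> \<phi> f"
      unfolding \<phi>_def using that fin p by (intro B.finsum_smult_ldistr[symmetric]) auto
    finally show ?thesis .
  qed
  have ad: "\<phi> (f \<oplus>\<^bsub>T\<^esub> g) = \<phi> f \<oplus>\<^bsub>B\<^esub> \<phi> g" if "f \<in> carrier T" "g \<in> carrier T" for f g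
  proof -
    let ?E = "supp f \<union> supp g"
    have fin: "finite ?E" "?E \<subseteq> H" "supp (f \<oplus>\<^bsub>T\<^esub> g) \<subseteq> ?E"
      using that supp_add[OF that] by (auto simp: carrier_T T_ops)
    have "\<phi> (f \<oplus>\<^bsub>T\<^esub> g) = finsum B (\<lambda>a. (f \<oplus>\<^bsub>T\<^esub> g) a \<odot>\<^bsub>B\<^esub> p a) ?E"
      using that fin by (intro eq) (auto)
    also have "\<dots> = finsum B (\<lambda>a. f a \<odot>\<^bsub>B\<^esub> p a \<oplus>\<^bsub>B\<^esub> g a \<odot>\<^bsub>B\<^esub> p a) ?E"
      using that fin p by (intro B.M.add.finprod_cong') (auto simp: T_ops B.smult_l_distr)
    also have "\<dots> = \<phi> f \<oplus>\<^bsub>B\<^esub> \<phi> g"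
      using that fin p by (subst B.M.finsum_addf) (auto simp: eq[of _ ?E])
    finally show ?thesis .
  qed
  have del: "\<phi> (delta a) = p a" if "a \<in> H" for a
    using that p B.M.finsum_insert[of "{}" a "\<lambda>i. delta a i \<odot>\<^bsub>B\<^esub> p i"]
    unfolding \<phi>_def supp_delta by (simp add: delta_def)
  have z: "\<phi> \<zero>\<^bsub>T\<^esub> = \<zero>\<^bsub>B\<^esub>"
    by (simp add: \<phi>_def supp_def T_ops)
  have mu: "\<phi> (f \<otimes>\<^bsub>T\<^esub> g) = \<phi> f \<otimes>\<^bsub>B\<^esub> \<phi> g" if f: "f \<in> carrier T" and g: "g \<in> carrier T" for f g
    using f
  proof (induction rule: T_induct)
    case zero
    then show ?case using g by (simp add: z closed)
  next
    case (add f f')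
    then show ?case using g by (simp add: T.A.l_distr ad closed B.A.l_distr)
  next
    case f: (delta c a)
    show ?case using g
    proof (induction rule: T_induct)
      case zero
      then show ?case using f by (simp add: z closed)
    next
      case (add g g')
      then show ?case using f by (simp add: T.A.r_distr ad closed B.A.r_distr)
    next
      case (delta d b)
      then show ?case using f p
        by (simp add: T_smult_mult T_smult_closed T_mult_closed sm del delta_mult m_in pm
            B.smult_mult_left B.smult_mult_right)
    qed
  qed
  show ?thesis
  proof (rule that)
    show "\<phi> \<in> algebra_hom K T B"
      using closed mu ad sm del[OF e_in] p1 by (intro algebra_homI) (auto simp: T_ops(1))
  qed (use del in auto)
qed

end

section \<open>Skew fields of right fractions and their realisation on a prescribed type\<close>

section \<open>Ore localisation\<close>

locale domain_algebra = assoc_algebra K A for K (structure) and A (structure) +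
  assumes one_not_zero_A: "\<one>\<^bsub>A\<^esub> \<noteq> \<zero>\<^bsub>A\<^esub>"
    and integral_A: "\<And>a b. a \<in> carrier A \<Longrightarrow> b \<in> carrier A \<Longrightarrow> a \<otimes>\<^bsub>A\<^esub> b = \<zero>\<^bsub>A\<^esub> \<Longrightarrow> a = \<zero>\<^bsub>A\<^esub> \<or> b = \<zero>\<^bsub>A\<^esub>"
begin

lemma diff_zero_eq: "a \<in> carrier A \<Longrightarrow> b \<in> carrier A \<Longrightarrow> a \<ominus>\<^bsub>A\<^esub> b = \<zero>\<^bsub>A\<^esub> \<Longrightarrow> a = b"
  by (metis A.r_right_minus_eq)

lemma cancel_right:
  assumes "a \<in> carrier A" "b \<in> carrier A" "r \<in> carrier A" "r \<noteq> \<zero>\<^bsub>A\<^esub>" "a \<otimes>\<^bsub>A\<^esub> r = b \<otimes>\<^bsub>A\<^esub> r"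
  shows "a = b"
proof -
  have "(a \<ominus>\<^bsub>A\<^esub> b) \<otimes>\<^bsub>A\<^esub> r = \<zero>\<^bsub>A\<^esub>"
    using assms by (simp add: a_minus_def A.l_distr A.l_minus M.r_neg)
  then show ?thesis
    using assms integral_A diff_zero_eq by (metis M.minus_closed)
qed

lemma cancel_left:
  assumes "a \<in> carrier A" "b \<in> carrier A" "r \<in> carrier A" "r \<noteq> \<zero>\<^bsub>A\<^esub>" "r \<otimes>\<^bsub>A\<^esub> a = r \<otimes>\<^bsub>A\<^esub> b"
  shows "a = b"
proof -
  have "r \<otimes>\<^bsub>A\<^esub> (a \<ominus>\<^bsub>A\<^esub> b) = \<zero>\<^bsub>A\<^esub>"
    using assms by (simp add: a_minus_def A.r_distr A.r_minus M.r_neg)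
  then show ?thesis
    using assms integral_A diff_zero_eq by (metis M.minus_closed)
qed

end

text \<open>This is the right Ore condition, in its symmetric form with a nonzero common right
  multiple.\<close>

locale ore_algebra = domain_algebra +
  assumes ore: "\<And>a b. a \<in> carrier A \<Longrightarrow> b \<in> carrier A \<Longrightarrow> a \<noteq> \<zero>\<^bsub>A\<^esub> \<Longrightarrow> b \<noteq> \<zero>\<^bsub>A\<^esub> \<Longrightarrow>
      \<exists>u\<in>carrier A. \<exists>v\<in>carrier A. a \<otimes>\<^bsub>A\<^esub> u = b \<otimes>\<^bsub>A\<^esub> v \<and> a \<otimes>\<^bsub>A\<^esub> u \<noteq> \<zero>\<^bsub>A\<^esub>"
begin

lemma ore':
  assumes "b \<in> carrier A" "b \<noteq> \<zero>\<^bsub>A\<^esub>" "d \<in> carrier A"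
  obtains u v where "u \<in> carrier A" "v \<in> carrier A" "v \<noteq> \<zero>\<^bsub>A\<^esub>" "b \<otimes>\<^bsub>A\<^esub> u = d \<otimes>\<^bsub>A\<^esub> v"
proof (cases "d = \<zero>\<^bsub>A\<^esub>")
  case True
  then show ?thesis
    using that[of "\<zero>\<^bsub>A\<^esub>" "\<one>\<^bsub>A\<^esub>"] assms one_not_zero_A by simp
next
  case False
  then obtain u v where "u \<in> carrier A" "v \<in> carrier A" "b \<otimes>\<^bsub>A\<^esub> u = d \<otimes>\<^bsub>A\<^esub> v" "b \<otimes>\<^bsub>A\<^esub> u \<noteq> \<zero>\<^bsub>A\<^esub>"
    using ore assms by meson
  then show ?thesis
    using that[of u v] assms by (cases "v = \<zero>\<^bsub>A\<^esub>") auto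
qed

text \<open>The fraction \<open>a b\<^sup>-\<^sup>1\<close>, as the set of all pairs \<open>(c, d)\<close> with \<open>a b\<^sup>-\<^sup>1 d = c\<close>.\<close>

definition frac :: "'c \<Rightarrow> 'c \<Rightarrow> ('c \<times> 'c) set" where
  "frac a b = {(c, d). c \<in> carrier A \<and> d \<in> carrier A \<and>
     (\<forall>u\<in>carrier A. \<forall>v\<in>carrier A. b \<otimes>\<^bsub>A\<^esub> u = d \<otimes>\<^bsub>A\<^esub> v \<longrightarrow> a \<otimes>\<^bsub>A\<^esub> u = c \<otimes>\<^bsub>A\<^esub> v)}"

text \<open>A fraction is the graph of left multiplication by it, on the right ideal of those
  \<open>d\<close> that it carries into the algebra. Products and sums of fractions are composition
  and pointwise sum of such partial maps, so no equivalence relation on pairs has to be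
  handled.\<close>

definition fracs :: "('c \<times> 'c) set set" where
  "fracs = {frac a b | a b. a \<in> carrier A \<and> b \<in> carrier A \<and> b \<noteq> \<zero>\<^bsub>A\<^esub>}"

lemma frac_in: "a \<in> carrier A \<Longrightarrow> b \<in> carrier A \<Longrightarrow> b \<noteq> \<zero>\<^bsub>A\<^esub> \<Longrightarrow> frac a b \<in> fracs"
  by (auto simp: fracs_def)

lemma fracs_carrier:
  assumes "x \<in> fracs" "(c, d) \<in> x"
  shows "c \<in> carrier A" "d \<in> carrier A"
  using assms by (auto simp: fracs_def frac_def)

lemma frac_self:
  assumes "a \<in> carrier A" "b \<in> carrier A" "b \<noteq> \<zero>\<^bsub>A\<^esub>"
  shows "(a, b) \<in> frac a b"
proof -
  have "u = v" if "u \<in> carrier A" "v \<in> carrier A" "b \<otimes>\<^bsub>A\<^esub> u = b \<otimes>\<^bsub>A\<^esub> v" for u v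
    using cancel_left[OF that(1,2) assms(2,3) that(3)] .
  then show ?thesis
    using assms by (auto simp: frac_def)
qed

lemma fracs_mult:
  assumes "x \<in> fracs" "(c, d) \<in> x" "w \<in> carrier A"
  shows "(c \<otimes>\<^bsub>A\<^esub> w, d \<otimes>\<^bsub>A\<^esub> w) \<in> x"
  using assms by (auto simp: fracs_def frac_def A.m_assoc)

lemma fracs_zero:
  assumes "x \<in> fracs"
  shows "(\<zero>\<^bsub>A\<^esub>, \<zero>\<^bsub>A\<^esub>) \<in> x"
proof -
  obtain a b where "a \<in> carrier A" "b \<in> carrier A" "(a, b) \<in> x"
    using assms frac_self by (auto simp: fracs_def)
  then show ?thesis
    using fracs_mult[OF assms, of a b "\<zero>\<^bsub>A\<^esub>"] by simp
qed

text \<open>Single-valuedness of the graph: two values at \<open>d\<close> agree after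
  multiplication by a \<open>v\<close> for which \<open>d v\<close> is a right multiple of
  \<open>b\<close>, and \<open>v\<close> cancels.\<close>

lemma fracs_unique:
  assumes "x \<in> fracs" "(c, d) \<in> x" "(c', d) \<in> x"
  shows "c = c'"
proof -
  obtain a b where ab: "a \<in> carrier A" "b \<in> carrier A" "b \<noteq> \<zero>\<^bsub>A\<^esub>" "x = frac a b"
    using assms by (auto simp: fracs_def)
  note c = fracs_carrier[OF assms(1,2)] fracs_carrier[OF assms(1,3)]
  obtain u v where uv: "u \<in> carrier A" "v \<in> carrier A" "v \<noteq> \<zero>\<^bsub>A\<^esub>" "b \<otimes>\<^bsub>A\<^esub> u = d \<otimes>\<^bsub>A\<^esub> v"
    using ore'[OF ab(2,3) c(2)] by blast
  have "c \<otimes>\<^bsub>A\<^esub> v = c' \<otimes>\<^bsub>A\<^esub> v"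
    using assms uv unfolding ab frac_def by auto
  then show ?thesis
    using cancel_right uv c by blast
qed

text \<open>For nonzero \<open>d\<close>, the domain of a fraction meets the right ideal of
  \<open>d\<close> in a nonzero element; common denominators are found in this way.\<close>

lemma fracs_dom:
  assumes "x \<in> fracs" "d \<in> carrier A"
  obtains c v where "c \<in> carrier A" "v \<in> carrier A" "v \<noteq> \<zero>\<^bsub>A\<^esub>" "(c, d \<otimes>\<^bsub>A\<^esub> v) \<in> x"
proof -
  obtain a b where ab: "a \<in> carrier A" "b \<in> carrier A" "b \<noteq> \<zero>\<^bsub>A\<^esub>" "x = frac a b"
    using assms by (auto simp: fracs_def)
  obtain u v where uv: "u \<in> carrier A" "v \<in> carrier A" "v \<noteq> \<zero>\<^bsub>A\<^esub>" "b \<otimes>\<^bsub>A\<^esub> u = d \<otimes>\<^bsub>A\<^esub> v"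
    using ore'[OF ab(2,3) assms(2)] by blast
  have "(a \<otimes>\<^bsub>A\<^esub> u, b \<otimes>\<^bsub>A\<^esub> u) \<in> x"
    using fracs_mult[OF assms(1)] frac_self ab uv by blast
  then show ?thesis
    using that[of "a \<otimes>\<^bsub>A\<^esub> u" v] uv ab by simp
qed

text \<open>One pair with nonzero denominator determines the whole graph. Both inclusions enlarge
  the given multiple by a factor \<open>r\<close> until it is a right multiple of the other
  denominator, and cancel \<open>r\<close> in the end.\<close>

lemma fracs_eq_frac:
  assumes x: "x \<in> fracs" and cd: "(c, d) \<in> x" "d \<noteq> \<zero>\<^bsub>A\<^esub>"
  shows "x = frac c d"
proof -
  obtain a b where ab: "a \<in> carrier A" "b \<in> carrier A" "b \<noteq> \<zero>\<^bsub>A\<^esub>" "x = frac a b"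
    using assms by (auto simp: fracs_def)
  note c = fracs_carrier[OF x cd(1)]
  have cd': "\<And>u v. u \<in> carrier A \<Longrightarrow> v \<in> carrier A \<Longrightarrow> b \<otimes>\<^bsub>A\<^esub> u = d \<otimes>\<^bsub>A\<^esub> v \<Longrightarrow> a \<otimes>\<^bsub>A\<^esub> u = c \<otimes>\<^bsub>A\<^esub> v"
    using cd unfolding ab frac_def by blast
  show ?thesis
  proof (intro equalityI subrelI)
    fix e f assume ef: "(e, f) \<in> x"
    note e = fracs_carrier[OF x ef]
    have ef': "\<And>u v. u \<in> carrier A \<Longrightarrow> v \<in> carrier A \<Longrightarrow> b \<otimes>\<^bsub>A\<^esub> u = f \<otimes>\<^bsub>A\<^esub> v \<Longrightarrow> a \<otimes>\<^bsub>A\<^esub> u = e \<otimes>\<^bsub>A\<^esub> v"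
      using ef unfolding ab frac_def by blast
    have "c \<otimes>\<^bsub>A\<^esub> u = e \<otimes>\<^bsub>A\<^esub> v"
      if uv: "u \<in> carrier A" "v \<in> carrier A" "d \<otimes>\<^bsub>A\<^esub> u = f \<otimes>\<^bsub>A\<^esub> v" for u v
    proof -
      obtain s r where sr: "s \<in> carrier A" "r \<in> carrier A" "r \<noteq> \<zero>\<^bsub>A\<^esub>" "b \<otimes>\<^bsub>A\<^esub> s = (d \<otimes>\<^bsub>A\<^esub> u) \<otimes>\<^bsub>A\<^esub> r"
        using ore'[OF ab(2,3) A.m_closed[OF c(2) uv(1)]] by blast
      have "a \<otimes>\<^bsub>A\<^esub> s = c \<otimes>\<^bsub>A\<^esub> (u \<otimes>\<^bsub>A\<^esub> r)"
        using sr uv c by (intro cd') (auto simp: A.m_assoc[symmetric])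
      moreover have "a \<otimes>\<^bsub>A\<^esub> s = e \<otimes>\<^bsub>A\<^esub> (v \<otimes>\<^bsub>A\<^esub> r)"
        using sr uv e by (intro ef') (auto simp: A.m_assoc[symmetric])
      ultimately show ?thesis
        using sr uv c e cancel_right[of "c \<otimes>\<^bsub>A\<^esub> u" "e \<otimes>\<^bsub>A\<^esub> v" r] by (auto simp: A.m_assoc[symmetric])
    qed
    then show "(e, f) \<in> frac c d"
      using e by (auto simp: frac_def)
  next
    fix e f assume ef: "(e, f) \<in> frac c d"
    then have e: "e \<in> carrier A" "f \<in> carrier A"
      by (auto simp: frac_def)
    have ef': "\<And>u v. u \<in> carrier A \<Longrightarrow> v \<in> carrier A \<Longrightarrow> d \<otimes>\<^bsub>A\<^esub> u = f \<otimes>\<^bsub>A\<^esub> v \<Longrightarrow> c \<otimes>\<^bsub>A\<^esub> u = e \<otimes>\<^bsub>A\<^esub> v"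
      using ef unfolding frac_def by blast
    have "a \<otimes>\<^bsub>A\<^esub> u = e \<otimes>\<^bsub>A\<^esub> v"
      if uv: "u \<in> carrier A" "v \<in> carrier A" "b \<otimes>\<^bsub>A\<^esub> u = f \<otimes>\<^bsub>A\<^esub> v" for u v
    proof -
      obtain s r where sr: "s \<in> carrier A" "r \<in> carrier A" "r \<noteq> \<zero>\<^bsub>A\<^esub>" "d \<otimes>\<^bsub>A\<^esub> s = (b \<otimes>\<^bsub>A\<^esub> u) \<otimes>\<^bsub>A\<^esub> r"
        using ore'[OF c(2) cd(2) A.m_closed[OF ab(2) uv(1)]] by blast
      have "a \<otimes>\<^bsub>A\<^esub> (u \<otimes>\<^bsub>A\<^esub> r) = c \<otimes>\<^bsub>A\<^esub> s"
        using sr uv ab by (intro cd') (auto simp: A.m_assoc[symmetric])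
      moreover have "c \<otimes>\<^bsub>A\<^esub> s = e \<otimes>\<^bsub>A\<^esub> (v \<otimes>\<^bsub>A\<^esub> r)"
        using sr uv e by (intro ef') (auto simp: A.m_assoc[symmetric])
      ultimately show ?thesis
        using sr uv ab e cancel_right[of "a \<otimes>\<^bsub>A\<^esub> u" "e \<otimes>\<^bsub>A\<^esub> v" r] by (auto simp: A.m_assoc[symmetric])
    qed
    then show "(e, f) \<in> x"
      using e by (auto simp: frac_def ab)
  qed
qed

lemma fracs_eqI:
  assumes "x \<in> fracs" "y \<in> fracs" "(c, d) \<in> x" "(c, d) \<in> y" "d \<noteq> \<zero>\<^bsub>A\<^esub>"
  shows "x = y"
  using fracs_eq_frac[of x c d] fracs_eq_frac[of y c d] assms by simp

lemma fracs_add: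
  assumes x: "x \<in> fracs" and cd: "(c, d) \<in> x" "(c', d') \<in> x"
  shows "(c \<oplus>\<^bsub>A\<^esub> c', d \<oplus>\<^bsub>A\<^esub> d') \<in> x"
proof -
  obtain a b where ab: "a \<in> carrier A" "b \<in> carrier A" "b \<noteq> \<zero>\<^bsub>A\<^esub>" "x = frac a b"
    using assms by (auto simp: fracs_def)
  note c = fracs_carrier[OF x cd(1)] fracs_carrier[OF x cd(2)]
  have cd1: "\<And>u v. u \<in> carrier A \<Longrightarrow> v \<in> carrier A \<Longrightarrow> b \<otimes>\<^bsub>A\<^esub> u = d \<otimes>\<^bsub>A\<^esub> v \<Longrightarrow> a \<otimes>\<^bsub>A\<^esub> u = c \<otimes>\<^bsub>A\<^esub> v"
    and cd2: "\<And>u v. u \<in> carrier A \<Longrightarrow> v \<in> carrier A \<Longrightarrow> b \<otimes>\<^bsub>A\<^esub> u = d' \<otimes>\<^bsub>A\<^esub> v \<Longrightarrow> a \<otimes>\<^bsub>A\<^esub> u = c' \<otimes>\<^bsub>A\<^esub> v"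
    using cd unfolding ab frac_def by blast+
  have "a \<otimes>\<^bsub>A\<^esub> u = (c \<oplus>\<^bsub>A\<^esub> c') \<otimes>\<^bsub>A\<^esub> v"
    if uv: "u \<in> carrier A" "v \<in> carrier A" "b \<otimes>\<^bsub>A\<^esub> u = (d \<oplus>\<^bsub>A\<^esub> d') \<otimes>\<^bsub>A\<^esub> v" for u v
  proof -
    \<comment> \<open>\<open>s\<close> accounts for the part \<open>d v r\<close> of
      \<open>b u r\<close>, so \<open>u r - s\<close> accounts for the part \<open>d' v r\<close>;
      each part is evaluated by one of the two pairs.\<close>
    obtain s r where sr: "s \<in> carrier A" "r \<in> carrier A" "r \<noteq> \<zero>\<^bsub>A\<^esub>" "b \<otimes>\<^bsub>A\<^esub> s = (d \<otimes>\<^bsub>A\<^esub> v) \<otimes>\<^bsub>A\<^esub> r"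
      using ore'[OF ab(2,3) A.m_closed[OF c(2) uv(2)]] by blast
    have 1: "a \<otimes>\<^bsub>A\<^esub> s = c \<otimes>\<^bsub>A\<^esub> (v \<otimes>\<^bsub>A\<^esub> r)"
      using sr uv c by (intro cd1) (auto simp: A.m_assoc[symmetric])
    have "b \<otimes>\<^bsub>A\<^esub> (u \<otimes>\<^bsub>A\<^esub> r) = d \<otimes>\<^bsub>A\<^esub> (v \<otimes>\<^bsub>A\<^esub> r) \<oplus>\<^bsub>A\<^esub> d' \<otimes>\<^bsub>A\<^esub> (v \<otimes>\<^bsub>A\<^esub> r)"
      using uv sr c ab by (simp add: A.m_assoc[symmetric] A.l_distr)
    then have "b \<otimes>\<^bsub>A\<^esub> (u \<otimes>\<^bsub>A\<^esub> r \<ominus>\<^bsub>A\<^esub> s) = d' \<otimes>\<^bsub>A\<^esub> (v \<otimes>\<^bsub>A\<^esub> r)"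
      using uv sr c ab
      by (simp add: a_minus_def A.r_distr A.r_minus A.m_assoc M.r_neg1 M.a_comm[of _ "\<ominus>\<^bsub>A\<^esub> _"] M.r_neg2)
    then have "a \<otimes>\<^bsub>A\<^esub> (u \<otimes>\<^bsub>A\<^esub> r \<ominus>\<^bsub>A\<^esub> s) = c' \<otimes>\<^bsub>A\<^esub> (v \<otimes>\<^bsub>A\<^esub> r)"
      using uv sr by (intro cd2) auto
    then have "a \<otimes>\<^bsub>A\<^esub> (u \<otimes>\<^bsub>A\<^esub> r \<ominus>\<^bsub>A\<^esub> s \<oplus>\<^bsub>A\<^esub> s) = (c \<oplus>\<^bsub>A\<^esub> c') \<otimes>\<^bsub>A\<^esub> (v \<otimes>\<^bsub>A\<^esub> r)"
      using 1 uv sr c ab by (subst A.r_distr) (simp_all add: A.l_distr M.a_comm)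
    moreover have "u \<otimes>\<^bsub>A\<^esub> r \<ominus>\<^bsub>A\<^esub> s \<oplus>\<^bsub>A\<^esub> s = u \<otimes>\<^bsub>A\<^esub> r"
      using uv sr by (simp add: a_minus_def M.a_assoc M.l_neg)
    ultimately show ?thesis
      using sr uv ab c cancel_right[of "a \<otimes>\<^bsub>A\<^esub> u" "(c \<oplus>\<^bsub>A\<^esub> c') \<otimes>\<^bsub>A\<^esub> v" r] by (simp add: A.m_assoc[symmetric])
  qed
  then show ?thesis
    using c by (auto simp: frac_def ab)
qed

lemma fracs_obtain:
  assumes "x \<in> fracs"
  obtains c d where "c \<in> carrier A" "d \<in> carrier A" "d \<noteq> \<zero>\<^bsub>A\<^esub>" "(c, d) \<in> x"
  using assms frac_self by (auto simp: fracs_def)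

lemma fracs_extend:
  assumes x: "x \<in> fracs" and b: "b \<in> carrier A" "b \<noteq> \<zero>\<^bsub>A\<^esub>" and "d \<in> carrier A"
  obtains c v where "c \<in> carrier A" "v \<in> carrier A" "v \<noteq> \<zero>\<^bsub>A\<^esub>" "(c, d \<otimes>\<^bsub>A\<^esub> v) \<in> x" "b \<otimes>\<^bsub>A\<^esub> v \<noteq> \<zero>\<^bsub>A\<^esub>"
  using fracs_dom[OF x assms(4)] integral_A b by metis

text \<open>The pairs are chosen arbitrarily; \<open>fmult_mem\<close>, \<open>fadd_mem\<close> and
  \<open>fsmult_mem\<close> show that every admissible choice of pairs lands in the resulting
  graph.\<close>

definition fmult where
  "fmult x y = (SOME z. \<exists>a b c. (b, c) \<in> y \<and> (a, b) \<in> x \<and> c \<noteq> \<zero>\<^bsub>A\<^esub> \<and> z = frac a c)"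

definition fadd where
  "fadd x y = (SOME z. \<exists>a b c. (a, c) \<in> x \<and> (b, c) \<in> y \<and> c \<noteq> \<zero>\<^bsub>A\<^esub> \<and> z = frac (a \<oplus>\<^bsub>A\<^esub> b) c)"

definition fsmult where
  "fsmult k x = (SOME z. \<exists>a c. (a, c) \<in> x \<and> c \<noteq> \<zero>\<^bsub>A\<^esub> \<and> z = frac (k \<odot>\<^bsub>A\<^esub> a) c)"

definition fraction_algebra :: "('a, ('c \<times> 'c) set) module" where
  "fraction_algebra = \<lparr>carrier = fracs, monoid.mult = fmult, monoid.one = frac \<one>\<^bsub>A\<^esub> \<one>\<^bsub>A\<^esub>,
     ring.zero = frac \<zero>\<^bsub>A\<^esub> \<one>\<^bsub>A\<^esub>, ring.add = fadd, smult = fsmult\<rparr>"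

lemma frac_eq_common:
  assumes "c \<noteq> \<zero>\<^bsub>A\<^esub>" "c' \<noteq> \<zero>\<^bsub>A\<^esub>" "a \<in> carrier A" "c \<in> carrier A" "a' \<in> carrier A" "c' \<in> carrier A"
    and "\<And>u v. u \<in> carrier A \<Longrightarrow> v \<in> carrier A \<Longrightarrow> c \<otimes>\<^bsub>A\<^esub> u = c' \<otimes>\<^bsub>A\<^esub> v \<Longrightarrow> a \<otimes>\<^bsub>A\<^esub> u = a' \<otimes>\<^bsub>A\<^esub> v"
  shows "frac a c = frac a' c'"
proof -
  obtain u v where uv: "u \<in> carrier A" "v \<in> carrier A" "c \<otimes>\<^bsub>A\<^esub> u = c' \<otimes>\<^bsub>A\<^esub> v" "c \<otimes>\<^bsub>A\<^esub> u \<noteq> \<zero>\<^bsub>A\<^esub>"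
    using ore[of c c'] assms by metis
  have 1: "frac a c \<in> fracs" "frac a' c' \<in> fracs"
    using assms by (simp_all add: frac_in)
  have 2: "(a \<otimes>\<^bsub>A\<^esub> u, c \<otimes>\<^bsub>A\<^esub> u) \<in> frac a c" "(a' \<otimes>\<^bsub>A\<^esub> v, c' \<otimes>\<^bsub>A\<^esub> v) \<in> frac a' c'"
    using fracs_mult[OF 1(1) frac_self uv(1)] fracs_mult[OF 1(2) frac_self uv(2)] assms by blast+
  then have "(a \<otimes>\<^bsub>A\<^esub> u, c \<otimes>\<^bsub>A\<^esub> u) \<in> frac a' c'"
    using assms(7)[OF uv(1,2,3)] uv(3) by simp
  then show ?thesis
    using fracs_eqI[OF 1 2(1) _ uv(4)] by blast
qed

lemma fmult_mem:
  assumes x: "x \<in> fracs" and y: "y \<in> fracs"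
  shows "fmult x y \<in> fracs"
    and "(b, c) \<in> y \<Longrightarrow> (a, b) \<in> x \<Longrightarrow> (a, c) \<in> fmult x y"
proof -
  obtain b0 c0 where 0: "b0 \<in> carrier A" "c0 \<in> carrier A" "c0 \<noteq> \<zero>\<^bsub>A\<^esub>" "(b0, c0) \<in> y"
    using fracs_obtain[OF y] by blast
  obtain a0 v where 1: "(a0, b0 \<otimes>\<^bsub>A\<^esub> v) \<in> x" "v \<in> carrier A" "c0 \<otimes>\<^bsub>A\<^esub> v \<noteq> \<zero>\<^bsub>A\<^esub>"
    using fracs_extend[OF x 0(2,3,1)] by blast
  have "(b0 \<otimes>\<^bsub>A\<^esub> v, c0 \<otimes>\<^bsub>A\<^esub> v) \<in> y"
    using fracs_mult[OF y 0(4) 1(2)] .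
  then have "\<exists>z a b c. (b, c) \<in> y \<and> (a, b) \<in> x \<and> c \<noteq> \<zero>\<^bsub>A\<^esub> \<and> z = frac a c"
    using 1 by blast
  from someI_ex[OF this] have "\<exists>a b c. (b, c) \<in> y \<and> (a, b) \<in> x \<and> c \<noteq> \<zero>\<^bsub>A\<^esub> \<and> fmult x y = frac a c"
    unfolding fmult_def .
  then obtain a' b' c' where 2: "(b', c') \<in> y" "(a', b') \<in> x" "c' \<noteq> \<zero>\<^bsub>A\<^esub>" "fmult x y = frac a' c'"
    by blast
  note c2 = fracs_carrier[OF y 2(1)] fracs_carrier[OF x 2(2)]
  show xy: "fmult x y \<in> fracs"
    using 2 c2 frac_in by simp
  assume 3: "(b, c) \<in> y" "(a, b) \<in> x"
  note c3 = fracs_carrier[OF y 3(1)] fracs_carrier[OF x 3(2)]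
  show "(a, c) \<in> fmult x y"
  proof (cases "c = \<zero>\<^bsub>A\<^esub>")
    case True
    then show ?thesis
      using fracs_unique[OF y 3(1)[unfolded True] fracs_zero[OF y]] fracs_zero[OF xy]
        fracs_unique[OF x 3(2), of "\<zero>\<^bsub>A\<^esub>"] fracs_zero[OF x] by simp
  next
    case False
    have "frac a c = frac a' c'"
    proof (rule frac_eq_common)
      fix u v assume uv: "u \<in> carrier A" "v \<in> carrier A" "c \<otimes>\<^bsub>A\<^esub> u = c' \<otimes>\<^bsub>A\<^esub> v"
      have "b \<otimes>\<^bsub>A\<^esub> u = b' \<otimes>\<^bsub>A\<^esub> v"
        using fracs_unique[OF y fracs_mult[OF y 3(1) uv(1)]] fracs_mult[OF y 2(1) uv(2)] uv by simp
      then show "a \<otimes>\<^bsub>A\<^esub> u = a' \<otimes>\<^bsub>A\<^esub> v"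
        using fracs_unique[OF x fracs_mult[OF x 3(2) uv(1)]] fracs_mult[OF x 2(2) uv(2)] by simp
    qed (use False 2 c2 c3 in auto)
    then show ?thesis
      using frac_self[of a c] 2 c3 False by simp
  qed
qed

lemma fracs_common:
  assumes x: "x \<in> fracs" and y: "y \<in> fracs"
  obtains a b c where "(a, c) \<in> x" "(b, c) \<in> y" "c \<noteq> \<zero>\<^bsub>A\<^esub>" "a \<in> carrier A" "b \<in> carrier A" "c \<in> carrier A"
proof -
  obtain b0 c0 where 0: "b0 \<in> carrier A" "c0 \<in> carrier A" "c0 \<noteq> \<zero>\<^bsub>A\<^esub>" "(b0, c0) \<in> y"
    using fracs_obtain[OF y] by blast
  obtain a v where 1: "(a, c0 \<otimes>\<^bsub>A\<^esub> v) \<in> x" "v \<in> carrier A" "c0 \<otimes>\<^bsub>A\<^esub> v \<noteq> \<zero>\<^bsub>A\<^esub>"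
    using fracs_extend[OF x 0(2,3,2)] by blast
  show ?thesis
    using that[OF 1(1) fracs_mult[OF y 0(4) 1(2)] 1(3)] 0 1 fracs_carrier[OF x 1(1)] by simp
qed

lemma fadd_mem:
  assumes x: "x \<in> fracs" and y: "y \<in> fracs"
  shows "fadd x y \<in> fracs"
    and "(a, c) \<in> x \<Longrightarrow> (b, c) \<in> y \<Longrightarrow> (a \<oplus>\<^bsub>A\<^esub> b, c) \<in> fadd x y"
proof -
  have "\<exists>z a b c. (a, c) \<in> x \<and> (b, c) \<in> y \<and> c \<noteq> \<zero>\<^bsub>A\<^esub> \<and> z = frac (a \<oplus>\<^bsub>A\<^esub> b) c"
    using fracs_common[OF x y] by metis
  from someI_ex[OF this]
  have "\<exists>a b c. (a, c) \<in> x \<and> (b, c) \<in> y \<and> c \<noteq> \<zero>\<^bsub>A\<^esub> \<and> fadd x y = frac (a \<oplus>\<^bsub>A\<^esub> b) c"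
    unfolding fadd_def .
  then obtain a' b' c' where 2: "(a', c') \<in> x" "(b', c') \<in> y" "c' \<noteq> \<zero>\<^bsub>A\<^esub>" "fadd x y = frac (a' \<oplus>\<^bsub>A\<^esub> b') c'"
    by blast
  note c2 = fracs_carrier[OF x 2(1)] fracs_carrier[OF y 2(2)]
  show xy: "fadd x y \<in> fracs"
    using 2 c2 frac_in by simp
  assume 3: "(a, c) \<in> x" "(b, c) \<in> y"
  note c3 = fracs_carrier[OF x 3(1)] fracs_carrier[OF y 3(2)]
  show "(a \<oplus>\<^bsub>A\<^esub> b, c) \<in> fadd x y"
  proof (cases "c = \<zero>\<^bsub>A\<^esub>")
    case True
    then show ?thesis
      using fracs_unique[OF x 3(1)[unfolded True] fracs_zero[OF x]] fracs_zero[OF xy]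
        fracs_unique[OF y 3(2)[unfolded True] fracs_zero[OF y]] by simp
  next
    case False
    have "frac (a \<oplus>\<^bsub>A\<^esub> b) c = frac (a' \<oplus>\<^bsub>A\<^esub> b') c'"
    proof (rule frac_eq_common)
      fix u v assume uv: "u \<in> carrier A" "v \<in> carrier A" "c \<otimes>\<^bsub>A\<^esub> u = c' \<otimes>\<^bsub>A\<^esub> v"
      have "b \<otimes>\<^bsub>A\<^esub> u = b' \<otimes>\<^bsub>A\<^esub> v" "a \<otimes>\<^bsub>A\<^esub> u = a' \<otimes>\<^bsub>A\<^esub> v"
        using fracs_unique[OF y fracs_mult[OF y 3(2) uv(1)]] fracs_mult[OF y 2(2) uv(2)]
          fracs_unique[OF x fracs_mult[OF x 3(1) uv(1)]] fracs_mult[OF x 2(1) uv(2)] uv by simp_all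
      then show "(a \<oplus>\<^bsub>A\<^esub> b) \<otimes>\<^bsub>A\<^esub> u = (a' \<oplus>\<^bsub>A\<^esub> b') \<otimes>\<^bsub>A\<^esub> v"
        using uv c2 c3 by (simp add: A.l_distr)
    qed (use False 2 c2 c3 in auto)
    then show ?thesis
      using frac_self[of "a \<oplus>\<^bsub>A\<^esub> b" c] 2 c3 False by simp
  qed
qed

lemma fsmult_mem:
  assumes k: "k \<in> carrier K" and x: "x \<in> fracs"
  shows "fsmult k x \<in> fracs"
    and "(a, c) \<in> x \<Longrightarrow> (k \<odot>\<^bsub>A\<^esub> a, c) \<in> fsmult k x"
proof -
  have "\<exists>z a c. (a, c) \<in> x \<and> c \<noteq> \<zero>\<^bsub>A\<^esub> \<and> z = frac (k \<odot>\<^bsub>A\<^esub> a) c"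
    using fracs_obtain[OF x] by metis
  from someI_ex[OF this] have "\<exists>a c. (a, c) \<in> x \<and> c \<noteq> \<zero>\<^bsub>A\<^esub> \<and> fsmult k x = frac (k \<odot>\<^bsub>A\<^esub> a) c"
    unfolding fsmult_def .
  then obtain a' c' where 2: "(a', c') \<in> x" "c' \<noteq> \<zero>\<^bsub>A\<^esub>" "fsmult k x = frac (k \<odot>\<^bsub>A\<^esub> a') c'"
    by blast
  note c2 = fracs_carrier[OF x 2(1)]
  show kx: "fsmult k x \<in> fracs"
    using 2 c2 frac_in k by simp
  assume 3: "(a, c) \<in> x"
  note c3 = fracs_carrier[OF x 3(1)]
  show "(k \<odot>\<^bsub>A\<^esub> a, c) \<in> fsmult k x"
  proof (cases "c = \<zero>\<^bsub>A\<^esub>")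
    case True
    then show ?thesis
      using fracs_unique[OF x 3(1)[unfolded True] fracs_zero[OF x]] fracs_zero[OF kx] k by simp
  next
    case False
    have "frac (k \<odot>\<^bsub>A\<^esub> a) c = frac (k \<odot>\<^bsub>A\<^esub> a') c'"
    proof (rule frac_eq_common)
      fix u v assume uv: "u \<in> carrier A" "v \<in> carrier A" "c \<otimes>\<^bsub>A\<^esub> u = c' \<otimes>\<^bsub>A\<^esub> v"
      have "a \<otimes>\<^bsub>A\<^esub> u = a' \<otimes>\<^bsub>A\<^esub> v"
        using fracs_unique[OF x fracs_mult[OF x 3(1) uv(1)]] fracs_mult[OF x 2(1) uv(2)] uv by simp_all
      then show "(k \<odot>\<^bsub>A\<^esub> a) \<otimes>\<^bsub>A\<^esub> u = (k \<odot>\<^bsub>A\<^esub> a') \<otimes>\<^bsub>A\<^esub> v"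
        using uv c2 c3 k by (simp add: smult_mult_left)
    qed (use False 2 c2 c3 k in auto)
    then show ?thesis
      using frac_self[of "k \<odot>\<^bsub>A\<^esub> a" c] 2 c3 False k by simp
  qed
qed

lemma frac_const:
  assumes "a \<in> carrier A" "c \<in> carrier A"
  shows "(a \<otimes>\<^bsub>A\<^esub> c, c) \<in> frac a \<one>\<^bsub>A\<^esub>"
  using fracs_mult[OF frac_in[OF assms(1) A.one_closed one_not_zero_A]
      frac_self[OF assms(1) A.one_closed one_not_zero_A] assms(2)] assms by simp

lemma const_in: "a \<in> carrier A \<Longrightarrow> frac a \<one>\<^bsub>A\<^esub> \<in> fracs"
  using one_not_zero_A by (simp add: frac_in)

lemma fracs_triple:
  assumes x: "x \<in> fracs" and y: "y \<in> fracs" and z: "z \<in> fracs"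
  obtains a b c d where "(a, d) \<in> x" "(b, d) \<in> y" "(c, d) \<in> z" "d \<noteq> \<zero>\<^bsub>A\<^esub>"
proof -
  obtain a b d where 0: "(a, d) \<in> x" "(b, d) \<in> y" "d \<noteq> \<zero>\<^bsub>A\<^esub>" "d \<in> carrier A"
    using fracs_common[OF x y] by metis
  obtain c v where 1: "(c, d \<otimes>\<^bsub>A\<^esub> v) \<in> z" "v \<in> carrier A" "d \<otimes>\<^bsub>A\<^esub> v \<noteq> \<zero>\<^bsub>A\<^esub>"
    using fracs_extend[OF z 0(4,3,4)] by blast
  show ?thesis
    using that[OF fracs_mult[OF x 0(1) 1(2)] fracs_mult[OF y 0(2) 1(2)] 1(1) 1(3)] .
qed

text \<open>Makes two graphs composable: after multiplication by \<open>v\<close> the numerator of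
  the pair in \<open>y\<close> serves as a denominator for \<open>x\<close>.\<close>

lemma fracs_chain:
  assumes x: "x \<in> fracs" and y: "y \<in> fracs" and bc: "(b, c) \<in> y" "c \<noteq> \<zero>\<^bsub>A\<^esub>"
  obtains a v where "(a, b \<otimes>\<^bsub>A\<^esub> v) \<in> x" "(b \<otimes>\<^bsub>A\<^esub> v, c \<otimes>\<^bsub>A\<^esub> v) \<in> y" "c \<otimes>\<^bsub>A\<^esub> v \<noteq> \<zero>\<^bsub>A\<^esub>" "v \<in> carrier A"
  using fracs_extend[OF x fracs_carrier(2)[OF y bc(1)] bc(2) fracs_carrier(1)[OF y bc(1)]]
    fracs_mult[OF y bc(1)] by metis

lemma fadd_assoc:
  assumes x: "x \<in> fracs" and y: "y \<in> fracs" and z: "z \<in> fracs"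
  shows "fadd (fadd x y) z = fadd x (fadd y z)"
proof -
  obtain a b c d where 0: "(a, d) \<in> x" "(b, d) \<in> y" "(c, d) \<in> z" "d \<noteq> \<zero>\<^bsub>A\<^esub>"
    by (rule fracs_triple[OF x y z]) blast
  note cl = fadd_mem(1)
  have "(a \<oplus>\<^bsub>A\<^esub> b \<oplus>\<^bsub>A\<^esub> c, d) \<in> fadd (fadd x y) z"
    using fadd_mem(2)[OF cl[OF x y] z fadd_mem(2)[OF x y 0(1,2)] 0(3)] .
  moreover have "(a \<oplus>\<^bsub>A\<^esub> (b \<oplus>\<^bsub>A\<^esub> c), d) \<in> fadd x (fadd y z)"
    using fadd_mem(2)[OF x cl[OF y z] 0(1) fadd_mem(2)[OF y z 0(2,3)]] .
  ultimately show ?thesis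
    using fracs_eqI[OF cl[OF cl[OF x y] z] cl[OF x cl[OF y z]]] 0
      fracs_carrier[OF x 0(1)] fracs_carrier[OF y 0(2)] fracs_carrier[OF z 0(3)]
    by (simp add: M.a_assoc)
qed

lemma fadd_comm:
  assumes x: "x \<in> fracs" and y: "y \<in> fracs"
  shows "fadd x y = fadd y x"
proof -
  obtain a b d where 0: "(a, d) \<in> x" "(b, d) \<in> y" "d \<noteq> \<zero>\<^bsub>A\<^esub>" "a \<in> carrier A" "b \<in> carrier A"
    using fracs_common[OF x y] by metis
  show ?thesis
    using fracs_eqI[OF fadd_mem(1)[OF x y] fadd_mem(1)[OF y x], of "a \<oplus>\<^bsub>A\<^esub> b" d]
      fadd_mem(2)[OF x y 0(1,2)] fadd_mem(2)[OF y x 0(2,1)] 0 by (simp add: M.a_comm)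
qed

lemma fmult_assoc:
  assumes x: "x \<in> fracs" and y: "y \<in> fracs" and z: "z \<in> fracs"
  shows "fmult (fmult x y) z = fmult x (fmult y z)"
proof -
  obtain c d where 0: "(c, d) \<in> z" "d \<noteq> \<zero>\<^bsub>A\<^esub>"
    using fracs_obtain[OF z] by blast
  obtain b v where 1: "(b, c \<otimes>\<^bsub>A\<^esub> v) \<in> y" "(c \<otimes>\<^bsub>A\<^esub> v, d \<otimes>\<^bsub>A\<^esub> v) \<in> z" "d \<otimes>\<^bsub>A\<^esub> v \<noteq> \<zero>\<^bsub>A\<^esub>"
    by (rule fracs_chain[OF y z 0]) blast
  note yz = fmult_mem[OF y z] and xy = fmult_mem[OF x y]
  obtain a w where 2: "(a, b \<otimes>\<^bsub>A\<^esub> w) \<in> x" "(b \<otimes>\<^bsub>A\<^esub> w, d \<otimes>\<^bsub>A\<^esub> v \<otimes>\<^bsub>A\<^esub> w) \<in> fmult y z"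
      "d \<otimes>\<^bsub>A\<^esub> v \<otimes>\<^bsub>A\<^esub> w \<noteq> \<zero>\<^bsub>A\<^esub>" "w \<in> carrier A"
    by (rule fracs_chain[OF x yz(1) yz(2)[OF 1(2,1)] 1(3)]) blast
  have "(a, d \<otimes>\<^bsub>A\<^esub> v \<otimes>\<^bsub>A\<^esub> w) \<in> fmult x (fmult y z)"
    using fmult_mem(2)[OF x yz(1) 2(2,1)] .
  moreover have "(a, d \<otimes>\<^bsub>A\<^esub> v \<otimes>\<^bsub>A\<^esub> w) \<in> fmult (fmult x y) z"
    using fmult_mem(2)[OF xy(1) z fracs_mult[OF z 1(2) 2(4)] xy(2)[OF fracs_mult[OF y 1(1) 2(4)] 2(1)]] .
  ultimately show ?thesis
    using fracs_eqI[OF fmult_mem(1)[OF xy(1) z] fmult_mem(1)[OF x yz(1)]] 2 by blast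
qed

lemma fmult_l_distr:
  assumes x: "x \<in> fracs" and y: "y \<in> fracs" and z: "z \<in> fracs"
  shows "fmult (fadd x y) z = fadd (fmult x z) (fmult y z)"
proof -
  obtain c d where 0: "(c, d) \<in> z" "d \<noteq> \<zero>\<^bsub>A\<^esub>"
    using fracs_obtain[OF z] by blast
  obtain b v where 1: "(b, c \<otimes>\<^bsub>A\<^esub> v) \<in> y" "(c \<otimes>\<^bsub>A\<^esub> v, d \<otimes>\<^bsub>A\<^esub> v) \<in> z" "d \<otimes>\<^bsub>A\<^esub> v \<noteq> \<zero>\<^bsub>A\<^esub>"
    by (rule fracs_chain[OF y z 0]) blast
  obtain a w where 2: "(a, c \<otimes>\<^bsub>A\<^esub> v \<otimes>\<^bsub>A\<^esub> w) \<in> x"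
      "(c \<otimes>\<^bsub>A\<^esub> v \<otimes>\<^bsub>A\<^esub> w, d \<otimes>\<^bsub>A\<^esub> v \<otimes>\<^bsub>A\<^esub> w) \<in> z" "d \<otimes>\<^bsub>A\<^esub> v \<otimes>\<^bsub>A\<^esub> w \<noteq> \<zero>\<^bsub>A\<^esub>" "w \<in> carrier A"
    by (rule fracs_chain[OF x z 1(2,3)]) blast
  have 3: "(b \<otimes>\<^bsub>A\<^esub> w, c \<otimes>\<^bsub>A\<^esub> v \<otimes>\<^bsub>A\<^esub> w) \<in> y"
    using fracs_mult[OF y 1(1) 2(4)] .
  note xy = fadd_mem[OF x y] and xz = fmult_mem[OF x z] and yz = fmult_mem[OF y z]
  show ?thesis
    using fracs_eqI[OF fmult_mem(1)[OF xy(1) z] fadd_mem(1)[OF xz(1) yz(1)]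
        fmult_mem(2)[OF xy(1) z 2(2) xy(2)[OF 2(1) 3]]
        fadd_mem(2)[OF xz(1) yz(1) xz(2)[OF 2(2,1)] yz(2)[OF 2(2) 3]] 2(3)] .
qed

lemma fmult_r_distr:
  assumes x: "x \<in> fracs" and y: "y \<in> fracs" and z: "z \<in> fracs"
  shows "fmult z (fadd x y) = fadd (fmult z x) (fmult z y)"
proof -
  obtain a b d where 0: "(a, d) \<in> x" "(b, d) \<in> y" "d \<noteq> \<zero>\<^bsub>A\<^esub>"
    using fracs_common[OF x y] by metis
  obtain a' v where 1: "(a', a \<otimes>\<^bsub>A\<^esub> v) \<in> z" "(a \<otimes>\<^bsub>A\<^esub> v, d \<otimes>\<^bsub>A\<^esub> v) \<in> x" "d \<otimes>\<^bsub>A\<^esub> v \<noteq> \<zero>\<^bsub>A\<^esub>" "v \<in> carrier A"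
    by (rule fracs_chain[OF z x 0(1,3)]) blast
  obtain b' w where 2: "(b', b \<otimes>\<^bsub>A\<^esub> v \<otimes>\<^bsub>A\<^esub> w) \<in> z"
      "(b \<otimes>\<^bsub>A\<^esub> v \<otimes>\<^bsub>A\<^esub> w, d \<otimes>\<^bsub>A\<^esub> v \<otimes>\<^bsub>A\<^esub> w) \<in> y" "d \<otimes>\<^bsub>A\<^esub> v \<otimes>\<^bsub>A\<^esub> w \<noteq> \<zero>\<^bsub>A\<^esub>" "w \<in> carrier A"
    by (rule fracs_chain[OF z y fracs_mult[OF y 0(2) 1(4)] 1(3)]) blast
  note 3 = fracs_mult[OF z 1(1) 2(4)] fracs_mult[OF x 1(2) 2(4)]
  note xy = fadd_mem[OF x y] and zx = fmult_mem[OF z x] and zy = fmult_mem[OF z y]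
  show ?thesis
    using fracs_eqI[OF fmult_mem(1)[OF z xy(1)] fadd_mem(1)[OF zx(1) zy(1)]
        fmult_mem(2)[OF z xy(1) xy(2)[OF 3(2) 2(2)] fracs_add[OF z 3(1) 2(1)]]
        fadd_mem(2)[OF zx(1) zy(1) zx(2)[OF 3(2,1)] zy(2)[OF 2(2,1)]] 2(3)] .
qed

lemma one_frac: "c \<in> carrier A \<Longrightarrow> (c, c) \<in> frac \<one>\<^bsub>A\<^esub> \<one>\<^bsub>A\<^esub>"
  using frac_const[of "\<one>\<^bsub>A\<^esub>" c] by simp

lemma zero_frac: "c \<in> carrier A \<Longrightarrow> (\<zero>\<^bsub>A\<^esub>, c) \<in> frac \<zero>\<^bsub>A\<^esub> \<one>\<^bsub>A\<^esub>"
  using frac_const[of "\<zero>\<^bsub>A\<^esub>" c] by simp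

lemma fmult_one:
  assumes x: "x \<in> fracs"
  shows "fmult (frac \<one>\<^bsub>A\<^esub> \<one>\<^bsub>A\<^esub>) x = x" "fmult x (frac \<one>\<^bsub>A\<^esub> \<one>\<^bsub>A\<^esub>) = x"
proof -
  obtain c d where 0: "(c, d) \<in> x" "d \<noteq> \<zero>\<^bsub>A\<^esub>" "c \<in> carrier A" "d \<in> carrier A"
    using fracs_obtain[OF x] by blast
  have 1: "frac \<one>\<^bsub>A\<^esub> \<one>\<^bsub>A\<^esub> \<in> fracs"
    by (simp add: const_in)
  show "fmult (frac \<one>\<^bsub>A\<^esub> \<one>\<^bsub>A\<^esub>) x = x"
    using fracs_eqI[OF fmult_mem(1)[OF 1 x] x fmult_mem(2)[OF 1 x 0(1) one_frac] 0(1,2)] 0 by simp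
  show "fmult x (frac \<one>\<^bsub>A\<^esub> \<one>\<^bsub>A\<^esub>) = x"
    using fracs_eqI[OF fmult_mem(1)[OF x 1] x fmult_mem(2)[OF x 1 one_frac 0(1)] 0(1,2)] 0 by simp
qed

lemma fadd_zero:
  assumes x: "x \<in> fracs"
  shows "fadd (frac \<zero>\<^bsub>A\<^esub> \<one>\<^bsub>A\<^esub>) x = x"
proof -
  obtain c d where 0: "(c, d) \<in> x" "d \<noteq> \<zero>\<^bsub>A\<^esub>" "c \<in> carrier A" "d \<in> carrier A"
    using fracs_obtain[OF x] by blast
  have 1: "frac \<zero>\<^bsub>A\<^esub> \<one>\<^bsub>A\<^esub> \<in> fracs"
    by (simp add: const_in)
  show ?thesis
    using fracs_eqI[OF fadd_mem(1)[OF 1 x] x fadd_mem(2)[OF 1 x zero_frac 0(1)] _ 0(2)] 0 by simp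
qed

lemma fadd_inverse:
  assumes x: "x \<in> fracs"
  shows "\<exists>y\<in>fracs. fadd y x = frac \<zero>\<^bsub>A\<^esub> \<one>\<^bsub>A\<^esub>"
proof -
  obtain c d where 0: "(c, d) \<in> x" "d \<noteq> \<zero>\<^bsub>A\<^esub>" "c \<in> carrier A" "d \<in> carrier A"
    using fracs_obtain[OF x] by blast
  let ?y = "frac (\<ominus>\<^bsub>A\<^esub> c) d"
  have y: "?y \<in> fracs" "(\<ominus>\<^bsub>A\<^esub> c, d) \<in> ?y"
    using 0 by (simp_all add: frac_in frac_self)
  have "fadd ?y x = frac \<zero>\<^bsub>A\<^esub> \<one>\<^bsub>A\<^esub>"
    using fracs_eqI[OF fadd_mem(1)[OF y(1) x] const_in fadd_mem(2)[OF y(1) x y(2) 0(1)], of "\<zero>\<^bsub>A\<^esub>"]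
      zero_frac 0 by (simp add: M.l_neg)
  then show ?thesis
    using y by blast
qed

lemma fraction_algebra_simps:
  "carrier fraction_algebra = fracs" "x \<otimes>\<^bsub>fraction_algebra\<^esub> y = fmult x y"
  "\<one>\<^bsub>fraction_algebra\<^esub> = frac \<one>\<^bsub>A\<^esub> \<one>\<^bsub>A\<^esub>" "\<zero>\<^bsub>fraction_algebra\<^esub> = frac \<zero>\<^bsub>A\<^esub> \<one>\<^bsub>A\<^esub>"
  "x \<oplus>\<^bsub>fraction_algebra\<^esub> y = fadd x y" "c \<odot>\<^bsub>fraction_algebra\<^esub> x = fsmult c x"
  by (simp_all add: fraction_algebra_def)

lemma fraction_ring: "ring fraction_algebra"
proof (rule ringI)
  show "abelian_group fraction_algebra"
    by (rule abelian_groupI, unfold fraction_algebra_simps)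
       (simp_all add: fadd_mem const_in fadd_assoc fadd_zero fadd_inverse, metis fadd_comm)
  show "Group.monoid fraction_algebra"
    by (rule monoidI)
       (simp_all add: fraction_algebra_simps fmult_mem const_in fmult_assoc fmult_one)
qed (simp_all add: fraction_algebra_simps fmult_l_distr fmult_r_distr)

lemma fraction_assoc_algebra: "assoc_algebra K fraction_algebra"
proof (rule assoc_algebraI, unfold fraction_algebra_simps)
  show "field K" "ring fraction_algebra"
    by (rule K.field_axioms fraction_ring)+
  show "fsmult c x \<in> fracs" if "c \<in> carrier K" "x \<in> fracs" for c x
    using that by (rule fsmult_mem)
next
  fix c d x assume c: "c \<in> carrier K" and d: "d \<in> carrier K" and x: "x \<in> fracs"
  obtain a b where 0: "(a, b) \<in> x" "b \<noteq> \<zero>\<^bsub>A\<^esub>" "a \<in> carrier A" "b \<in> carrier A"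
    using fracs_obtain[OF x] by blast
  note mem = fsmult_mem[OF c x] fsmult_mem[OF d x]
  show "fsmult (c \<oplus> d) x = fadd (fsmult c x) (fsmult d x)"
    using fracs_eqI[OF fsmult_mem(1)[OF _ x] fadd_mem(1)[OF mem(1,3)] fsmult_mem(2)[OF _ x 0(1)], of "c \<oplus> d"]
      fadd_mem(2)[OF mem(1,3) mem(2)[OF 0(1)] mem(4)[OF 0(1)]] 0 c d by (simp add: smult_l_distr)
  show "fsmult (c \<otimes> d) x = fsmult c (fsmult d x)"
    using fracs_eqI[OF fsmult_mem(1)[OF _ x] fsmult_mem(1)[OF c mem(3)] fsmult_mem(2)[OF _ x 0(1)], of "c \<otimes> d"]
      fsmult_mem(2)[OF c mem(3) mem(4)[OF 0(1)]] 0 c d by (simp add: smult_assoc1)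
next
  fix x assume x: "x \<in> fracs"
  obtain a b where 0: "(a, b) \<in> x" "b \<noteq> \<zero>\<^bsub>A\<^esub>" "a \<in> carrier A" "b \<in> carrier A"
    using fracs_obtain[OF x] by blast
  show "fsmult \<one> x = x"
    using fracs_eqI[OF fsmult_mem(1)[OF _ x] x fsmult_mem(2)[OF _ x 0(1)], of \<one>] 0 by simp
next
  fix c x y assume c: "c \<in> carrier K" and x: "x \<in> fracs" and y: "y \<in> fracs"
  note mem = fsmult_mem[OF c x] fsmult_mem[OF c y]
  obtain a b d where 0: "(a, d) \<in> x" "(b, d) \<in> y" "d \<noteq> \<zero>\<^bsub>A\<^esub>" "a \<in> carrier A" "b \<in> carrier A"
    using fracs_common[OF x y] by metis
  show "fsmult c (fadd x y) = fadd (fsmult c x) (fsmult c y)"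
    using fracs_eqI[OF fsmult_mem(1)[OF c fadd_mem(1)[OF x y]] fadd_mem(1)[OF mem(1,3)]
       fsmult_mem(2)[OF c fadd_mem(1)[OF x y] fadd_mem(2)[OF x y 0(1,2)]]]
      fadd_mem(2)[OF mem(1,3) mem(2)[OF 0(1)] mem(4)[OF 0(2)]] 0 c by (simp add: smult_r_distr)
  obtain a' b' where 1: "(a', b') \<in> y" "b' \<noteq> \<zero>\<^bsub>A\<^esub>"
    using fracs_obtain[OF y] by blast
  obtain a'' v where 2: "(a'', a' \<otimes>\<^bsub>A\<^esub> v) \<in> x" "(a' \<otimes>\<^bsub>A\<^esub> v, b' \<otimes>\<^bsub>A\<^esub> v) \<in> y" "b' \<otimes>\<^bsub>A\<^esub> v \<noteq> \<zero>\<^bsub>A\<^esub>" "v \<in> carrier A"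
    by (rule fracs_chain[OF x y 1]) blast
  note xy = fmult_mem[OF x y]
  show "fmult (fsmult c x) y = fsmult c (fmult x y)"
    using fracs_eqI[OF fmult_mem(1)[OF mem(1) y] fsmult_mem(1)[OF c xy(1)]
        fmult_mem(2)[OF mem(1) y 2(2) mem(2)[OF 2(1)]] fsmult_mem(2)[OF c xy(1) xy(2)[OF 2(2,1)]] 2(3)] .
  \<comment> \<open>Right multiplication by the central element \<open>c 1\<close> scales numerator
    and denominator alike.\<close>
  have 3: "(c \<odot>\<^bsub>A\<^esub> a'', c \<odot>\<^bsub>A\<^esub> (a' \<otimes>\<^bsub>A\<^esub> v)) \<in> x"
  proof -
    have "c \<odot>\<^bsub>A\<^esub> \<one>\<^bsub>A\<^esub> \<in> carrier A"
      using c by simp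
    from fracs_mult[OF x 2(1) this] show ?thesis
      using c fracs_carrier[OF x 2(1)] by (simp add: smult_mult_right)
  qed
  show "fmult x (fsmult c y) = fsmult c (fmult x y)"
    using fracs_eqI[OF fmult_mem(1)[OF x mem(3)] fsmult_mem(1)[OF c xy(1)]
        fmult_mem(2)[OF x mem(3) mem(4)[OF 2(2)] 3] fsmult_mem(2)[OF c xy(1) xy(2)[OF 2(2,1)]] 2(3)] .
qed

lemma fmult_inverse:
  assumes x: "x \<in> fracs" and 0: "(c, d) \<in> x" "c \<noteq> \<zero>\<^bsub>A\<^esub>" "d \<noteq> \<zero>\<^bsub>A\<^esub>"
  shows "fmult (frac d c) x = frac \<one>\<^bsub>A\<^esub> \<one>\<^bsub>A\<^esub>" "fmult x (frac d c) = frac \<one>\<^bsub>A\<^esub> \<one>\<^bsub>A\<^esub>"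
proof -
  note c = fracs_carrier[OF x 0(1)]
  have y: "frac d c \<in> fracs" "(d, c) \<in> frac d c"
    using 0 c by (auto simp: frac_in frac_self)
  show "fmult (frac d c) x = frac \<one>\<^bsub>A\<^esub> \<one>\<^bsub>A\<^esub>"
    using fracs_eqI[OF fmult_mem(1)[OF y(1) x] const_in fmult_mem(2)[OF y(1) x 0(1) y(2)] one_frac] 0 c by simp
  show "fmult x (frac d c) = frac \<one>\<^bsub>A\<^esub> \<one>\<^bsub>A\<^esub>"
    using fracs_eqI[OF fmult_mem(1)[OF x y(1)] const_in fmult_mem(2)[OF x y(1) y(2) 0(1)] one_frac] 0 c by simp
qed

lemma const_inj:
  assumes "a \<in> carrier A" "b \<in> carrier A" "frac a \<one>\<^bsub>A\<^esub> = frac b \<one>\<^bsub>A\<^esub>"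
  shows "a = b"
  using fracs_unique[OF const_in[OF assms(1)], of a "\<one>\<^bsub>A\<^esub>" b] frac_const[of a "\<one>\<^bsub>A\<^esub>"]
    frac_const[of b "\<one>\<^bsub>A\<^esub>"] assms by simp

lemma fraction_skew_field: "skew_field fraction_algebra"
  unfolding skew_field_def
proof (intro conjI)
  interpret F: ring fraction_algebra
    by (rule fraction_ring)
  show "ring fraction_algebra"
    by (rule fraction_ring)
  show ne: "\<one>\<^bsub>fraction_algebra\<^esub> \<noteq> \<zero>\<^bsub>fraction_algebra\<^esub>"
    unfolding fraction_algebra_simps using const_inj[of "\<one>\<^bsub>A\<^esub>" "\<zero>\<^bsub>A\<^esub>"] one_not_zero_A by auto
  show "Units fraction_algebra = carrier fraction_algebra - {\<zero>\<^bsub>fraction_algebra\<^esub>}"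
  proof
    show "Units fraction_algebra \<subseteq> carrier fraction_algebra - {\<zero>\<^bsub>fraction_algebra\<^esub>}"
    proof
      fix x assume x: "x \<in> Units fraction_algebra"
      have "x \<noteq> \<zero>\<^bsub>fraction_algebra\<^esub>"
        using F.Units_r_inv[OF x] F.l_null[OF F.Units_inv_closed[OF x]] ne by metis
      then show "x \<in> carrier fraction_algebra - {\<zero>\<^bsub>fraction_algebra\<^esub>}"
        using F.Units_closed[OF x] by simp
    qed
    show "carrier fraction_algebra - {\<zero>\<^bsub>fraction_algebra\<^esub>} \<subseteq> Units fraction_algebra"
    proof
      fix x assume x: "x \<in> carrier fraction_algebra - {\<zero>\<^bsub>fraction_algebra\<^esub>}"
      then have xF: "x \<in> fracs" by (simp add: fraction_algebra_simps)
      obtain c d where 0: "(c, d) \<in> x" "d \<noteq> \<zero>\<^bsub>A\<^esub>" "c \<in> carrier A" "d \<in> carrier A"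
        using fracs_obtain[OF xF] by blast
      have "c \<noteq> \<zero>\<^bsub>A\<^esub>"
        using x fracs_eqI[OF xF const_in[OF M.zero_closed] 0(1)] zero_frac[OF 0(4)] 0(2)
        by (auto simp: fraction_algebra_simps)
      then have "frac d c \<in> fracs" "fmult (frac d c) x = frac \<one>\<^bsub>A\<^esub> \<one>\<^bsub>A\<^esub>" "fmult x (frac d c) = frac \<one>\<^bsub>A\<^esub> \<one>\<^bsub>A\<^esub>"
        using fmult_inverse[OF xF 0(1) _ 0(2)] 0 frac_in by auto
      then show "x \<in> Units fraction_algebra"
        using xF by (auto simp: Units_def fraction_algebra_simps)
    qed
  qed
qed

lemma const_hom: "(\<lambda>a. frac a \<one>\<^bsub>A\<^esub>) \<in> algebra_hom K A fraction_algebra"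
proof (rule algebra_homI, unfold fraction_algebra_simps)
  show "frac x \<one>\<^bsub>A\<^esub> \<in> fracs" if "x \<in> carrier A" for x
    using that by (rule const_in)
next
  fix x y assume x: "x \<in> carrier A" and y: "y \<in> carrier A"
  note mem = const_in[OF x] const_in[OF y] const_in[of "x \<otimes>\<^bsub>A\<^esub> y"] const_in[of "x \<oplus>\<^bsub>A\<^esub> y"]
  have s: "(z, \<one>\<^bsub>A\<^esub>) \<in> frac z \<one>\<^bsub>A\<^esub>" if "z \<in> carrier A" for z
    using frac_const[of z "\<one>\<^bsub>A\<^esub>"] that by simp
  show "frac (x \<otimes>\<^bsub>A\<^esub> y) \<one>\<^bsub>A\<^esub> = fmult (frac x \<one>\<^bsub>A\<^esub>) (frac y \<one>\<^bsub>A\<^esub>)"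
    using fracs_eqI[OF mem(3) fmult_mem(1)[OF mem(1,2)] s fmult_mem(2)[OF mem(1,2) s[OF y] frac_const]]
      x y one_not_zero_A by simp
  show "frac (x \<oplus>\<^bsub>A\<^esub> y) \<one>\<^bsub>A\<^esub> = fadd (frac x \<one>\<^bsub>A\<^esub>) (frac y \<one>\<^bsub>A\<^esub>)"
    using fracs_eqI[OF mem(4) fadd_mem(1)[OF mem(1,2)] s fadd_mem(2)[OF mem(1,2) s[OF x] s[OF y]]]
      x y one_not_zero_A by simp
  fix c assume c: "c \<in> carrier K"
  show "frac (c \<odot>\<^bsub>A\<^esub> x) \<one>\<^bsub>A\<^esub> = fsmult c (frac x \<one>\<^bsub>A\<^esub>)"
    using fracs_eqI[OF const_in fsmult_mem(1)[OF c mem(1)] s fsmult_mem(2)[OF c mem(1) s[OF x]]]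
      c x one_not_zero_A by simp
qed simp

lemma fraction_eq:
  assumes x: "x \<in> carrier fraction_algebra"
  obtains a b where "a \<in> carrier A" "b \<in> carrier A" "b \<noteq> \<zero>\<^bsub>A\<^esub>"
    "x \<otimes>\<^bsub>fraction_algebra\<^esub> frac b \<one>\<^bsub>A\<^esub> = frac a \<one>\<^bsub>A\<^esub>"
proof -
  have xF: "x \<in> fracs" using x by (simp add: fraction_algebra_simps)
  obtain c d where 0: "(c, d) \<in> x" "d \<noteq> \<zero>\<^bsub>A\<^esub>" "c \<in> carrier A" "d \<in> carrier A"
    using fracs_obtain[OF xF] by blast
  have s: "(z, \<one>\<^bsub>A\<^esub>) \<in> frac z \<one>\<^bsub>A\<^esub>" if "z \<in> carrier A" for z
    using frac_const[of z "\<one>\<^bsub>A\<^esub>"] that by simp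
  have "fmult x (frac d \<one>\<^bsub>A\<^esub>) = frac c \<one>\<^bsub>A\<^esub>"
    using fracs_eqI[OF fmult_mem(1)[OF xF const_in] const_in fmult_mem(2)[OF xF const_in s 0(1)] s] 0 one_not_zero_A
    by simp
  then show ?thesis
    using that[OF 0(3,4,2)] by (simp add: fraction_algebra_simps)
qed

end

section \<open>Transport of structure\<close>

text \<open>The fractions of the torus live on the wrong type: the definition of a quantum cluster
  algebra asks for a skew field on sets of pairs of elements of the cell. An injection into that
  type carries the structure over.\<close>

lemma transport_algebra:
  fixes F :: "('k, 'f) module" and \<theta> :: "'f \<Rightarrow> 'c"
  assumes alg: "assoc_algebra K F" and sf: "skew_field F" and inj: "inj_on \<theta> (carrier F)"
  obtains F' :: "('k, 'c) module"
  where "assoc_algebra K F'" "skew_field F'" "\<theta> \<in> algebra_hom K F F'" "carrier F' = \<theta> ` carrier F"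
proof -
  interpret F: assoc_algebra K F by fact
  define g where "g = inv_into (carrier F) \<theta>"
  have g [simp]: "g (\<theta> x) = x" if "x \<in> carrier F" for x
    using that inj by (simp add: g_def)
  define F' :: "('k, 'c) module" where
    "F' = \<lparr>carrier = \<theta> ` carrier F, monoid.mult = (\<lambda>x y. \<theta> (g x \<otimes>\<^bsub>F\<^esub> g y)), monoid.one = \<theta> \<one>\<^bsub>F\<^esub>,
      ring.zero = \<theta> \<zero>\<^bsub>F\<^esub>, ring.add = (\<lambda>x y. \<theta> (g x \<oplus>\<^bsub>F\<^esub> g y)), smult = (\<lambda>c x. \<theta> (c \<odot>\<^bsub>F\<^esub> g x))\<rparr>"
  have F': "carrier F' = \<theta> ` carrier F" "\<And>x y. x \<otimes>\<^bsub>F'\<^esub> y = \<theta> (g x \<otimes>\<^bsub>F\<^esub> g y)" "\<one>\<^bsub>F'\<^esub> = \<theta> \<one>\<^bsub>F\<^esub>"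
    "\<zero>\<^bsub>F'\<^esub> = \<theta> \<zero>\<^bsub>F\<^esub>" "\<And>x y. x \<oplus>\<^bsub>F'\<^esub> y = \<theta> (g x \<oplus>\<^bsub>F\<^esub> g y)" "\<And>c x. c \<odot>\<^bsub>F'\<^esub> x = \<theta> (c \<odot>\<^bsub>F\<^esub> g x)"
    by (simp_all add: F'_def)
  have ring: "ring F'"
  proof (rule ringI)
    show "abelian_group F'"
    proof (rule abelian_groupI)
      fix x assume "x \<in> carrier F'"
      then obtain a where "a \<in> carrier F" "x = \<theta> a"
        by (auto simp: F')
      then show "\<exists>y\<in>carrier F'. y \<oplus>\<^bsub>F'\<^esub> x = \<zero>\<^bsub>F'\<^esub>"
        by (intro bexI[of _ "\<theta> (\<ominus>\<^bsub>F\<^esub> a)"]) (simp_all add: F' F.M.l_neg)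
    qed (auto simp: F' F.M.a_ac)
    show "Group.monoid F'"
      by (rule monoidI) (auto simp: F' F.A.m_assoc)
  qed (auto simp: F' F.A.l_distr F.A.r_distr)
  have alg': "assoc_algebra K F'"
    by (rule assoc_algebraI)
       (auto simp: F' ring F.K.field_axioms F.smult_l_distr F.smult_r_distr F.smult_assoc1
          F.smult_mult_left F.smult_mult_right)
  have hom: "\<theta> \<in> algebra_hom K F F'"
    by (rule algebra_homI) (auto simp: F')
  have "Units F' = \<theta> ` Units F"
  proof
    show "Units F' \<subseteq> \<theta> ` Units F"
    proof
      fix x assume "x \<in> Units F'"
      then obtain a b where ab: "a \<in> carrier F" "b \<in> carrier F" "x = \<theta> a" "\<theta> (b \<otimes>\<^bsub>F\<^esub> a) = \<theta> \<one>\<^bsub>F\<^esub>"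
          "\<theta> (a \<otimes>\<^bsub>F\<^esub> b) = \<theta> \<one>\<^bsub>F\<^esub>"
        by (auto simp: Units_def F')
      then have "b \<otimes>\<^bsub>F\<^esub> a = \<one>\<^bsub>F\<^esub>" "a \<otimes>\<^bsub>F\<^esub> b = \<one>\<^bsub>F\<^esub>"
        using inj_onD[OF inj] by auto
      then show "x \<in> \<theta> ` Units F"
        using ab by (auto simp: Units_def)
    qed
    show "\<theta> ` Units F \<subseteq> Units F'"
      by (auto simp: Units_def F') metis
  qed
  then have "skew_field F'"
    using sf ring inj_on_image_set_diff[OF inj, of "carrier F" "{\<zero>\<^bsub>F\<^esub>}"] inj_onD[OF inj, of "\<one>\<^bsub>F\<^esub>" "\<zero>\<^bsub>F\<^esub>"]
    by (auto simp: skew_field_def F')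
  then show ?thesis
    using that alg' hom F'(1) by blast
qed

section \<open>Noetherian domains by Dickson's lemma and leading exponents\<close>

section \<open>Dickson's lemma\<close>

text \<open>Every tail attains its minimum; dependent choice picks increasing positions at which
  this happens.\<close>

lemma nat_seq_mono_subseq:
  fixes s :: "nat \<Rightarrow> nat"
  obtains r :: "nat \<Rightarrow> nat" where "strict_mono r" "\<And>m n. m \<le> n \<Longrightarrow> s (r m) \<le> s (r n)"
proof -
  have ex: "\<exists>n\<ge>N. \<forall>m\<ge>n. s n \<le> s m" for N
  proof -
    obtain n where "n \<ge> N" "\<forall>m. m \<ge> N \<longrightarrow> s n \<le> s m"
      using ex_has_least_nat[of "\<lambda>n. n \<ge> N" N s] by auto
    then show ?thesis by (meson le_trans)
  qed
  obtain r where r: "\<forall>n. \<forall>m\<ge>r n. s (r n) \<le> s m" "\<forall>n. Suc (r n) \<le> r (Suc n)"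
    using dependent_nat_choice[of "\<lambda>n x. \<forall>m\<ge>x. s x \<le> s m" "\<lambda>n x y. Suc x \<le> y"] ex by metis
  have sm: "strict_mono r"
    using r(2) by (simp add: strict_mono_Suc_iff Suc_le_eq)
  show ?thesis
    by (rule that[OF sm]) (use r(1) sm in \<open>simp add: strict_mono_less_eq\<close>)
qed

lemma dickson_subseq:
  fixes v :: "nat \<Rightarrow> 'i \<Rightarrow> nat"
  assumes "finite I"
  obtains r :: "nat \<Rightarrow> nat" where "strict_mono r" "\<And>k m n. k \<in> I \<Longrightarrow> m \<le> n \<Longrightarrow> v (r m) k \<le> v (r n) k"
  using assms
proof (induction I arbitrary: thesis)
  case empty
  show ?case
    by (rule empty(1)[of id]) (auto simp: strict_mono_def)
next
  case (insert a I)
  obtain r :: "nat \<Rightarrow> nat" where r: "strict_mono r" "\<And>k m n. k \<in> I \<Longrightarrow> m \<le> n \<Longrightarrow> v (r m) k \<le> v (r n) k"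
    using insert.IH by blast
  obtain r' :: "nat \<Rightarrow> nat" where r': "strict_mono r'" "\<And>m n. m \<le> n \<Longrightarrow> v (r (r' m)) a \<le> v (r (r' n)) a"
    using nat_seq_mono_subseq[of "\<lambda>n. v (r n) a"] by blast
  show ?case
  proof (rule insert.prems)
    show "strict_mono (r \<circ> r')"
      using r r' by (simp add: strict_mono_o)
    show "v ((r \<circ> r') m) k \<le> v ((r \<circ> r') n) k" if "k \<in> insert a I" "m \<le> n" for k m n
      using that r r' by (auto simp: strict_mono_less_eq)
  qed
qed

lemma dickson:
  fixes v :: "nat \<Rightarrow> 'i \<Rightarrow> nat"
  assumes "finite I"
  obtains m n where "m < n" "\<And>k. k \<in> I \<Longrightarrow> v m k \<le> v n k"
proof -
  obtain r :: "nat \<Rightarrow> nat" where r: "strict_mono r" "\<And>k m n. k \<in> I \<Longrightarrow> m \<le> n \<Longrightarrow> v (r m) k \<le> v (r n) k"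
    using dickson_subseq[OF assms] by blast
  show ?thesis
    using that[of "r 0" "r 1"] r by (simp add: strict_mono_def)
qed

text \<open>If no finite subset worked, dependent choice would give a sequence in \<open>E\<close>
  in which no term is below a later one, contradicting \<open>dickson\<close>.\<close>

lemma dickson_basis:
  fixes c :: "'g \<Rightarrow> 'i \<Rightarrow> nat"
  assumes "finite I"
  obtains E0 where "finite E0" "E0 \<subseteq> E" "\<And>y. y \<in> E \<Longrightarrow> \<exists>x\<in>E0. \<forall>k\<in>I. c x k \<le> c y k"
proof (rule ccontr)
  assume neg: "\<not> thesis"
  note basis = that
  have step: "\<exists>y\<in>E. \<forall>x\<in>E0. \<not> (\<forall>k\<in>I. c x k \<le> c y k)" if "finite E0" "E0 \<subseteq> E" for E0
    using neg basis[OF that] by blast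
  have "\<exists>f. \<forall>n::nat. f n \<in> E \<and> (\<forall>i<n. \<not> (\<forall>k\<in>I. c (f i) k \<le> c (f n) k))"
  proof (rule dependent_wf_choice[of less_than, simplified])
    fix n :: nat and f :: "nat \<Rightarrow> 'g"
    assume "\<And>y. y < n \<Longrightarrow> f y \<in> E \<and> (\<forall>i<y. \<not> (\<forall>k\<in>I. c (f i) k \<le> c (f y) k))"
    then have "f ` {..<n} \<subseteq> E" by auto
    from step[OF _ this] show "\<exists>r. r \<in> E \<and> (\<forall>i<n. \<not> (\<forall>k\<in>I. c (f i) k \<le> c r k))"
      by auto
  qed auto
  then obtain f :: "nat \<Rightarrow> 'g"
    where f: "\<forall>n. f n \<in> E \<and> (\<forall>i<n. \<not> (\<forall>k\<in>I. c (f i) k \<le> c (f n) k))" ..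
  obtain m n where "m < n" "\<And>k. k \<in> I \<Longrightarrow> c (f m) k \<le> c (f n) k"
    by (rule dickson[OF assms, of "\<lambda>n. c (f n)"]) blast
  then show False
    using f by blast
qed

section \<open>Noetherian domains\<close>

text \<open>Left ideals are right ideals of the opposite algebra, so noetherianity and the Ore
  condition are proved for the right side and transferred.\<close>

definition opp :: "('k, 'a) module \<Rightarrow> ('k, 'a) module" where
  "opp A = A\<lparr>monoid.mult := (\<lambda>x y. y \<otimes>\<^bsub>A\<^esub> x)\<rparr>"

lemma opp_simps [simp]:
  "carrier (opp A) = carrier A" "x \<otimes>\<^bsub>opp A\<^esub> y = y \<otimes>\<^bsub>A\<^esub> x" "\<one>\<^bsub>opp A\<^esub> = \<one>\<^bsub>A\<^esub>"
  "\<zero>\<^bsub>opp A\<^esub> = \<zero>\<^bsub>A\<^esub>" "x \<oplus>\<^bsub>opp A\<^esub> y = x \<oplus>\<^bsub>A\<^esub> y" "c \<odot>\<^bsub>opp A\<^esub> x = c \<odot>\<^bsub>A\<^esub> x"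
  by (simp_all add: opp_def)

lemma add_opp: "add (opp A) = add A"
  by (simp add: opp_def)

lemma left_ideal_opp: "left_ideal A I \<longleftrightarrow> right_ideal (opp A) I"
  by (simp add: left_ideal_def right_ideal_def additive_subgroup_def add_opp)

lemma domain_algebra_opp:
  assumes "domain_algebra K A"
  shows "domain_algebra K (opp A)"
proof -
  interpret domain_algebra K A by fact
  have "ring (opp A)"
  proof (rule ringI)
    show "abelian_group (opp A)"
      using M.abelian_group_axioms
      by (simp add: abelian_group_def abelian_monoid_def abelian_group_axioms_def add_opp)
    show "Group.monoid (opp A)"
      by (rule monoidI) (auto simp: A.m_assoc)
  qed (auto simp: A.l_distr A.r_distr)
  then have "assoc_algebra K (opp A)"
    by (intro assoc_algebraI)
       (auto simp: K.field_axioms smult_l_distr smult_r_distr smult_assoc1 smult_mult_left smult_mult_right)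
  then show ?thesis
    by (intro domain_algebra.intro domain_algebra_axioms.intro) (use one_not_zero_A integral_A in auto)
qed

definition right_noetherian :: "('k, 'a) module \<Rightarrow> bool" where
  "right_noetherian A \<longleftrightarrow> (\<forall>I. right_ideal A I \<longrightarrow>
     (\<exists>G. finite G \<and> G \<subseteq> carrier A \<and> I = \<Inter>{J. right_ideal A J \<and> G \<subseteq> J}))"

lemma noetherian_iff: "noetherian A \<longleftrightarrow> right_noetherian (opp A) \<and> right_noetherian A"
  by (simp add: noetherian_def right_noetherian_def left_ideal_opp)

context assoc_algebra
begin

text \<open>Negatives are supplied by right multiplication with \<open>-1\<close>.\<close>

lemma right_idealI:
  assumes "J \<subseteq> carrier A" "\<zero>\<^bsub>A\<^esub> \<in> J" "\<And>x y. x \<in> J \<Longrightarrow> y \<in> J \<Longrightarrow> x \<oplus>\<^bsub>A\<^esub> y \<in> J"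
    and "\<And>x a. x \<in> J \<Longrightarrow> a \<in> carrier A \<Longrightarrow> x \<otimes>\<^bsub>A\<^esub> a \<in> J"
  shows "right_ideal A J"
proof -
  have "\<ominus>\<^bsub>A\<^esub> x \<in> J" if "x \<in> J" for x
    using assms(4)[OF that, of "\<ominus>\<^bsub>A\<^esub> \<one>\<^bsub>A\<^esub>"] assms(1) that by (auto simp: A.r_minus)
  then have "subgroup J (add_monoid A)"
    using assms by (intro M.add.subgroupI) (auto simp: a_inv_def)
  then show ?thesis
    using assms by (simp add: right_ideal_def additive_subgroup_def)
qed

lemma right_idealD:
  assumes "right_ideal A J"
  shows "J \<subseteq> carrier A" "\<zero>\<^bsub>A\<^esub> \<in> J" "\<And>x y. x \<in> J \<Longrightarrow> y \<in> J \<Longrightarrow> x \<oplus>\<^bsub>A\<^esub> y \<in> J"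
    and "\<And>x a. x \<in> J \<Longrightarrow> a \<in> carrier A \<Longrightarrow> x \<otimes>\<^bsub>A\<^esub> a \<in> J"
    and "\<And>x c. x \<in> J \<Longrightarrow> c \<in> carrier K \<Longrightarrow> c \<odot>\<^bsub>A\<^esub> x \<in> J"
    and "\<And>x. x \<in> J \<Longrightarrow> \<ominus>\<^bsub>A\<^esub> x \<in> J"
proof -
  interpret additive_subgroup J A
    using assms by (simp add: right_ideal_def)
  show sub: "J \<subseteq> carrier A"
    by (rule a_subset)
  show "\<zero>\<^bsub>A\<^esub> \<in> J"
    by (rule zero_closed)
  show "\<And>x y. x \<in> J \<Longrightarrow> y \<in> J \<Longrightarrow> x \<oplus>\<^bsub>A\<^esub> y \<in> J"
    by (rule a_closed)
  show mult: "\<And>x a. x \<in> J \<Longrightarrow> a \<in> carrier A \<Longrightarrow> x \<otimes>\<^bsub>A\<^esub> a \<in> J"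
    using assms by (simp add: right_ideal_def)
  show "c \<odot>\<^bsub>A\<^esub> x \<in> J" if "x \<in> J" "c \<in> carrier K" for x c
    using mult[OF that(1), of "c \<odot>\<^bsub>A\<^esub> \<one>\<^bsub>A\<^esub>"] that sub by (auto simp: smult_mult_right)
  show "\<ominus>\<^bsub>A\<^esub> x \<in> J" if "x \<in> J" for x
    using mult[OF that, of "\<ominus>\<^bsub>A\<^esub> \<one>\<^bsub>A\<^esub>"] that sub by (auto simp: A.r_minus)
qed

end

context domain_algebra
begin

text \<open>
  If \<open>a A \<inter> b A = 0\<close>, the right ideals \<open>a\<^sup>n b A\<close> form a direct sum, so their sum is not finitely
  generated. Its partial sums are written in Horner form.
\<close>

primrec horner_ideal :: "'c \<Rightarrow> 'c \<Rightarrow> nat \<Rightarrow> 'c set" where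
  "horner_ideal a b 0 = {\<zero>\<^bsub>A\<^esub>}"
| "horner_ideal a b (Suc n) = {b \<otimes>\<^bsub>A\<^esub> c \<oplus>\<^bsub>A\<^esub> a \<otimes>\<^bsub>A\<^esub> z | c z. c \<in> carrier A \<and> z \<in> horner_ideal a b n}"

lemma horner_ideal_right_ideal:
  assumes a: "a \<in> carrier A" and b: "b \<in> carrier A"
  shows "right_ideal A (horner_ideal a b n)"
proof (induction n)
  case 0
  show ?case by (rule right_idealI) auto
next
  case (Suc n)
  note IH = right_idealD[OF Suc]
  have IH1: "z \<in> carrier A" if "z \<in> horner_ideal a b n" for z
    using IH(1) that by blast
  show ?case
  proof (rule right_idealI)
    show "horner_ideal a b (Suc n) \<subseteq> carrier A"
      using a b IH1 by auto
    show "\<zero>\<^bsub>A\<^esub> \<in> horner_ideal a b (Suc n)"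
      using a b IH(2) by (auto intro!: exI[of _ "\<zero>\<^bsub>A\<^esub>"])
  next
    fix x y assume "x \<in> horner_ideal a b (Suc n)" "y \<in> horner_ideal a b (Suc n)"
    then obtain c z c' z' where *: "x = b \<otimes>\<^bsub>A\<^esub> c \<oplus>\<^bsub>A\<^esub> a \<otimes>\<^bsub>A\<^esub> z" "y = b \<otimes>\<^bsub>A\<^esub> c' \<oplus>\<^bsub>A\<^esub> a \<otimes>\<^bsub>A\<^esub> z'"
        "c \<in> carrier A" "c' \<in> carrier A" "z \<in> horner_ideal a b n" "z' \<in> horner_ideal a b n"
      by auto
    then have "x \<oplus>\<^bsub>A\<^esub> y = b \<otimes>\<^bsub>A\<^esub> (c \<oplus>\<^bsub>A\<^esub> c') \<oplus>\<^bsub>A\<^esub> a \<otimes>\<^bsub>A\<^esub> (z \<oplus>\<^bsub>A\<^esub> z')"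
      using a b IH1 by (simp add: A.r_distr M.a_ac)
    then show "x \<oplus>\<^bsub>A\<^esub> y \<in> horner_ideal a b (Suc n)"
      using * IH(3) by auto
  next
    fix x d assume "x \<in> horner_ideal a b (Suc n)" and d: "d \<in> carrier A"
    then obtain c z where *: "x = b \<otimes>\<^bsub>A\<^esub> c \<oplus>\<^bsub>A\<^esub> a \<otimes>\<^bsub>A\<^esub> z" "c \<in> carrier A" "z \<in> horner_ideal a b n"
      by auto
    then have "x \<otimes>\<^bsub>A\<^esub> d = b \<otimes>\<^bsub>A\<^esub> (c \<otimes>\<^bsub>A\<^esub> d) \<oplus>\<^bsub>A\<^esub> a \<otimes>\<^bsub>A\<^esub> (z \<otimes>\<^bsub>A\<^esub> d)"
      using a b d IH1 by (simp add: A.l_distr A.m_assoc)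
    then show "x \<otimes>\<^bsub>A\<^esub> d \<in> horner_ideal a b (Suc n)"
      using * d IH(4) by auto
  qed
qed

lemma horner_ideal_mono:
  assumes a: "a \<in> carrier A" and b: "b \<in> carrier A" and "m \<le> n"
  shows "horner_ideal a b m \<subseteq> horner_ideal a b n"
proof -
  have "horner_ideal a b n \<subseteq> horner_ideal a b (Suc n)" for n
  proof (induction n)
    case 0
    show ?case
      using a b by (auto intro!: exI[of _ "\<zero>\<^bsub>A\<^esub>"])
  next
    case (Suc n)
    show ?case
    proof
      fix x assume "x \<in> horner_ideal a b (Suc n)"
      then obtain c z where "x = b \<otimes>\<^bsub>A\<^esub> c \<oplus>\<^bsub>A\<^esub> a \<otimes>\<^bsub>A\<^esub> z" "c \<in> carrier A" "z \<in> horner_ideal a b n"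
        by auto
      then show "x \<in> horner_ideal a b (Suc (Suc n))"
        using Suc unfolding horner_ideal.simps(2)[of a b "Suc n"] by blast
    qed
  qed
  then show ?thesis
    using lift_Suc_mono_le assms by blast
qed

lemma right_noetherian_ore:
  assumes noeth: "\<And>I. right_ideal A I \<Longrightarrow>
      \<exists>G. finite G \<and> G \<subseteq> carrier A \<and> I = \<Inter>{J. right_ideal A J \<and> G \<subseteq> J}"
  shows "ore_algebra K A"
proof (intro ore_algebra.intro ore_algebra_axioms.intro domain_algebra_axioms)
  fix a b assume a: "a \<in> carrier A" "a \<noteq> \<zero>\<^bsub>A\<^esub>" and b: "b \<in> carrier A" "b \<noteq> \<zero>\<^bsub>A\<^esub>"
  show "\<exists>u\<in>carrier A. \<exists>v\<in>carrier A. a \<otimes>\<^bsub>A\<^esub> u = b \<otimes>\<^bsub>A\<^esub> v \<and> a \<otimes>\<^bsub>A\<^esub> u \<noteq> \<zero>\<^bsub>A\<^esub>"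
  proof (rule ccontr)
    assume "\<not> ?thesis"
    then have triv: "a \<otimes>\<^bsub>A\<^esub> u = \<zero>\<^bsub>A\<^esub>" if "u \<in> carrier A" "v \<in> carrier A" "a \<otimes>\<^bsub>A\<^esub> u = b \<otimes>\<^bsub>A\<^esub> v" for u v
      using that by blast
    let ?H = "horner_ideal a b"
    \<comment> \<open>\<open>p n\<close> is the product of \<open>n\<close> factors \<open>a\<close>
      and one \<open>b\<close>. It lies in the ideal with index \<open>n + 1\<close> but not in the
      one with index \<open>n\<close>, so the union of the chain is not finitely generated.\<close>
    define p where "p n = ((\<otimes>\<^bsub>A\<^esub>) a ^^ n) b" for n
    have p0: "p 0 = b" and pS: "p (Suc n) = a \<otimes>\<^bsub>A\<^esub> p n" for n
      by (simp_all add: p_def)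
    have p_in: "p n \<in> carrier A" for n
      by (induction n) (simp_all add: p0 pS a b)
    have mem: "p n \<in> ?H (Suc n)" for n
    proof (induction n)
      case 0
      show ?case
        using a b by (auto simp: p0 intro!: exI[of _ "\<one>\<^bsub>A\<^esub>"])
    next
      case (Suc n)
      have "p (Suc n) = b \<otimes>\<^bsub>A\<^esub> \<zero>\<^bsub>A\<^esub> \<oplus>\<^bsub>A\<^esub> a \<otimes>\<^bsub>A\<^esub> p n"
        using a b p_in by (simp add: pS)
      then show ?case
        using Suc unfolding horner_ideal.simps(2)[of a b "Suc n"] by blast
    qed
    \<comment> \<open>If \<open>a (p n) = b c + a z\<close>, then \<open>a (p n - z)\<close> lies in
      both \<open>a A\<close> and \<open>b A\<close>, hence vanishes; so \<open>p n = z\<close> lies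
      in the smaller ideal, against the induction hypothesis.\<close>
    have nmem: "p n \<notin> ?H n" for n
    proof (induction n)
      case 0
      show ?case using b by (simp add: p0)
    next
      case (Suc n)
      show ?case
      proof
        assume "p (Suc n) \<in> ?H (Suc n)"
        then obtain c z where cz: "a \<otimes>\<^bsub>A\<^esub> p n = b \<otimes>\<^bsub>A\<^esub> c \<oplus>\<^bsub>A\<^esub> a \<otimes>\<^bsub>A\<^esub> z" "c \<in> carrier A" "z \<in> ?H n"
          by (auto simp: pS)
        have z: "z \<in> carrier A"
          using cz(3) right_idealD(1)[OF horner_ideal_right_ideal[OF a(1) b(1)]] by blast
        have "a \<otimes>\<^bsub>A\<^esub> (p n \<ominus>\<^bsub>A\<^esub> z) = a \<otimes>\<^bsub>A\<^esub> p n \<ominus>\<^bsub>A\<^esub> a \<otimes>\<^bsub>A\<^esub> z"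
          using a p_in z by (simp add: a_minus_def A.r_distr A.r_minus)
        also have "\<dots> = b \<otimes>\<^bsub>A\<^esub> c"
          using a b cz z by (simp add: a_minus_def M.a_assoc M.r_neg)
        finally have "a \<otimes>\<^bsub>A\<^esub> (p n \<ominus>\<^bsub>A\<^esub> z) = \<zero>\<^bsub>A\<^esub>"
          using triv[of "p n \<ominus>\<^bsub>A\<^esub> z" c] p_in z cz by simp
        then have "p n = z"
          using integral_A[OF a(1)] a(2) p_in z diff_zero_eq by (metis M.minus_closed)
        then show False
          using Suc cz by simp
      qed
    qed
    have chain: "?H m \<subseteq> ?H n" if "m \<le> n" for m n
      using horner_ideal_mono[OF a(1) b(1) that] .
    note ri = horner_ideal_right_ideal[OF a(1) b(1)]
    have "right_ideal A (\<Union>n. ?H n)"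
    proof (rule right_idealI)
      fix x y assume "x \<in> (\<Union>n. ?H n)" "y \<in> (\<Union>n. ?H n)"
      then obtain m n where "x \<in> ?H m" "y \<in> ?H n"
        by blast
      then have "x \<in> ?H (max m n)" "y \<in> ?H (max m n)"
        using chain[of m "max m n"] chain[of n "max m n"] by auto
      then show "x \<oplus>\<^bsub>A\<^esub> y \<in> (\<Union>n. ?H n)"
        using right_idealD(3)[OF ri] by blast
    next
      show "(\<Union>n. ?H n) \<subseteq> carrier A"
        using right_idealD(1)[OF ri] by blast
      show "\<zero>\<^bsub>A\<^esub> \<in> (\<Union>n. ?H n)"
        using right_idealD(2)[OF ri] by blast
      fix x d assume "x \<in> (\<Union>n. ?H n)" "d \<in> carrier A"
      then show "x \<otimes>\<^bsub>A\<^esub> d \<in> (\<Union>n. ?H n)"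
        using right_idealD(4)[OF ri] by blast
    qed
    from noeth[OF this] obtain G where G: "finite G" "(\<Union>n. ?H n) = \<Inter>{J. right_ideal A J \<and> G \<subseteq> J}"
      by blast
    then have "G \<subseteq> (\<Union>n. ?H n)"
      by blast
    with G(1) have "\<exists>n. G \<subseteq> ?H n"
    proof (induction G rule: finite_induct)
      case (insert x G)
      then obtain m n where "x \<in> ?H m" "G \<subseteq> ?H n"
        by blast
      then have "insert x G \<subseteq> ?H (max m n)"
        using chain[of m "max m n"] chain[of n "max m n"] by auto
      then show ?case by blast
    qed auto
    then obtain n where "G \<subseteq> ?H n" by blast
    then have "(\<Union>n. ?H n) \<subseteq> ?H n"
      using G(2) ri by blast
    then show False
      using mem[of n] nmem[of n] by blast
  qed
qed

end

text \<open>The data of a Groebner basis argument: \<open>v\<close> is the leading exponent,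
  elements with equal leading exponents are proportional up to lower terms, and \<open>C\<close> is
  the semigroup of all leading exponents. The coordinates \<open>co\<close> turn componentwise
  comparison into divisibility in \<open>C\<close>, which is where Dickson's lemma enters.\<close>

locale valued_algebra = assoc_algebra K A for K (structure) and A :: "('k, 'c) module" (structure) +
  fixes v :: "'c \<Rightarrow> 'g :: linordered_ab_group_add" and C :: "'g set" and I :: "'i set" and co :: "'g \<Rightarrow> 'i \<Rightarrow> nat"
  assumes finite_I: "finite I"
    and nontrivial: "\<one>\<^bsub>A\<^esub> \<noteq> \<zero>\<^bsub>A\<^esub>"
    and v_in: "\<And>a. a \<in> carrier A \<Longrightarrow> a \<noteq> \<zero>\<^bsub>A\<^esub> \<Longrightarrow> v a \<in> C"
    and v_surj: "\<And>\<gamma>. \<gamma> \<in> C \<Longrightarrow> \<exists>a\<in>carrier A. a \<noteq> \<zero>\<^bsub>A\<^esub> \<and> v a = \<gamma>"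
    and v_mult: "\<And>a b. a \<in> carrier A \<Longrightarrow> b \<in> carrier A \<Longrightarrow> a \<noteq> \<zero>\<^bsub>A\<^esub> \<Longrightarrow> b \<noteq> \<zero>\<^bsub>A\<^esub> \<Longrightarrow>
        a \<otimes>\<^bsub>A\<^esub> b \<noteq> \<zero>\<^bsub>A\<^esub> \<and> v (a \<otimes>\<^bsub>A\<^esub> b) = v a + v b"
    and v_reduce: "\<And>a b. a \<in> carrier A \<Longrightarrow> b \<in> carrier A \<Longrightarrow> a \<noteq> \<zero>\<^bsub>A\<^esub> \<Longrightarrow> b \<noteq> \<zero>\<^bsub>A\<^esub> \<Longrightarrow> v a = v b \<Longrightarrow>
        \<exists>k\<in>carrier K. \<exists>d\<in>carrier A. a = k \<odot>\<^bsub>A\<^esub> b \<oplus>\<^bsub>A\<^esub> d \<and> (d = \<zero>\<^bsub>A\<^esub> \<or> v d < v a)"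
    and co_le: "\<And>\<alpha> \<beta>. \<alpha> \<in> C \<Longrightarrow> \<beta> \<in> C \<Longrightarrow> (\<And>k. k \<in> I \<Longrightarrow> co \<alpha> k \<le> co \<beta> k) \<Longrightarrow> \<beta> - \<alpha> \<in> C"
    and C_pos: "\<And>\<gamma>. \<gamma> \<in> C \<Longrightarrow> 0 \<le> \<gamma>"
begin

lemma domain: "domain_algebra K A"
  by (intro domain_algebra.intro domain_algebra_axioms.intro assoc_algebra_axioms)
     (use nontrivial v_mult in blast)+

lemma valued_opp: "valued_algebra K (opp A) v C I co"
proof (intro valued_algebra.intro valued_algebra_axioms.intro)
  show "assoc_algebra K (opp A)"
    using domain_algebra_opp[OF domain] by (simp add: domain_algebra_def)
qed (use finite_I nontrivial v_in v_surj v_mult v_reduce co_le C_pos in \<open>auto simp: add.commute\<close>)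

text \<open>\<open>G\<close> lifts finitely many leading exponents that lie below all those of
  \<open>J\<close>. Any element of \<open>J\<close> is reduced by a right multiple of a member of
  \<open>G\<close> with the same leading exponent, and the remainder is zero or has a smaller
  one.\<close>

lemma right_noetherian: "right_noetherian A"
  unfolding right_noetherian_def
proof (intro allI impI)
  fix J assume J: "right_ideal A J"
  note JD = right_idealD[OF J]
  obtain E0 where E0: "finite E0" "E0 \<subseteq> v ` (J - {\<zero>\<^bsub>A\<^esub>})"
      "\<And>y. y \<in> v ` (J - {\<zero>\<^bsub>A\<^esub>}) \<Longrightarrow> \<exists>x\<in>E0. \<forall>k\<in>I. co x k \<le> co y k"
    using dickson_basis[OF finite_I, of "v ` (J - {\<zero>\<^bsub>A\<^esub>})" co] by blast
  obtain G where G: "finite G" "G \<subseteq> J - {\<zero>\<^bsub>A\<^esub>}" "E0 = v ` G"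
    using finite_subset_image[OF E0(1,2)] by blast
  \<comment> \<open>In an infinite descent Dickson's lemma finds \<open>m < n\<close> with
    \<open>f n - f m\<close> in \<open>C\<close>, hence nonnegative, while the descent makes it
    negative.\<close>
  have wf: "wf {(x, y). x \<in> C \<and> y \<in> C \<and> x < y}"
    unfolding wf_iff_no_infinite_down_chain
  proof
    assume "\<exists>f. \<forall>i. (f (Suc i), f i) \<in> {(x, y). x \<in> C \<and> y \<in> C \<and> x < y}"
    then obtain f where f: "\<And>i. f i \<in> C" "\<And>i. f (Suc i) < f i"
      by blast
    have dec: "f n < f m" if "m < n" for m n
      using lift_Suc_mono_less[of "\<lambda>n. - f n"] f(2) that by simp
    obtain m n where mn: "m < n" "\<And>k. k \<in> I \<Longrightarrow> co (f m) k \<le> co (f n) k"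
      using dickson[OF finite_I, of "\<lambda>n. co (f n)"] by blast
    then have "0 \<le> f n - f m"
      using C_pos[OF co_le[OF f(1) f(1)]] by blast
    then show False
      using dec[OF mn(1)] by simp
  qed
  have sub: "J \<subseteq> L" if L: "right_ideal A L" "G \<subseteq> L" for L
  proof -
    note LD = right_idealD[OF L(1)]
    have "\<forall>a\<in>J - {\<zero>\<^bsub>A\<^esub>}. v a = \<gamma> \<longrightarrow> a \<in> L" for \<gamma>
      using wf
    proof (induction \<gamma>)
      case (less \<gamma>)
      show ?case
      proof (intro ballI impI)
        fix a assume a: "a \<in> J - {\<zero>\<^bsub>A\<^esub>}" "v a = \<gamma>"
        obtain b where b: "b \<in> G" "\<forall>k\<in>I. co (v b) k \<le> co (v a) k"
          using E0(3)[of "v a"] a G(3) by blast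
        have aC: "a \<in> carrier A" "a \<noteq> \<zero>\<^bsub>A\<^esub>" and bC: "b \<in> carrier A" "b \<noteq> \<zero>\<^bsub>A\<^esub>" "b \<in> J"
          using a b G(2) JD(1) by auto
        have "v a - v b \<in> C"
          using co_le[OF v_in[OF bC(1,2)] v_in[OF aC]] b by blast
        then obtain c where c: "c \<in> carrier A" "c \<noteq> \<zero>\<^bsub>A\<^esub>" "v c = v a - v b"
          using v_surj by blast
        have bc: "b \<otimes>\<^bsub>A\<^esub> c \<noteq> \<zero>\<^bsub>A\<^esub>" "v (b \<otimes>\<^bsub>A\<^esub> c) = v a" "b \<otimes>\<^bsub>A\<^esub> c \<in> carrier A"
          using v_mult[OF bC(1) c(1) bC(2) c(2)] c bC by auto
        obtain k d where kd: "k \<in> carrier K" "d \<in> carrier A" "a = k \<odot>\<^bsub>A\<^esub> (b \<otimes>\<^bsub>A\<^esub> c) \<oplus>\<^bsub>A\<^esub> d"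
            "d = \<zero>\<^bsub>A\<^esub> \<or> v d < v a"
          using v_reduce[OF aC(1) bc(3) aC(2) bc(1)] bc(2) by metis
        have kbc: "k \<odot>\<^bsub>A\<^esub> (b \<otimes>\<^bsub>A\<^esub> c) \<in> J" "k \<odot>\<^bsub>A\<^esub> (b \<otimes>\<^bsub>A\<^esub> c) \<in> L" "k \<odot>\<^bsub>A\<^esub> (b \<otimes>\<^bsub>A\<^esub> c) \<in> carrier A"
          using JD(5)[OF JD(4)[OF bC(3) c(1)] kd(1)] LD(5)[OF LD(4)[OF _ c(1)] kd(1), of b] b L(2) bc(3) kd(1)
          by auto
        have "d = \<ominus>\<^bsub>A\<^esub> (k \<odot>\<^bsub>A\<^esub> (b \<otimes>\<^bsub>A\<^esub> c)) \<oplus>\<^bsub>A\<^esub> a"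
          using kd kbc by (simp add: M.r_neg1)
        then have dJ: "d \<in> J"
          using JD(3,6) kbc a by blast
        have "d \<in> L"
        proof (cases "d = \<zero>\<^bsub>A\<^esub>")
          case True
          then show ?thesis using LD(2) by simp
        next
          case False
          then have "(v d, \<gamma>) \<in> {(x, y). x \<in> C \<and> y \<in> C \<and> x < y}"
            using kd v_in[OF kd(2) False] v_in[OF aC] a(2) by auto
          from less[OF this] show ?thesis
            using dJ False by auto
        qed
        then show "a \<in> L"
          using LD(3) kbc(2) kd(3) by blast
      qed
    qed
    then show ?thesis
      using LD(2) by blast
  qed
  have "J = \<Inter>{L. right_ideal A L \<and> G \<subseteq> L}"
    using sub J G(2) by blast
  then show "\<exists>G. finite G \<and> G \<subseteq> carrier A \<and> J = \<Inter>{L. right_ideal A L \<and> G \<subseteq> L}"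
    using G JD(1) by blast
qed

lemma noetherian: "noetherian A"
  using right_noetherian valued_algebra.right_noetherian[OF valued_opp] by (simp add: noetherian_iff)

lemma ore: "ore_algebra K A"
  using right_noetherian domain_algebra.right_noetherian_ore[OF domain] by (simp add: right_noetherian_def)

lemma ore_opp: "ore_algebra K (opp A)"
  using valued_algebra.ore[OF valued_opp] .

end

section \<open>Presented algebras and the quantum matrix algebra\<close>

section \<open>Algebras given by generators and relations\<close>

text \<open>The multiplications of the free algebra and of its twisted counterpart are shown to
  agree on the carrier only, so the ring axioms are transferred along pointwise equality
  there.\<close>

lemma ring_cong:
  assumes "ring R" and "carrier S = carrier R" "\<one>\<^bsub>S\<^esub> = \<one>\<^bsub>R\<^esub>" "\<zero>\<^bsub>S\<^esub> = \<zero>\<^bsub>R\<^esub>"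
    and "\<And>x y. x \<in> carrier R \<Longrightarrow> y \<in> carrier R \<Longrightarrow> x \<oplus>\<^bsub>S\<^esub> y = x \<oplus>\<^bsub>R\<^esub> y"
    and "\<And>x y. x \<in> carrier R \<Longrightarrow> y \<in> carrier R \<Longrightarrow> x \<otimes>\<^bsub>S\<^esub> y = x \<otimes>\<^bsub>R\<^esub> y"
  shows "ring S"
proof -
  interpret R: ring R by fact
  show ?thesis
  proof (rule ringI)
    show "abelian_group S"
    proof (rule abelian_groupI)
      fix x assume "x \<in> carrier S"
      then show "\<exists>y\<in>carrier S. y \<oplus>\<^bsub>S\<^esub> x = \<zero>\<^bsub>S\<^esub>"
        using assms by (intro bexI[of _ "\<ominus>\<^bsub>R\<^esub> x"]) (auto simp: R.l_neg)
    qed (use assms in \<open>auto simp: R.a_ac\<close>)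
    show "Group.monoid S"
      by (rule monoidI) (use assms in \<open>auto simp: R.m_assoc\<close>)
  qed (use assms in \<open>auto simp: R.l_distr R.r_distr\<close>)
qed

lemma assoc_algebra_cong:
  assumes "assoc_algebra K A" and "carrier B = carrier A" "\<one>\<^bsub>B\<^esub> = \<one>\<^bsub>A\<^esub>" "\<zero>\<^bsub>B\<^esub> = \<zero>\<^bsub>A\<^esub>"
    and "\<And>x y. x \<in> carrier A \<Longrightarrow> y \<in> carrier A \<Longrightarrow> x \<oplus>\<^bsub>B\<^esub> y = x \<oplus>\<^bsub>A\<^esub> y"
    and "\<And>x y. x \<in> carrier A \<Longrightarrow> y \<in> carrier A \<Longrightarrow> x \<otimes>\<^bsub>B\<^esub> y = x \<otimes>\<^bsub>A\<^esub> y"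
    and "\<And>c x. c \<in> carrier K \<Longrightarrow> x \<in> carrier A \<Longrightarrow> c \<odot>\<^bsub>B\<^esub> x = c \<odot>\<^bsub>A\<^esub> x"
  shows "assoc_algebra K B"
proof -
  interpret A: assoc_algebra K A by fact
  have "ring B"
    by (rule ring_cong[OF A.A.ring_axioms]) (use assms in auto)
  then show ?thesis
    using assms
    by (intro assoc_algebraI)
       (auto simp: A.K.field_axioms A.smult_l_distr A.smult_r_distr A.smult_assoc1
          A.smult_mult_left A.smult_mult_right)
qed

locale free_alg = K?: field K for K (structure) +
  fixes G :: "'g set"
begin

sublocale W: twisted_monoid K "(@)" "[]" "\<lambda>_ _. \<one>" "lists G"
  by unfold_locales auto

text \<open>Factorisations of \<open>w\<close> into two words correspond to cut positions; those
  outside the supports contribute zero.\<close>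

lemma free_mult:
  assumes f: "f \<in> carrier W.T" and g: "g \<in> carrier W.T"
  shows "f \<otimes>\<^bsub>free_algebra K G\<^esub> g = f \<otimes>\<^bsub>W.T\<^esub> g"
proof
  fix w :: "'g list"
  note [simp] = W.carrier_TD[OF f] W.carrier_TD[OF g]
  let ?h = "\<lambda>p. f (fst p) \<otimes> g (snd p)"
  let ?P = "(\<lambda>i. (take i w, drop i w)) ` {..length w}"
  let ?S = "{p. f (fst p) \<noteq> \<zero> \<and> g (snd p) \<noteq> \<zero> \<and> fst p @ snd p = w}"
  have P: "p \<in> ?P" if "fst p @ snd p = w" for p
    using that by (intro image_eqI[of _ _ "length (fst p)"]) auto
  have inj: "inj_on (\<lambda>i. (take i w, drop i w)) {..length w}"
    by (rule inj_onI) (metis Pair_inject atMost_iff length_take min.absorb2)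
  have "(f \<otimes>\<^bsub>free_algebra K G\<^esub> g) w = (\<Oplus>i\<in>{..length w}. ?h (take i w, drop i w))"
    by (simp add: free_algebra_def)
  also have "\<dots> = (\<Oplus>p\<in>?P. ?h p)"
    by (rule finsum_reindex[OF _ inj, symmetric]) auto
  also have "\<dots> = (\<Oplus>p\<in>?S. ?h p)"
  proof (rule add.finprod_mono_neutral_cong_right)
    show "?S \<subseteq> ?P" using P by blast
    show "?h p = \<zero>" if "p \<in> ?P - ?S" for p
    proof -
      have "f (fst p) = \<zero> \<or> g (snd p) = \<zero>"
        using that by auto
      then show ?thesis by auto
    qed
  qed auto
  also have "\<dots> = (f \<otimes>\<^bsub>W.T\<^esub> g) w"
    unfolding W.T_def twisted_algebra_def monoid.simps by simp
  finally show "(f \<otimes>\<^bsub>free_algebra K G\<^esub> g) w = (f \<otimes>\<^bsub>W.T\<^esub> g) w" .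
qed

lemma free_simps: "carrier (free_algebra K G) = carrier W.T" "\<one>\<^bsub>free_algebra K G\<^esub> = \<one>\<^bsub>W.T\<^esub>"
  "\<zero>\<^bsub>free_algebra K G\<^esub> = \<zero>\<^bsub>W.T\<^esub>" "x \<oplus>\<^bsub>free_algebra K G\<^esub> y = x \<oplus>\<^bsub>W.T\<^esub> y"
  "c \<odot>\<^bsub>free_algebra K G\<^esub> x = c \<odot>\<^bsub>W.T\<^esub> x"
  unfolding free_algebra_def W.T_def twisted_algebra_def
  by (simp_all only: partial_object.simps monoid.simps ring.simps module.simps)

lemma free_assoc_algebra: "assoc_algebra K (free_algebra K G)"
  by (rule assoc_algebra_cong[OF W.T_algebra]) (auto simp: free_simps free_mult)

lemma free_gen_in: "g \<in> G \<Longrightarrow> free_gen K g \<in> carrier (free_algebra K G)"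
  using W.delta_closed[of "[g]"] by (simp add: free_simps free_gen_def W.delta_def)

lemma free_hom:
  assumes B: "assoc_algebra K B" and x: "\<And>g. g \<in> G \<Longrightarrow> x g \<in> carrier B"
  shows "\<exists>\<phi>\<in>algebra_hom K (free_algebra K G) B. \<forall>g\<in>G. \<phi> (free_gen K g) = x g"
proof -
  interpret B: assoc_algebra K B by fact
  define p where "p w = foldr (\<lambda>g y. x g \<otimes>\<^bsub>B\<^esub> y) w \<one>\<^bsub>B\<^esub>" for w
  have p_in: "p w \<in> carrier B" if "w \<in> lists G" for w
    using that by induction (auto simp: p_def x)
  have "p v \<otimes>\<^bsub>B\<^esub> p w = p (v @ w)" if "v \<in> lists G" "w \<in> lists G" for v w
    using that
  proof (induction v)
    case Nil
    then show ?case using p_in[of w] by (simp add: p_def)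
  next
    case (Cons g v)
    have "p (g # v) \<otimes>\<^bsub>B\<^esub> p w = x g \<otimes>\<^bsub>B\<^esub> (p v \<otimes>\<^bsub>B\<^esub> p w)"
      using Cons p_in[of v] p_in[of w] x by (simp add: p_def B.A.m_assoc)
    also have "\<dots> = p ((g # v) @ w)"
      using Cons by (simp add: p_def)
    finally show ?case .
  qed
  then obtain \<phi> where \<phi>: "\<phi> \<in> algebra_hom K W.T B" "\<And>w. w \<in> lists G \<Longrightarrow> \<phi> (W.delta w) = p w"
    using W.T_hom[OF B, of p] p_in by (metis B.smult_one append_in_lists_conv foldr_Nil id_apply p_def)
  have "\<phi> \<in> algebra_hom K (free_algebra K G) B"
    using algebra_homD[OF \<phi>(1)] by (intro algebra_homI) (auto simp: free_simps free_mult)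
  moreover have "\<phi> (free_gen K g) = x g" if "g \<in> G" for g
    using \<phi>(2)[of "[g]"] that x by (simp add: p_def W.delta_def free_gen_def)
  ultimately show ?thesis
    by blast
qed

end

context assoc_algebra
begin

lemma kernel_ideal:
  assumes B: "assoc_algebra K B" and \<phi>: "\<phi> \<in> algebra_hom K A B"
  shows "ideal {a \<in> carrier A. \<phi> a = \<zero>\<^bsub>B\<^esub>} A"
proof -
  interpret B: assoc_algebra K B by fact
  interpret \<phi>: algebra_morphism K A B \<phi>
    by (intro algebra_morphism.intro algebra_morphism_axioms.intro assoc_algebra_axioms B \<phi>)
  show ?thesis
  proof (rule idealI)
    show "subgroup {a \<in> carrier A. \<phi> a = \<zero>\<^bsub>B\<^esub>} (add_monoid A)"
    proof (rule M.add.subgroupI)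
      show "{a \<in> carrier A. \<phi> a = \<zero>\<^bsub>B\<^esub>} \<noteq> {}"
        using \<phi>.hom_zero by auto
      show "\<ominus>\<^bsub>A\<^esub> a \<in> {a \<in> carrier A. \<phi> a = \<zero>\<^bsub>B\<^esub>}"
        if "a \<in> {a \<in> carrier A. \<phi> a = \<zero>\<^bsub>B\<^esub>}" for a
        using that \<phi>.hom_uminus[of a] by auto
    qed (auto simp: \<phi>.hom_simps)
  qed (auto simp: \<phi>.hom_simps A.ring_axioms)
qed

context
  fixes R assumes R: "R \<subseteq> carrier A \<times> carrier A"
begin

abbreviation "I \<equiv> relation_ideal A R"
abbreviation "Q \<equiv> quotient_algebra A I"

lemma relation_ideal: "ideal I A"
  unfolding relation_ideal_def using R by (intro A.genideal_ideal) auto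

interpretation I: ideal I A
  by (rule relation_ideal)

lemma ideal_smult:
  assumes "c \<in> carrier K" "x \<in> I"
  shows "c \<odot>\<^bsub>A\<^esub> x \<in> I"
proof -
  have x: "x \<in> carrier A"
    using assms I.a_subset by blast
  have "(c \<odot>\<^bsub>A\<^esub> \<one>\<^bsub>A\<^esub>) \<otimes>\<^bsub>A\<^esub> x \<in> I"
    using assms by (intro I.I_l_closed) auto
  then show ?thesis
    using assms x by (simp add: smult_mult_left)
qed

lemma quotient_smult:
  assumes "c \<in> carrier K" "a \<in> carrier A"
  shows "c \<odot>\<^bsub>Q\<^esub> (I +>\<^bsub>A\<^esub> a) = I +>\<^bsub>A\<^esub> (c \<odot>\<^bsub>A\<^esub> a)"
proof -
  have "I +>\<^bsub>A\<^esub> (c \<odot>\<^bsub>A\<^esub> x) = I +>\<^bsub>A\<^esub> (c \<odot>\<^bsub>A\<^esub> a)" if "x \<in> I +>\<^bsub>A\<^esub> a" for x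
  proof -
    obtain i where i: "i \<in> I" "x = i \<oplus>\<^bsub>A\<^esub> a" "i \<in> carrier A"
      using \<open>x \<in> I +>\<^bsub>A\<^esub> a\<close> I.a_subset by (auto simp: a_r_coset_def')
    have "c \<odot>\<^bsub>A\<^esub> x \<in> I +>\<^bsub>A\<^esub> (c \<odot>\<^bsub>A\<^esub> a)"
      using i assms ideal_smult[OF assms(1) i(1)] by (auto simp: a_r_coset_def' smult_r_distr)
    then show ?thesis
      using assms I.a_repr_independence'[symmetric] by simp
  qed
  moreover have "a \<in> I +>\<^bsub>A\<^esub> a"
    using assms I.a_rcos_self by blast
  ultimately have "(\<Union>x\<in>I +>\<^bsub>A\<^esub> a. I +>\<^bsub>A\<^esub> (c \<odot>\<^bsub>A\<^esub> x)) = I +>\<^bsub>A\<^esub> (c \<odot>\<^bsub>A\<^esub> a)"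
    by blast
  then show ?thesis
    by (simp only: quotient_algebra_def ring.extend_def module.fields_def module.simps)
qed

lemma quotient_simps: "carrier Q = carrier (A Quot I)" "\<one>\<^bsub>Q\<^esub> = \<one>\<^bsub>A Quot I\<^esub>" "\<zero>\<^bsub>Q\<^esub> = \<zero>\<^bsub>A Quot I\<^esub>"
  "x \<oplus>\<^bsub>Q\<^esub> y = x \<oplus>\<^bsub>A Quot I\<^esub> y" "x \<otimes>\<^bsub>Q\<^esub> y = x \<otimes>\<^bsub>A Quot I\<^esub> y"
  by (simp_all add: quotient_algebra_def ring.extend_def module.fields_def)

lemma quotient_carrier: "carrier Q = (\<lambda>a. I +>\<^bsub>A\<^esub> a) ` carrier A"
  by (auto simp: quotient_simps FactRing_def A_RCOSETS_def')

lemma quotient_proj: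
  "x \<in> carrier A \<Longrightarrow> I +>\<^bsub>A\<^esub> x \<in> carrier Q"
  "x \<in> carrier A \<Longrightarrow> y \<in> carrier A \<Longrightarrow> I +>\<^bsub>A\<^esub> (x \<otimes>\<^bsub>A\<^esub> y) = (I +>\<^bsub>A\<^esub> x) \<otimes>\<^bsub>Q\<^esub> (I +>\<^bsub>A\<^esub> y)"
  "x \<in> carrier A \<Longrightarrow> y \<in> carrier A \<Longrightarrow> I +>\<^bsub>A\<^esub> (x \<oplus>\<^bsub>A\<^esub> y) = (I +>\<^bsub>A\<^esub> x) \<oplus>\<^bsub>Q\<^esub> (I +>\<^bsub>A\<^esub> y)"
  "I +>\<^bsub>A\<^esub> \<one>\<^bsub>A\<^esub> = \<one>\<^bsub>Q\<^esub>"
  using I.rcos_ring_hom by (auto simp: quotient_simps ring_hom_def)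

lemma quotient_assoc_algebra: "assoc_algebra K Q"
proof (rule assoc_algebraI)
  show "ring Q"
    by (rule ring_cong[OF I.quotient_is_ring]) (auto simp: quotient_simps)
qed (auto simp: K.field_axioms quotient_carrier quotient_smult smult_l_distr smult_r_distr smult_assoc1
       smult_mult_left smult_mult_right simp flip: quotient_proj(2,3) intro!: imageI)

lemma quotient_proj_hom: "(\<lambda>a. I +>\<^bsub>A\<^esub> a) \<in> algebra_hom K A Q"
  by (rule algebra_homI) (auto simp: quotient_proj quotient_smult)

lemma quotient_relation:
  assumes "(u, v) \<in> R"
  shows "I +>\<^bsub>A\<^esub> u = I +>\<^bsub>A\<^esub> v"
proof -
  have uv: "u \<in> carrier A" "v \<in> carrier A"
    using assms R by auto
  have "u \<ominus>\<^bsub>A\<^esub> v \<in> I"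
    unfolding relation_ideal_def by (rule subsetD[OF A.genideal_self]) (use assms R in auto)
  moreover have "u = (u \<ominus>\<^bsub>A\<^esub> v) \<oplus>\<^bsub>A\<^esub> v"
    using uv by (simp add: a_minus_def M.a_assoc M.l_neg)
  ultimately have "u \<in> I +>\<^bsub>A\<^esub> v"
    by (auto simp: a_r_coset_def')
  then show ?thesis
    using uv I.a_repr_independence'[symmetric] by simp
qed

lemma quotient_hom:
  assumes B: "assoc_algebra K B" and \<phi>: "\<phi> \<in> algebra_hom K A B"
    and rel: "\<And>u v. (u, v) \<in> R \<Longrightarrow> \<phi> u = \<phi> v"
  shows "\<exists>\<psi>\<in>algebra_hom K Q B. \<forall>a\<in>carrier A. \<psi> (I +>\<^bsub>A\<^esub> a) = \<phi> a"
proof -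
  interpret B: assoc_algebra K B by fact
  interpret \<phi>: algebra_morphism K A B \<phi>
    by (intro algebra_morphism.intro algebra_morphism_axioms.intro assoc_algebra_axioms B \<phi>)
  have "u \<ominus>\<^bsub>A\<^esub> v \<in> {a \<in> carrier A. \<phi> a = \<zero>\<^bsub>B\<^esub>}" if "(u, v) \<in> R" for u v
  proof -
    have uv: "u \<in> carrier A" "v \<in> carrier A"
      using that R by auto
    then have "\<phi> (u \<ominus>\<^bsub>A\<^esub> v) = \<phi> v \<ominus>\<^bsub>B\<^esub> \<phi> v"
      using rel[OF that] by (simp add: \<phi>.hom_minus)
    then show ?thesis
      using uv by (simp add: a_minus_def B.M.r_neg \<phi>.hom_simps)
  qed
  then have "{u \<ominus>\<^bsub>A\<^esub> v | u v. (u, v) \<in> R} \<subseteq> {a \<in> carrier A. \<phi> a = \<zero>\<^bsub>B\<^esub>}"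
    by blast
  then have "I \<subseteq> {a \<in> carrier A. \<phi> a = \<zero>\<^bsub>B\<^esub>}"
    unfolding relation_ideal_def by (rule A.genideal_minimal[OF kernel_ideal[OF B \<phi>]])
  then have ker: "\<phi> i = \<zero>\<^bsub>B\<^esub>" if "i \<in> I" for i
    using that by blast
  define \<psi> where "\<psi> X = the_elem (\<phi> ` X)" for X
  have \<psi>: "\<psi> (I +>\<^bsub>A\<^esub> a) = \<phi> a" if a: "a \<in> carrier A" for a
  proof -
    have "\<phi> x = \<phi> a" if "x \<in> I +>\<^bsub>A\<^esub> a" for x
      using that a ker I.a_subset \<phi>.hom_simps by (force simp: a_r_coset_def')
    then have "\<phi> ` (I +>\<^bsub>A\<^esub> a) = {\<phi> a}"
      using I.a_rcos_self[OF a] by blast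
    then show ?thesis by (simp add: \<psi>_def)
  qed
  have "\<psi> \<in> algebra_hom K Q B"
  proof (rule algebra_homI)
    show "\<psi> \<one>\<^bsub>Q\<^esub> = \<one>\<^bsub>B\<^esub>"
      using \<psi>[of "\<one>\<^bsub>A\<^esub>"] by (simp add: quotient_proj \<phi>.hom_simps)
  qed (auto simp: quotient_carrier quotient_smult \<psi> \<phi>.hom_simps simp flip: quotient_proj(2,3))
  then show ?thesis
    using \<psi> by blast
qed

end
end

section \<open>Quantum matrices\<close>

text \<open>A predicate on an arbitrary algebra, to be checked for the generators as well as for the
  elements \<open>X\<close> of the torus. The mixed relation is solved for one product, so that no
  subtraction takes place in \<open>B\<close>.\<close>

definition quantum_matrix_relations ::
  "('k, 'm) ring_scheme \<Rightarrow> 'k \<Rightarrow> nat \<Rightarrow> nat \<Rightarrow> ('k, 'b, 'n) module_scheme \<Rightarrow> (nat \<Rightarrow> nat \<Rightarrow> 'b) \<Rightarrow> bool"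
where
  "quantum_matrix_relations K q t s B X \<longleftrightarrow>
     (\<forall>j\<in>{1..t}. X 1 j \<in> carrier B) \<and> (\<forall>j\<in>{1..s}. X 2 j \<in> carrier B) \<and>
     (\<forall>j\<in>{1..s}. X 1 j \<otimes>\<^bsub>B\<^esub> X 2 j = q \<odot>\<^bsub>B\<^esub> (X 2 j \<otimes>\<^bsub>B\<^esub> X 1 j)) \<and>
     (\<forall>j l. 1 \<le> j \<longrightarrow> j < l \<longrightarrow> l \<le> t \<longrightarrow> X 1 j \<otimes>\<^bsub>B\<^esub> X 1 l = q \<odot>\<^bsub>B\<^esub> (X 1 l \<otimes>\<^bsub>B\<^esub> X 1 j)) \<and>
     (\<forall>j l. 1 \<le> j \<longrightarrow> j < l \<longrightarrow> l \<le> t \<longrightarrow> j \<le> s \<longrightarrow> X 1 l \<otimes>\<^bsub>B\<^esub> X 2 j = X 2 j \<otimes>\<^bsub>B\<^esub> X 1 l) \<and>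
     (\<forall>j l. 1 \<le> j \<longrightarrow> j < l \<longrightarrow> l \<le> s \<longrightarrow> X 2 j \<otimes>\<^bsub>B\<^esub> X 2 l = q \<odot>\<^bsub>B\<^esub> (X 2 l \<otimes>\<^bsub>B\<^esub> X 2 j)) \<and>
     (\<forall>j l. 1 \<le> j \<longrightarrow> j < l \<longrightarrow> l \<le> s \<longrightarrow>
        X 1 j \<otimes>\<^bsub>B\<^esub> X 2 l = X 2 l \<otimes>\<^bsub>B\<^esub> X 1 j \<oplus>\<^bsub>B\<^esub> (q \<ominus>\<^bsub>K\<^esub> inv\<^bsub>K\<^esub> q) \<odot>\<^bsub>B\<^esub> (X 1 l \<otimes>\<^bsub>B\<^esub> X 2 j))"

locale quantum_matrices = K?: field K for K (structure) +
  fixes q :: 'a and m :: nat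
  assumes q_in: "q \<in> carrier K" and q_ne: "q \<noteq> \<zero>"
begin

abbreviation "P \<equiv> qmat_free K m"
abbreviation "M \<equiv> quantum_matrix_algebra K q m"
abbreviation "x i j \<equiv> free_gen K (i, j)"

lemma P_algebra: "assoc_algebra K P"
proof -
  interpret free_alg K "{1..2::nat} \<times> {1..m}" ..
  show ?thesis
    using free_assoc_algebra by (simp add: qmat_free_def)
qed

interpretation P: assoc_algebra K P
  by (rule P_algebra)

lemma gen_in_P: "i \<in> {1..2} \<Longrightarrow> j \<in> {1..m} \<Longrightarrow> x i j \<in> carrier P"
proof -
  interpret free_alg K "{1..2::nat} \<times> {1..m}" ..
  show "i \<in> {1..2} \<Longrightarrow> j \<in> {1..m} \<Longrightarrow> x i j \<in> carrier P"
    using free_gen_in[of "(i, j)"] by (simp add: qmat_free_def)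
qed

lemma inv_q: "inv q \<in> carrier K"
  using q_in q_ne by (simp add: field_Units)

lemma relations_carrier: "qmat_relations K q m \<subseteq> carrier P \<times> carrier P"
  using q_in inv_q by (auto simp: qmat_relations_def Let_def gen_in_P)

lemma M_eq: "M = quotient_algebra P (relation_ideal P (qmat_relations K q m))"
  by (simp add: quantum_matrix_algebra_def qmat_ideal_def)

lemma M_algebra: "assoc_algebra K M"
  unfolding M_eq by (rule P.quotient_assoc_algebra[OF relations_carrier])

interpretation M: assoc_algebra K M
  by (rule M_algebra)

interpretation \<pi>: algebra_morphism K P M "\<lambda>a. relation_ideal P (qmat_relations K q m) +>\<^bsub>P\<^esub> a"
  using P.quotient_proj_hom[OF relations_carrier] M_algebra
  by unfold_locales (simp add: M_eq)

lemma qmat_gen_eq: "qmat_gen K q m i j = relation_ideal P (qmat_relations K q m) +>\<^bsub>P\<^esub> x i j"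
  by (simp add: qmat_gen_def qmat_ideal_def)

lemma qmat_gen_relations: "quantum_matrix_relations K q m m M (qmat_gen K q m)"
proof -
  note rel = P.quotient_relation[OF relations_carrier]
  have g [simp]: "x i j \<in> carrier P" if "i = 1 \<or> i = 2" "1 \<le> j" "j \<le> m" for i j
    using that by (intro gen_in_P) auto
  note [simp] = q_in inv_q
  let ?\<pi> = "\<lambda>a. relation_ideal P (qmat_relations K q m) +>\<^bsub>P\<^esub> a"
  have 1: "?\<pi> (x 1 j \<otimes>\<^bsub>P\<^esub> x 2 j) = ?\<pi> (q \<odot>\<^bsub>P\<^esub> (x 2 j \<otimes>\<^bsub>P\<^esub> x 1 j))" if "1 \<le> j" "j \<le> m" for j
    by (rule rel) (use that in \<open>auto simp: qmat_relations_def Let_def\<close>)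
  have 2: "?\<pi> (x 1 j \<otimes>\<^bsub>P\<^esub> x 1 l) = ?\<pi> (q \<odot>\<^bsub>P\<^esub> (x 1 l \<otimes>\<^bsub>P\<^esub> x 1 j))"
    "?\<pi> (x 1 l \<otimes>\<^bsub>P\<^esub> x 2 j) = ?\<pi> (x 2 j \<otimes>\<^bsub>P\<^esub> x 1 l)"
    "?\<pi> (x 2 j \<otimes>\<^bsub>P\<^esub> x 2 l) = ?\<pi> (q \<odot>\<^bsub>P\<^esub> (x 2 l \<otimes>\<^bsub>P\<^esub> x 2 j))"
    "?\<pi> (x 1 j \<otimes>\<^bsub>P\<^esub> x 2 l \<ominus>\<^bsub>P\<^esub> x 2 l \<otimes>\<^bsub>P\<^esub> x 1 j) = ?\<pi> ((q \<ominus> inv q) \<odot>\<^bsub>P\<^esub> (x 1 l \<otimes>\<^bsub>P\<^esub> x 2 j))"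
    if "1 \<le> j" "j < l" "l \<le> m" for j l
    by (rule rel, unfold qmat_relations_def Let_def, rule UnI2, rule UN_I[of "(j, l)"]; use that in simp)+
  have 3: "?\<pi> (x 1 j) \<otimes>\<^bsub>M\<^esub> ?\<pi> (x 2 l) = ?\<pi> (x 2 l) \<otimes>\<^bsub>M\<^esub> ?\<pi> (x 1 j) \<oplus>\<^bsub>M\<^esub> (q \<ominus> inv q) \<odot>\<^bsub>M\<^esub> (?\<pi> (x 1 l) \<otimes>\<^bsub>M\<^esub> ?\<pi> (x 2 j))"
    if "1 \<le> j" "j < l" "l \<le> m" for j l
  proof -
    have c: "?\<pi> (x 1 j) \<in> carrier M" "?\<pi> (x 2 l) \<in> carrier M"
      using that by (auto intro!: \<pi>.hom_simps(1))
    have "?\<pi> (x 1 j) \<otimes>\<^bsub>M\<^esub> ?\<pi> (x 2 l) \<ominus>\<^bsub>M\<^esub> ?\<pi> (x 2 l) \<otimes>\<^bsub>M\<^esub> ?\<pi> (x 1 j) = (q \<ominus> inv q) \<odot>\<^bsub>M\<^esub> (?\<pi> (x 1 l) \<otimes>\<^bsub>M\<^esub> ?\<pi> (x 2 j))"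
      using 2(4)[OF that] that by (simp add: \<pi>.hom_simps \<pi>.hom_minus)
    then have "?\<pi> (x 2 l) \<otimes>\<^bsub>M\<^esub> ?\<pi> (x 1 j) \<oplus>\<^bsub>M\<^esub> (q \<ominus> inv q) \<odot>\<^bsub>M\<^esub> (?\<pi> (x 1 l) \<otimes>\<^bsub>M\<^esub> ?\<pi> (x 2 j)) =
       ?\<pi> (x 2 l) \<otimes>\<^bsub>M\<^esub> ?\<pi> (x 1 j) \<oplus>\<^bsub>M\<^esub> (?\<pi> (x 1 j) \<otimes>\<^bsub>M\<^esub> ?\<pi> (x 2 l) \<ominus>\<^bsub>M\<^esub> ?\<pi> (x 2 l) \<otimes>\<^bsub>M\<^esub> ?\<pi> (x 1 j))"
      by simp
    also have "\<dots> = ?\<pi> (x 1 j) \<otimes>\<^bsub>M\<^esub> ?\<pi> (x 2 l)"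
      using c M.M.r_neg2[of "?\<pi> (x 2 l) \<otimes>\<^bsub>M\<^esub> ?\<pi> (x 1 j)" "?\<pi> (x 1 j) \<otimes>\<^bsub>M\<^esub> ?\<pi> (x 2 l)"]
      by (simp add: a_minus_def M.M.a_comm)
    finally show ?thesis ..
  qed
  show ?thesis
    unfolding quantum_matrix_relations_def qmat_gen_eq
    using 1 2 3 by (auto simp: \<pi>.hom_simps)
qed

lemma qmat_hom:
  assumes B: "assoc_algebra K B" and X: "quantum_matrix_relations K q m m B X"
  obtains \<psi> where "\<psi> \<in> algebra_hom K M B" "\<And>i j. i = 1 \<or> i = 2 \<Longrightarrow> 1 \<le> j \<Longrightarrow> j \<le> m \<Longrightarrow> \<psi> (qmat_gen K q m i j) = X i j"
proof -
  interpret B: assoc_algebra K B by fact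
  interpret free_alg K "{1..2::nat} \<times> {1..m}" ..
  have X_in: "X i j \<in> carrier B" if "i = 1 \<or> i = 2" "1 \<le> j" "j \<le> m" for i j
    using X that by (auto simp: quantum_matrix_relations_def)
  have X_in': "case_prod X g \<in> carrier B" if "g \<in> {1..2} \<times> {1..m}" for g
  proof -
    have "fst g = 1 \<or> fst g = 2" using that by auto
    then show ?thesis using that X_in[of "fst g" "snd g"] by (auto simp: case_prod_beta)
  qed
  have "\<exists>\<phi>\<in>algebra_hom K P B. \<forall>g\<in>{1..2} \<times> {1..m}. \<phi> (free_gen K g) = case_prod X g"
    unfolding qmat_free_def by (rule free_hom[OF B]) (rule X_in')
  then obtain \<phi> where \<phi>: "\<phi> \<in> algebra_hom K P B" "\<forall>g\<in>{1..2} \<times> {1..m}. \<phi> (free_gen K g) = case_prod X g" ..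
  interpret \<phi>: algebra_morphism K P B \<phi>
    using P_algebra B \<phi>(1) by (simp add: algebra_morphism_def algebra_morphism_axioms_def)
  have \<phi>x: "\<phi> (x i j) = X i j" if "i = 1 \<or> i = 2" "1 \<le> j" "j \<le> m" for i j
    using bspec[OF \<phi>(2), of "(i, j)"] that by auto
  have g [simp]: "x i j \<in> carrier P" if "i = 1 \<or> i = 2" "1 \<le> j" "j \<le> m" for i j
    using that by (intro gen_in_P) auto
  note [simp] = q_in inv_q X_in
  have X3: "a \<oplus>\<^bsub>B\<^esub> b \<ominus>\<^bsub>B\<^esub> a = b" if "a \<in> carrier B" "b \<in> carrier B" for a b
    using that by (simp add: a_minus_def B.M.a_comm[of "a \<oplus>\<^bsub>B\<^esub> b"] B.M.r_neg1)
  have "\<phi> u = \<phi> v" if uv: "(u, v) \<in> qmat_relations K q m" for u v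
    using uv[unfolded qmat_relations_def Let_def]
  proof (elim UnE UN_E)
    fix j assume "j \<in> {1..m}" "(u, v) \<in> {(x 1 j \<otimes>\<^bsub>P\<^esub> x 2 j, q \<odot>\<^bsub>P\<^esub> (x 2 j \<otimes>\<^bsub>P\<^esub> x 1 j))}"
    then show ?thesis
      using X by (simp add: quantum_matrix_relations_def \<phi>.hom_simps \<phi>x)
  next
    fix p assume p: "p \<in> {(j, l). 1 \<le> j \<and> j < l \<and> l \<le> m}" and uv: "(u, v) \<in> (case p of (j, l) \<Rightarrow>
         {(x 1 j \<otimes>\<^bsub>P\<^esub> x 1 l, q \<odot>\<^bsub>P\<^esub> (x 1 l \<otimes>\<^bsub>P\<^esub> x 1 j)),
          (x 1 j \<otimes>\<^bsub>P\<^esub> x 2 j, q \<odot>\<^bsub>P\<^esub> (x 2 j \<otimes>\<^bsub>P\<^esub> x 1 j)),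
          (x 1 l \<otimes>\<^bsub>P\<^esub> x 2 j, x 2 j \<otimes>\<^bsub>P\<^esub> x 1 l),
          (x 1 l \<otimes>\<^bsub>P\<^esub> x 2 l, q \<odot>\<^bsub>P\<^esub> (x 2 l \<otimes>\<^bsub>P\<^esub> x 1 l)),
          (x 2 j \<otimes>\<^bsub>P\<^esub> x 2 l, q \<odot>\<^bsub>P\<^esub> (x 2 l \<otimes>\<^bsub>P\<^esub> x 2 j)),
          (x 1 j \<otimes>\<^bsub>P\<^esub> x 2 l \<ominus>\<^bsub>P\<^esub> x 2 l \<otimes>\<^bsub>P\<^esub> x 1 j, (q \<ominus> inv q) \<odot>\<^bsub>P\<^esub> (x 1 l \<otimes>\<^bsub>P\<^esub> x 2 j))})"
    obtain j l where jl: "p = (j, l)" "1 \<le> j" "j < l" "l \<le> m"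
      using p by auto
    show ?thesis
      using X jl uv by (auto simp: quantum_matrix_relations_def \<phi>.hom_simps \<phi>.hom_minus \<phi>x X3)
  qed
  then have "\<exists>\<psi>\<in>algebra_hom K M B. \<forall>a\<in>carrier P.
      \<psi> (relation_ideal P (qmat_relations K q m) +>\<^bsub>P\<^esub> a) = \<phi> a"
    unfolding M_eq by (rule P.quotient_hom[OF relations_carrier B \<phi>(1)])
  then obtain \<psi> where "\<psi> \<in> algebra_hom K M B"
      "\<forall>a\<in>carrier P. \<psi> (relation_ideal P (qmat_relations K q m) +>\<^bsub>P\<^esub> a) = \<phi> a" ..
  then show ?thesis
    using that[of \<psi>] \<phi>x g by (simp add: qmat_gen_eq)
qed

end

section \<open>Quantum tori and the quantum minors inside them\<close>

section \<open>Quantum tori\<close>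

context Group.monoid
begin

text \<open>Integer powers of units obey the usual laws because they can be computed in the group
  \<open>units_of G\<close>.\<close>

lemma units_nat_pow: "x [^]\<^bsub>units_of G\<^esub> (n::nat) = x [^]\<^bsub>G\<^esub> n"
  by (induction n) (simp_all add: units_of_mult units_of_one)

lemma units_int_pow:
  assumes "x \<in> Units G"
  shows "x [^]\<^bsub>units_of G\<^esub> (z::int) = x [^]\<^bsub>G\<^esub> z"
  unfolding int_pow_def2 units_nat_pow units_of_inv[OF Units_pow_closed[OF assms]] ..

lemma unit_int_pow_closed:
  assumes "x \<in> Units G"
  shows "x [^] (z::int) \<in> Units G"
  using group.int_pow_closed[OF units_group, of x z] assms unfolding units_int_pow[OF assms] units_of_carrier
  by simp

lemma unit_int_pow_add:
  assumes "x \<in> Units G"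
  shows "x [^] (a + b :: int) = x [^] a \<otimes> x [^] b"
  using group.int_pow_mult[OF units_group, of x a b] assms
  unfolding units_int_pow[OF assms] units_of_carrier units_of_mult by simp

lemma unit_int_pow_one:
  assumes "x \<in> Units G"
  shows "x [^] (1::int) = x"
  using assms Units_closed[OF assms] by (simp add: int_pow_def2)

lemma unit_int_pow_pow:
  assumes "x \<in> Units G"
  shows "(x [^] (a::int)) [^] (b::int) = x [^] (a * b)"
  using group.int_pow_pow[OF units_group, of x a b] assms
  unfolding units_int_pow[OF assms] units_int_pow[OF unit_int_pow_closed[OF assms]] units_of_carrier
  by simp

lemma unit_int_pow_neg:
  assumes "x \<in> Units G"
  shows "x [^] (- a :: int) = inv (x [^] a)"
  using group.int_pow_neg[OF units_group, of x a] assms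
  unfolding units_int_pow[OF assms] units_of_carrier units_of_inv[OF unit_int_pow_closed[OF assms]]
  by simp

end

locale scalar_root = K?: field K for K (structure) +
  fixes h :: 'a
  assumes h_in: "h \<in> carrier K" and h_ne: "h \<noteq> \<zero>"
begin

text \<open>Half-integral powers of \<open>q\<close> become integral powers of its root:
  \<open>pw z\<close> is \<open>q\<close> to the power \<open>z / 2\<close>, and a factor
  \<open>q\<close> reads \<open>pw 2\<close>.\<close>

definition pw :: "int \<Rightarrow> 'a" where "pw z = h [^] z"

lemma h_unit: "h \<in> Units K"
  using h_in h_ne by (simp add: field_Units)

lemma pw_in [simp]: "pw z \<in> carrier K"
  using unit_int_pow_closed[OF h_unit] by (auto simp: pw_def)

lemma pw_ne [simp]: "pw z \<noteq> \<zero>"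
  using unit_int_pow_closed[OF h_unit, of z] by (simp add: pw_def field_Units)

lemma pw_add: "pw a \<otimes> pw b = pw (a + b)"
  by (simp add: pw_def unit_int_pow_add[OF h_unit])

lemma pw_0 [simp]: "pw 0 = \<one>"
  by (simp add: pw_def)

lemma pw_1: "pw 1 = h"
  by (simp add: pw_def unit_int_pow_one[OF h_unit])

lemma pw_inv: "inv (pw z) = pw (- z)"
  by (simp add: pw_def unit_int_pow_neg[OF h_unit])

lemma pw_pow: "(pw a) [^] (z::int) = pw (a * z)"
  by (simp add: pw_def unit_int_pow_pow[OF h_unit])

lemma pw_smult:
  assumes "assoc_algebra K B" "x \<in> carrier B"
  shows "pw a \<odot>\<^bsub>B\<^esub> (pw b \<odot>\<^bsub>B\<^esub> x) = pw (a + b) \<odot>\<^bsub>B\<^esub> x"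
proof -
  interpret B: assoc_algebra K B by fact
  show ?thesis
    using assms by (simp add: B.smult_assoc1 flip: pw_add)
qed

end

text \<open>A biadditive form yields a cocycle, and the linear order on the exponents provides
  leading terms.\<close>

locale quantum_torus = scalar_root K h for K (structure) and h +
  fixes \<Lambda> :: "'g :: linordered_ab_group_add \<Rightarrow> 'g \<Rightarrow> int" and H :: "'g set"
  assumes \<Lambda>_add: "\<Lambda> (a + b) c = \<Lambda> a c + \<Lambda> b c" "\<Lambda> c (a + b) = \<Lambda> c a + \<Lambda> c b"
    and H0: "0 \<in> H" and H_add: "a \<in> H \<Longrightarrow> b \<in> H \<Longrightarrow> a + b \<in> H"
begin

lemma \<Lambda>_zero: "\<Lambda> 0 c = 0" "\<Lambda> c 0 = 0"
  using \<Lambda>_add(1)[of 0 0 c] \<Lambda>_add(2)[of c 0 0] by auto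

sublocale twisted_monoid K "(+)" 0 "\<lambda>a b. pw (\<Lambda> a b)" H
  by unfold_locales (auto simp: H0 H_add add.assoc \<Lambda>_zero \<Lambda>_add pw_add algebra_simps)

lemma mon_mult: "a \<in> H \<Longrightarrow> b \<in> H \<Longrightarrow> delta a \<otimes>\<^bsub>T\<^esub> delta b = pw (\<Lambda> a b) \<odot>\<^bsub>T\<^esub> delta (a + b)"
  by (rule delta_mult)

definition lead :: "('g \<Rightarrow> 'a) \<Rightarrow> 'g" where "lead f = Max (supp f)"

lemma supp_nonempty:
  assumes "f \<in> carrier T" "f \<noteq> \<zero>\<^bsub>T\<^esub>"
  shows "finite (supp f)" "supp f \<noteq> {}"
proof -
  show "finite (supp f)"
    using assms by (simp add: carrier_T)
  show "supp f \<noteq> {}"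
  proof
    assume "supp f = {}"
    then have "f = (\<lambda>w. \<zero>)"
      by (auto simp: supp_def)
    then show False
      using assms by (simp add: T_ops)
  qed
qed

lemma lead_in:
  assumes "f \<in> carrier T" "f \<noteq> \<zero>\<^bsub>T\<^esub>"
  shows "lead f \<in> supp f" "f (lead f) \<noteq> \<zero>" "lead f \<in> H"
proof -
  show 1: "lead f \<in> supp f"
    using supp_nonempty[OF assms] by (simp add: lead_def)
  then show "f (lead f) \<noteq> \<zero>" "lead f \<in> H"
    using assms by (auto simp: supp_def carrier_T)
qed

lemma lead_ge: "f \<in> carrier T \<Longrightarrow> w \<in> supp f \<Longrightarrow> w \<le> lead f"
  by (simp add: lead_def carrier_T)

lemma leadI:
  assumes "f \<in> carrier T" "f w \<noteq> \<zero>" "\<And>w'. w < w' \<Longrightarrow> f w' = \<zero>"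
  shows "lead f = w"
  unfolding lead_def using assms
  by (intro Max_eqI) (auto simp: carrier_T supp_def not_less intro: leI)

text \<open>Every pair of support elements other than the two leading ones has a strictly smaller
  sum, so nothing can cancel at \<open>lead f + lead g\<close>; the coefficient there is a product
  of nonzero scalars.\<close>

lemma lead_mult:
  assumes f: "f \<in> carrier T" "f \<noteq> \<zero>\<^bsub>T\<^esub>" and g: "g \<in> carrier T" "g \<noteq> \<zero>\<^bsub>T\<^esub>"
  shows "f \<otimes>\<^bsub>T\<^esub> g \<noteq> \<zero>\<^bsub>T\<^esub>" "lead (f \<otimes>\<^bsub>T\<^esub> g) = lead f + lead g"
proof -
  let ?a = "lead f" and ?b = "lead g"
  let ?t = "\<lambda>w p. if fst p + snd p = w then pw (\<Lambda> (fst p) (snd p)) \<otimes> (f (fst p) \<otimes> g (snd p)) else \<zero>"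
  have fin: "finite (supp f)" "finite (supp g)"
    using supp_nonempty f g by auto
  note [simp] = carrier_TD[OF f(1)] carrier_TD[OF g(1)]
  have prod: "(f \<otimes>\<^bsub>T\<^esub> g) w = (\<Oplus>p\<in>supp f \<times> supp g. ?t w p)" for w
    by (rule mult_T[OF f(1) g(1) fin subset_refl subset_refl])
  have le: "fst p \<le> ?a" "snd p \<le> ?b" if "p \<in> supp f \<times> supp g" for p
    using that lead_ge f g by auto
  have zero: "(f \<otimes>\<^bsub>T\<^esub> g) w = \<zero>" if "?a + ?b < w" for w
    unfolding prod
  proof (rule K.add.finprod_one_eqI)
    fix p assume p: "p \<in> supp f \<times> supp g"
    then show "?t w p = \<zero>"
      using le[OF p] that add_mono[OF le[OF p]] by auto
  qed
  have "(f \<otimes>\<^bsub>T\<^esub> g) (?a + ?b) = (\<Oplus>p\<in>{(?a, ?b)}. ?t (?a + ?b) p)"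
    unfolding prod
  proof (rule K.add.finprod_mono_neutral_cong_right)
    show "{(?a, ?b)} \<subseteq> supp f \<times> supp g"
      using lead_in f g by auto
    fix p assume p: "p \<in> supp f \<times> supp g - {(?a, ?b)}"
    then have l: "fst p \<le> ?a" "snd p \<le> ?b" "fst p \<noteq> ?a \<or> snd p \<noteq> ?b"
      using le[of p] by (auto simp: prod_eq_iff)
    then have "fst p + snd p < ?a + ?b"
      by (metis add_le_less_mono add_less_le_mono order.not_eq_order_implies_strict)
    then show "?t (?a + ?b) p = \<zero>"
      by auto
  qed (use fin in auto)
  also have "\<dots> = pw (\<Lambda> ?a ?b) \<otimes> (f ?a \<otimes> g ?b)"
    by (simp add: K.finsum_insert)
  finally have ne: "(f \<otimes>\<^bsub>T\<^esub> g) (?a + ?b) \<noteq> \<zero>"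
    using lead_in(2) f g by (simp add: K.integral_iff)
  then show "f \<otimes>\<^bsub>T\<^esub> g \<noteq> \<zero>\<^bsub>T\<^esub>"
    by (auto simp: T_ops)
  show "lead (f \<otimes>\<^bsub>T\<^esub> g) = lead f + lead g"
    using leadI[OF T_mult_closed[OF f(1) g(1)] ne zero] .
qed

lemma T_domain: "domain_algebra K T"
proof (intro domain_algebra.intro domain_algebra_axioms.intro T_algebra)
  show "\<one>\<^bsub>T\<^esub> \<noteq> \<zero>\<^bsub>T\<^esub>"
    by (auto simp: T_ops delta_def fun_eq_iff)
qed (use lead_mult(1) in blast)

lemma delta_ne: "delta a \<noteq> \<zero>\<^bsub>T\<^esub>"
  by (auto simp: T_ops delta_def fun_eq_iff)

lemma lead_delta: "a \<in> H \<Longrightarrow> lead (delta a) = a"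
  by (rule leadI[OF delta_closed]) (auto simp: delta_def)

lemma lead_smult:
  assumes "c \<in> carrier K" "c \<noteq> \<zero>" "f \<in> carrier T"
  shows "lead (c \<odot>\<^bsub>T\<^esub> f) = lead f"
proof -
  have "supp (c \<odot>\<^bsub>T\<^esub> f) = supp f"
    using assms by (auto simp: supp_def T_ops K.integral_iff)
  then show ?thesis by (simp add: lead_def)
qed

end

section \<open>The exponent lattice of the quantum matrix torus\<close>

text \<open>
  \<open>E j\<close> is the exponent of \<open>X\<^bsub>1j\<^esub>\<close> and \<open>Y l\<close> that of the leading term of \<open>X\<^bsub>2l\<^esub>\<close>. The negative keys
  make the lexicographic order on exponents compare the second row, from the last column on, first.
  The convention \<open>E 0 = 0\<close> adds a column \<open>0\<close> whose first entry is \<open>1\<close>.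
\<close>

definition E :: "nat \<Rightarrow> (int \<Rightarrow>\<^sub>0 int)" where
  "E j = (if j = 0 then 0 else Poly_Mapping.single (int j) 1)"

definition Y :: "nat \<Rightarrow> (int \<Rightarrow>\<^sub>0 int)" where
  "Y l = Poly_Mapping.single (- int l) 1"

text \<open>\<open>M (U l)\<close> is the increment of the ratio of second to first row from column
  \<open>l - 1\<close> to \<open>l\<close>: the minor of these columns has exponent
  \<open>E (l - 1) + Y l\<close>, and dividing by both first-row entries leaves
  \<open>Y l - E l\<close>.\<close>

definition U :: "nat \<Rightarrow> (int \<Rightarrow>\<^sub>0 int)" where
  "U l = Y l - E l"

text \<open>The power of \<open>q\<close> with which the leading terms of two matrix entries
  quasi-commute; positive keys are columns of the first row, negative keys columns of the second.
  Entries in different rows and columns get \<open>0\<close>, since the correction in their relation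
  is absent or has a lower leading term.\<close>

definition form :: "int \<Rightarrow> int \<Rightarrow> int" where
  "form i j = (if 0 < i \<and> 0 < j then sgn (j - i) else if i < 0 \<and> j < 0 then sgn (i - j)
     else if 0 < i \<and> i = - j then 1 else if i < 0 \<and> i = - j then - 1 else 0)"

text \<open>The biadditive extension of \<open>form\<close>; cutting the keys off at
  \<open>m\<close> gives the double sum a fixed finite range.\<close>

definition Lam :: "nat \<Rightarrow> (int \<Rightarrow>\<^sub>0 int) \<Rightarrow> (int \<Rightarrow>\<^sub>0 int) \<Rightarrow> int" where
  "Lam m a b = (\<Sum>i\<in>{- int m..int m}. \<Sum>j\<in>{- int m..int m}.
     Poly_Mapping.lookup a i * Poly_Mapping.lookup b j * form i j)"

lemma Lam_add: "Lam m (a + b) c = Lam m a c + Lam m b c" "Lam m c (a + b) = Lam m c a + Lam m c b"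
  by (simp_all add: Lam_def lookup_add algebra_simps sum.distrib)

lemma Lam_uminus: "Lam m (- a) c = - Lam m a c" "Lam m c (- a) = - Lam m c a"
  by (simp_all add: Lam_def sum_negf)

lemma Lam_diff: "Lam m (a - b) c = Lam m a c - Lam m b c" "Lam m c (a - b) = Lam m c a - Lam m c b"
  by (simp_all add: Lam_def lookup_minus algebra_simps sum_subtractf)

lemma Lam_zero: "Lam m 0 c = 0" "Lam m c 0 = 0"
  by (simp_all add: Lam_def)

lemma form_skew: "form i j = - form j i"
  by (auto simp: form_def sgn_if)

lemma Lam_skew: "Lam m a b = - Lam m b a"
proof -
  have "Lam m a b = (\<Sum>j\<in>{- int m..int m}. \<Sum>i\<in>{- int m..int m}.
     Poly_Mapping.lookup a i * Poly_Mapping.lookup b j * form i j)"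
    unfolding Lam_def by (rule sum.swap)
  also have "\<dots> = - Lam m b a"
    unfolding Lam_def sum_negf[symmetric]
    by (intro sum.cong refl) (subst form_skew, simp)
  finally show ?thesis .
qed

lemma Lam_self: "Lam m a a = 0"
  using Lam_skew[of m a a] by simp

lemma Lam_single:
  assumes "\<bar>i\<bar> \<le> int m" "\<bar>j\<bar> \<le> int m"
  shows "Lam m (Poly_Mapping.single i 1) (Poly_Mapping.single j 1) = form i j"
proof -
  have "Lam m (Poly_Mapping.single i 1) (Poly_Mapping.single j 1) =
    (\<Sum>i'\<in>{- int m..int m}. \<Sum>j'\<in>{- int m..int m}. if j' = j then if i' = i then form i j else 0 else 0)"
    unfolding Lam_def by (intro sum.cong refl) (auto simp: lookup_single when_def)
  also have "\<dots> = (\<Sum>i'\<in>{- int m..int m}. if i' = i then form i j else 0)"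
    using assms by (intro sum.cong refl) (simp add: abs_le_iff)
  also have "\<dots> = form i j"
    using assms by (simp add: abs_le_iff)
  finally show ?thesis .
qed

lemma Lam_EE: "j \<le> m \<Longrightarrow> k \<le> m \<Longrightarrow> Lam m (E j) (E k) = (if j = 0 \<or> k = 0 then 0 else sgn (int k - int j))"
  by (auto simp: E_def Lam_zero Lam_single form_def)

lemma Lam_EY: "j \<le> m \<Longrightarrow> k \<le> m \<Longrightarrow> 0 < k \<Longrightarrow> Lam m (E j) (Y k) = (if j = k then 1 else 0)"
  by (auto simp: E_def Y_def Lam_zero Lam_single form_def)

lemma Lam_YY: "j \<le> m \<Longrightarrow> k \<le> m \<Longrightarrow> 0 < j \<Longrightarrow> 0 < k \<Longrightarrow> Lam m (Y j) (Y k) = sgn (int k - int j)"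
  by (auto simp: Y_def Lam_single form_def)

text \<open>Only the side of column \<open>k\<close> on which \<open>j\<close> lies matters. Hence a
  monomial in first-row entries quasi-commutes uniformly with all \<open>U k\<close> of a range of
  columns, as long as none of its own columns cuts that range in two.\<close>

lemma Lam_EU: "j \<le> m \<Longrightarrow> k \<le> m \<Longrightarrow> 0 < k \<Longrightarrow>
    Lam m (E j) (U k) = (if j = 0 then 0 else if k \<le> j then 1 else - 1)"
  by (auto simp: U_def Lam_diff Lam_EE Lam_EY sgn_if)

lemma Lam_UE: "j \<le> m \<Longrightarrow> k \<le> m \<Longrightarrow> 0 < k \<Longrightarrow>
    Lam m (U k) (E j) = (if j = 0 then 0 else if k \<le> j then - 1 else 1)"
  using Lam_EU[of j m k] Lam_skew[of m "U k" "E j"] by auto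

lemma Lam_UU: "j \<le> m \<Longrightarrow> k \<le> m \<Longrightarrow> 0 < j \<Longrightarrow> 0 < k \<Longrightarrow> Lam m (U j) (U k) = 2 * sgn (int k - int j)"
  using Lam_EY[of j m k] Lam_EY[of k m j] Lam_skew[of m "Y j" "E k"]
  by (auto simp: U_def[of j] U_def[of k] Lam_diff Lam_EE Lam_YY sgn_if)

lemmas Lam_simps = Lam_add Lam_diff Lam_uminus Lam_zero Lam_EE Lam_EU Lam_UE Lam_UU

lemma lookup_EYU:
  "Poly_Mapping.lookup (E j) i = (if j \<noteq> 0 \<and> i = int j then 1 else 0)"
  "Poly_Mapping.lookup (Y l) i = (if i = - int l then 1 else 0)"
  "Poly_Mapping.lookup (U l) i = (if i = - int l then 1 else 0) - (if l \<noteq> 0 \<and> i = int l then 1 else 0)"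
  by (auto simp: E_def Y_def U_def lookup_single lookup_minus when_def)

lemma poly_mapping_lessI:
  fixes a b :: "int \<Rightarrow>\<^sub>0 int"
  assumes "Poly_Mapping.lookup a k < Poly_Mapping.lookup b k"
    and "\<And>k'. k' < k \<Longrightarrow> Poly_Mapping.lookup a k' = Poly_Mapping.lookup b k'"
  shows "a < b"
  using assms unfolding less_poly_mapping.rep_eq less_fun_def by blast

lemma U_less:
  assumes "0 < k" "k < l"
  shows "U k < U l"
  by (rule poly_mapping_lessI[of _ "- int l"]) (use assms in \<open>auto simp: lookup_EYU\<close>)

section \<open>Quantum minors in the quantum torus\<close>

locale matrix_torus = scalar_root K h for K (structure) and h +
  fixes m :: nat
begin

sublocale Q: quantum_torus K h "Lam m" UNIV
  by unfold_locales (auto simp: Lam_add)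

abbreviation "T \<equiv> Q.T"
abbreviation "M \<equiv> Q.delta"

lemma T_pw_smult [simp]: "x \<in> carrier T \<Longrightarrow> pw a \<odot>\<^bsub>T\<^esub> (pw b \<odot>\<^bsub>T\<^esub> x) = pw (a + b) \<odot>\<^bsub>T\<^esub> x"
  by (rule pw_smult[OF Q.T_algebra])

lemma M_mult: "M a \<otimes>\<^bsub>T\<^esub> M b = pw (Lam m a b) \<odot>\<^bsub>T\<^esub> M (a + b)"
  by (simp add: Q.mon_mult)

lemma M_comm: "M a \<otimes>\<^bsub>T\<^esub> M b = pw (2 * Lam m a b) \<odot>\<^bsub>T\<^esub> (M b \<otimes>\<^bsub>T\<^esub> M a)"
  by (simp add: M_mult add.commute Lam_skew[of m b a])

lemma M_in [simp]: "M a \<in> carrier T"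
  by simp

text \<open>A block: the increments of the ratio of the rows over the columns from \<open>j\<close>
  to \<open>l\<close>, with all exponents shifted by \<open>e\<close>. Second-row entries and minors
  are scalar multiples of blocks.\<close>

definition W :: "(int \<Rightarrow>\<^sub>0 int) \<Rightarrow> nat \<Rightarrow> nat \<Rightarrow> (int \<Rightarrow>\<^sub>0 int) \<Rightarrow> 'a" where
  "W e j l = finsum T (\<lambda>k. M (e + U k)) {j<..l}"

lemma W_in [simp]: "W e j l \<in> carrier T"
  by (auto simp: W_def intro!: Q.T.M.finsum_closed)

lemma W_split:
  assumes "j \<le> k" "k \<le> l"
  shows "W e j l = W e j k \<oplus>\<^bsub>T\<^esub> W e k l"
proof -
  have "{j<..l} = {j<..k} \<union> {k<..l}"
    using assms by auto
  then show ?thesis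
    unfolding W_def by (simp only:) (rule Q.T.M.finsum_Un_disjoint, auto)
qed

lemma W_single: "j < l \<Longrightarrow> j = l - 1 \<Longrightarrow> W e j l = M (e + U l)"
proof -
  assume "j < l" "j = l - 1"
  then have "{j<..l} = {l}" by auto
  then show ?thesis
    using Q.T.M.finsum_insert[of "{}" l "\<lambda>k. M (e + U k)"] by (simp add: W_def)
qed

lemma M_W:
  assumes "\<And>k. j < k \<Longrightarrow> k \<le> l \<Longrightarrow> Lam m a (e + U k) = c"
  shows "M a \<otimes>\<^bsub>T\<^esub> W e j l = pw c \<odot>\<^bsub>T\<^esub> W (a + e) j l"
proof -
  have "M a \<otimes>\<^bsub>T\<^esub> W e j l = finsum T (\<lambda>k. M a \<otimes>\<^bsub>T\<^esub> M (e + U k)) {j<..l}"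
    unfolding W_def by (rule Q.T.A.finsum_rdistr) auto
  also have "\<dots> = finsum T (\<lambda>k. pw c \<odot>\<^bsub>T\<^esub> M (a + e + U k)) {j<..l}"
    using assms by (intro Q.T.M.add.finprod_cong') (auto simp: M_mult add.assoc)
  also have "\<dots> = pw c \<odot>\<^bsub>T\<^esub> W (a + e) j l"
    unfolding W_def by (rule Q.T.finsum_smult_ldistr[symmetric]) auto
  finally show ?thesis .
qed

lemma W_M:
  assumes "\<And>k. j < k \<Longrightarrow> k \<le> l \<Longrightarrow> Lam m a (e + U k) = c"
  shows "W e j l \<otimes>\<^bsub>T\<^esub> M a = pw (- c) \<odot>\<^bsub>T\<^esub> W (a + e) j l"
proof -
  have "W e j l \<otimes>\<^bsub>T\<^esub> M a = finsum T (\<lambda>k. M (e + U k) \<otimes>\<^bsub>T\<^esub> M a) {j<..l}"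
    unfolding W_def by (rule Q.T.A.finsum_ldistr) auto
  also have "\<dots> = finsum T (\<lambda>k. pw (- c) \<odot>\<^bsub>T\<^esub> M (a + e + U k)) {j<..l}"
    using assms by (intro Q.T.M.add.finprod_cong') (auto simp: M_mult Lam_skew[of m _ a] ac_simps)
  also have "\<dots> = pw (- c) \<odot>\<^bsub>T\<^esub> W (a + e) j l"
    unfolding W_def by (rule Q.T.finsum_smult_ldistr[symmetric]) auto
  finally show ?thesis .
qed

text \<open>Normal form for a product of two blocks, with both shifts collected in one monomial on
  the left.\<close>

definition D where "D e j l j' l' = M e \<otimes>\<^bsub>T\<^esub> (W 0 j l \<otimes>\<^bsub>T\<^esub> W 0 j' l')"

lemma D_in [simp]: "D e j l j' l' \<in> carrier T"
  by (simp add: D_def)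

text \<open>In \<open>z\<close>, the terms \<open>c\<close> and \<open>c2\<close> come from
  splitting the shifts off their blocks, \<open>2 * c1\<close> from moving \<open>M e'\<close> left
  past the first block, and \<open>Lam m e e'\<close> from merging the two monomials.\<close>

lemma WW:
  assumes c: "\<And>k. j < k \<Longrightarrow> k \<le> l \<Longrightarrow> Lam m e (U k) = c"
    and c1: "\<And>k. j < k \<Longrightarrow> k \<le> l \<Longrightarrow> Lam m e' (U k) = c1"
    and c2: "\<And>k. j' < k \<Longrightarrow> k \<le> l' \<Longrightarrow> Lam m e' (U k) = c2"
    and z: "z = Lam m e e' - c - c2 - 2 * c1"
  shows "W e j l \<otimes>\<^bsub>T\<^esub> W e' j' l' = pw z \<odot>\<^bsub>T\<^esub> D (e + e') j l j' l'"
proof -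
  have W1: "W e j l = pw (- c) \<odot>\<^bsub>T\<^esub> (M e \<otimes>\<^bsub>T\<^esub> W 0 j l)"
    using M_W[of j l e 0 c] c by simp
  have W2: "W e' j' l' = pw (- c2) \<odot>\<^bsub>T\<^esub> (M e' \<otimes>\<^bsub>T\<^esub> W 0 j' l')"
    using M_W[of j' l' e' 0 c2] c2 by simp
  have W3: "W 0 j l \<otimes>\<^bsub>T\<^esub> M e' = pw (- 2 * c1) \<odot>\<^bsub>T\<^esub> (M e' \<otimes>\<^bsub>T\<^esub> W 0 j l)"
    using M_W[of j l e' 0 c1] W_M[of j l e' 0 c1] c1 by simp
  have "W e j l \<otimes>\<^bsub>T\<^esub> W e' j' l' = pw (- c - c2) \<odot>\<^bsub>T\<^esub> (M e \<otimes>\<^bsub>T\<^esub> (W 0 j l \<otimes>\<^bsub>T\<^esub> M e') \<otimes>\<^bsub>T\<^esub> W 0 j' l')"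
    unfolding W1 W2 by (simp add: Q.T.smult_mult_left Q.T.smult_mult_right Q.T.A.m_assoc algebra_simps)
  also have "\<dots> = pw (- c - c2 - 2 * c1) \<odot>\<^bsub>T\<^esub> ((M e \<otimes>\<^bsub>T\<^esub> M e') \<otimes>\<^bsub>T\<^esub> (W 0 j l \<otimes>\<^bsub>T\<^esub> W 0 j' l'))"
    unfolding W3 by (simp add: Q.T.smult_mult_left Q.T.smult_mult_right Q.T.A.m_assoc)
  also have "\<dots> = pw z \<odot>\<^bsub>T\<^esub> D (e + e') j l j' l'"
    by (simp add: M_mult D_def z Q.T.smult_mult_left algebra_simps)
  finally show ?thesis .
qed

text \<open>Every column of the first block lies left of every column of the second, so all pairs
  have form value \<open>2\<close> by \<open>Lam_UU\<close>, and interchanging the factors doubles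
  it.\<close>

lemma W0_comm:
  assumes "l \<le> j'" "l' \<le> m"
  shows "W 0 j l \<otimes>\<^bsub>T\<^esub> W 0 j' l' = pw 4 \<odot>\<^bsub>T\<^esub> (W 0 j' l' \<otimes>\<^bsub>T\<^esub> W 0 j l)"
proof -
  have 1: "M (U k) \<otimes>\<^bsub>T\<^esub> W 0 j' l' = pw 4 \<odot>\<^bsub>T\<^esub> (W 0 j' l' \<otimes>\<^bsub>T\<^esub> M (U k))" if "j < k" "k \<le> l" for k
  proof -
    have "Lam m (U k) (0 + U k') = 2" if "j' < k'" "k' \<le> l'" for k'
      using that \<open>j < k\<close> \<open>k \<le> l\<close> assms by (simp add: Lam_UU)
    then show ?thesis
      using M_W[of j' l' "U k" 0 2] W_M[of j' l' "U k" 0 2] by simp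
  qed
  have "W 0 j l \<otimes>\<^bsub>T\<^esub> W 0 j' l' = finsum T (\<lambda>k. M (U k) \<otimes>\<^bsub>T\<^esub> W 0 j' l') {j<..l}"
    unfolding W_def[of 0 j l] by (simp, rule Q.T.A.finsum_ldistr) auto
  also have "\<dots> = finsum T (\<lambda>k. pw 4 \<odot>\<^bsub>T\<^esub> (W 0 j' l' \<otimes>\<^bsub>T\<^esub> M (U k))) {j<..l}"
    using 1 by (intro Q.T.M.add.finprod_cong') auto
  also have "\<dots> = pw 4 \<odot>\<^bsub>T\<^esub> finsum T (\<lambda>k. W 0 j' l' \<otimes>\<^bsub>T\<^esub> M (U k)) {j<..l}"
    by (rule Q.T.finsum_smult_ldistr[symmetric]) auto
  also have "finsum T (\<lambda>k. W 0 j' l' \<otimes>\<^bsub>T\<^esub> M (U k)) {j<..l} = W 0 j' l' \<otimes>\<^bsub>T\<^esub> W 0 j l"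
    unfolding W_def[of 0 j l] by (simp, rule Q.T.A.finsum_rdistr[symmetric]) auto
  finally show ?thesis .
qed

lemma D_comm:
  assumes "l \<le> j'" "l' \<le> m"
  shows "D e j' l' j l = pw (- 4) \<odot>\<^bsub>T\<^esub> D e j l j' l'"
  unfolding D_def W0_comm[OF assms] by (simp add: Q.T.smult_mult_right)

text \<open>For \<open>1 \<le> l \<le> m\<close> the factor \<open>pw 1\<close> makes
  \<open>X 2 l\<close> the product of \<open>X 1 l\<close> and the sum of the \<open>M (U k)\<close>
  with \<open>0 < k \<le> l\<close>: by \<open>M_W\<close> that product is \<open>pw 1\<close> times
  the block \<open>W (E l) 0 l\<close>.\<close>

definition X :: "nat \<Rightarrow> nat \<Rightarrow> (int \<Rightarrow>\<^sub>0 int) \<Rightarrow> 'a" where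
  "X i j = (if i = 1 then M (E j) else pw 1 \<odot>\<^bsub>T\<^esub> W (E j) 0 j)"

lemma X_in [simp]: "X i j \<in> carrier T"
  by (simp add: X_def)

lemma X_relations: "quantum_matrix_relations K (h \<otimes> h) m m T X"
proof -
  have q: "h \<otimes> h = pw 2"
    using pw_add[of 1 1] by (simp add: pw_1)
  have qi: "inv (h \<otimes> h) = pw (- 2)"
    by (simp add: q pw_inv)
  note [simp] = Q.T.smult_mult_left Q.T.smult_mult_right Q.T.smult_r_distr
  have 1: "X 1 j \<otimes>\<^bsub>T\<^esub> X 2 j = pw 2 \<odot>\<^bsub>T\<^esub> (X 2 j \<otimes>\<^bsub>T\<^esub> X 1 j)" if "1 \<le> j" "j \<le> m" for j
    using that M_W[of 0 j "E j" "E j" 1] W_M[of 0 j "E j" "E j" 1]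
    by (simp add: X_def Lam_simps)
  have 2: "X 1 j \<otimes>\<^bsub>T\<^esub> X 1 l = pw 2 \<odot>\<^bsub>T\<^esub> (X 1 l \<otimes>\<^bsub>T\<^esub> X 1 j)" if "1 \<le> j" "j < l" "l \<le> m" for j l
    using that M_comm[of "E j" "E l"] by (simp add: X_def Lam_EE)
  have 3: "X 1 l \<otimes>\<^bsub>T\<^esub> X 2 j = X 2 j \<otimes>\<^bsub>T\<^esub> X 1 l" if "1 \<le> j" "j < l" "l \<le> m" for j l
    using that M_W[of 0 j "E l" "E j" 0] W_M[of 0 j "E l" "E j" 0]
    by (simp add: X_def Lam_simps)
  \<comment> \<open>Both products split at column \<open>j\<close> into pairs of blocks; they match
    once the pair in the wrong order is interchanged by \<open>D_comm\<close>.\<close>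
  have 4: "X 2 j \<otimes>\<^bsub>T\<^esub> X 2 l = pw 2 \<odot>\<^bsub>T\<^esub> (X 2 l \<otimes>\<^bsub>T\<^esub> X 2 j)" if "1 \<le> j" "j < l" "l \<le> m" for j l
  proof -
    have "W (E j) 0 j \<otimes>\<^bsub>T\<^esub> W (E l) 0 l =
        pw (- 3) \<odot>\<^bsub>T\<^esub> D (E j + E l) 0 j 0 j \<oplus>\<^bsub>T\<^esub> pw (- 3) \<odot>\<^bsub>T\<^esub> D (E j + E l) 0 j j l"
      using that WW[of 0 j "E j" 1 "E l" 1 0 j 1 "-3"] WW[of 0 j "E j" 1 "E l" 1 j l 1 "-3"]
      by (simp add: W_split[of 0 j l] Q.T.A.r_distr Lam_simps)
    moreover have "W (E l) 0 l \<otimes>\<^bsub>T\<^esub> W (E j) 0 j =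
        pw (- 5) \<odot>\<^bsub>T\<^esub> D (E j + E l) 0 j 0 j \<oplus>\<^bsub>T\<^esub> pw (- 1) \<odot>\<^bsub>T\<^esub> D (E j + E l) j l 0 j"
      using that WW[of 0 j "E l" 1 "E j" 1 0 j 1 "-5"] WW[of j l "E l" 1 "E j" "-1" 0 j 1 "-1"]
      by (simp add: W_split[of 0 j l] Q.T.A.l_distr Lam_simps add.commute[of "E l"])
    ultimately show ?thesis
      using that by (simp add: X_def D_comm[of j j l])
  qed
  have 5: "X 1 j \<otimes>\<^bsub>T\<^esub> X 2 l = X 2 l \<otimes>\<^bsub>T\<^esub> X 1 j \<oplus>\<^bsub>T\<^esub> (pw 2 \<ominus> pw (- 2)) \<odot>\<^bsub>T\<^esub> (X 1 l \<otimes>\<^bsub>T\<^esub> X 2 j)"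
    if "1 \<le> j" "j < l" "l \<le> m" for j l
  proof -
    \<comment> \<open>The two products differ only in the coefficient of \<open>?A\<close>, which is
      \<open>pw 3\<close> against \<open>pw (- 1)\<close>; the difference is
      \<open>q - inv q\<close> times \<open>pw 1\<close>.\<close>
    let ?A = "W (E j + E l) 0 j" and ?B = "W (E j + E l) j l"
    have "M (E j) \<otimes>\<^bsub>T\<^esub> W (E l) 0 l = pw 2 \<odot>\<^bsub>T\<^esub> ?A \<oplus>\<^bsub>T\<^esub> ?B"
      using that M_W[of 0 j "E j" "E l" 2] M_W[of j l "E j" "E l" 0]
      by (simp add: W_split[of 0 j l] Q.T.A.r_distr Lam_simps)
    then have a: "X 1 j \<otimes>\<^bsub>T\<^esub> X 2 l = pw 3 \<odot>\<^bsub>T\<^esub> ?A \<oplus>\<^bsub>T\<^esub> pw 1 \<odot>\<^bsub>T\<^esub> ?B"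
      by (simp add: X_def)
    have "W (E l) 0 l \<otimes>\<^bsub>T\<^esub> M (E j) = pw (- 2) \<odot>\<^bsub>T\<^esub> ?A \<oplus>\<^bsub>T\<^esub> ?B"
      using that W_M[of 0 j "E j" "E l" 2] W_M[of j l "E j" "E l" 0]
      by (simp add: W_split[of 0 j l] Q.T.A.l_distr Lam_simps)
    then have b: "X 2 l \<otimes>\<^bsub>T\<^esub> X 1 j = pw (- 1) \<odot>\<^bsub>T\<^esub> ?A \<oplus>\<^bsub>T\<^esub> pw 1 \<odot>\<^bsub>T\<^esub> ?B"
      by (simp add: X_def)
    have c: "X 1 l \<otimes>\<^bsub>T\<^esub> X 2 j = pw 1 \<odot>\<^bsub>T\<^esub> ?A"
      using that M_W[of 0 j "E l" "E j" 0] by (simp add: X_def Lam_simps add.commute)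
    have "(pw 2 \<ominus> pw (- 2)) \<odot>\<^bsub>T\<^esub> (pw 1 \<odot>\<^bsub>T\<^esub> ?A) = (pw 3 \<ominus> pw (- 1)) \<odot>\<^bsub>T\<^esub> ?A"
      by (simp add: a_minus_def K.l_distr K.l_minus pw_add flip: Q.T.smult_assoc1)
    moreover have "pw (- 1) \<odot>\<^bsub>T\<^esub> ?A \<oplus>\<^bsub>T\<^esub> (pw 3 \<ominus> pw (- 1)) \<odot>\<^bsub>T\<^esub> ?A = pw 3 \<odot>\<^bsub>T\<^esub> ?A"
      by (simp add: a_minus_def K.a_comm[of "pw 3"] K.r_neg2 flip: Q.T.smult_l_distr)
    ultimately show ?thesis
      unfolding a b c by (simp add: Q.T.M.a_ac)
  qed
  show ?thesis
    unfolding quantum_matrix_relations_def qi unfolding q using 1 2 3 4 5 by simp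
qed

text \<open>
  The quantum minor of the columns \<open>j < l \<le> s\<close> is \<open>h\<close> times \<open>N s j l\<close>; the bound \<open>s\<close> separates the columns
  from the additional vertex, which stands for the column \<open>(0, 1)\<close>.
\<close>

definition g :: "nat \<Rightarrow> nat \<Rightarrow> nat \<Rightarrow> (int \<Rightarrow>\<^sub>0 int)" where
  "g s j l = (if l \<le> s then E j + E l + U l else E j)"

definition N :: "nat \<Rightarrow> nat \<Rightarrow> nat \<Rightarrow> (int \<Rightarrow>\<^sub>0 int) \<Rightarrow> 'a" where
  "N s j l = (if l \<le> s then W (E j + E l) j l else M (E j))"

lemma N_in [simp]: "N s j l \<in> carrier T"
  by (simp add: N_def)

text \<open>The part of \<open>X 1 j X 2 l\<close> from the columns up to \<open>j\<close> is
  exactly \<open>q X 1 l X 2 j\<close>; what is left is the block from \<open>j\<close> to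
  \<open>l\<close>.\<close>

lemma minor_identity:
  assumes "1 \<le> j" "j < l" "l \<le> s" "s \<le> m"
  shows "pw 1 \<odot>\<^bsub>T\<^esub> N s j l = X 1 j \<otimes>\<^bsub>T\<^esub> X 2 l \<ominus>\<^bsub>T\<^esub> pw 2 \<odot>\<^bsub>T\<^esub> (X 1 l \<otimes>\<^bsub>T\<^esub> X 2 j)"
proof -
  note [simp] = Q.T.smult_mult_left Q.T.smult_mult_right Q.T.smult_r_distr
  let ?A = "W (E j + E l) 0 j" and ?B = "W (E j + E l) j l"
  have "M (E j) \<otimes>\<^bsub>T\<^esub> W (E l) 0 l = pw 2 \<odot>\<^bsub>T\<^esub> ?A \<oplus>\<^bsub>T\<^esub> ?B"
    using assms M_W[of 0 j "E j" "E l" 2] M_W[of j l "E j" "E l" 0]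
    by (simp add: W_split[of 0 j l] Q.T.A.r_distr Lam_simps)
  then have a: "X 1 j \<otimes>\<^bsub>T\<^esub> X 2 l = pw 3 \<odot>\<^bsub>T\<^esub> ?A \<oplus>\<^bsub>T\<^esub> pw 1 \<odot>\<^bsub>T\<^esub> ?B"
    by (simp add: X_def)
  have c: "X 1 l \<otimes>\<^bsub>T\<^esub> X 2 j = pw 1 \<odot>\<^bsub>T\<^esub> ?A"
    using assms M_W[of 0 j "E l" "E j" 0] by (simp add: X_def Lam_simps add.commute)
  show ?thesis
    unfolding a c using assms
    by (simp add: N_def a_minus_def Q.T.M.a_comm[of "pw 3 \<odot>\<^bsub>T\<^esub> ?A"] Q.T.M.a_assoc Q.T.M.r_neg)
qed

text \<open>The value \<open>E 0 = 0\<close> encodes the added column \<open>(1, 0)\<close>, whose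
  minor with column \<open>l\<close> is the second-row entry; the scalar is the common normalisation
  of all \<open>N\<close>.\<close>

lemma first_row_two: "N s 0 l = pw (- 1) \<odot>\<^bsub>T\<^esub> X 2 l" if "l \<le> s"
  using that by (simp add: N_def X_def E_def)

lemma lead_X:
  shows "Q.lead (X 1 j) = E j" "0 < l \<Longrightarrow> Q.lead (X 2 l) = Y l"
    "X 1 j \<noteq> \<zero>\<^bsub>T\<^esub>" "0 < l \<Longrightarrow> X 2 l \<noteq> \<zero>\<^bsub>T\<^esub>"
proof -
  show "Q.lead (X 1 j) = E j" "X 1 j \<noteq> \<zero>\<^bsub>T\<^esub>"
    by (simp_all add: X_def Q.lead_delta Q.delta_ne)
  assume l: "0 < l"
  have W: "W (E l) 0 l w = (if w = Y l then \<one> else \<zero>)" if "Y l \<le> w" for w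
  proof -
    \<comment> \<open>Among the exponents \<open>E l + U k\<close> the one with \<open>k = l\<close>
      is the largest by \<open>U_less\<close>, and it equals \<open>Y l\<close>.\<close>
    have eq: "w = E l + U k \<longleftrightarrow> k = l \<and> w = Y l" if "0 < k" "k \<le> l" for k
    proof (cases "k = l")
      case True
      then show ?thesis by (auto simp: U_def)
    next
      case False
      then have "E l + U k < E l + U l"
        using that U_less[of k l] by simp
      also have "\<dots> = Y l"
        by (simp add: U_def)
      finally show ?thesis
        using \<open>Y l \<le> w\<close> False by auto
    qed
    have "W (E l) 0 l w = (\<Oplus>k\<in>{0<..l}. M (E l + U k) w)"
      unfolding W_def by (rule Q.finsum_T_apply) auto
    also have "\<dots> = (\<Oplus>k\<in>{0<..l}. if l = k then (if w = Y l then \<one> else \<zero>) else \<zero>)"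
    proof (intro K.add.finprod_cong' refl)
      show "M (E l + U k) w = (if l = k then (if w = Y l then \<one> else \<zero>) else \<zero>)" if "k \<in> {0<..l}" for k
        using that eq[of k] by (simp add: Q.delta_def)
    qed auto
    also have "\<dots> = (if w = Y l then \<one> else \<zero>)"
      using l by (intro K.finsum_singleton) auto
    finally show ?thesis .
  qed
  have ne: "W (E l) 0 l (Y l) \<noteq> \<zero>"
    using W[of "Y l"] by simp
  have "Q.lead (W (E l) 0 l) = Y l"
    by (rule Q.leadI) (use W ne in auto)
  then show "Q.lead (X 2 l) = Y l"
    by (simp add: X_def Q.lead_smult)
  have "X 2 l (Y l) \<noteq> \<zero>"
    using ne by (simp add: X_def Q.T_ops K.integral_iff)
  then show "X 2 l \<noteq> \<zero>\<^bsub>T\<^esub>"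
    by (auto simp: Q.T_ops)
qed

text \<open>The quantum Pluecker relation of the columns \<open>a < b < c < d\<close>. Its scalars
  are those that the mutation formula produces when \<open>Lam\<close> on the leading exponents
  \<open>g\<close> is the quasi-commutation matrix. If \<open>d\<close> is an honest column, cutting
  at \<open>b\<close> and \<open>c\<close> gives four pairs of blocks: the block from
  \<open>a\<close> to \<open>b\<close> with the block from \<open>c\<close> to \<open>d\<close>
  yields the first term, the other three pairs the second.\<close>

lemma exchange_identity:
  assumes "a < b" "b < c" "c < d" "c \<le> s" "s \<le> m"
  shows "N s a c \<otimes>\<^bsub>T\<^esub> N s b d =
    pw (Lam m (g s a c) (g s a b + g s c d) - Lam m (g s a b) (g s c d)) \<odot>\<^bsub>T\<^esub> (N s a b \<otimes>\<^bsub>T\<^esub> N s c d) \<oplus>\<^bsub>T\<^esub>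
    pw (Lam m (g s a c) (g s a d + g s b c) - Lam m (g s a d) (g s b c)) \<odot>\<^bsub>T\<^esub> (N s a d \<otimes>\<^bsub>T\<^esub> N s b c)"
    (is "?lhs = pw ?\<alpha> \<odot>\<^bsub>T\<^esub> ?r1 \<oplus>\<^bsub>T\<^esub> pw ?\<beta> \<odot>\<^bsub>T\<^esub> ?r2")
proof -
  have sg: "sgn (int y - int x) = 1" "sgn (int x - int y) = - 1" if "x < y" for x y
    using that by auto
  note [simp] = sg[OF assms(1)] sg[OF assms(2)] sg[OF assms(3)] sg[OF less_trans[OF assms(1,2)]]
    sg[OF less_trans[OF assms(2,3)]] sg[OF less_trans[OF assms(1) less_trans[OF assms(2,3)]]]
  note [simp] = Q.T.smult_mult_left Q.T.smult_mult_right Q.T.smult_r_distr Q.T.A.l_distr Q.T.A.r_distr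
  have abc: "a < c" "a < d" "b < d" "0 < b" "0 < c" "0 < d" "a \<le> s" "b \<le> s"
      "a \<le> m" "b \<le> m" "c \<le> m" "a \<le> b" "b \<le> c" "a \<le> c"
      "\<not> b \<le> a" "\<not> c \<le> a" "\<not> c \<le> b" "a \<noteq> b" "a \<noteq> c" "b \<noteq> c"
    using assms by auto
  \<comment> \<open>Column \<open>0\<close> has exponent \<open>0\<close> and contributes nothing to
    \<open>Lam\<close>; \<open>p\<close> treats it together with the other columns.\<close>
  define p :: int where "p = (if a = 0 then 0 else 1)"
  have EaU: "Lam m (E a) (U k) = - p" if "a < k" "k \<le> m" for k
    using that abc by (simp add: Lam_EU p_def)
  have Lac: "Lam m (E a) (E x) = p" "Lam m (E x) (E a) = - p" if "a < x" "x \<le> m" for x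
    using that by (auto simp: Lam_EE p_def)
  have pos: "Lam m (E x) (U k) = 1" "Lam m (U k) (E x) = - 1" if "0 < k" "k \<le> x" "x \<le> m" for x k
    using that by (simp_all add: Lam_EU Lam_UE)
  have neg: "Lam m (E x) (U k) = - 1" "Lam m (U k) (E x) = 1" if "0 < x" "x < k" "k \<le> m" for x k
    using that by (simp_all add: Lam_EU Lam_UE)
  have UEa: "Lam m (U k) (E a) = p" if "a < k" "k \<le> m" for k
    using EaU[OF that] Lam_skew[of m "U k" "E a"] by simp
  show ?thesis
  proof (cases "d \<le> s")
    case True
    then have dm: "d \<le> m" "c \<le> d" "b \<le> d" "a \<le> d" "\<not> d \<le> c" "\<not> d \<le> b" "\<not> d \<le> a"
      using assms by auto
    let ?e = "E a + E b + E c + E d"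
    have e: "E a + E c + (E b + E d) = ?e" "E a + E b + (E c + E d) = ?e" "E a + E d + (E b + E c) = ?e"
      by (simp_all add: ac_simps)
    note ev = Lam_add EaU UEa Lac pos neg
    have l1: "N s a c \<otimes>\<^bsub>T\<^esub> N s b d = W (E a + E c) a b \<otimes>\<^bsub>T\<^esub> W (E b + E d) b c \<oplus>\<^bsub>T\<^esub> W (E a + E c) a b \<otimes>\<^bsub>T\<^esub> W (E b + E d) c d \<oplus>\<^bsub>T\<^esub>
       (W (E a + E c) b c \<otimes>\<^bsub>T\<^esub> W (E b + E d) b c \<oplus>\<^bsub>T\<^esub> W (E a + E c) b c \<otimes>\<^bsub>T\<^esub> W (E b + E d) c d)"
      using assms True abc by (simp add: N_def W_split[of a b c] W_split[of b c d] Q.T.M.a_ac)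
    have l2: "N s a d \<otimes>\<^bsub>T\<^esub> N s b c = W (E a + E d) a b \<otimes>\<^bsub>T\<^esub> W (E b + E c) b c \<oplus>\<^bsub>T\<^esub>
       (W (E a + E d) b c \<otimes>\<^bsub>T\<^esub> W (E b + E c) b c \<oplus>\<^bsub>T\<^esub> W (E a + E d) c d \<otimes>\<^bsub>T\<^esub> W (E b + E c) b c)"
      using assms True abc dm by (simp add: N_def W_split[of a b d] W_split[of b c d] Q.T.M.a_assoc)
    \<comment> \<open>The values for \<open>WW\<close>: each column of the second shift contributes
      \<open>1\<close> or \<open>- 1\<close> on the first block, as it lies to the right or to the
      left of it, which gives \<open>2\<close>, \<open>0\<close> or \<open>- 2\<close>. On its own
      block the second shift always gives \<open>0\<close>, and the first shift gives
      \<open>1 - p\<close>.\<close>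
    have t1: "W (E a + E c) a b \<otimes>\<^bsub>T\<^esub> W (E b + E d) b c = pw (Lam m (E a + E c) (E b + E d) + p - 5) \<odot>\<^bsub>T\<^esub> D ?e a b b c"
      unfolding e(1)[symmetric] by (rule WW[where c = "1 - p" and ?c1.0 = 2 and ?c2.0 = 0]) (use abc dm in \<open>simp_all add: ev\<close>)
    have t2: "W (E a + E c) a b \<otimes>\<^bsub>T\<^esub> W (E b + E d) c d = pw (Lam m (E a + E c) (E b + E d) + p - 5) \<odot>\<^bsub>T\<^esub> D ?e a b c d"
      unfolding e(1)[symmetric] by (rule WW[where c = "1 - p" and ?c1.0 = 2 and ?c2.0 = 0]) (use abc dm in \<open>simp_all add: ev\<close>)
    have t3: "W (E a + E c) b c \<otimes>\<^bsub>T\<^esub> W (E b + E d) b c = pw (Lam m (E a + E c) (E b + E d) + p - 1) \<odot>\<^bsub>T\<^esub> D ?e b c b c"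
      unfolding e(1)[symmetric] by (rule WW[where c = "1 - p" and ?c1.0 = 0 and ?c2.0 = 0]) (use abc dm in \<open>simp_all add: ev\<close>)
    have t4: "W (E a + E c) b c \<otimes>\<^bsub>T\<^esub> W (E b + E d) c d = pw (Lam m (E a + E c) (E b + E d) + p - 1) \<odot>\<^bsub>T\<^esub> D ?e b c c d"
      unfolding e(1)[symmetric] by (rule WW[where c = "1 - p" and ?c1.0 = 0 and ?c2.0 = 0]) (use abc dm in \<open>simp_all add: ev\<close>)
    have t5: "N s a b \<otimes>\<^bsub>T\<^esub> N s c d = pw (Lam m (E a + E b) (E c + E d) + p - 5) \<odot>\<^bsub>T\<^esub> D ?e a b c d"
      unfolding e(2)[symmetric] N_def using True abc
      by (simp, intro WW[where c = "1 - p" and ?c1.0 = 2 and ?c2.0 = 0]) (use abc dm in \<open>simp_all add: ev\<close>)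
    have t6: "W (E a + E d) a b \<otimes>\<^bsub>T\<^esub> W (E b + E c) b c = pw (Lam m (E a + E d) (E b + E c) + p - 5) \<odot>\<^bsub>T\<^esub> D ?e a b b c"
      unfolding e(3)[symmetric] by (rule WW[where c = "1 - p" and ?c1.0 = 2 and ?c2.0 = 0]) (use abc dm in \<open>simp_all add: ev\<close>)
    have t7: "W (E a + E d) b c \<otimes>\<^bsub>T\<^esub> W (E b + E c) b c = pw (Lam m (E a + E d) (E b + E c) + p - 1) \<odot>\<^bsub>T\<^esub> D ?e b c b c"
      unfolding e(3)[symmetric] by (rule WW[where c = "1 - p" and ?c1.0 = 0 and ?c2.0 = 0]) (use abc dm in \<open>simp_all add: ev\<close>)
    \<comment> \<open>The only pair of blocks that arises in the wrong order.\<close>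
    have t8: "W (E a + E d) c d \<otimes>\<^bsub>T\<^esub> W (E b + E c) b c = pw (Lam m (E a + E d) (E b + E c) + p - 1) \<odot>\<^bsub>T\<^esub> D ?e b c c d"
    proof -
      have "W (E a + E d) c d \<otimes>\<^bsub>T\<^esub> W (E b + E c) b c = pw (Lam m (E a + E d) (E b + E c) + p + 3) \<odot>\<^bsub>T\<^esub> D ?e c d b c"
        unfolding e(3)[symmetric] by (rule WW[where c = "1 - p" and ?c1.0 = "- 2" and ?c2.0 = 0]) (use abc dm in \<open>simp_all add: ev\<close>)
      then show ?thesis
        using D_comm[of c c d ?e b] dm by simp
    qed
    have \<alpha>: "?\<alpha> + Lam m (E a + E b) (E c + E d) = Lam m (E a + E c) (E b + E d)"
      and \<beta>: "?\<beta> + Lam m (E a + E d) (E b + E c) = Lam m (E a + E c) (E b + E d)"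
      using True abc dm assms by (simp_all add: g_def ev Lam_EE Lam_UU p_def)
    have \<alpha>': "Lam m (E a + E c) (E b + E d) = ?\<alpha> + Lam m (E a + E b) (E c + E d)"
      and \<beta>': "?\<beta> = Lam m (E a + E c) (E b + E d) - Lam m (E a + E d) (E b + E c)"
      and \<alpha>'': "?\<alpha> = Lam m (E a + E c) (E b + E d) - Lam m (E a + E b) (E c + E d)"
      using \<alpha> \<beta> by simp_all
    show ?thesis
      unfolding l1 l2 t1 t2 t3 t4 t5 t6 t7 t8 \<beta>' \<alpha>'' by (simp add: Q.T.M.a_ac add_diff_eq)
  next
    \<comment> \<open>Now \<open>d\<close> stands for the column \<open>(0, 1)\<close>: minors with
      it are first-row entries, and single blocks remain.\<close>
    case False
    have e: "E b + (E a + E c) = E a + E b + E c" "E c + (E a + E b) = E a + E b + E c"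
      "E a + (E b + E c) = E a + E b + E c"
      by (simp_all add: ac_simps)
    note ev = Lam_add EaU UEa Lac pos neg
    have l1: "N s a c \<otimes>\<^bsub>T\<^esub> N s b d = W (E a + E c) a b \<otimes>\<^bsub>T\<^esub> M (E b) \<oplus>\<^bsub>T\<^esub> W (E a + E c) b c \<otimes>\<^bsub>T\<^esub> M (E b)"
      using assms False abc by (simp add: N_def W_split[of a b c])
    have t1: "W (E a + E c) a b \<otimes>\<^bsub>T\<^esub> M (E b) = pw (- (2 - p)) \<odot>\<^bsub>T\<^esub> W (E a + E b + E c) a b"
      unfolding e(1)[symmetric] by (rule W_M) (use abc in \<open>simp_all add: ev Lam_EE p_def\<close>)
    have t2: "W (E a + E c) b c \<otimes>\<^bsub>T\<^esub> M (E b) = pw (- (- p)) \<odot>\<^bsub>T\<^esub> W (E a + E b + E c) b c"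
      unfolding e(1)[symmetric] by (rule W_M) (use abc in \<open>simp_all add: ev Lam_EE p_def\<close>)
    have t3: "N s a b \<otimes>\<^bsub>T\<^esub> N s c d = pw (- (- p)) \<odot>\<^bsub>T\<^esub> W (E a + E b + E c) a b"
      unfolding e(2)[symmetric] N_def using False abc
      by (simp, intro W_M[where c = "- p", simplified]) (use abc in \<open>simp_all add: ev Lam_EE p_def\<close>)
    have t4: "N s a d \<otimes>\<^bsub>T\<^esub> N s b c = pw p \<odot>\<^bsub>T\<^esub> W (E a + E b + E c) b c"
      unfolding e(3)[symmetric] N_def using False abc assms
      by (simp, intro M_W) (use abc in \<open>simp_all add: ev Lam_EE p_def\<close>)
    have \<alpha>: "?\<alpha> = - 2" and \<beta>: "?\<beta> = 0"
      using False abc assms by (simp_all add: g_def ev Lam_EE Lam_UU p_def)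
    show ?thesis
      unfolding l1 t1 t2 t3 t4 \<alpha> \<beta> by simp
  qed
qed

end

section \<open>The cell: ordered monomials, valuation and skew field of fractions\<close>

section \<open>Straightening\<close>

text \<open>Letters \<open>1, ..., t\<close> are the first row, later ones the second. Reordering
  \<open>z i z d\<close> with \<open>d < i\<close> may create a correction, but both of its letters
  exceed \<open>d\<close>, and its first letter is in the first row, whose letters reorder among
  themselves by scalars only. This keeps the process under control.\<close>

locale straightening = assoc_algebra K B for K (structure) and B (structure) +
  fixes z :: "nat \<Rightarrow> 'c" and t r :: nat
  assumes z_in: "\<And>i. 1 \<le> i \<Longrightarrow> i \<le> r \<Longrightarrow> z i \<in> carrier B"
    and straight: "\<And>d i. 1 \<le> d \<Longrightarrow> d < i \<Longrightarrow> i \<le> r \<Longrightarrow> \<exists>a\<in>carrier K. \<exists>b\<in>carrier K. \<exists>d' i'.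
        d < d' \<and> d' \<le> t \<and> d' \<le> r \<and> d < i' \<and> i' \<le> r \<and> z i \<otimes>\<^bsub>B\<^esub> z d = a \<odot>\<^bsub>B\<^esub> (z d \<otimes>\<^bsub>B\<^esub> z i) \<oplus>\<^bsub>B\<^esub> b \<odot>\<^bsub>B\<^esub> (z d' \<otimes>\<^bsub>B\<^esub> z i')
      \<or> z i \<otimes>\<^bsub>B\<^esub> z d = a \<odot>\<^bsub>B\<^esub> (z d \<otimes>\<^bsub>B\<^esub> z i)"
    and straight1: "\<And>d i. 1 \<le> d \<Longrightarrow> d < i \<Longrightarrow> i \<le> t \<Longrightarrow> i \<le> r \<Longrightarrow>
        \<exists>a\<in>carrier K. z i \<otimes>\<^bsub>B\<^esub> z d = a \<odot>\<^bsub>B\<^esub> (z d \<otimes>\<^bsub>B\<^esub> z i)"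
begin

definition mon :: "nat list \<Rightarrow> 'c" where
  "mon w = foldr (\<lambda>i y. z i \<otimes>\<^bsub>B\<^esub> y) w \<one>\<^bsub>B\<^esub>"

lemma mon_simps [simp]: "mon [] = \<one>\<^bsub>B\<^esub>" "mon (i # w) = z i \<otimes>\<^bsub>B\<^esub> mon w"
  by (simp_all add: mon_def)

definition words :: "nat \<Rightarrow> nat list set" where
  "words c = {w. sorted w \<and> set w \<subseteq> {c..r}}"

lemma mon_in [simp]: "set w \<subseteq> {1..r} \<Longrightarrow> mon w \<in> carrier B"
  by (induction w) (auto simp: z_in)

lemma mon_in_words: "w \<in> words c \<Longrightarrow> 1 \<le> c \<Longrightarrow> mon w \<in> carrier B"
  by (intro mon_in) (auto simp: words_def)

text \<open>The span of the ordered monomials with letters at least \<open>c\<close>. The bound is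
  tracked because \<open>z d\<close> can be put in front of the monomials of \<open>SP d\<close>
  without reordering.\<close>

inductive_set SP :: "nat \<Rightarrow> 'c set" for c where
  zero: "\<zero>\<^bsub>B\<^esub> \<in> SP c"
| add: "x \<in> SP c \<Longrightarrow> w \<in> words c \<Longrightarrow> a \<in> carrier K \<Longrightarrow> a \<odot>\<^bsub>B\<^esub> mon w \<oplus>\<^bsub>B\<^esub> x \<in> SP c"

lemma SP_carrier:
  assumes "x \<in> SP c" "1 \<le> c"
  shows "x \<in> carrier B"
  using assms by induction (auto simp: mon_in_words)

lemma SP_mon:
  assumes "w \<in> words c" "1 \<le> c"
  shows "mon w \<in> SP c"
  using SP.add[OF SP.zero assms(1) K.one_closed] mon_in_words[OF assms] by simp

lemma SP_add:
  assumes "x \<in> SP c" "y \<in> SP c" "1 \<le> c"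
  shows "x \<oplus>\<^bsub>B\<^esub> y \<in> SP c"
  using assms
proof induction
  case zero
  then show ?case by (simp add: SP_carrier)
next
  case (add x w a)
  then have "a \<odot>\<^bsub>B\<^esub> mon w \<oplus>\<^bsub>B\<^esub> x \<oplus>\<^bsub>B\<^esub> y = a \<odot>\<^bsub>B\<^esub> mon w \<oplus>\<^bsub>B\<^esub> (x \<oplus>\<^bsub>B\<^esub> y)"
    by (intro M.a_assoc) (auto simp: SP_carrier mon_in_words)
  then show ?case
    using SP.add[OF _ add(2,3), of "x \<oplus>\<^bsub>B\<^esub> y"] add by simp
qed

lemma SP_smult:
  assumes "x \<in> SP c" "k \<in> carrier K" "1 \<le> c"
  shows "k \<odot>\<^bsub>B\<^esub> x \<in> SP c"
  using assms
proof induction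
  case zero
  then show ?case by (simp add: SP.zero)
next
  case (add x w a)
  then have "k \<odot>\<^bsub>B\<^esub> (a \<odot>\<^bsub>B\<^esub> mon w \<oplus>\<^bsub>B\<^esub> x) = (k \<otimes> a) \<odot>\<^bsub>B\<^esub> mon w \<oplus>\<^bsub>B\<^esub> k \<odot>\<^bsub>B\<^esub> x"
    by (simp add: smult_r_distr smult_assoc1 SP_carrier mon_in_words)
  then show ?case
    using SP.add[of "k \<odot>\<^bsub>B\<^esub> x" c w "k \<otimes> a"] add by simp
qed

lemma SP_mono:
  assumes "x \<in> SP c'" "c \<le> c'"
  shows "x \<in> SP c"
  using assms
proof induction
  case (add x w a)
  then have "w \<in> words c" by (auto simp: words_def)
  then show ?case using add by (auto intro: SP.add)
qed (rule SP.zero)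

lemma SP_prepend:
  assumes "x \<in> SP d" "1 \<le> d" "d \<le> r"
  shows "z d \<otimes>\<^bsub>B\<^esub> x \<in> SP d"
  using assms
proof induction
  case zero
  then show ?case using z_in[of d] by (simp add: SP.zero)
next
  case (add x w a)
  have w: "d # w \<in> words d"
    using add by (auto simp: words_def)
  have "z d \<otimes>\<^bsub>B\<^esub> (a \<odot>\<^bsub>B\<^esub> mon w \<oplus>\<^bsub>B\<^esub> x) = a \<odot>\<^bsub>B\<^esub> mon (d # w) \<oplus>\<^bsub>B\<^esub> z d \<otimes>\<^bsub>B\<^esub> x"
    using add z_in[of d] SP_carrier mon_in_words[OF add(2)] by (simp add: A.r_distr smult_mult_right)
  then show ?case
    using SP.add[OF add.IH[OF add(5,6)] w add(3)] by simp
qed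

text \<open>Left multiplication is linear, so it suffices to consider it on monomials.\<close>

lemma SP_left:
  assumes mon: "\<And>w. w \<in> words c \<Longrightarrow> z i \<otimes>\<^bsub>B\<^esub> mon w \<in> SP c"
    and x: "x \<in> SP c" and "1 \<le> c" "1 \<le> i" "i \<le> r"
  shows "z i \<otimes>\<^bsub>B\<^esub> x \<in> SP c"
  using x
proof induction
  case zero
  then show ?case using assms by (simp add: z_in SP.zero)
next
  case (add x w a)
  then have "z i \<otimes>\<^bsub>B\<^esub> (a \<odot>\<^bsub>B\<^esub> mon w \<oplus>\<^bsub>B\<^esub> x) = a \<odot>\<^bsub>B\<^esub> (z i \<otimes>\<^bsub>B\<^esub> mon w) \<oplus>\<^bsub>B\<^esub> z i \<otimes>\<^bsub>B\<^esub> x"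
    using assms by (simp add: z_in A.r_distr smult_mult_right SP_carrier mon_in_words)
  then show ?case
    using SP_add[OF SP_smult[OF mon[OF add(2)] add(3)] add.IH] assms by simp
qed

lemma words_Cons:
  assumes "d # w \<in> words c"
  shows "w \<in> words d" "c \<le> d" "d \<le> r" "w \<in> words c"
  using assms by (auto simp: words_def)

text \<open>A first-row letter passes every smaller letter at the cost of a scalar. This case comes
  first because the corrections in \<open>SP_mon_left\<close> begin with such a letter.\<close>

lemma SP_row1_mon:
  assumes "w \<in> words c" "1 \<le> c" "c \<le> i" "i \<le> t" "i \<le> r"
  shows "z i \<otimes>\<^bsub>B\<^esub> mon w \<in> SP c"
  using assms
proof (induction w arbitrary: c)
  case Nil
  then show ?case using SP_mon[of "[i]" c] by (auto simp: words_def)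
next
  case (Cons d w)
  note w = words_Cons[OF Cons.prems(1)]
  show ?case
  proof (cases "i \<le> d")
    case True
    then have "i # d # w \<in> words c"
      using Cons.prems by (auto simp: words_def)
    then show ?thesis
      using SP_mon Cons.prems by fastforce
  next
    case False
    then obtain a where a: "a \<in> carrier K" "z i \<otimes>\<^bsub>B\<^esub> z d = a \<odot>\<^bsub>B\<^esub> (z d \<otimes>\<^bsub>B\<^esub> z i)"
      using straight1[of d i] Cons.prems w by force
    have zc: "z i \<in> carrier B" "z d \<in> carrier B" "mon w \<in> carrier B"
      using z_in[of i] z_in[of d] Cons.prems w False mon_in_words[OF w(1)] by auto
    have "z i \<otimes>\<^bsub>B\<^esub> mon (d # w) = (z i \<otimes>\<^bsub>B\<^esub> z d) \<otimes>\<^bsub>B\<^esub> mon w"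
      using zc by (simp add: A.m_assoc)
    also have "\<dots> = a \<odot>\<^bsub>B\<^esub> (z d \<otimes>\<^bsub>B\<^esub> (z i \<otimes>\<^bsub>B\<^esub> mon w))"
      unfolding a using zc a by (simp add: A.m_assoc smult_mult_left)
    also have "\<dots> \<in> SP d"
      using Cons.prems w False a by (intro SP_smult SP_prepend Cons.IH) auto
    finally show ?thesis
      using SP_mono w by blast
  qed
qed

lemma SP_row1:
  assumes "x \<in> SP c" "1 \<le> c" "c \<le> i" "i \<le> t" "i \<le> r"
  shows "z i \<otimes>\<^bsub>B\<^esub> x \<in> SP c"
  by (rule SP_left[OF SP_row1_mon]) (use assms in auto)

lemma SP_mon_left:
  assumes "w \<in> words c" "1 \<le> c" "c \<le> i" "i \<le> r"
  shows "z i \<otimes>\<^bsub>B\<^esub> mon w \<in> SP c"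
  using assms
proof (induction w arbitrary: c i)
  case Nil
  then show ?case using SP_mon[of "[i]" c] by (auto simp: words_def)
next
  case (Cons d w)
  note w = words_Cons[OF Cons.prems(1)]
  show ?case
  proof (cases "i \<le> d")
    case True
    then have "i # d # w \<in> words c"
      using Cons.prems by (auto simp: words_def)
    then show ?thesis
      using SP_mon Cons.prems by fastforce
  next
    case False
    then have d: "1 \<le> d" "d < i"
      using Cons.prems w by auto
    have zc: "z i \<in> carrier B" "z d \<in> carrier B" "mon w \<in> carrier B"
      using z_in[of i] z_in[of d] Cons.prems w False mon_in_words[OF w(1)] by auto
    have 0: "z i \<otimes>\<^bsub>B\<^esub> mon (d # w) = (z i \<otimes>\<^bsub>B\<^esub> z d) \<otimes>\<^bsub>B\<^esub> mon w"
      using zc by (simp add: A.m_assoc)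
    have 1: "z d \<otimes>\<^bsub>B\<^esub> (z i \<otimes>\<^bsub>B\<^esub> mon w) \<in> SP d"
      using Cons.prems w d by (intro SP_prepend Cons.IH) auto
    obtain a b d' i' where ab: "a \<in> carrier K" "b \<in> carrier K" and
      disj: "d < d' \<and> d' \<le> t \<and> d' \<le> r \<and> d < i' \<and> i' \<le> r \<and> z i \<otimes>\<^bsub>B\<^esub> z d = a \<odot>\<^bsub>B\<^esub> (z d \<otimes>\<^bsub>B\<^esub> z i) \<oplus>\<^bsub>B\<^esub> b \<odot>\<^bsub>B\<^esub> (z d' \<otimes>\<^bsub>B\<^esub> z i')
        \<or> z i \<otimes>\<^bsub>B\<^esub> z d = a \<odot>\<^bsub>B\<^esub> (z d \<otimes>\<^bsub>B\<^esub> z i)"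
      using straight[OF d Cons.prems(4)] by metis
    have "z i \<otimes>\<^bsub>B\<^esub> mon (d # w) \<in> SP d"
      using disj
    proof (elim disjE conjE)
      assume e: "z i \<otimes>\<^bsub>B\<^esub> z d = a \<odot>\<^bsub>B\<^esub> (z d \<otimes>\<^bsub>B\<^esub> z i)"
      have "z i \<otimes>\<^bsub>B\<^esub> mon (d # w) = a \<odot>\<^bsub>B\<^esub> (z d \<otimes>\<^bsub>B\<^esub> (z i \<otimes>\<^bsub>B\<^esub> mon w))"
        unfolding 0 e using zc ab by (simp add: A.m_assoc smult_mult_left)
      then show ?thesis
        using SP_smult[OF 1 ab(1) d(1)] by simp
    next
      assume e: "z i \<otimes>\<^bsub>B\<^esub> z d = a \<odot>\<^bsub>B\<^esub> (z d \<otimes>\<^bsub>B\<^esub> z i) \<oplus>\<^bsub>B\<^esub> b \<odot>\<^bsub>B\<^esub> (z d' \<otimes>\<^bsub>B\<^esub> z i')"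
        and d': "d < d'" "d' \<le> t" "d' \<le> r" "d < i'" "i' \<le> r"
      have zc': "z d' \<in> carrier B" "z i' \<in> carrier B"
        using z_in d' d by auto
      \<comment> \<open>The tail \<open>w\<close> is shorter and \<open>i'\<close> exceeds
        \<open>d\<close>, so the induction hypothesis applies to \<open>i'\<close>; the factor
        \<open>d'\<close> in front is then absorbed by \<open>SP_row1\<close>.\<close>
      have 2: "z i' \<otimes>\<^bsub>B\<^esub> mon w \<in> SP d"
        using Cons.IH[OF w(1), of i'] d d' by simp
      have 3: "z d' \<otimes>\<^bsub>B\<^esub> (z i' \<otimes>\<^bsub>B\<^esub> mon w) \<in> SP d"
        using SP_row1[OF 2] d d' by simp
      have "z i \<otimes>\<^bsub>B\<^esub> mon (d # w) = a \<odot>\<^bsub>B\<^esub> (z d \<otimes>\<^bsub>B\<^esub> (z i \<otimes>\<^bsub>B\<^esub> mon w)) \<oplus>\<^bsub>B\<^esub> b \<odot>\<^bsub>B\<^esub> (z d' \<otimes>\<^bsub>B\<^esub> (z i' \<otimes>\<^bsub>B\<^esub> mon w))"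
        unfolding 0 e using zc zc' ab by (simp add: A.m_assoc A.l_distr smult_mult_left)
      then show ?thesis
        using SP_add[OF SP_smult[OF 1 ab(1) d(1)] SP_smult[OF 3 ab(2) d(1)] d(1)] by simp
    qed
    then show ?thesis
      using SP_mono w by blast
  qed
qed

text \<open>Membership does not pass to products directly. What passes is stability of
  \<open>SP 1\<close> under left multiplication, and applied to the unit it gives the claim.\<close>

lemma generated_SP: "generated_algebra K B (z ` {1..r}) \<subseteq> SP 1"
proof
  fix x assume x: "x \<in> generated_algebra K B (z ` {1..r})"
  have zsub: "z ` {1..r} \<subseteq> carrier B"
    using z_in by auto
  have cl: "u \<in> carrier B" if "u \<in> generated_algebra K B (z ` {1..r})" for u
    using generated_algebra_closed[OF zsub] that by blast
  have SPc: "y \<in> carrier B" if "y \<in> SP 1" for y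
    using SP_carrier that by simp
  have "\<forall>y\<in>SP 1. x \<otimes>\<^bsub>B\<^esub> y \<in> SP 1"
    using x
  proof induction
    case (incl x)
    then show ?case
      using SP_left[OF SP_mon_left] by auto
  next
    case one
    then show ?case by (simp add: SPc)
  next
    case (add x y)
    then show ?case by (auto simp: A.l_distr cl SPc intro: SP_add)
  next
    case (mult x y)
    then show ?case by (auto simp: A.m_assoc cl SPc)
  next
    case (smult c x)
    then show ?case by (auto simp: smult_mult_left cl SPc intro: SP_smult)
  qed
  moreover have "\<one>\<^bsub>B\<^esub> \<in> SP 1"
    using SP_mon[of "[]" 1] by (simp add: words_def)
  ultimately show "x \<in> SP 1"
    using cl[OF x] by (metis A.r_one)
qed

text \<open>Equal words are collected and zero coefficients dropped, so that each word present
  contributes its leading exponent.\<close>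

lemma SP_normal_form:
  assumes "x \<in> SP 1"
  shows "\<exists>F a. finite F \<and> F \<subseteq> words 1 \<and> (\<forall>w\<in>F. a w \<in> carrier K - {\<zero>}) \<and>
    x = finsum B (\<lambda>w. a w \<odot>\<^bsub>B\<^esub> mon w) F"
proof -
  have "\<exists>F a. finite F \<and> F \<subseteq> words 1 \<and> (\<forall>w\<in>F. a w \<in> carrier K) \<and> x = finsum B (\<lambda>w. a w \<odot>\<^bsub>B\<^esub> mon w) F"
    using assms
  proof induction
    case zero
    then show ?case by (intro exI[of _ "{}"]) simp
  next
    case (add x w b)
    then obtain F a where F: "finite F" "F \<subseteq> words 1" "\<And>w. w \<in> F \<Longrightarrow> a w \<in> carrier K"
        "x = finsum B (\<lambda>w. a w \<odot>\<^bsub>B\<^esub> mon w) F"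
      by auto
    have mc: "mon v \<in> carrier B" if "v \<in> F" for v
      using mon_in_words F that by auto
    have wc: "mon w \<in> carrier B"
      using mon_in_words add by simp
    let ?G = "F - {w}"
    define c where "c = (if w \<in> F then b \<oplus> a w else b)"
    have c: "c \<in> carrier K"
      using F add by (simp add: c_def)
    let ?a = "\<lambda>v. if v = w then c else a v"
    have G: "finsum B (\<lambda>v. ?a v \<odot>\<^bsub>B\<^esub> mon v) (insert w ?G) = c \<odot>\<^bsub>B\<^esub> mon w \<oplus>\<^bsub>B\<^esub> finsum B (\<lambda>v. a v \<odot>\<^bsub>B\<^esub> mon v) ?G"
    proof -
      have "finsum B (\<lambda>v. ?a v \<odot>\<^bsub>B\<^esub> mon v) ?G = finsum B (\<lambda>v. a v \<odot>\<^bsub>B\<^esub> mon v) ?G"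
        using F mc by (intro M.add.finprod_cong') auto
      then show ?thesis
        using F mc wc c by (subst M.finsum_insert) auto
    qed
    have "b \<odot>\<^bsub>B\<^esub> mon w \<oplus>\<^bsub>B\<^esub> x = finsum B (\<lambda>v. ?a v \<odot>\<^bsub>B\<^esub> mon v) (insert w ?G)"
    proof (cases "w \<in> F")
      case True
      have Gc: "finsum B (\<lambda>v. a v \<odot>\<^bsub>B\<^esub> mon v) ?G \<in> carrier B"
        using F mc by (intro M.finsum_closed) auto
      have "x = finsum B (\<lambda>v. a v \<odot>\<^bsub>B\<^esub> mon v) (insert w ?G)"
        using F(4) True by (simp add: insert_absorb)
      also have "\<dots> = a w \<odot>\<^bsub>B\<^esub> mon w \<oplus>\<^bsub>B\<^esub> finsum B (\<lambda>v. a v \<odot>\<^bsub>B\<^esub> mon v) ?G"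
        using F mc True by (subst M.finsum_insert) auto
      finally show ?thesis
        unfolding G using True F add wc Gc by (simp add: c_def smult_l_distr M.a_assoc)
    next
      case False
      then show ?thesis
        unfolding G using F by (simp add: c_def)
    qed
    moreover have "insert w ?G \<subseteq> words 1"
      using F add by auto
    ultimately show ?case
      using F c by (intro exI[of _ "insert w ?G"] exI[of _ ?a]) auto
  qed
  then obtain F a where F: "finite F" "F \<subseteq> words 1" "\<And>w. w \<in> F \<Longrightarrow> a w \<in> carrier K"
        "x = finsum B (\<lambda>w. a w \<odot>\<^bsub>B\<^esub> mon w) F"
    by auto
  let ?F = "{w \<in> F. a w \<noteq> \<zero>}"
  have "x = finsum B (\<lambda>w. a w \<odot>\<^bsub>B\<^esub> mon w) ?F"
    unfolding F(4) using F mon_in_words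
    by (intro M.add.finprod_mono_neutral_cong_right) (auto simp: subset_iff)
  then show ?thesis
    using F by (intro exI[of _ ?F] exI[of _ a]) auto
qed

end

section \<open>The quantum Schubert cell inside the quantum torus\<close>

locale schubert_cell = matrix_torus K h m for K (structure) and h and m +
  fixes s t :: nat
  assumes s_pos: "1 \<le> s" and s_le: "s \<le> t" and t_le: "t \<le> m"
begin

sublocale QM: quantum_matrices K "h \<otimes> h" m
  by unfold_locales (use h_in h_ne in \<open>auto simp: K.integral_iff\<close>)

abbreviation "B \<equiv> QM.M"
abbreviation "gen \<equiv> qmat_gen K (h \<otimes> h) m"

sublocale B: assoc_algebra K B
  by (rule QM.M_algebra)

definition z :: "nat \<Rightarrow> ((nat \<times> nat) list \<Rightarrow> 'a) set" where
  "z i = (if i \<le> t then gen 1 i else gen 2 (i - t))"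

lemma q_pw: "h \<otimes> h = pw 2"
  using pw_add[of 1 1] by (simp add: pw_1)

lemma gen_relations:
  "1 \<le> j \<Longrightarrow> j \<le> m \<Longrightarrow> gen 1 j \<in> carrier B"
  "1 \<le> j \<Longrightarrow> j \<le> m \<Longrightarrow> gen 2 j \<in> carrier B"
  "1 \<le> j \<Longrightarrow> j \<le> m \<Longrightarrow> gen 1 j \<otimes>\<^bsub>B\<^esub> gen 2 j = pw 2 \<odot>\<^bsub>B\<^esub> (gen 2 j \<otimes>\<^bsub>B\<^esub> gen 1 j)"
  "1 \<le> j \<Longrightarrow> j < l \<Longrightarrow> l \<le> m \<Longrightarrow> gen 1 j \<otimes>\<^bsub>B\<^esub> gen 1 l = pw 2 \<odot>\<^bsub>B\<^esub> (gen 1 l \<otimes>\<^bsub>B\<^esub> gen 1 j)"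
  "1 \<le> j \<Longrightarrow> j < l \<Longrightarrow> l \<le> m \<Longrightarrow> gen 1 l \<otimes>\<^bsub>B\<^esub> gen 2 j = gen 2 j \<otimes>\<^bsub>B\<^esub> gen 1 l"
  "1 \<le> j \<Longrightarrow> j < l \<Longrightarrow> l \<le> m \<Longrightarrow> gen 2 j \<otimes>\<^bsub>B\<^esub> gen 2 l = pw 2 \<odot>\<^bsub>B\<^esub> (gen 2 l \<otimes>\<^bsub>B\<^esub> gen 2 j)"
  "1 \<le> j \<Longrightarrow> j < l \<Longrightarrow> l \<le> m \<Longrightarrow> gen 1 j \<otimes>\<^bsub>B\<^esub> gen 2 l =
     gen 2 l \<otimes>\<^bsub>B\<^esub> gen 1 j \<oplus>\<^bsub>B\<^esub> (pw 2 \<ominus> pw (- 2)) \<odot>\<^bsub>B\<^esub> (gen 1 l \<otimes>\<^bsub>B\<^esub> gen 2 j)"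
proof -
  have inv: "inv (h \<otimes> h) = pw (- 2)"
    by (simp add: q_pw pw_inv)
  show "1 \<le> j \<Longrightarrow> j \<le> m \<Longrightarrow> gen 1 j \<in> carrier B"
    "1 \<le> j \<Longrightarrow> j \<le> m \<Longrightarrow> gen 2 j \<in> carrier B"
    "1 \<le> j \<Longrightarrow> j \<le> m \<Longrightarrow> gen 1 j \<otimes>\<^bsub>B\<^esub> gen 2 j = pw 2 \<odot>\<^bsub>B\<^esub> (gen 2 j \<otimes>\<^bsub>B\<^esub> gen 1 j)"
    "1 \<le> j \<Longrightarrow> j < l \<Longrightarrow> l \<le> m \<Longrightarrow> gen 1 j \<otimes>\<^bsub>B\<^esub> gen 1 l = pw 2 \<odot>\<^bsub>B\<^esub> (gen 1 l \<otimes>\<^bsub>B\<^esub> gen 1 j)"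
    "1 \<le> j \<Longrightarrow> j < l \<Longrightarrow> l \<le> m \<Longrightarrow> gen 1 l \<otimes>\<^bsub>B\<^esub> gen 2 j = gen 2 j \<otimes>\<^bsub>B\<^esub> gen 1 l"
    "1 \<le> j \<Longrightarrow> j < l \<Longrightarrow> l \<le> m \<Longrightarrow> gen 2 j \<otimes>\<^bsub>B\<^esub> gen 2 l = pw 2 \<odot>\<^bsub>B\<^esub> (gen 2 l \<otimes>\<^bsub>B\<^esub> gen 2 j)"
    "1 \<le> j \<Longrightarrow> j < l \<Longrightarrow> l \<le> m \<Longrightarrow> gen 1 j \<otimes>\<^bsub>B\<^esub> gen 2 l =
     gen 2 l \<otimes>\<^bsub>B\<^esub> gen 1 j \<oplus>\<^bsub>B\<^esub> (pw 2 \<ominus> pw (- 2)) \<odot>\<^bsub>B\<^esub> (gen 1 l \<otimes>\<^bsub>B\<^esub> gen 2 j)"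
    using QM.qmat_gen_relations unfolding quantum_matrix_relations_def inv unfolding q_pw
    by (simp_all only: atLeastAtMost_iff Ball_def)
qed

lemmas gen_relations' = gen_relations[unfolded One_nat_def]

lemma B_pw_swap:
  assumes "x = pw 2 \<odot>\<^bsub>B\<^esub> y" "y \<in> carrier B"
  shows "y = pw (- 2) \<odot>\<^bsub>B\<^esub> x"
  unfolding assms(1) pw_smult[OF B.assoc_algebra_axioms assms(2)] using assms(2) by simp

lemma z_in: "1 \<le> i \<Longrightarrow> i \<le> t + s \<Longrightarrow> z i \<in> carrier B"
  using s_le t_le by (auto simp: z_def intro!: gen_relations'(1,2))

sublocale S: straightening K B z t "t + s"
proof (unfold_locales)
  fix i :: nat assume "1 \<le> i" "i \<le> t + s"
  then show "z i \<in> carrier B"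
    by (rule z_in)
next
  fix d i :: nat assume d: "1 \<le> d" "d < i" and i: "i \<le> t" "i \<le> t + s"
  have "gen 1 i \<otimes>\<^bsub>B\<^esub> gen 1 d = pw (- 2) \<odot>\<^bsub>B\<^esub> (gen 1 d \<otimes>\<^bsub>B\<^esub> gen 1 i)"
    by (rule B_pw_swap, rule gen_relations) (use d i t_le in \<open>auto intro!: gen_relations'(1,2) B.A.m_closed\<close>)
  then show "\<exists>a\<in>carrier K. z i \<otimes>\<^bsub>B\<^esub> z d = a \<odot>\<^bsub>B\<^esub> (z d \<otimes>\<^bsub>B\<^esub> z i)"
    using d i by (intro bexI[of _ "pw (- 2)"]) (auto simp: z_def)
next
  fix d i :: nat assume d: "1 \<le> d" "d < i" and i: "i \<le> t + s"
  show "\<exists>a\<in>carrier K. \<exists>b\<in>carrier K. \<exists>d' i'.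
        d < d' \<and> d' \<le> t \<and> d' \<le> t + s \<and> d < i' \<and> i' \<le> t + s \<and> z i \<otimes>\<^bsub>B\<^esub> z d = a \<odot>\<^bsub>B\<^esub> (z d \<otimes>\<^bsub>B\<^esub> z i) \<oplus>\<^bsub>B\<^esub> b \<odot>\<^bsub>B\<^esub> (z d' \<otimes>\<^bsub>B\<^esub> z i')
      \<or> z i \<otimes>\<^bsub>B\<^esub> z d = a \<odot>\<^bsub>B\<^esub> (z d \<otimes>\<^bsub>B\<^esub> z i)"
  proof -
    consider (11) "i \<le> t" | (22) "t < d" | (lt) "d \<le> t" "t < i" "i - t < d"
      | (eq) "d \<le> t" "t < i" "i - t = d" | (gt) "d \<le> t" "t < i" "d < i - t"
      by linarith
    then show ?thesis
    proof cases
      case 11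
      have "gen 1 i \<otimes>\<^bsub>B\<^esub> gen 1 d = pw (- 2) \<odot>\<^bsub>B\<^esub> (gen 1 d \<otimes>\<^bsub>B\<^esub> gen 1 i)"
        by (rule B_pw_swap, rule gen_relations) (use d i 11 t_le in \<open>auto intro!: gen_relations'(1,2) B.A.m_closed\<close>)
      then show ?thesis
        using d 11 by (intro bexI[of _ "pw (- 2)"] bexI[of _ \<one>] exI) (auto simp: z_def)
    next
      case 22
      have "gen 2 (i - t) \<otimes>\<^bsub>B\<^esub> gen 2 (d - t) = pw (- 2) \<odot>\<^bsub>B\<^esub> (gen 2 (d - t) \<otimes>\<^bsub>B\<^esub> gen 2 (i - t))"
        by (rule B_pw_swap, rule gen_relations) (use d i 22 t_le s_le in \<open>auto intro!: gen_relations'(1,2) B.A.m_closed\<close>)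
      then show ?thesis
        using d 22 by (intro bexI[of _ "pw (- 2)"] bexI[of _ \<one>] exI) (auto simp: z_def)
    next
      case lt
      have "gen 1 d \<otimes>\<^bsub>B\<^esub> gen 2 (i - t) = gen 2 (i - t) \<otimes>\<^bsub>B\<^esub> gen 1 d"
        by (rule gen_relations) (use d i lt t_le s_le in auto)
      moreover have "gen 1 d \<otimes>\<^bsub>B\<^esub> gen 2 (i - t) \<in> carrier B"
        using d i lt t_le s_le by (intro B.A.m_closed gen_relations) auto
      ultimately show ?thesis
        using d lt by (intro bexI[of _ \<one>] exI) (auto simp: z_def)
    next
      case eq
      have "gen 2 d \<otimes>\<^bsub>B\<^esub> gen 1 d = pw (- 2) \<odot>\<^bsub>B\<^esub> (gen 1 d \<otimes>\<^bsub>B\<^esub> gen 2 d)"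
        by (rule B_pw_swap, rule gen_relations) (use d i eq t_le s_le in \<open>auto intro!: gen_relations'(1,2) B.A.m_closed\<close>)
      then show ?thesis
        using d eq by (intro bexI[of _ "pw (- 2)"] bexI[of _ \<one>] exI) (auto simp: z_def)
    next
      \<comment> \<open>The only reordering with a correction. It involves the first-row entry of a
        column \<open>l \<le> s\<close>, which belongs to the cell because
        \<open>s \<le> t\<close>.\<close>
      case gt
      define l where "l = i - t"
      have l: "d < l" "l \<le> s" "l \<le> m" "l \<le> t" "i = t + l" "d \<le> m"
        using gt i s_le t_le by (auto simp: l_def)
      have c: "gen 1 d \<in> carrier B" "gen 2 l \<in> carrier B" "gen 1 l \<in> carrier B" "gen 2 d \<in> carrier B"
        using d l by (auto intro!: gen_relations'(1,2))
      let ?c = "pw 2 \<ominus> pw (- 2)"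
      have "gen 1 d \<otimes>\<^bsub>B\<^esub> gen 2 l = gen 2 l \<otimes>\<^bsub>B\<^esub> gen 1 d \<oplus>\<^bsub>B\<^esub> ?c \<odot>\<^bsub>B\<^esub> (gen 1 l \<otimes>\<^bsub>B\<^esub> gen 2 d)"
        using d l by (intro gen_relations) auto
      then have "gen 2 l \<otimes>\<^bsub>B\<^esub> gen 1 d = \<one> \<odot>\<^bsub>B\<^esub> (gen 1 d \<otimes>\<^bsub>B\<^esub> gen 2 l) \<oplus>\<^bsub>B\<^esub> (\<ominus> ?c) \<odot>\<^bsub>B\<^esub> (gen 1 l \<otimes>\<^bsub>B\<^esub> gen 2 d)"
        using c by (simp add: B.smult_l_minus B.M.a_assoc B.M.r_neg)
      moreover have "z i = gen 2 l" "z d = gen 1 d" "z l = gen 1 l" "z (t + d) = gen 2 d"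
        using l gt d by (auto simp: z_def)
      ultimately show ?thesis
        using l d gt by (intro bexI[of _ "\<ominus> ?c"] bexI[of _ \<one>] exI[of _ l] exI[of _ "t + d"] disjI1) auto
    qed
  qed
qed

definition A :: "('a, ((nat \<times> nat) list \<Rightarrow> 'a) set) module" where
  "A = B\<lparr>carrier := generated_algebra K B (z ` {1..t + s})\<rparr>"

lemma z_sub: "z ` {1..t + s} \<subseteq> carrier B"
  using z_in by auto

lemma A_simps [simp]: "carrier A = generated_algebra K B (z ` {1..t + s})" "x \<otimes>\<^bsub>A\<^esub> y = x \<otimes>\<^bsub>B\<^esub> y"
  "x \<oplus>\<^bsub>A\<^esub> y = x \<oplus>\<^bsub>B\<^esub> y" "\<one>\<^bsub>A\<^esub> = \<one>\<^bsub>B\<^esub>" "\<zero>\<^bsub>A\<^esub> = \<zero>\<^bsub>B\<^esub>" "c \<odot>\<^bsub>A\<^esub> x = c \<odot>\<^bsub>B\<^esub> x"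
  by (simp_all add: A_def)

lemma A_algebra: "assoc_algebra K A"
  unfolding A_def by (rule B.assoc_algebra_generated[OF z_sub])

lemma A_carrier_B: "x \<in> carrier A \<Longrightarrow> x \<in> carrier B"
  using B.generated_algebra_closed[OF z_sub] by auto

lemma schubert_eq: "quantum_schubert_cell K (h \<otimes> h) (m + 2) (t, s) = A"
proof -
  have "z ` {1..t + s} = gen 1 ` {1..t} \<union> gen 2 ` {1..s}"
  proof (intro equalityI subsetI)
    fix x assume "x \<in> z ` {1..t + s}"
    then obtain i where i: "i \<in> {1..t + s}" "x = z i" by blast
    show "x \<in> gen 1 ` {1..t} \<union> gen 2 ` {1..s}"
    proof (cases "i \<le> t")
      case False
      then have "i - t \<in> {1..s}" using i by auto
      then show ?thesis using i False by (auto simp: z_def)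
    qed (use i in \<open>auto simp: z_def\<close>)
  next
    fix x assume "x \<in> gen 1 ` {1..t} \<union> gen 2 ` {1..s}"
    then show "x \<in> z ` {1..t + s}"
    proof
      assume "x \<in> gen 2 ` {1..s}"
      then obtain j where "j \<in> {1..s}" "x = gen 2 j" by blast
      then show ?thesis
        by (intro image_eqI[of _ _ "t + j"]) (auto simp: z_def)
    qed (auto simp: z_def)
  qed
  then show ?thesis
    by (simp add: quantum_schubert_cell_def A_def Let_def)
qed

text \<open>The universal property only gives existence; a fixed choice can be named in the
  sublocales that follow.\<close>

definition psi :: "((nat \<times> nat) list \<Rightarrow> 'a) set \<Rightarrow> (int \<Rightarrow>\<^sub>0 int) \<Rightarrow> 'a" where
  "psi = (SOME \<psi>. \<psi> \<in> algebra_hom K B T \<and> (\<forall>i j. i = 1 \<or> i = 2 \<longrightarrow> 1 \<le> j \<longrightarrow> j \<le> m \<longrightarrow> \<psi> (gen i j) = X i j))"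

lemma psi: "psi \<in> algebra_hom K B T" "i = 1 \<or> i = 2 \<Longrightarrow> 1 \<le> j \<Longrightarrow> j \<le> m \<Longrightarrow> psi (gen i j) = X i j"
proof -
  have "\<exists>\<psi>. \<psi> \<in> algebra_hom K B T \<and> (\<forall>i j. i = 1 \<or> i = 2 \<longrightarrow> 1 \<le> j \<longrightarrow> j \<le> m \<longrightarrow> \<psi> (gen i j) = X i j)"
  proof -
    obtain \<psi> where "\<psi> \<in> algebra_hom K B T" "\<And>i j. i = 1 \<or> i = 2 \<Longrightarrow> 1 \<le> j \<Longrightarrow> j \<le> m \<Longrightarrow> \<psi> (gen i j) = X i j"
      using QM.qmat_hom[OF Q.T_algebra X_relations] by blast
    then show ?thesis by blast
  qed
  from someI_ex[OF this] show "psi \<in> algebra_hom K B T"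
    "i = 1 \<or> i = 2 \<Longrightarrow> 1 \<le> j \<Longrightarrow> j \<le> m \<Longrightarrow> psi (gen i j) = X i j"
    unfolding psi_def by blast+
qed

sublocale psi: algebra_morphism K B T psi
  by unfold_locales (rule psi)

definition key :: "nat \<Rightarrow> int" where "key i = (if i \<le> t then int i else - int (i - t))"

definition xi :: "nat \<Rightarrow> (int \<Rightarrow>\<^sub>0 int)" where "xi i = (if i \<le> t then E i else Y (i - t))"

lemma lookup_xi:
  assumes "1 \<le> i" "1 \<le> k"
  shows "Poly_Mapping.lookup (xi i) (key k) = (if i = k then 1 else 0)"
  using assms by (auto simp: xi_def key_def lookup_EYU)

definition lexp :: "nat list \<Rightarrow> (int \<Rightarrow>\<^sub>0 int)" where "lexp w = sum_list (map xi w)"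

lemma lookup_lexp:
  assumes "set w \<subseteq> {1..t + s}" "1 \<le> k"
  shows "Poly_Mapping.lookup (lexp w) (key k) = int (count (mset w) k)"
  using assms(1)
proof (induction w)
  case (Cons i w)
  then show ?case
    using assms(2) by (simp add: lexp_def lookup_add lookup_xi)
qed (simp add: lexp_def)

text \<open>The keys read the multiplicity of each letter off the exponent, and a sorted word is
  determined by its multiset of letters.\<close>

lemma lexp_inj:
  assumes "w \<in> S.words 1" "w' \<in> S.words 1" "lexp w = lexp w'"
  shows "w = w'"
proof -
  have sub: "set w \<subseteq> {1..t + s}" "set w' \<subseteq> {1..t + s}"
    using assms by (auto simp: S.words_def)
  have "mset w = mset w'"
  proof (rule multiset_eqI)
    fix k
    show "count (mset w) k = count (mset w') k"
    proof (cases "1 \<le> k")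
      case True
      then show ?thesis
        using lookup_lexp[OF sub(1) True] lookup_lexp[OF sub(2) True] assms(3) by simp
    next
      case False
      then have "count (mset w) k = 0" "count (mset w') k = 0"
        using sub by (auto simp: count_mset_0_iff)
      then show ?thesis
        by (simp only:)
    qed
  qed
  then show ?thesis
    using assms by (auto simp: S.words_def dest: properties_for_sort sorted_sort_id)
qed

lemma psi_z:
  assumes "1 \<le> i" "i \<le> t + s"
  shows "psi (z i) \<noteq> \<zero>\<^bsub>T\<^esub>" "Q.lead (psi (z i)) = xi i"
  using assms t_le s_le psi(2)[of 1 i] psi(2)[of 2 "i - t"]
  by (auto simp: z_def xi_def lead_X lead_X[unfolded One_nat_def])

lemma psi_mon:
  assumes "set w \<subseteq> {1..t + s}"
  shows "psi (S.mon w) \<noteq> \<zero>\<^bsub>T\<^esub> \<and> Q.lead (psi (S.mon w)) = lexp w"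
  using assms
proof (induction w)
  case Nil
  show ?case
    using Q.lead_delta[of 0] Q.delta_ne[of 0] by (simp add: psi.hom_simps lexp_def Q.T_ops(1))
next
  case (Cons i w)
  then have i: "1 \<le> i" "i \<le> t + s" and w: "set w \<subseteq> {1..t + s}"
    by auto
  have c: "psi (z i) \<in> carrier T" "psi (S.mon w) \<in> carrier T"
    using z_in[OF i] S.mon_in[OF w] by (auto intro: psi.hom_simps)
  have "psi (S.mon (i # w)) = psi (z i) \<otimes>\<^bsub>T\<^esub> psi (S.mon w)"
    using z_in[OF i] S.mon_in[OF w] by (simp add: psi.hom_simps)
  then show ?case
    using Q.lead_mult[OF c(1) psi_z(1)[OF i] c(2)] Cons w psi_z(2)[OF i] by (simp add: lexp_def)
qed

definition C :: "(int \<Rightarrow>\<^sub>0 int) set" where "C = lexp ` {w. set w \<subseteq> {1..t + s}}"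

text \<open>In the normal form of \<open>a\<close> the words have pairwise distinct leading
  exponents by \<open>lexp_inj\<close>, so the coefficient at the largest one comes from the single
  word \<open>w0\<close> and survives.\<close>

lemma psi_lead:
  assumes a: "a \<in> carrier A" "a \<noteq> \<zero>\<^bsub>A\<^esub>"
  shows "psi a \<noteq> \<zero>\<^bsub>T\<^esub>" "Q.lead (psi a) \<in> C"
proof -
  have "a \<in> S.SP 1"
    using S.generated_SP a(1) by auto
  from S.SP_normal_form[OF this] obtain F c where F0: "finite F" "F \<subseteq> S.words 1"
      "\<forall>w\<in>F. c w \<in> carrier K - {\<zero>}" and F4: "a = finsum B (\<lambda>w. c w \<odot>\<^bsub>B\<^esub> S.mon w) F"
    by blast
  note F = F0(1,2) bspec[OF F0(3)] F4
  have "F \<noteq> {}"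
    using F4 a(2) by auto
  then have "Max (lexp ` F) \<in> lexp ` F"
    using F(1) by (intro Max_in) auto
  then obtain w0 where "w0 \<in> F" "Max (lexp ` F) = lexp w0"
    by blast
  then have w0: "w0 \<in> F" "\<And>w. w \<in> F \<Longrightarrow> lexp w \<le> lexp w0"
    using F(1) Max_ge[of "lexp ` F"] by auto
  have sub: "set w \<subseteq> {1..t + s}" if "w \<in> F" for w
    using F(2) that by (auto simp: S.words_def)
  have monc: "S.mon w \<in> carrier B" if "w \<in> F" for w
    using sub[OF that] by simp
  have "psi a = finsum T (\<lambda>w. psi (c w \<odot>\<^bsub>B\<^esub> S.mon w)) F"
    unfolding F(4) using F monc by (intro psi.hom_finsum) auto
  also have "\<dots> = finsum T (\<lambda>w. c w \<odot>\<^bsub>T\<^esub> psi (S.mon w)) F"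
    using F monc by (intro Q.T.M.add.finprod_cong') (auto simp: psi.hom_simps)
  finally have app: "psi a v = (\<Oplus>w\<in>F. c w \<otimes> psi (S.mon w) v)" for v
    using F monc by (simp add: Q.finsum_T_apply psi.hom_simps Pi_iff) (simp add: Q.T_ops)
  have zero: "psi (S.mon w) v = \<zero>" if "w \<in> F" "lexp w < v" for w v
    using Q.lead_ge[of "psi (S.mon w)" v] psi_mon[OF sub[OF that(1)]] that monc[OF that(1)]
    by (auto simp: psi.hom_simps Q.supp_def not_le[symmetric])
  have pc: "psi (S.mon w) v \<in> carrier K" if "w \<in> F" for w v
    using Q.carrier_TD[of "psi (S.mon w)"] monc[OF that] by (simp add: psi.hom_simps)
  have big: "psi a v = \<zero>" if "lexp w0 < v" for v
    unfolding app
  proof (rule K.add.finprod_one_eqI)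
    fix w assume w: "w \<in> F"
    then have "lexp w < v" using w0(2)[OF w] that by simp
    then show "c w \<otimes> psi (S.mon w) v = \<zero>"
      using zero[OF w] F(3)[OF w] by simp
  qed
  have "psi a (lexp w0) = (\<Oplus>w\<in>{w0}. c w \<otimes> psi (S.mon w) (lexp w0))"
    unfolding app
  proof (rule K.add.finprod_mono_neutral_cong_right)
    fix w assume w: "w \<in> F - {w0}"
    then have "lexp w \<noteq> lexp w0"
      using lexp_inj[of w w0] w0(1) F(2) by auto
    then have "lexp w < lexp w0"
      using w0(2)[of w] w by simp
    then show "c w \<otimes> psi (S.mon w) (lexp w0) = \<zero>"
      using zero[of w] F(3)[of w] w by auto
  qed (use F w0 pc in auto)
  also have "\<dots> = c w0 \<otimes> psi (S.mon w0) (lexp w0)"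
    using F(3)[OF w0(1)] pc[OF w0(1)] by (simp add: K.finsum_insert)
  also have "\<dots> \<noteq> \<zero>"
  proof -
    have "psi (S.mon w0) \<in> carrier T"
      using monc[OF w0(1)] by (rule psi.hom_simps)
    then have "psi (S.mon w0) (lexp w0) \<noteq> \<zero>"
      using Q.lead_in(2)[of "psi (S.mon w0)"] psi_mon[OF sub[OF w0(1)]] by simp
    then show ?thesis
      using F(3)[OF w0(1)] pc[OF w0(1)] by (simp add: K.integral_iff)
  qed
  finally have ne: "psi a (lexp w0) \<noteq> \<zero>" .
  then show "psi a \<noteq> \<zero>\<^bsub>T\<^esub>"
    by (auto simp: Q.T_ops)
  have "Q.lead (psi a) = lexp w0"
    by (rule Q.leadI) (use ne big psi.hom_simps(1)[OF A_carrier_B[OF a(1)]] in auto)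
  then show "Q.lead (psi a) \<in> C"
    using sub[OF w0(1)] by (auto simp: C_def)
qed

lemma psi_inj: "inj_on psi (carrier A)"
proof (rule inj_onI)
  fix x y assume xy: "x \<in> carrier A" "y \<in> carrier A" "psi x = psi y"
  interpret A: assoc_algebra K A by (rule A_algebra)
  \<comment> \<open>Subtraction in the subalgebra refers to its own additive group; it agrees with
    that of \<open>B\<close> because both negatives are multiples by \<open>-1\<close>.\<close>
  have minus: "x \<ominus>\<^bsub>A\<^esub> y = x \<ominus>\<^bsub>B\<^esub> y"
  proof -
    have "\<ominus>\<^bsub>A\<^esub> y = \<ominus>\<^bsub>B\<^esub> y"
      using A.smult_l_minus[of \<one> y] B.smult_l_minus[of \<one> y] xy(2) A_carrier_B[OF xy(2)]
      by (metis A.smult_one A_simps(6) B.smult_one K.one_closed)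
    then show ?thesis
      by (simp add: a_minus_def)
  qed
  have "psi (x \<ominus>\<^bsub>A\<^esub> y) = psi y \<ominus>\<^bsub>T\<^esub> psi y"
    unfolding minus psi.hom_minus[OF A_carrier_B[OF xy(1)] A_carrier_B[OF xy(2)]] xy(3) ..
  also have "\<dots> = \<zero>\<^bsub>T\<^esub>"
    unfolding a_minus_def by (rule Q.T.M.r_neg[OF psi.hom_simps(1)[OF A_carrier_B[OF xy(2)]]])
  finally have "psi (x \<ominus>\<^bsub>A\<^esub> y) = \<zero>\<^bsub>T\<^esub>" .
  then have "x \<ominus>\<^bsub>A\<^esub> y = \<zero>\<^bsub>A\<^esub>"
    using psi_lead(1)[of "x \<ominus>\<^bsub>A\<^esub> y"] A.M.minus_closed[OF xy(1,2)] by blast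
  then show "x = y"
    using A.A.r_right_minus_eq xy by blast
qed

lemma A_valued: "valued_algebra K A (\<lambda>a. Q.lead (psi a)) C {1..t + s} (\<lambda>\<gamma> k. nat (Poly_Mapping.lookup \<gamma> (key k)))"
proof (intro valued_algebra.intro valued_algebra_axioms.intro A_algebra)
  interpret A: assoc_algebra K A by (rule A_algebra)
  note zero_iff = psi_lead(1)
  have pc: "psi a \<in> carrier T" if "a \<in> carrier A" for a
    using A_carrier_B[OF that] by (rule psi.hom_simps)
  show "\<one>\<^bsub>A\<^esub> \<noteq> \<zero>\<^bsub>A\<^esub>"
  proof
    assume "\<one>\<^bsub>A\<^esub> = \<zero>\<^bsub>A\<^esub>"
    then have "\<one>\<^bsub>T\<^esub> = \<zero>\<^bsub>T\<^esub>"
      using psi.hom_simps(4) psi.hom_zero by simp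
    then show False
      using Q.delta_ne[of 0] by (simp add: Q.T_ops(1))
  qed
  show "Q.lead (psi a) \<in> C" if "a \<in> carrier A" "a \<noteq> \<zero>\<^bsub>A\<^esub>" for a
    using psi_lead(2) that .
  show "\<exists>a\<in>carrier A. a \<noteq> \<zero>\<^bsub>A\<^esub> \<and> Q.lead (psi a) = \<gamma>" if \<gamma>: "\<gamma> \<in> C" for \<gamma>
  proof -
    obtain w where w: "set w \<subseteq> {1..t + s}" "\<gamma> = lexp w"
      using \<gamma> by (auto simp: C_def)
    have "S.mon w \<in> carrier A"
      using w(1)
    proof (induction w)
      case (Cons i w)
      then have "z i \<in> carrier A" "S.mon w \<in> carrier A"
        by (auto intro: generated_algebra.incl)
      then show ?case
        by (simp add: generated_algebra.mult)
    qed (simp add: generated_algebra.one)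
    moreover have "S.mon w \<noteq> \<zero>\<^bsub>A\<^esub>"
      using psi_mon[OF w(1)] psi.hom_zero by auto
    ultimately show ?thesis
      using psi_mon[OF w(1)] w(2) by blast
  qed
  show "a \<otimes>\<^bsub>A\<^esub> b \<noteq> \<zero>\<^bsub>A\<^esub> \<and> Q.lead (psi (a \<otimes>\<^bsub>A\<^esub> b)) = Q.lead (psi a) + Q.lead (psi b)"
    if "a \<in> carrier A" "b \<in> carrier A" "a \<noteq> \<zero>\<^bsub>A\<^esub>" "b \<noteq> \<zero>\<^bsub>A\<^esub>" for a b
  proof -
    have "psi (a \<otimes>\<^bsub>A\<^esub> b) = psi a \<otimes>\<^bsub>T\<^esub> psi b"
      using that A_carrier_B by (simp only: A_simps(2) psi.hom_simps(2))
    then show ?thesis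
      using Q.lead_mult[OF pc[OF that(1)] zero_iff[OF that(1,3)] pc[OF that(2)] zero_iff[OF that(2,4)]]
        psi.hom_zero by auto
  qed
  show "\<exists>k\<in>carrier K. \<exists>d\<in>carrier A. a = k \<odot>\<^bsub>A\<^esub> b \<oplus>\<^bsub>A\<^esub> d \<and> (d = \<zero>\<^bsub>A\<^esub> \<or> Q.lead (psi d) < Q.lead (psi a))"
    if a: "a \<in> carrier A" "a \<noteq> \<zero>\<^bsub>A\<^esub>" and b: "b \<in> carrier A" "b \<noteq> \<zero>\<^bsub>A\<^esub>"
      and lead: "Q.lead (psi a) = Q.lead (psi b)" for a b
  proof -
    let ?v = "Q.lead (psi a)"
    \<comment> \<open>The quotient of the leading coefficients, so that \<open>a - k b\<close> loses
      the leading term.\<close>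
    define k where "k = psi a ?v \<otimes> inv (psi b ?v)"
    have ne: "psi b ?v \<noteq> \<zero>" "psi b ?v \<in> carrier K" "psi a ?v \<in> carrier K"
      using Q.lead_in(2)[OF pc[OF b(1)] zero_iff[OF b]] lead Q.carrier_TD[OF pc[OF b(1)]]
        Q.carrier_TD[OF pc[OF a(1)]] by auto
    have inv: "inv (psi b ?v) \<in> carrier K" "inv (psi b ?v) \<otimes> psi b ?v = \<one>"
      using ne by (auto simp: field_Units)
    have k: "k \<in> carrier K" "k \<otimes> psi b ?v = psi a ?v"
      using ne inv by (auto simp: k_def K.m_assoc)
    define d where "d = a \<ominus>\<^bsub>A\<^esub> k \<odot>\<^bsub>A\<^esub> b"
    have kb: "k \<odot>\<^bsub>A\<^esub> b \<in> carrier A"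
      using k b A.smult_closed by blast
    have d: "d \<in> carrier A"
      unfolding d_def by (rule A.M.minus_closed[OF a(1) kb])
    have a_eq: "a = k \<odot>\<^bsub>A\<^esub> b \<oplus>\<^bsub>A\<^esub> d"
      unfolding d_def a_minus_def using a(1) kb A.M.a_comm[OF a(1)] A.M.r_neg2[OF kb a(1)]
      by (metis A.M.a_inv_closed)
    have psi_a: "psi a v = k \<otimes> psi b v \<oplus> psi d v" for v
    proof -
      have "psi a = k \<odot>\<^bsub>T\<^esub> psi b \<oplus>\<^bsub>T\<^esub> psi d"
        using a_eq k(1) A_carrier_B[OF b(1)] A_carrier_B[OF d] A_carrier_B[OF kb]
        by (metis A_simps(3,6) psi.hom_simps(3,5))
      then show ?thesis by (simp add: Q.T_ops)
    qed
    note dc = Q.carrier_TD[OF pc[OF d]] and bc = Q.carrier_TD[OF pc[OF b(1)]]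
    have "Q.lead (psi d) < ?v" if "d \<noteq> \<zero>\<^bsub>A\<^esub>"
    proof -
      have l: "psi d (Q.lead (psi d)) \<noteq> \<zero>"
        using Q.lead_in(2)[OF pc[OF d] zero_iff[OF d that]] .
      have "psi d ?v = \<zero>"
        using psi_a[of ?v] k ne dc[of ?v] by simp
      then have "Q.lead (psi d) \<noteq> ?v"
        using l by auto
      moreover have "\<not> ?v < Q.lead (psi d)"
      proof
        assume less: "?v < Q.lead (psi d)"
        have "psi a (Q.lead (psi d)) = \<zero>" "psi b (Q.lead (psi d)) = \<zero>"
          using Q.lead_ge[OF pc[OF a(1)], of "Q.lead (psi d)"] Q.lead_ge[OF pc[OF b(1)], of "Q.lead (psi d)"]
            less lead by (auto simp: Q.supp_def not_le[symmetric])
        then show False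
          using psi_a[of "Q.lead (psi d)"] k(1) l dc[of "Q.lead (psi d)"] by simp
      qed
      ultimately show ?thesis by simp
    qed
    then show ?thesis
      using k(1) d a_eq by blast
  qed
  show "\<beta> - \<alpha> \<in> C" if \<alpha>: "\<alpha> \<in> C" and \<beta>: "\<beta> \<in> C"
    and le: "\<And>k. k \<in> {1..t + s} \<Longrightarrow> nat (Poly_Mapping.lookup \<alpha> (key k)) \<le> nat (Poly_Mapping.lookup \<beta> (key k))" for \<alpha> \<beta>
  proof -
    obtain v w where v: "set v \<subseteq> {1..t + s}" "\<alpha> = lexp v" and w: "set w \<subseteq> {1..t + s}" "\<beta> = lexp w"
      using \<alpha> \<beta> by (auto simp: C_def)
    \<comment> \<open>Elements of \<open>C\<close> are given by multisets of letters, and the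
      difference of two comparable ones by the multiset difference.\<close>
    have "mset v \<subseteq># mset w"
    proof (rule mset_subset_eqI)
      fix k
      show "count (mset v) k \<le> count (mset w) k"
      proof (cases "k \<in> {1..t + s}")
        case True
        then show ?thesis
          using le[OF True] v w lookup_lexp[of _ k] by simp
      next
        case False
        then have "count (mset v) k = 0"
          using v by (auto simp: count_mset_0_iff)
        then show ?thesis by (simp only: le0)
      qed
    qed
    then obtain M where M: "mset w = mset v + M"
      by (metis subset_mset.add_diff_inverse)
    obtain u where u: "mset u = M"
      using ex_mset by blast
    have "lexp w = lexp v + lexp u"
    proof -
      have "lexp w' = sum_mset (image_mset xi (mset w'))" for w'
        by (simp add: lexp_def sum_mset_sum_list[symmetric])
      then show ?thesis
        using M u by simp
    qed
    moreover have "set u \<subseteq> {1..t + s}"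
    proof -
      have "set_mset (mset u) \<subseteq> set_mset (mset w)"
        using M u by simp
      then show ?thesis using w by simp
    qed
    ultimately show ?thesis
      using v w by (auto simp: C_def)
  qed
  show "0 \<le> \<gamma>" if "\<gamma> \<in> C" for \<gamma>
  proof -
    have xi: "0 \<le> xi i" for i
    proof -
      have "0 < E j" if "j \<noteq> 0" for j
        by (rule poly_mapping_lessI[of _ "int j"]) (use that in \<open>auto simp: lookup_EYU\<close>)
      moreover have "0 < Y l" for l
        by (rule poly_mapping_lessI[of _ "- int l"]) (auto simp: lookup_EYU)
      ultimately show ?thesis
        by (auto simp: xi_def less_imp_le E_def)
    qed
    have "0 \<le> lexp w" for w
      by (induction w) (auto simp: lexp_def xi add_nonneg_nonneg)
    then show ?thesis using that by (auto simp: C_def)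
  qed
qed simp

end

locale skew_algebra = assoc_algebra K F for K (structure) and F (structure) +
  assumes skew: "skew_field F"
begin

lemma unit_iff: "x \<in> Units F \<longleftrightarrow> x \<in> carrier F \<and> x \<noteq> \<zero>\<^bsub>F\<^esub>"
  using skew by (auto simp: skew_field_def)

lemma smult_unit:
  assumes "c \<in> carrier K" "c \<noteq> \<zero>" "x \<in> Units F"
  shows "c \<odot>\<^bsub>F\<^esub> x \<in> Units F" "inv\<^bsub>F\<^esub> (c \<odot>\<^bsub>F\<^esub> x) = inv c \<odot>\<^bsub>F\<^esub> inv\<^bsub>F\<^esub> x"
proof -
  have c: "inv c \<in> carrier K" "c \<otimes> inv c = \<one>" "inv c \<otimes> c = \<one>"
    using assms by (simp_all add: K.field_Units)
  have x: "x \<in> carrier F" "inv\<^bsub>F\<^esub> x \<in> carrier F" "x \<otimes>\<^bsub>F\<^esub> inv\<^bsub>F\<^esub> x = \<one>\<^bsub>F\<^esub>" "inv\<^bsub>F\<^esub> x \<otimes>\<^bsub>F\<^esub> x = \<one>\<^bsub>F\<^esub>"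
    using assms by (simp_all add: A.Units_closed)
  have 1: "(c \<odot>\<^bsub>F\<^esub> x) \<otimes>\<^bsub>F\<^esub> (inv c \<odot>\<^bsub>F\<^esub> inv\<^bsub>F\<^esub> x) = \<one>\<^bsub>F\<^esub>"
    using c x assms by (simp add: smult_mult_left smult_mult_right flip: smult_assoc1)
  have 2: "(inv c \<odot>\<^bsub>F\<^esub> inv\<^bsub>F\<^esub> x) \<otimes>\<^bsub>F\<^esub> (c \<odot>\<^bsub>F\<^esub> x) = \<one>\<^bsub>F\<^esub>"
    using c x assms by (simp add: smult_mult_left smult_mult_right flip: smult_assoc1)
  show "c \<odot>\<^bsub>F\<^esub> x \<in> Units F"
    unfolding Units_def using 1 2 c x assms by blast
  show "inv\<^bsub>F\<^esub> (c \<odot>\<^bsub>F\<^esub> x) = inv c \<odot>\<^bsub>F\<^esub> inv\<^bsub>F\<^esub> x"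
    by (rule A.inv_unique'[symmetric, OF _ _ 1 2]) (use c x assms in auto)
qed

lemma unit_cancel_right:
  assumes "u \<in> Units F" "x \<in> carrier F" "y \<in> carrier F" "x \<otimes>\<^bsub>F\<^esub> u = y \<otimes>\<^bsub>F\<^esub> u"
  shows "x = y"
proof -
  have u: "u \<in> carrier F" "inv\<^bsub>F\<^esub> u \<in> carrier F" "u \<otimes>\<^bsub>F\<^esub> inv\<^bsub>F\<^esub> u = \<one>\<^bsub>F\<^esub>"
    using assms by (simp_all add: A.Units_closed)
  have "x \<otimes>\<^bsub>F\<^esub> (u \<otimes>\<^bsub>F\<^esub> inv\<^bsub>F\<^esub> u) = y \<otimes>\<^bsub>F\<^esub> (u \<otimes>\<^bsub>F\<^esub> inv\<^bsub>F\<^esub> u)"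
    using assms(4) assms(2,3) u by (metis A.m_assoc)
  then show ?thesis
    using assms u by simp
qed

end

section \<open>The subtorus belonging to the cell, denominators, and the common skew field\<close>

context schubert_cell
begin

text \<open>The full torus has two exponents for each of the \<open>m\<close> columns, but the cell
  has only \<open>t + s\<close> generators; its skew field is that of the subtorus with exponents in
  \<open>HH\<close>.\<close>

definition HH :: "(int \<Rightarrow>\<^sub>0 int) set" where
  "HH = {e. \<forall>i. Poly_Mapping.lookup e i \<noteq> 0 \<longrightarrow> i \<in> key ` {1..t + s}}"

lemma HH_add: "a \<in> HH \<Longrightarrow> b \<in> HH \<Longrightarrow> a + b \<in> HH"
  unfolding HH_def mem_Collect_eq lookup_add by (metis add.right_neutral)

lemma HH_uminus: "a \<in> HH \<Longrightarrow> - a \<in> HH"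
  by (simp add: HH_def)

lemma HH_diff: "a \<in> HH \<Longrightarrow> b \<in> HH \<Longrightarrow> a - b \<in> HH"
  using HH_add[of a "- b"] HH_uminus[of b] by simp

lemma HH_zero: "0 \<in> HH"
  by (simp add: HH_def)

lemma key_E: "1 \<le> j \<Longrightarrow> j \<le> t \<Longrightarrow> int j \<in> key ` {1..t + s}"
  by (intro image_eqI[of _ _ j]) (auto simp: key_def)

lemma key_Y: "1 \<le> l \<Longrightarrow> l \<le> s \<Longrightarrow> - int l \<in> key ` {1..t + s}"
  by (intro image_eqI[of _ _ "t + l"]) (auto simp: key_def)

lemma E_HH: "j \<le> t \<Longrightarrow> E j \<in> HH"
  using key_E[of j] by (cases "j = 0") (auto simp: HH_def lookup_EYU)

lemma Y_HH: "1 \<le> l \<Longrightarrow> l \<le> s \<Longrightarrow> Y l \<in> HH"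
  using key_Y[of l] by (auto simp: HH_def lookup_EYU)

lemma U_HH: "1 \<le> l \<Longrightarrow> l \<le> s \<Longrightarrow> U l \<in> HH"
  using Y_HH[of l] E_HH[of l] HH_diff s_le by (simp add: U_def)

sublocale R: quantum_torus K h "Lam m" HH
  by unfold_locales (auto simp: Lam_add HH_zero HH_add)

lemma R_ops:
  "x \<otimes>\<^bsub>R.T\<^esub> y = x \<otimes>\<^bsub>T\<^esub> y" "x \<oplus>\<^bsub>R.T\<^esub> y = x \<oplus>\<^bsub>T\<^esub> y" "c \<odot>\<^bsub>R.T\<^esub> x = c \<odot>\<^bsub>T\<^esub> x"
  "\<one>\<^bsub>R.T\<^esub> = \<one>\<^bsub>T\<^esub>" "\<zero>\<^bsub>R.T\<^esub> = \<zero>\<^bsub>T\<^esub>"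
  unfolding R.T_def Q.T_def twisted_algebra_def
  by (simp_all only: partial_object.simps monoid.simps ring.simps module.simps)

lemma R_carrier: "f \<in> carrier R.T \<longleftrightarrow> f \<in> carrier T \<and> Q.supp f \<subseteq> HH"
  unfolding R.carrier_T Q.carrier_T by blast

lemma R_sub: "f \<in> carrier R.T \<Longrightarrow> f \<in> carrier T"
  by (simp add: R_carrier)

lemma M_R: "w \<in> HH \<Longrightarrow> M w \<in> carrier R.T"
  using R.delta_closed .

lemma W_R:
  assumes "e \<in> HH" "l \<le> s"
  shows "W e j l \<in> carrier R.T"
proof -
  \<comment> \<open>\<open>finsum\<close> depends on the carrier, so agreement of sums in the two
    tori has to be proved by induction.\<close>
  have "finsum R.T (\<lambda>k. M (e + U k)) S = finsum T (\<lambda>k. M (e + U k)) S" if "finite S" "S \<subseteq> {j<..l}" for S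
    using that
  proof (induction S)
    case (insert k S)
    have "M (e + U k') \<in> carrier R.T" if "k' \<in> insert k S" for k'
      using insert.prems that assms by (intro M_R HH_add U_HH) auto
    then show ?case
      using insert by (subst R.T.M.finsum_insert, auto) (simp add: R_ops)
  qed (simp add: R_ops)
  then have "W e j l = finsum R.T (\<lambda>k. M (e + U k)) {j<..l}"
    by (simp add: W_def)
  also have "\<dots> \<in> carrier R.T"
    using assms by (intro R.T.M.finsum_closed) (auto intro!: M_R HH_add U_HH)
  finally show ?thesis .
qed

lemma N_R:
  assumes "j < l" "l \<le> s \<or> j \<le> t"
  shows "N s j l \<in> carrier R.T"
  using assms s_le by (auto simp: N_def intro!: W_R M_R HH_add E_HH)

lemma psi_R:
  assumes "a \<in> carrier A"
  shows "psi a \<in> carrier R.T"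
proof -
  have z: "psi (z i) \<in> carrier R.T" if "i \<in> {1..t + s}" for i
    using that psi(2)[of 1 i] psi(2)[of 2 "i - t"] s_le t_le
    by (auto simp: z_def X_def R_ops(3)[symmetric] intro!: M_R W_R E_HH R.T_smult_closed)
  show ?thesis
    using assms unfolding A_simps
  proof induction
    case (incl x)
    then show ?case using z by auto
  next
    case one
    then show ?case using R.T.A.one_closed by (simp add: psi.hom_simps R_ops)
  next
    case (add x y)
    then show ?case
      using R.T.M.a_closed[of "psi x" "psi y"] A_carrier_B by (simp add: psi.hom_simps R_ops)
  next
    case (mult x y)
    then show ?case
      using R.T.A.m_closed[of "psi x" "psi y"] A_carrier_B by (simp add: psi.hom_simps R_ops)
  next
    case (smult c x)
    then show ?case
      using R.T.smult_closed[of c "psi x"] A_carrier_B by (simp add: psi.hom_simps R_ops)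
  qed
qed

lemma psi_R_hom: "psi \<in> algebra_hom K A R.T"
proof (rule algebra_homI)
  show "psi x \<in> carrier R.T" if "x \<in> carrier A" for x
    using psi_R that .
  show "psi (x \<otimes>\<^bsub>A\<^esub> y) = psi x \<otimes>\<^bsub>R.T\<^esub> psi y" if "x \<in> carrier A" "y \<in> carrier A" for x y
    unfolding A_simps R_ops using that[THEN A_carrier_B] by (rule psi.hom_simps)
  show "psi (x \<oplus>\<^bsub>A\<^esub> y) = psi x \<oplus>\<^bsub>R.T\<^esub> psi y" if "x \<in> carrier A" "y \<in> carrier A" for x y
    unfolding A_simps R_ops using that[THEN A_carrier_B] by (rule psi.hom_simps)
  show "psi \<one>\<^bsub>A\<^esub> = \<one>\<^bsub>R.T\<^esub>"
    unfolding A_simps R_ops by (rule psi.hom_simps)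
  show "psi (c \<odot>\<^bsub>A\<^esub> x) = c \<odot>\<^bsub>R.T\<^esub> psi x" if "c \<in> carrier K" "x \<in> carrier A" for c x
    unfolding A_simps R_ops using that(1) that(2)[THEN A_carrier_B] by (rule psi.hom_simps)
qed

sublocale A: assoc_algebra K A
  by (rule A_algebra)

sublocale psiR: algebra_morphism K A R.T psi
  by unfold_locales (rule psi_R_hom)

definition img :: "((int \<Rightarrow>\<^sub>0 int) \<Rightarrow> 'a) set" where "img = psi ` carrier A"

lemma img_ops:
  "x \<in> img \<Longrightarrow> y \<in> img \<Longrightarrow> x \<otimes>\<^bsub>T\<^esub> y \<in> img" "x \<in> img \<Longrightarrow> y \<in> img \<Longrightarrow> x \<oplus>\<^bsub>T\<^esub> y \<in> img"
  "c \<in> carrier K \<Longrightarrow> x \<in> img \<Longrightarrow> c \<odot>\<^bsub>T\<^esub> x \<in> img" "x \<in> img \<Longrightarrow> x \<in> carrier T"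
proof -
  show "x \<otimes>\<^bsub>T\<^esub> y \<in> img" "x \<oplus>\<^bsub>T\<^esub> y \<in> img" if xy: "x \<in> img" "y \<in> img"
  proof -
    obtain a b where ab: "x = psi a" "a \<in> carrier A" "y = psi b" "b \<in> carrier A"
      using xy unfolding img_def by blast
    show "x \<otimes>\<^bsub>T\<^esub> y \<in> img"
      unfolding img_def ab
      by (rule image_eqI[OF _ A.A.m_closed[OF ab(2,4)]]) (simp only: psiR.hom_simps ab R_ops)
    show "x \<oplus>\<^bsub>T\<^esub> y \<in> img"
      unfolding img_def ab
      by (rule image_eqI[OF _ A.M.a_closed[OF ab(2,4)]]) (simp only: psiR.hom_simps ab R_ops)
  qed
  show "c \<odot>\<^bsub>T\<^esub> x \<in> img" if c: "c \<in> carrier K" "x \<in> img"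
  proof -
    obtain a where a: "x = psi a" "a \<in> carrier A"
      using c unfolding img_def by blast
    show ?thesis
      unfolding img_def a
      by (rule image_eqI[OF _ A.smult_closed[OF c(1) a(2)]]) (simp only: psiR.hom_simps c a R_ops)
  qed
  show "x \<in> img \<Longrightarrow> x \<in> carrier T"
    unfolding img_def using R_sub psi_R by blast
qed

lemma img_minus: "x \<in> img \<Longrightarrow> y \<in> img \<Longrightarrow> x \<ominus>\<^bsub>T\<^esub> y \<in> img"
proof -
  assume xy: "x \<in> img" "y \<in> img"
  then have "x \<ominus>\<^bsub>T\<^esub> y = x \<oplus>\<^bsub>T\<^esub> (\<ominus> \<one>) \<odot>\<^bsub>T\<^esub> y"
    using img_ops(4) by (simp add: a_minus_def Q.T.smult_l_minus)
  then show ?thesis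
    using xy img_ops(2,3) by simp
qed

lemma X_img: "1 \<le> j \<Longrightarrow> j \<le> t \<Longrightarrow> X 1 j \<in> img" "1 \<le> j \<Longrightarrow> j \<le> s \<Longrightarrow> X 2 j \<in> img"
proof -
  show "X 1 j \<in> img" if "1 \<le> j" "j \<le> t"
    unfolding img_def using that t_le psi(2)[of 1 j]
    by (intro image_eqI[of _ _ "z j"]) (auto simp: z_def intro!: generated_algebra.incl image_eqI[of _ _ j])
  show "X 2 j \<in> img" if "1 \<le> j" "j \<le> s"
    unfolding img_def using that t_le s_le psi(2)[of 2 j]
    by (intro image_eqI[of _ _ "z (t + j)"]) (auto simp: z_def intro!: generated_algebra.incl image_eqI[of _ _ "t + j"])
qed

text \<open>Since coefficients are not inverted, every cluster variable has to be a polynomial in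
  the generators. All of them will be minors \<open>N\<close>, and \<open>minor_identity\<close>
  expresses these.\<close>

lemma N_img:
  assumes "j < l" "l \<le> s \<or> 1 \<le> j \<and> j \<le> t"
  shows "N s j l \<in> img"
proof -
  consider "s < l" | "l \<le> s" "j = 0" | "l \<le> s" "1 \<le> j"
    by linarith
  then show ?thesis
  proof cases
    case 1
    then show ?thesis
      using assms X_img(1)[of j] by (simp add: N_def X_def)
  next
    case 2
    then show ?thesis
      using assms X_img(2)[of l] by (simp add: first_row_two img_ops)
  next
    case 3
    have "pw 1 \<odot>\<^bsub>T\<^esub> N s j l = X 1 j \<otimes>\<^bsub>T\<^esub> X 2 l \<ominus>\<^bsub>T\<^esub> pw 2 \<odot>\<^bsub>T\<^esub> (X 1 l \<otimes>\<^bsub>T\<^esub> X 2 j)"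
      using 3 assms s_le t_le by (intro minor_identity) auto
    also have "\<dots> \<in> img"
      using 3 assms s_le by (intro img_minus img_ops X_img pw_in) auto
    finally have "pw (- 1) \<odot>\<^bsub>T\<^esub> (pw 1 \<odot>\<^bsub>T\<^esub> N s j l) \<in> img"
      by (rule img_ops(3)[OF pw_in])
    then show ?thesis by simp
  qed
qed

lemma HH_induct [consumes 1, case_names zero add uminus E Y]:
  assumes "w \<in> HH" and "P 0" and "\<And>a b. P a \<Longrightarrow> P b \<Longrightarrow> P (a + b)" and "\<And>a. P a \<Longrightarrow> P (- a)"
    and "\<And>j. 1 \<le> j \<Longrightarrow> j \<le> t \<Longrightarrow> P (E j)" and "\<And>l. 1 \<le> l \<Longrightarrow> l \<le> s \<Longrightarrow> P (Y l)"
  shows "P w"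
proof -
  have nat: "P (Poly_Mapping.single i (int n))" if "P (Poly_Mapping.single i 1)" for i n
  proof (induction n)
    case (Suc n)
    have "Poly_Mapping.single i (int (Suc n)) = Poly_Mapping.single i (int n) + Poly_Mapping.single i 1"
      by (simp add: single_add[symmetric] add.commute)
    then show ?case
      using assms(3)[OF Suc that] by simp
  qed (use assms(2) in simp)
  have int: "P (Poly_Mapping.single i c)" if "P (Poly_Mapping.single i 1)" for i c
  proof (cases "c \<ge> 0")
    case True
    then show ?thesis using nat[OF that, of "nat c"] by simp
  next
    case False
    then show ?thesis
      using assms(4)[OF nat[OF that, of "nat (- c)"]] by (simp add: single_uminus[symmetric])
  qed
  have single: "P (Poly_Mapping.single (key k) c)" if "k \<in> {1..t + s}" for k c
  proof (rule int)
    show "P (Poly_Mapping.single (key k) 1)"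
    proof (cases "k \<le> t")
      case True
      then show ?thesis using assms(5)[of k] that by (simp add: key_def E_def)
    next
      case False
      then show ?thesis using assms(6)[of "k - t"] that by (simp add: key_def Y_def)
    qed
  qed
  have "inj_on key {1..t + s}"
    by (rule inj_onI) (auto simp: key_def split: if_splits)
  have sum: "P (\<Sum>i\<in>S. Poly_Mapping.single i (Poly_Mapping.lookup w i))" if "finite S" "S \<subseteq> key ` {1..t + s}" for S
    using that by (induction S) (auto intro!: assms(2,3) single)
  have "w = (\<Sum>i\<in>key ` {1..t + s}. Poly_Mapping.single i (Poly_Mapping.lookup w i))"
  proof (rule poly_mapping_eqI)
    fix k
    have "Poly_Mapping.lookup (\<Sum>i\<in>key ` {1..t + s}. Poly_Mapping.single i (Poly_Mapping.lookup w i)) k =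
       (\<Sum>i\<in>key ` {1..t + s}. if i = k then Poly_Mapping.lookup w k else 0)"
      unfolding lookup_sum by (intro sum.cong refl) (auto simp: lookup_single when_def)
    also have "\<dots> = Poly_Mapping.lookup w k"
      using assms(1) by (auto simp: HH_def)
    finally show "Poly_Mapping.lookup w k =
       Poly_Mapping.lookup (\<Sum>i\<in>key ` {1..t + s}. Poly_Mapping.single i (Poly_Mapping.lookup w i)) k" ..
  qed
  then show ?thesis
    using sum[of "key ` {1..t + s}"] by simp
qed

definition G :: "(int \<Rightarrow>\<^sub>0 int) set" where "G = {w. M w \<in> img}"

lemma G_add:
  assumes "a \<in> G" "b \<in> G"
  shows "a + b \<in> G"
proof -
  have "M (a + b) = pw (- Lam m a b) \<odot>\<^bsub>T\<^esub> (M a \<otimes>\<^bsub>T\<^esub> M b)"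
    by (simp add: M_mult)
  then show ?thesis
    using assms by (simp add: G_def img_ops)
qed

lemma E_G: "j \<le> t \<Longrightarrow> E j \<in> G"
proof (cases "j = 0")
  case True
  have "M 0 = psi \<one>\<^bsub>A\<^esub>"
    using psiR.hom_simps(4) by (simp only: R_ops Q.T_ops)
  then have "M 0 \<in> img"
    unfolding img_def using A.A.one_closed by (rule image_eqI)
  then show ?thesis
    using True by (simp add: G_def E_def)
next
  case False
  assume "j \<le> t"
  then show ?thesis
    using X_img(1)[of j] False by (simp add: G_def X_def)
qed

text \<open>A block of one column has a single term, so minors of consecutive columns are monomials.
  They bring the second-row exponents into \<open>G\<close>.\<close>

lemma EY_G:
  assumes "1 \<le> l" "l \<le> s"
  shows "E (l - 1) + Y l \<in> G"
proof -
  have e: "E (l - 1) + E l + U l = E (l - 1) + Y l"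
    by (simp add: U_def)
  have "N s (l - 1) l = M (E (l - 1) + Y l)"
    unfolding e[symmetric] using assms by (simp add: N_def W_single)
  moreover have "N s (l - 1) l \<in> img"
    using assms by (intro N_img) auto
  ultimately show ?thesis
    by (simp only: G_def mem_Collect_eq)
qed

text \<open>\<open>Y l\<close> is the exponent of a consecutive minor minus that of the first-row
  entry of column \<open>l - 1\<close>; with the \<open>E j\<close> and the group operations this
  reaches all of \<open>HH\<close>.\<close>

lemma HH_G:
  assumes "w \<in> HH"
  shows "\<exists>v\<in>G. w + v \<in> G"
  using assms
proof (induction rule: HH_induct)
  case zero
  show ?case using E_G[of 0] by (intro bexI[of _ 0]) (auto simp: E_def)
next
  case (add a b)
  then obtain v v' where "v \<in> G" "a + v \<in> G" "v' \<in> G" "b + v' \<in> G"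
    by blast
  then show ?case
    using G_add[of v v'] G_add[of "a + v" "b + v'"] by (intro bexI[of _ "v + v'"]) (auto simp: ac_simps)
next
  case (uminus a)
  then obtain v where "v \<in> G" "a + v \<in> G" by blast
  then show ?case by (intro bexI[of _ "a + v"]) auto
next
  case (E j)
  then show ?case
    using E_G[of j] E_G[of 0] by (intro bexI[of _ 0]) (auto simp: E_def)
next
  case (Y l)
  then show ?case
    using EY_G[of l] E_G[of "l - 1"] s_le by (intro bexI[of _ "E (l - 1)"]) (auto simp: add.commute)
qed

text \<open>Each torus monomial has a denominator by \<open>HH_G\<close>. In a sum, the denominators
  \<open>M v\<close> and \<open>M w\<close> quasi-commute, so \<open>M (v + w)\<close> serves both
  summands.\<close>

lemma clear_denominator:
  assumes "a \<in> carrier R.T"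
  shows "\<exists>w\<in>G. a \<otimes>\<^bsub>T\<^esub> M w \<in> img"
  using assms
proof (induction rule: R.T_induct)
  case zero
  have "psi \<zero>\<^bsub>A\<^esub> = \<zero>\<^bsub>T\<^esub>"
    using psiR.hom_zero by (simp only: R_ops)
  then have "\<zero>\<^bsub>T\<^esub> \<in> img"
    unfolding img_def by (rule image_eqI[OF sym A.M.zero_closed])
  then show ?case
    using E_G[of 0] by (intro bexI[of _ "E 0"]) (simp_all add: R_ops)
next
  case (delta c a)
  obtain v where v: "v \<in> G" "a + v \<in> G"
    using HH_G[OF delta(2)] by blast
  have "(c \<odot>\<^bsub>T\<^esub> M a) \<otimes>\<^bsub>T\<^esub> M v = c \<odot>\<^bsub>T\<^esub> (pw (Lam m a v) \<odot>\<^bsub>T\<^esub> M (a + v))"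
    using delta by (simp add: Q.T.smult_mult_left M_mult)
  then show ?case
    using v delta by (intro bexI[of _ v]) (auto simp: R_ops G_def intro!: img_ops)
next
  case (add f g)
  then obtain v w where v: "v \<in> G" "f \<otimes>\<^bsub>T\<^esub> M v \<in> img" and w: "w \<in> G" "g \<otimes>\<^bsub>T\<^esub> M w \<in> img"
    by blast
  have fg: "f \<in> carrier T" "g \<in> carrier T"
    using add R_sub by auto
  have "f \<otimes>\<^bsub>T\<^esub> M (v + w) = pw (- Lam m v w) \<odot>\<^bsub>T\<^esub> (f \<otimes>\<^bsub>T\<^esub> M v \<otimes>\<^bsub>T\<^esub> M w)"
    using fg by (simp add: Q.T.A.m_assoc M_mult Q.T.smult_mult_right)
  moreover have "g \<otimes>\<^bsub>T\<^esub> M (v + w) = pw (- Lam m w v) \<odot>\<^bsub>T\<^esub> (g \<otimes>\<^bsub>T\<^esub> M w \<otimes>\<^bsub>T\<^esub> M v)"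
    using fg by (simp add: Q.T.A.m_assoc M_mult Q.T.smult_mult_right add.commute[of w v])
  ultimately have "(f \<oplus>\<^bsub>T\<^esub> g) \<otimes>\<^bsub>T\<^esub> M (v + w) =
     pw (- Lam m v w) \<odot>\<^bsub>T\<^esub> (f \<otimes>\<^bsub>T\<^esub> M v \<otimes>\<^bsub>T\<^esub> M w) \<oplus>\<^bsub>T\<^esub> pw (- Lam m w v) \<odot>\<^bsub>T\<^esub> (g \<otimes>\<^bsub>T\<^esub> M w \<otimes>\<^bsub>T\<^esub> M v)"
    using fg by (simp add: Q.T.A.l_distr)
  also have "\<dots> \<in> img"
    using v(1) w(1) unfolding G_def mem_Collect_eq
    by (intro img_ops(2) img_ops(3) img_ops(1)[OF v(2)] img_ops(1)[OF w(2)] pw_in)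
  finally show ?case
    using G_add[OF v(1) w(1)] by (auto simp: R_ops)
qed

lemma clear_denominator':
  assumes "a \<in> carrier R.T"
  obtains c a' where "c \<in> carrier A" "psi c \<noteq> \<zero>\<^bsub>T\<^esub>" "a' \<in> carrier A" "a \<otimes>\<^bsub>R.T\<^esub> psi c = psi a'"
proof -
  obtain w where "w \<in> G" "a \<otimes>\<^bsub>T\<^esub> M w \<in> img"
    using clear_denominator[OF assms] by blast
  then have "M w \<in> psi ` carrier A" and aw: "a \<otimes>\<^bsub>T\<^esub> M w \<in> psi ` carrier A"
    unfolding G_def img_def by blast+
  then obtain c where c: "M w = psi c" "c \<in> carrier A"
    by blast
  obtain a' where a': "a \<otimes>\<^bsub>T\<^esub> M w = psi a'" "a' \<in> carrier A"
    using aw by blast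
  show ?thesis
    using that[OF c(2) _ a'(2)] a'(1) Q.delta_ne[of w] unfolding c(1) R_ops by blast
qed

sublocale V: valued_algebra K A "\<lambda>a. Q.lead (psi a)" C "{1..t + s}" "\<lambda>\<gamma> k. nat (Poly_Mapping.lookup \<gamma> (key k))"
  by (rule A_valued)

lemma psi_zero_iff: "a \<in> carrier A \<Longrightarrow> psi a = \<zero>\<^bsub>T\<^esub> \<longleftrightarrow> a = \<zero>\<^bsub>A\<^esub>"
  using psi_lead(1)[of a] psiR.hom_zero by (auto simp only: R_ops)

text \<open>Clearing denominators on the right turns a common right multiple in the cell, which
  exists because the cell is noetherian, into one in the torus.\<close>

lemma R_ore: "ore_algebra K R.T"
proof (intro ore_algebra.intro ore_algebra_axioms.intro R.T_domain)
  interpret O: ore_algebra K A by (rule V.ore)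
  interpret RD: domain_algebra K R.T by (rule R.T_domain)
  fix a b assume a: "a \<in> carrier R.T" "a \<noteq> \<zero>\<^bsub>R.T\<^esub>" and b: "b \<in> carrier R.T" "b \<noteq> \<zero>\<^bsub>R.T\<^esub>"
  obtain c a' where c: "c \<in> carrier A" "psi c \<noteq> \<zero>\<^bsub>T\<^esub>" "a' \<in> carrier A" "a \<otimes>\<^bsub>R.T\<^esub> psi c = psi a'"
    using clear_denominator'[OF a(1)] .
  obtain d b' where d: "d \<in> carrier A" "psi d \<noteq> \<zero>\<^bsub>T\<^esub>" "b' \<in> carrier A" "b \<otimes>\<^bsub>R.T\<^esub> psi d = psi b'"
    using clear_denominator'[OF b(1)] .
  have "a' \<noteq> \<zero>\<^bsub>A\<^esub>" "b' \<noteq> \<zero>\<^bsub>A\<^esub>"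
    using RD.integral_A[OF a(1) psi_R[OF c(1)]] RD.integral_A[OF b(1) psi_R[OF d(1)]] a b c d
      psiR.hom_zero by (auto simp only: R_ops)
  then obtain u v where uv: "u \<in> carrier A" "v \<in> carrier A" "a' \<otimes>\<^bsub>A\<^esub> u = b' \<otimes>\<^bsub>A\<^esub> v" "a' \<otimes>\<^bsub>A\<^esub> u \<noteq> \<zero>\<^bsub>A\<^esub>"
    using O.ore[OF c(3) d(3)] by blast
  have e: "a \<otimes>\<^bsub>R.T\<^esub> (psi c \<otimes>\<^bsub>R.T\<^esub> psi u) = psi (a' \<otimes>\<^bsub>A\<^esub> u)" "b \<otimes>\<^bsub>R.T\<^esub> (psi d \<otimes>\<^bsub>R.T\<^esub> psi v) = psi (b' \<otimes>\<^bsub>A\<^esub> v)"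
    using a(1) b(1) c(1,3,4) d(1,3,4) uv(1,2) by (simp_all only: psiR.hom_simps R.T.A.m_assoc[symmetric] psi_R)
  have ne: "psi (a' \<otimes>\<^bsub>A\<^esub> u) \<noteq> \<zero>\<^bsub>R.T\<^esub>"
    using psi_zero_iff[OF A.A.m_closed[OF c(3) uv(1)]] uv(4) unfolding R_ops by blast
  show "\<exists>u\<in>carrier R.T. \<exists>v\<in>carrier R.T. a \<otimes>\<^bsub>R.T\<^esub> u = b \<otimes>\<^bsub>R.T\<^esub> v \<and> a \<otimes>\<^bsub>R.T\<^esub> u \<noteq> \<zero>\<^bsub>R.T\<^esub>"
  proof (intro bexI conjI)
    show "a \<otimes>\<^bsub>R.T\<^esub> (psi c \<otimes>\<^bsub>R.T\<^esub> psi u) = b \<otimes>\<^bsub>R.T\<^esub> (psi d \<otimes>\<^bsub>R.T\<^esub> psi v)"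
      unfolding e uv(3) ..
    show "a \<otimes>\<^bsub>R.T\<^esub> (psi c \<otimes>\<^bsub>R.T\<^esub> psi u) \<noteq> \<zero>\<^bsub>R.T\<^esub>"
      unfolding e by (rule ne)
  qed (rule R.T.A.m_closed[OF psi_R psi_R], rule uv c d, rule uv c d)+
qed

text \<open>
  The skew field of fractions of the torus is also the one of the cell. Its elements are encoded by
  their sets of right fractions.
\<close>

lemma fraction_field:
  obtains F :: "('a, (((nat \<times> nat) list \<Rightarrow> 'a) set \<times> ((nat \<times> nat) list \<Rightarrow> 'a) set) set) module" and j
  where "assoc_algebra K F" "skew_field F" "j \<in> algebra_hom K R.T F" "inj_on j (carrier R.T)"
    "skew_field_of_fractions K A F (j \<circ> psi)"
proof -
  interpret RO: ore_algebra K R.T by (rule R_ore)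
  let ?F = "RO.fraction_algebra"
  interpret F0: skew_algebra K ?F
    by (intro skew_algebra.intro skew_algebra_axioms.intro RO.fraction_assoc_algebra RO.fraction_skew_field)
  define j0 where "j0 a = RO.frac a \<one>\<^bsub>R.T\<^esub>" for a
  have j0_hom: "j0 \<in> algebra_hom K R.T ?F"
    using RO.const_hom unfolding j0_def .
  interpret j0: algebra_morphism K R.T ?F j0
    by unfold_locales (rule j0_hom)
  have j0_inj: "inj_on j0 (carrier R.T)"
    by (rule inj_onI) (use RO.const_inj in \<open>auto simp: j0_def\<close>)
  have j0_ne: "j0 a \<noteq> \<zero>\<^bsub>?F\<^esub>" if "a \<in> carrier R.T" "a \<noteq> \<zero>\<^bsub>R.T\<^esub>" for a
    using that inj_onD[OF j0_inj, of a "\<zero>\<^bsub>R.T\<^esub>"] j0.hom_zero R.T.M.zero_closed by auto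
  \<comment> \<open>A fraction of torus elements becomes one of cell elements in two steps:
    \<open>c\<close> clears the denominator \<open>b\<close>, then \<open>d\<close> clears the
    numerator \<open>a c\<close>.\<close>
  have right: "\<exists>a\<in>carrier A. \<exists>b\<in>carrier A - {\<zero>\<^bsub>A\<^esub>}. x \<otimes>\<^bsub>?F\<^esub> j0 (psi b) = j0 (psi a)" if x: "x \<in> carrier ?F" for x
  proof -
    obtain a b where ab: "a \<in> carrier R.T" "b \<in> carrier R.T" "b \<noteq> \<zero>\<^bsub>R.T\<^esub>" "x \<otimes>\<^bsub>?F\<^esub> j0 b = j0 a"
      using RO.fraction_eq[OF x] unfolding j0_def by blast
    obtain c b' where c: "c \<in> carrier A" "psi c \<noteq> \<zero>\<^bsub>T\<^esub>" "b' \<in> carrier A" "b \<otimes>\<^bsub>R.T\<^esub> psi c = psi b'"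
      using clear_denominator'[OF ab(2)] .
    obtain d a' where d: "d \<in> carrier A" "psi d \<noteq> \<zero>\<^bsub>T\<^esub>" "a' \<in> carrier A" "(a \<otimes>\<^bsub>R.T\<^esub> psi c) \<otimes>\<^bsub>R.T\<^esub> psi d = psi a'"
      using clear_denominator'[OF R.T.A.m_closed[OF ab(1) psi_R[OF c(1)]]] .
    note cl = ab(1,2) psi_R[OF c(1)] psi_R[OF d(1)] psi_R[OF c(3)] psi_R[OF d(3)]
    note jcl = cl[THEN j0.hom_simps(1)]
    have "j0 (psi (b' \<otimes>\<^bsub>A\<^esub> d)) = j0 b \<otimes>\<^bsub>?F\<^esub> (j0 (psi c) \<otimes>\<^bsub>?F\<^esub> j0 (psi d))"
      using cl jcl c(1,3) d(1) by (simp only: psiR.hom_simps c(4)[symmetric] j0.hom_simps R.T.A.m_closed F0.A.m_assoc)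
    then have "x \<otimes>\<^bsub>?F\<^esub> j0 (psi (b' \<otimes>\<^bsub>A\<^esub> d)) = (x \<otimes>\<^bsub>?F\<^esub> j0 b) \<otimes>\<^bsub>?F\<^esub> (j0 (psi c) \<otimes>\<^bsub>?F\<^esub> j0 (psi d))"
      using jcl x by (simp only: F0.A.m_assoc F0.A.m_closed)
    also have "\<dots> = j0 (psi a')"
      unfolding ab(4) using cl jcl by (simp only: d(4)[symmetric] j0.hom_simps R.T.A.m_closed F0.A.m_assoc)
    finally have "x \<otimes>\<^bsub>?F\<^esub> j0 (psi (b' \<otimes>\<^bsub>A\<^esub> d)) = j0 (psi a')" .
    moreover have "b' \<otimes>\<^bsub>A\<^esub> d \<noteq> \<zero>\<^bsub>A\<^esub>"
    proof -
      have "psi b' \<noteq> \<zero>\<^bsub>R.T\<^esub>"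
        unfolding c(4)[symmetric] using RO.integral_A[OF ab(2) psi_R[OF c(1)]] ab(3) c(2) by (auto simp only: R_ops)
      then have "b' \<noteq> \<zero>\<^bsub>A\<^esub>" "d \<noteq> \<zero>\<^bsub>A\<^esub>"
        using d(2) psiR.hom_zero by (auto simp only: R_ops)
      then show ?thesis
        using V.v_mult[OF c(3) d(1)] by blast
    qed
    ultimately show ?thesis
      using A.A.m_closed[OF c(3) d(1)] d(3) by blast
  qed
  define \<theta> where "\<theta> x = {(a, b). a \<in> carrier A \<and> b \<in> carrier A \<and> x \<otimes>\<^bsub>?F\<^esub> j0 (psi b) = j0 (psi a)}" for x
  have jpu: "j0 (psi b) \<in> Units ?F" if "b \<in> carrier A - {\<zero>\<^bsub>A\<^esub>}" for b
  proof -
    have b: "b \<in> carrier A" "b \<noteq> \<zero>\<^bsub>A\<^esub>"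
      using that by blast+
    then have "psi b \<noteq> \<zero>\<^bsub>R.T\<^esub>"
      using psi_zero_iff[OF b(1)] unfolding R_ops by blast
    then show ?thesis
      unfolding F0.unit_iff using j0_ne[OF psi_R[OF b(1)]] j0.hom_simps(1)[OF psi_R[OF b(1)]] by blast
  qed
  have "inj_on \<theta> (carrier ?F)"
  proof (rule inj_onI)
    fix x y assume x: "x \<in> carrier ?F" and y: "y \<in> carrier ?F" and eq: "\<theta> x = \<theta> y"
    obtain a b where ab: "a \<in> carrier A" "b \<in> carrier A - {\<zero>\<^bsub>A\<^esub>}" "x \<otimes>\<^bsub>?F\<^esub> j0 (psi b) = j0 (psi a)"
      using right[OF x] by blast
    then have "(a, b) \<in> \<theta> x"
      unfolding \<theta>_def by blast
    then have "y \<otimes>\<^bsub>?F\<^esub> j0 (psi b) = j0 (psi a)"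
      unfolding eq unfolding \<theta>_def by blast
    then show "x = y"
      using F0.unit_cancel_right[OF jpu[OF ab(2)] x y] ab(3) by simp
  qed
  then obtain F :: "('a, (((nat \<times> nat) list \<Rightarrow> 'a) set \<times> ((nat \<times> nat) list \<Rightarrow> 'a) set) set) module"
    where F: "assoc_algebra K F" "skew_field F" "\<theta> \<in> algebra_hom K ?F F" "carrier F = \<theta> ` carrier ?F"
    by (rule transport_algebra[OF RO.fraction_assoc_algebra RO.fraction_skew_field])
  interpret F: skew_algebra K F
    by (intro skew_algebra.intro skew_algebra_axioms.intro F)
  interpret \<theta>: algebra_morphism K ?F F \<theta>
    by unfold_locales (rule F)
  define j where "j = \<theta> \<circ> j0"
  have j_hom: "j \<in> algebra_hom K R.T F"
    unfolding j_def by (rule algebra_hom_comp[OF j0_hom F(3)])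
  have j_inj: "inj_on j (carrier R.T)"
    unfolding j_def
    by (rule comp_inj_on[OF j0_inj]) (rule inj_on_subset[OF \<open>inj_on \<theta> (carrier ?F)\<close>], use j0.hom_simps(1) in blast)
  interpret j: algebra_morphism K R.T F j
    by unfold_locales (rule j_hom)
  have ju: "j (psi b) \<in> Units F" if "b \<in> carrier A - {\<zero>\<^bsub>A\<^esub>}" for b
  proof -
    have b: "b \<in> carrier A" "b \<noteq> \<zero>\<^bsub>A\<^esub>"
      using that by blast+
    then have "psi b \<noteq> \<zero>\<^bsub>R.T\<^esub>"
      using psi_zero_iff[OF b(1)] unfolding R_ops by blast
    then have "j (psi b) \<noteq> \<zero>\<^bsub>F\<^esub>"
      using inj_onD[OF j_inj, of "psi b" "\<zero>\<^bsub>R.T\<^esub>"] j.hom_zero R.T.M.zero_closed psi_R[OF b(1)] by auto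
    then show ?thesis
      unfolding F.unit_iff using j.hom_simps(1)[OF psi_R[OF b(1)]] by blast
  qed
  have right': "\<exists>a\<in>carrier A. \<exists>b\<in>carrier A - {\<zero>\<^bsub>A\<^esub>}. x \<otimes>\<^bsub>F\<^esub> j (psi b) = j (psi a)" if x: "x \<in> carrier F" for x
  proof -
    obtain y where y: "y \<in> carrier ?F" "x = \<theta> y"
      using x F(4) by blast
    obtain a b where ab: "a \<in> carrier A" "b \<in> carrier A - {\<zero>\<^bsub>A\<^esub>}" "y \<otimes>\<^bsub>?F\<^esub> j0 (psi b) = j0 (psi a)"
      using right[OF y(1)] by blast
    have "j0 (psi b) \<in> carrier ?F"
      using ab(2) by (intro j0.hom_simps(1) psi_R) blast
    then have "x \<otimes>\<^bsub>F\<^esub> j (psi b) = j (psi a)"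
      unfolding j_def comp_def y(2) ab(3)[symmetric] using y(1) by (simp only: \<theta>.hom_simps)
    then show ?thesis
      using ab by blast
  qed
  have "skew_field_of_fractions K A F (j \<circ> psi)"
    unfolding skew_field_of_fractions_def
  proof (intro conjI ballI)
    show "assoc_algebra K F" "skew_field F"
      by (rule F)+
    show "j \<circ> psi \<in> algebra_hom K A F"
      by (rule algebra_hom_comp[OF psi_R_hom j_hom])
    show "inj_on (j \<circ> psi) (carrier A)"
      by (rule comp_inj_on[OF psi_inj]) (rule inj_on_subset[OF j_inj], use psi_R in blast)
    fix x assume x: "x \<in> carrier F"
    obtain a b where ab: "a \<in> carrier A" "b \<in> carrier A - {\<zero>\<^bsub>A\<^esub>}" "x \<otimes>\<^bsub>F\<^esub> j (psi b) = j (psi a)"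
      using right'[OF x] by blast
    have b: "j (psi b) \<in> carrier F" "inv\<^bsub>F\<^esub> (j (psi b)) \<in> carrier F" "j (psi b) \<otimes>\<^bsub>F\<^esub> inv\<^bsub>F\<^esub> (j (psi b)) = \<one>\<^bsub>F\<^esub>"
      using ju[OF ab(2)] F.A.Units_closed F.A.Units_inv_closed F.A.Units_r_inv by blast+
    have xe: "x = j (psi a) \<otimes>\<^bsub>F\<^esub> inv\<^bsub>F\<^esub> (j (psi b))"
      unfolding ab(3)[symmetric] using b x by (simp only: F.A.m_assoc F.A.r_one)
    then show "\<exists>a\<in>carrier A. \<exists>b\<in>carrier A - {\<zero>\<^bsub>A\<^esub>}. x = (j \<circ> psi) a \<otimes>\<^bsub>F\<^esub> inv\<^bsub>F\<^esub> ((j \<circ> psi) b)"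
      using ab unfolding comp_def by blast
    \<comment> \<open>For left fractions: if \<open>u a = v b\<close>, then \<open>x\<close>, which
      is \<open>a\<close> times the inverse of \<open>b\<close>, equals the inverse of
      \<open>u\<close> times \<open>v\<close>. Such \<open>u\<close> and \<open>v\<close> come from
      the Ore condition in the opposite algebra.\<close>
    have "\<exists>u\<in>carrier A - {\<zero>\<^bsub>A\<^esub>}. \<exists>v\<in>carrier A. u \<otimes>\<^bsub>A\<^esub> a = v \<otimes>\<^bsub>A\<^esub> b"
    proof (cases "a = \<zero>\<^bsub>A\<^esub>")
      case True
      have "\<one>\<^bsub>A\<^esub> \<otimes>\<^bsub>A\<^esub> a = \<zero>\<^bsub>A\<^esub> \<otimes>\<^bsub>A\<^esub> b" "\<one>\<^bsub>A\<^esub> \<in> carrier A - {\<zero>\<^bsub>A\<^esub>}"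
        using True ab A.A.one_closed V.nontrivial A.A.l_null[of b] A.A.l_one[OF ab(1)] by blast+
      then show ?thesis
        using A.M.zero_closed by blast
    next
      case False
      have "a \<in> carrier (opp A)" "b \<in> carrier (opp A)" "a \<noteq> \<zero>\<^bsub>opp A\<^esub>" "b \<noteq> \<zero>\<^bsub>opp A\<^esub>"
        using False ab unfolding opp_simps by blast+
      from ore_algebra.ore[OF V.ore_opp this] obtain u v where
        uv: "u \<in> carrier A" "v \<in> carrier A" "u \<otimes>\<^bsub>A\<^esub> a = v \<otimes>\<^bsub>A\<^esub> b" "u \<otimes>\<^bsub>A\<^esub> a \<noteq> \<zero>\<^bsub>A\<^esub>"
        unfolding opp_simps by blast
      then have "u \<noteq> \<zero>\<^bsub>A\<^esub>"
        using A.A.l_null[OF ab(1)] by blast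
      then show ?thesis
        using uv by blast
    qed
    then obtain u v where uv: "u \<in> carrier A - {\<zero>\<^bsub>A\<^esub>}" "v \<in> carrier A" "u \<otimes>\<^bsub>A\<^esub> a = v \<otimes>\<^bsub>A\<^esub> b"
      by blast
    have uA: "u \<in> carrier A" "b \<in> carrier A"
      using uv ab by blast+
    have u: "j (psi u) \<in> carrier F" "inv\<^bsub>F\<^esub> (j (psi u)) \<in> carrier F" "inv\<^bsub>F\<^esub> (j (psi u)) \<otimes>\<^bsub>F\<^esub> j (psi u) = \<one>\<^bsub>F\<^esub>"
      using ju[OF uv(1)] F.A.Units_closed F.A.Units_inv_closed F.A.Units_l_inv by blast+
    note jc = j.hom_simps(1)[OF psi_R[OF uv(2)]] j.hom_simps(1)[OF psi_R[OF ab(1)]]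
    have "j (psi u) \<otimes>\<^bsub>F\<^esub> j (psi a) = j (psi v) \<otimes>\<^bsub>F\<^esub> j (psi b)"
      using arg_cong[OF uv(3), of "\<lambda>c. j (psi c)"] uA uv(2) ab(1) psi_R
      by (simp only: psiR.hom_simps j.hom_simps)
    then have "j (psi u) \<otimes>\<^bsub>F\<^esub> x = j (psi v)"
      unfolding xe using u b jc by (simp only: F.A.m_assoc[symmetric]) (simp only: F.A.m_assoc F.A.r_one)
    then have "inv\<^bsub>F\<^esub> (j (psi u)) \<otimes>\<^bsub>F\<^esub> j (psi v) = inv\<^bsub>F\<^esub> (j (psi u)) \<otimes>\<^bsub>F\<^esub> (j (psi u) \<otimes>\<^bsub>F\<^esub> x)"
      by (simp only:)
    also have "\<dots> = (inv\<^bsub>F\<^esub> (j (psi u)) \<otimes>\<^bsub>F\<^esub> j (psi u)) \<otimes>\<^bsub>F\<^esub> x"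
      by (rule F.A.m_assoc[OF u(2,1) x, symmetric])
    finally have "x = inv\<^bsub>F\<^esub> (j (psi u)) \<otimes>\<^bsub>F\<^esub> j (psi v)"
      unfolding u(3) using x by (simp only: F.A.l_one)
    then show "\<exists>a\<in>carrier A. \<exists>b\<in>carrier A - {\<zero>\<^bsub>A\<^esub>}. x = inv\<^bsub>F\<^esub> ((j \<circ> psi) b) \<otimes>\<^bsub>F\<^esub> (j \<circ> psi) a"
      using uv unfolding comp_def by blast
  qed
  then show ?thesis
    using that[OF F(1,2) j_hom j_inj] by blast
qed

end

section \<open>Combinatorics of flips of diagonals\<close>

section \<open>Flips of diagonals\<close>

definition cross :: "nat \<times> nat \<Rightarrow> nat \<times> nat \<Rightarrow> bool" where
  "cross \<alpha> \<beta> \<longleftrightarrow> (fst \<alpha> < fst \<beta> \<and> fst \<beta> < snd \<alpha> \<and> snd \<alpha> < snd \<beta>) \<or>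
     (fst \<beta> < fst \<alpha> \<and> fst \<alpha> < snd \<beta> \<and> snd \<beta> < snd \<alpha>)"

definition sides :: "nat \<Rightarrow> nat \<Rightarrow> nat \<Rightarrow> nat \<Rightarrow> (nat \<times> nat) set" where
  "sides a b c d = {(a, b), (b, c), (c, d), (a, d)}"

text \<open>The column of the exchange matrix at the diagonal \<open>(a, c)\<close> of a quadrilateral; the one at \<open>(b, d)\<close> has the opposite sign.\<close>

definition col :: "nat \<Rightarrow> nat \<Rightarrow> nat \<Rightarrow> nat \<Rightarrow> nat \<times> nat \<Rightarrow> int" where
  "col a b c d \<alpha> = of_bool (\<alpha> = (a, b)) + of_bool (\<alpha> = (c, d)) - of_bool (\<alpha> = (b, c)) - of_bool (\<alpha> = (a, d))"

text \<open>\<open>\<sigma>\<close> tells which of the two diagonals belongs to the triangulation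
  and thereby fixes the sign of its exchange column; \<open>\<kappa>'\<close> is the diagonal after
  the flip.\<close>

definition diag :: "nat \<Rightarrow> nat \<Rightarrow> nat \<Rightarrow> nat \<Rightarrow> int \<Rightarrow> nat \<times> nat \<Rightarrow> nat \<times> nat \<Rightarrow> bool" where
  "diag a b c d \<sigma> \<kappa> \<kappa>' \<longleftrightarrow> (\<sigma> = 1 \<and> \<kappa> = (a, c) \<and> \<kappa>' = (b, d)) \<or> (\<sigma> = - 1 \<and> \<kappa> = (b, d) \<and> \<kappa>' = (a, c))"

lemma col_zero_iff:
  assumes "a < b" "b < c" "c < d"
  shows "col a b c d \<alpha> = 0 \<longleftrightarrow> \<alpha> \<notin> sides a b c d"
  using assms by (auto simp: col_def sides_def)

lemma col_side: 
  assumes "a < b" "b < c" "c < d"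
  shows "col a b c d (a, b) = 1" "col a b c d (c, d) = 1" "col a b c d (b, c) = - 1" "col a b c d (a, d) = - 1"
  using assms by (auto simp: col_def)

lemma col_diag:
  assumes "a < b" "b < c" "c < d" "diag a b c d \<sigma> \<kappa> \<kappa>'"
  shows "col a b c d \<kappa> = 0" "col a b c d \<kappa>' = 0"
  using assms by (auto simp: col_def diag_def)

text \<open>An endpoint strictly between two neighbouring vertices of the quadrilateral would make a
  segment crossing \<open>\<kappa>'\<close> cross the side joining them as well. So such a segment
  ends at the two remaining vertices and is \<open>\<kappa>\<close>.\<close>

lemma not_cross_flip:
  assumes "a < b" "b < c" "c < d" "diag a b c d \<sigma> \<kappa> \<kappa>'"
    and "fst \<alpha> < snd \<alpha>" "\<alpha> \<noteq> \<kappa>" "\<not> cross \<alpha> \<kappa>" "\<And>\<beta>. \<beta> \<in> sides a b c d \<Longrightarrow> \<not> cross \<alpha> \<beta>"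
  shows "\<not> cross \<alpha> \<kappa>'"
proof -
  obtain x y where \<alpha>: "\<alpha> = (x, y)" by (cases \<alpha>)
  have nc: "\<not> cross (x, y) (a, b)" "\<not> cross (x, y) (b, c)" "\<not> cross (x, y) (c, d)" "\<not> cross (x, y) (a, d)"
    using assms(8) by (auto simp: \<alpha> sides_def)
  show ?thesis
  proof (cases "\<sigma> = 1")
    case True
    then have \<kappa>: "\<kappa> = (a, c)" "\<kappa>' = (b, d)"
      using assms(4) by (auto simp: diag_def)
    have "x \<noteq> a \<or> y \<noteq> c"
      using assms(6) \<alpha> \<kappa> by auto
    then show ?thesis
      using assms(1-3,5,7) nc unfolding \<alpha> \<kappa> cross_def fst_conv snd_conv
      by (cases x a rule: linorder_cases; cases y c rule: linorder_cases) auto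
  next
    case False
    then have \<kappa>: "\<kappa> = (b, d)" "\<kappa>' = (a, c)"
      using assms(4) by (auto simp: diag_def)
    have "x \<noteq> b \<or> y \<noteq> d"
      using assms(6) \<alpha> \<kappa> by auto
    then show ?thesis
      using assms(1-3,5,7) nc unfolding \<alpha> \<kappa> cross_def fst_conv snd_conv
      by (cases x b rule: linorder_cases; cases y d rule: linorder_cases) auto
  qed
qed

lemma cross_diag: "a < b \<Longrightarrow> b < c \<Longrightarrow> c < d \<Longrightarrow> diag a b c d \<sigma> \<kappa> \<kappa>' \<Longrightarrow> cross \<kappa> \<kappa>' \<and> cross \<kappa>' \<kappa>"
  by (auto simp: diag_def cross_def)

lemma diag_swap: "diag a b c d \<sigma> \<kappa> \<kappa>' \<Longrightarrow> diag a b c d (- \<sigma>) \<kappa>' \<kappa>"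
  by (auto simp: diag_def)

text \<open>The halves that occur in \<open>mutate_exch\<close> when the other factor is
  \<open>1\<close> or \<open>- 1\<close>: positive and negative part of the column, for both
  signs.\<close>

lemma col_half:
  assumes "a < b" "b < c" "c < d"
  shows "(\<bar>col a b c d \<alpha>\<bar> + col a b c d \<alpha>) div 2 = of_bool (\<alpha> = (a, b)) + of_bool (\<alpha> = (c, d))"
    and "(- \<bar>col a b c d \<alpha>\<bar> + col a b c d \<alpha>) div 2 = - of_bool (\<alpha> = (b, c)) - of_bool (\<alpha> = (a, d))"
    and "(\<bar>col a b c d \<alpha>\<bar> - col a b c d \<alpha>) div 2 = of_bool (\<alpha> = (b, c)) + of_bool (\<alpha> = (a, d))"
    and "(- \<bar>col a b c d \<alpha>\<bar> - col a b c d \<alpha>) div 2 = - of_bool (\<alpha> = (a, b)) - of_bool (\<alpha> = (c, d))"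
proof -
  consider "\<alpha> = (a, b)" | "\<alpha> = (b, c)" | "\<alpha> = (c, d)" | "\<alpha> = (a, d)" | "\<alpha> \<notin> sides a b c d"
    by (auto simp: sides_def)
  then have "(\<bar>col a b c d \<alpha>\<bar> + col a b c d \<alpha>) div 2 = of_bool (\<alpha> = (a, b)) + of_bool (\<alpha> = (c, d)) \<and>
     (- \<bar>col a b c d \<alpha>\<bar> + col a b c d \<alpha>) div 2 = - of_bool (\<alpha> = (b, c)) - of_bool (\<alpha> = (a, d)) \<and>
     (\<bar>col a b c d \<alpha>\<bar> - col a b c d \<alpha>) div 2 = of_bool (\<alpha> = (b, c)) + of_bool (\<alpha> = (a, d)) \<and>
     (- \<bar>col a b c d \<alpha>\<bar> - col a b c d \<alpha>) div 2 = - of_bool (\<alpha> = (a, b)) - of_bool (\<alpha> = (c, d))"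
  proof cases
    case 5
    then show ?thesis
      using col_zero_iff[OF assms, of \<alpha>] by (auto simp: sides_def)
  qed (use assms col_side[OF assms] in simp_all)
  then show "(\<bar>col a b c d \<alpha>\<bar> + col a b c d \<alpha>) div 2 = of_bool (\<alpha> = (a, b)) + of_bool (\<alpha> = (c, d))"
    "(- \<bar>col a b c d \<alpha>\<bar> + col a b c d \<alpha>) div 2 = - of_bool (\<alpha> = (b, c)) - of_bool (\<alpha> = (a, d))"
    "(\<bar>col a b c d \<alpha>\<bar> - col a b c d \<alpha>) div 2 = of_bool (\<alpha> = (b, c)) + of_bool (\<alpha> = (a, d))"
    "(- \<bar>col a b c d \<alpha>\<bar> - col a b c d \<alpha>) div 2 = - of_bool (\<alpha> = (a, b)) - of_bool (\<alpha> = (c, d))"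
    by blast+
qed

text \<open>The double-primed quadrilateral surrounds \<open>\<iota>\<close> after the flip of
  \<open>\<kappa>\<close> to \<open>\<kappa>'\<close>, and its column is the mutated column of
  \<open>\<iota>\<close>. The labels \<open>\<kappa>\<close> and \<open>\<kappa>'\<close> are set
  apart because they name the same position, where mutation only changes the sign.\<close>

definition flip_ok where
  "flip_ok a b c d \<sigma> \<kappa> \<kappa>' a' b' c' d' \<sigma>' \<iota> a'' b'' c'' d'' \<sigma>'' \<longleftrightarrow>
     a'' < b'' \<and> b'' < c'' \<and> c'' < d'' \<and> {a'', b'', c'', d''} \<subseteq> {a, b, c, d, a', b', c', d'} \<and>
     (\<exists>\<iota>''. diag a'' b'' c'' d'' \<sigma>'' \<iota> \<iota>'') \<and>
     sides a'' b'' c'' d'' \<subseteq> (sides a b c d \<union> sides a' b' c' d' \<union> {\<kappa>'}) - {\<kappa>} \<and>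
     (\<forall>\<alpha>. \<alpha> \<noteq> \<kappa> \<longrightarrow> \<alpha> \<noteq> \<kappa>' \<longrightarrow> \<sigma>'' * col a'' b'' c'' d'' \<alpha> = \<sigma>' * col a' b' c' d' \<alpha> +
        (\<bar>\<sigma> * col a b c d \<alpha>\<bar> * (\<sigma>' * col a' b' c' d' \<kappa>) + \<sigma> * col a b c d \<alpha> * \<bar>\<sigma>' * col a' b' c' d' \<kappa>\<bar>) div 2) \<and>
     \<sigma>'' * col a'' b'' c'' d'' \<kappa>' = - (\<sigma>' * col a' b' c' d' \<kappa>)"

text \<open>
  If the diagonal of a second quadrilateral is a side of the first one and vice versa, the two share
  a triangle, and flipping the diagonal of the first replaces one vertex of the second.
\<close>

lemma flip_adjacent:
  assumes abcd: "a < b" "b < c" "c < d" and abcd': "a' < b'" "b' < c'" "c' < d'"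
    and \<kappa>: "diag a b c d \<sigma> \<kappa> \<kappa>'" and \<iota>: "diag a' b' c' d' \<sigma>' \<iota> \<iota>'"
    and adj: "\<iota> \<in> sides a b c d" "\<kappa> \<in> sides a' b' c' d'"
  shows "\<exists>a'' b'' c'' d'' \<sigma>''. flip_ok a b c d \<sigma> \<kappa> \<kappa>' a' b' c' d' \<sigma>' \<iota> a'' b'' c'' d'' \<sigma>''"
proof -
  note half = col_half[OF abcd]
  from \<kappa> consider (ac) "\<sigma> = 1" "\<kappa> = (a, c)" "\<kappa>' = (b, d)" | (bd) "\<sigma> = - 1" "\<kappa> = (b, d)" "\<kappa>' = (a, c)"
    by (auto simp: diag_def)
  then show ?thesis
  proof cases
    case ac
    from adj(1) consider (1) "\<iota> = (a, b)" | (2) "\<iota> = (b, c)" | (3) "\<iota> = (c, d)" | (4) "\<iota> = (a, d)"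
      by (auto simp: sides_def)
    then show ?thesis
    proof cases
      case 1
      \<comment> \<open>The second quadrilateral is the triangle \<open>a, b, c\<close> with an apex
        \<open>b'\<close> beyond its side \<open>\<iota>\<close>. After the flip the triangle at
        \<open>\<iota>\<close> is \<open>a, b, d\<close>, so \<open>c\<close> is replaced by
        \<open>d\<close>. The other cases follow this pattern.\<close>
      then have e: "a' = a" "c' = b" "d' = c" "\<sigma>' = 1"
        using \<iota> adj(2) ac abcd abcd' by (auto simp: diag_def sides_def)
      have "flip_ok a b c d \<sigma> \<kappa> \<kappa>' a' b' c' d' \<sigma>' \<iota> a b' b d 1"
        unfolding flip_ok_def e ac 1
      by (intro conjI allI impI; use abcd abcd'[unfolded e] in \<open>simp_all add: col_side half; simp add: col_def diag_def sides_def\<close>)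
      then show ?thesis by blast
    next
      case 2
      then have e: "a' = a" "b' = b" "d' = c" "\<sigma>' = - 1"
        using \<iota> adj(2) ac abcd abcd' by (auto simp: diag_def sides_def)
      have "flip_ok a b c d \<sigma> \<kappa> \<kappa>' a' b' c' d' \<sigma>' \<iota> b c' c d 1"
        unfolding flip_ok_def e ac 2
      by (intro conjI allI impI; use abcd abcd'[unfolded e] in \<open>simp_all add: col_side half; simp add: col_def diag_def sides_def\<close>)
      then show ?thesis by blast
    next
      case 3
      then have e: "a' = a" "b' = c" "d' = d" "\<sigma>' = - 1"
        using \<iota> adj(2) ac abcd abcd' by (auto simp: diag_def sides_def)
      have "flip_ok a b c d \<sigma> \<kappa> \<kappa>' a' b' c' d' \<sigma>' \<iota> b c c' d (- 1)"
        unfolding flip_ok_def e ac 3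
      by (intro conjI allI impI; use abcd abcd'[unfolded e] in \<open>simp_all add: col_side half; simp add: col_def diag_def sides_def\<close>)
      then show ?thesis by blast
    next
      case 4
      \<comment> \<open>The apex beyond the outer side \<open>(a, d)\<close> can come before
        \<open>a\<close> or after \<open>d\<close> in the linear order of the vertices.\<close>
      then consider (i) "b' = a" "c' = c" "d' = d" "\<sigma>' = - 1" | (o) "a' = a" "b' = c" "c' = d" "\<sigma>' = 1"
        using \<iota> adj(2) ac abcd abcd' by (auto simp: diag_def sides_def)
      then show ?thesis
      proof cases
        case i
        have "flip_ok a b c d \<sigma> \<kappa> \<kappa>' a' b' c' d' \<sigma>' \<iota> a' a b d (- 1)"
          unfolding flip_ok_def i ac 4
      by (intro conjI allI impI; use abcd abcd'[unfolded i] in \<open>simp_all add: col_side half; simp add: col_def diag_def sides_def\<close>)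
        then show ?thesis by blast
      next
        case o
        have "flip_ok a b c d \<sigma> \<kappa> \<kappa>' a' b' c' d' \<sigma>' \<iota> a b d d' 1"
          unfolding flip_ok_def o ac 4
      by (intro conjI allI impI; use abcd abcd'[unfolded o] in \<open>simp_all add: col_side half; simp add: col_def diag_def sides_def\<close>)
        then show ?thesis by blast
      qed
    qed
  next
    case bd
    from adj(1) consider (1) "\<iota> = (a, b)" | (2) "\<iota> = (b, c)" | (3) "\<iota> = (c, d)" | (4) "\<iota> = (a, d)"
      by (auto simp: sides_def)
    then show ?thesis
    proof cases
      case 1
      then have e: "a' = a" "c' = b" "d' = d" "\<sigma>' = 1"
        using \<iota> adj(2) bd abcd abcd' by (auto simp: diag_def sides_def)
      have "flip_ok a b c d \<sigma> \<kappa> \<kappa>' a' b' c' d' \<sigma>' \<iota> a b' b c 1"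
        unfolding flip_ok_def e bd 1
      by (intro conjI allI impI; use abcd abcd'[unfolded e] in \<open>simp_all add: col_side half; simp add: col_def diag_def sides_def\<close>)
      then show ?thesis by blast
    next
      case 2
      then have e: "a' = b" "c' = c" "d' = d" "\<sigma>' = 1"
        using \<iota> adj(2) bd abcd abcd' by (auto simp: diag_def sides_def)
      have "flip_ok a b c d \<sigma> \<kappa> \<kappa>' a' b' c' d' \<sigma>' \<iota> a b b' c (- 1)"
        unfolding flip_ok_def e bd 2
      by (intro conjI allI impI; use abcd abcd'[unfolded e] in \<open>simp_all add: col_side half; simp add: col_def diag_def sides_def\<close>)
      then show ?thesis by blast
    next
      case 3
      then have e: "a' = b" "b' = c" "d' = d" "\<sigma>' = - 1"
        using \<iota> adj(2) bd abcd abcd' by (auto simp: diag_def sides_def)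
      have "flip_ok a b c d \<sigma> \<kappa> \<kappa>' a' b' c' d' \<sigma>' \<iota> a c c' d (- 1)"
        unfolding flip_ok_def e bd 3
      by (intro conjI allI impI; use abcd abcd'[unfolded e] in \<open>simp_all add: col_side half; simp add: col_def diag_def sides_def\<close>)
      then show ?thesis by blast
    next
      case 4
      then consider (i) "b' = a" "c' = b" "d' = d" "\<sigma>' = - 1" | (o) "a' = a" "b' = b" "c' = d" "\<sigma>' = 1"
        using \<iota> adj(2) bd abcd abcd' by (auto simp: diag_def sides_def)
      then show ?thesis
      proof cases
        case i
        have "flip_ok a b c d \<sigma> \<kappa> \<kappa>' a' b' c' d' \<sigma>' \<iota> a' a c d (- 1)"
          unfolding flip_ok_def i bd 4
      by (intro conjI allI impI; use abcd abcd'[unfolded i] in \<open>simp_all add: col_side half; simp add: col_def diag_def sides_def\<close>)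
        then show ?thesis by blast
      next
        case o
        have "flip_ok a b c d \<sigma> \<kappa> \<kappa>' a' b' c' d' \<sigma>' \<iota> a c d d' 1"
          unfolding flip_ok_def o bd 4
      by (intro conjI allI impI; use abcd abcd'[unfolded o] in \<open>simp_all add: col_side half; simp add: col_def diag_def sides_def\<close>)
        then show ?thesis by blast
      qed
    qed
  qed
qed

section \<open>The toric frame of a quantum cluster\<close>

section \<open>Monomials in quasi-commuting elements\<close>

locale quantum_cluster = skew_algebra K F + scalar_root K h for K (structure) and F (structure) and h +
  fixes S :: "'c seed"
  assumes Y_unit: "\<And>i. i \<in> positions S \<Longrightarrow> sd_cluster S i \<in> Units F"
    and L_skew: "\<And>i j. i \<in> positions S \<Longrightarrow> j \<in> positions S \<Longrightarrow> sd_quasi S i j = - sd_quasi S j i"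
    and Y_comm: "\<And>i j. i \<in> positions S \<Longrightarrow> j \<in> positions S \<Longrightarrow> sd_cluster S i \<otimes>\<^bsub>F\<^esub> sd_cluster S j =
        pw (2 * sd_quasi S i j) \<odot>\<^bsub>F\<^esub> (sd_cluster S j \<otimes>\<^bsub>F\<^esub> sd_cluster S i)"
begin

abbreviation "y \<equiv> sd_cluster S"
abbreviation "L \<equiv> sd_quasi S"
abbreviation "r \<equiv> sd_rank S"

lemma F_pw_smult [simp]: "x \<in> carrier F \<Longrightarrow> pw a \<odot>\<^bsub>F\<^esub> (pw b \<odot>\<^bsub>F\<^esub> x) = pw (a + b) \<odot>\<^bsub>F\<^esub> x"
  by (rule pw_smult[OF assoc_algebra_axioms])

lemma unit_comm_inv:
  assumes u: "u \<in> Units F" and x: "x \<in> carrier F" and e: "u \<otimes>\<^bsub>F\<^esub> x = pw c \<odot>\<^bsub>F\<^esub> (x \<otimes>\<^bsub>F\<^esub> u)"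
  shows "inv\<^bsub>F\<^esub> u \<otimes>\<^bsub>F\<^esub> x = pw (- c) \<odot>\<^bsub>F\<^esub> (x \<otimes>\<^bsub>F\<^esub> inv\<^bsub>F\<^esub> u)"
proof -
  have uc: "u \<in> carrier F" "inv\<^bsub>F\<^esub> u \<in> carrier F" "inv\<^bsub>F\<^esub> u \<otimes>\<^bsub>F\<^esub> u = \<one>\<^bsub>F\<^esub>" "u \<otimes>\<^bsub>F\<^esub> inv\<^bsub>F\<^esub> u = \<one>\<^bsub>F\<^esub>"
    using u by (simp_all add: A.Units_closed)
  have "x \<otimes>\<^bsub>F\<^esub> inv\<^bsub>F\<^esub> u = inv\<^bsub>F\<^esub> u \<otimes>\<^bsub>F\<^esub> (u \<otimes>\<^bsub>F\<^esub> x) \<otimes>\<^bsub>F\<^esub> inv\<^bsub>F\<^esub> u"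
    using uc x by (simp add: A.m_assoc[symmetric])
  also have "\<dots> = pw c \<odot>\<^bsub>F\<^esub> (inv\<^bsub>F\<^esub> u \<otimes>\<^bsub>F\<^esub> x \<otimes>\<^bsub>F\<^esub> (u \<otimes>\<^bsub>F\<^esub> inv\<^bsub>F\<^esub> u))"
    unfolding e using uc(1,2) x by (simp add: A.m_assoc smult_mult_left smult_mult_right)
  also have "\<dots> = pw c \<odot>\<^bsub>F\<^esub> (inv\<^bsub>F\<^esub> u \<otimes>\<^bsub>F\<^esub> x)"
    using uc x by simp
  finally have "pw (- c) \<odot>\<^bsub>F\<^esub> (x \<otimes>\<^bsub>F\<^esub> inv\<^bsub>F\<^esub> u) = pw (- c) \<odot>\<^bsub>F\<^esub> (pw c \<odot>\<^bsub>F\<^esub> (inv\<^bsub>F\<^esub> u \<otimes>\<^bsub>F\<^esub> x))"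
    by simp
  then show ?thesis
    using uc x by simp
qed

lemma unit_comm_pow:
  assumes u: "u \<in> Units F" and x: "x \<in> carrier F" and e: "u \<otimes>\<^bsub>F\<^esub> x = pw c \<odot>\<^bsub>F\<^esub> (x \<otimes>\<^bsub>F\<^esub> u)"
  shows "u [^]\<^bsub>F\<^esub> (a :: int) \<otimes>\<^bsub>F\<^esub> x = pw (a * c) \<odot>\<^bsub>F\<^esub> (x \<otimes>\<^bsub>F\<^esub> u [^]\<^bsub>F\<^esub> a)"
proof -
  have uc: "u \<in> carrier F"
    using u by (simp add: A.Units_closed)
  have nat: "u [^]\<^bsub>F\<^esub> (n :: nat) \<otimes>\<^bsub>F\<^esub> x = pw (int n * c) \<odot>\<^bsub>F\<^esub> (x \<otimes>\<^bsub>F\<^esub> u [^]\<^bsub>F\<^esub> n)" for n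
  proof (induction n)
    case (Suc n)
    have un: "u [^]\<^bsub>F\<^esub> n \<in> carrier F"
      using uc by simp
    have "u [^]\<^bsub>F\<^esub> Suc n \<otimes>\<^bsub>F\<^esub> x = pw c \<odot>\<^bsub>F\<^esub> ((u [^]\<^bsub>F\<^esub> n \<otimes>\<^bsub>F\<^esub> x) \<otimes>\<^bsub>F\<^esub> u)"
      using un uc x e by (simp add: A.m_assoc smult_mult_right)
    also have "\<dots> = pw (int (Suc n) * c) \<odot>\<^bsub>F\<^esub> (x \<otimes>\<^bsub>F\<^esub> u [^]\<^bsub>F\<^esub> Suc n)"
      unfolding Suc using un uc x by (simp add: A.m_assoc smult_mult_left algebra_simps)
    finally show ?case .
  qed (use x uc in simp)
  show ?thesis
  proof (cases "a \<ge> 0")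
    case True
    then show ?thesis
      using nat[of "nat a"] int_pow_int[of F u "nat a"] by simp
  next
    case False
    then have e: "u [^]\<^bsub>F\<^esub> a = inv\<^bsub>F\<^esub> (u [^]\<^bsub>F\<^esub> nat (- a))" and a: "- (int (nat (- a)) * c) = a * c"
      using int_pow_def2[of F u a] by auto
    show ?thesis
      unfolding e a[symmetric] by (rule unit_comm_inv[OF A.Units_pow_closed[OF u] x nat])
  qed
qed

text \<open>The part of the ordered product from position \<open>k\<close> on, made for induction
  from the last position downwards with \<open>pos_induct\<close>.\<close>

definition lm :: "nat \<Rightarrow> (nat \<Rightarrow> int) \<Rightarrow> 'c" where
  "lm k a = foldr (\<lambda>i z. y i [^]\<^bsub>F\<^esub> a i \<otimes>\<^bsub>F\<^esub> z) [k..<Suc r] \<one>\<^bsub>F\<^esub>"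

lemma lm_laurent: "laurent_monomial F S a = lm 1 a"
  by (simp add: laurent_monomial_def lm_def)

lemma lm_step: "k \<le> r \<Longrightarrow> lm k a = y k [^]\<^bsub>F\<^esub> a k \<otimes>\<^bsub>F\<^esub> lm (Suc k) a"
  by (simp add: lm_def upt_conv_Cons del: upt_Suc)

lemma lm_end: "r < k \<Longrightarrow> lm k a = \<one>\<^bsub>F\<^esub>"
  by (simp add: lm_def)

lemma pos_induct [consumes 1, case_names le step]:
  assumes "1 \<le> k" "\<And>k. r < k \<Longrightarrow> P k" "\<And>k. 1 \<le> k \<Longrightarrow> k \<le> r \<Longrightarrow> P (Suc k) \<Longrightarrow> P k"
  shows "P k"
  using assms(1)
proof (induction "Suc r - k" arbitrary: k)
  case 0
  then show ?case using assms(2) by simp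
next
  case (Suc n)
  show ?case
  proof (cases "r < k")
    case True
    then show ?thesis by (rule assms(2))
  next
    case False
    have "P (Suc k)"
      by (rule Suc.hyps(1)) (use Suc.hyps(2) in simp_all)
    show ?thesis
      by (rule assms(3)[OF Suc.prems _ \<open>P (Suc k)\<close>]) (use False in simp)
  qed
qed

lemma pos_iff: "i \<in> positions S \<longleftrightarrow> 1 \<le> i \<and> i \<le> r"
  by (simp add: positions_def)

lemma ypow_unit: "1 \<le> i \<Longrightarrow> i \<le> r \<Longrightarrow> y i [^]\<^bsub>F\<^esub> (a :: int) \<in> Units F"
  using Y_unit[of i] A.unit_int_pow_closed by (simp add: pos_iff)

lemma lm_unit:
  assumes "1 \<le> k"
  shows "lm k a \<in> Units F"
  using assms
proof (induction k rule: pos_induct)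
  case (le k)
  then show ?case by (simp add: lm_end)
next
  case (step k)
  then show ?case by (simp add: lm_step ypow_unit A.Units_m_closed)
qed

lemma lm_closed: "1 \<le> k \<Longrightarrow> lm k a \<in> carrier F"
  using lm_unit A.Units_closed by blast

lemma lm_cong:
  assumes "1 \<le> k" "\<And>i. 1 \<le> i \<Longrightarrow> i \<le> r \<Longrightarrow> a i = b i"
  shows "lm k a = lm k b"
  using assms(1)
proof (induction k rule: pos_induct)
  case (step k)
  then show ?case using assms(2) by (simp add: lm_step)
qed (simp_all add: lm_end)

lemma lm_comm:
  assumes k: "1 \<le> k" and x: "x \<in> carrier F"
    and c: "\<And>i. k \<le> i \<Longrightarrow> i \<le> r \<Longrightarrow> y i \<otimes>\<^bsub>F\<^esub> x = pw (c i) \<odot>\<^bsub>F\<^esub> (x \<otimes>\<^bsub>F\<^esub> y i)"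
  shows "lm k a \<otimes>\<^bsub>F\<^esub> x = pw (\<Sum>i\<in>{k..r}. a i * c i) \<odot>\<^bsub>F\<^esub> (x \<otimes>\<^bsub>F\<^esub> lm k a)"
  using k c
proof (induction k rule: pos_induct)
  case (le k)
  then show ?case using x by (simp add: lm_end)
next
  case (step k)
  have u: "y k \<in> Units F" "y k [^]\<^bsub>F\<^esub> a k \<in> carrier F" "lm (Suc k) a \<in> carrier F"
    using step ypow_unit A.Units_closed lm_closed Y_unit by (auto simp: pos_iff)
  have IH: "lm (Suc k) a \<otimes>\<^bsub>F\<^esub> x = pw (\<Sum>i\<in>{Suc k..r}. a i * c i) \<odot>\<^bsub>F\<^esub> (x \<otimes>\<^bsub>F\<^esub> lm (Suc k) a)"
    using step by auto
  have 1: "y k [^]\<^bsub>F\<^esub> a k \<otimes>\<^bsub>F\<^esub> x = pw (a k * c k) \<odot>\<^bsub>F\<^esub> (x \<otimes>\<^bsub>F\<^esub> y k [^]\<^bsub>F\<^esub> a k)"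
    using step by (intro unit_comm_pow u x) auto
  have "lm k a \<otimes>\<^bsub>F\<^esub> x = y k [^]\<^bsub>F\<^esub> a k \<otimes>\<^bsub>F\<^esub> (lm (Suc k) a \<otimes>\<^bsub>F\<^esub> x)"
    using step u x by (simp add: lm_step A.m_assoc)
  also have "\<dots> = pw (\<Sum>i\<in>{Suc k..r}. a i * c i) \<odot>\<^bsub>F\<^esub> ((y k [^]\<^bsub>F\<^esub> a k \<otimes>\<^bsub>F\<^esub> x) \<otimes>\<^bsub>F\<^esub> lm (Suc k) a)"
    unfolding IH using u x by (simp add: A.m_assoc smult_mult_right)
  also have "\<dots> = pw ((\<Sum>i\<in>{Suc k..r}. a i * c i) + a k * c k) \<odot>\<^bsub>F\<^esub> (x \<otimes>\<^bsub>F\<^esub> lm k a)"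
    unfolding 1 using u x step by (simp add: lm_step A.m_assoc smult_mult_left)
  finally show ?case
    using step by (simp add: sum.atLeast_Suc_atMost[of k r] add.commute)
qed

text \<open>The power of \<open>q\<close> that appears when the factors of the second ordered
  monomial are moved left past the later positions of the first.\<close>

definition om :: "nat \<Rightarrow> (nat \<Rightarrow> int) \<Rightarrow> (nat \<Rightarrow> int) \<Rightarrow> int" where
  "om k a b = (\<Sum>i\<in>{k..r}. \<Sum>j\<in>{Suc i..r}. a j * b i * L j i)"

lemma lm_mult:
  assumes "1 \<le> k"
  shows "lm k a \<otimes>\<^bsub>F\<^esub> lm k b = pw (2 * om k a b) \<odot>\<^bsub>F\<^esub> lm k (\<lambda>i. a i + b i)"
  using assms
proof (induction k rule: pos_induct)
  case (le k)
  then show ?case by (simp add: lm_end om_def)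
next
  case (step k)
  have yk: "y k \<in> Units F" "k \<in> positions S"
    using step Y_unit by (auto simp: pos_iff)
  have u: "y k [^]\<^bsub>F\<^esub> a k \<in> carrier F" "y k [^]\<^bsub>F\<^esub> b k \<in> carrier F"
      "lm (Suc k) a \<in> carrier F" "lm (Suc k) b \<in> carrier F" "lm (Suc k) (\<lambda>i. a i + b i) \<in> carrier F"
    using step ypow_unit A.Units_closed lm_closed by auto
  have c: "y j \<otimes>\<^bsub>F\<^esub> y k [^]\<^bsub>F\<^esub> b k = pw (2 * (b k * L j k)) \<odot>\<^bsub>F\<^esub> (y k [^]\<^bsub>F\<^esub> b k \<otimes>\<^bsub>F\<^esub> y j)"
    if "Suc k \<le> j" "j \<le> r" for j
  proof -
    have j: "j \<in> positions S" "y j \<in> carrier F"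
      using that step Y_unit[of j] A.Units_closed by (auto simp: pos_iff)
    have "y k [^]\<^bsub>F\<^esub> b k \<otimes>\<^bsub>F\<^esub> y j = pw (b k * (2 * L k j)) \<odot>\<^bsub>F\<^esub> (y j \<otimes>\<^bsub>F\<^esub> y k [^]\<^bsub>F\<^esub> b k)"
      by (rule unit_comm_pow[OF yk(1) j(2) Y_comm[OF yk(2) j(1)]])
    then show ?thesis
      using u j L_skew[OF yk(2) j(1)] by simp
  qed
  have 1: "lm (Suc k) a \<otimes>\<^bsub>F\<^esub> y k [^]\<^bsub>F\<^esub> b k =
      pw (\<Sum>j\<in>{Suc k..r}. a j * (2 * (b k * L j k))) \<odot>\<^bsub>F\<^esub> (y k [^]\<^bsub>F\<^esub> b k \<otimes>\<^bsub>F\<^esub> lm (Suc k) a)"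
    by (rule lm_comm[OF _ u(2) c]) auto
  have e: "(\<Sum>j\<in>{Suc k..r}. a j * (2 * (b k * L j k))) + 2 * om (Suc k) a b = 2 * om k a b"
    using step by (simp add: om_def sum.atLeast_Suc_atMost[of k r] sum_distrib_left ac_simps)
  have "lm k a \<otimes>\<^bsub>F\<^esub> lm k b = y k [^]\<^bsub>F\<^esub> a k \<otimes>\<^bsub>F\<^esub> (lm (Suc k) a \<otimes>\<^bsub>F\<^esub> y k [^]\<^bsub>F\<^esub> b k) \<otimes>\<^bsub>F\<^esub> lm (Suc k) b"
    using step u by (simp add: lm_step A.m_assoc)
  also have "\<dots> = pw (\<Sum>j\<in>{Suc k..r}. a j * (2 * (b k * L j k))) \<odot>\<^bsub>F\<^esub>
     ((y k [^]\<^bsub>F\<^esub> a k \<otimes>\<^bsub>F\<^esub> y k [^]\<^bsub>F\<^esub> b k) \<otimes>\<^bsub>F\<^esub> (lm (Suc k) a \<otimes>\<^bsub>F\<^esub> lm (Suc k) b))"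
    unfolding 1 using u by (simp add: smult_mult_left smult_mult_right A.m_assoc)
  also have "\<dots> = pw (2 * om k a b) \<odot>\<^bsub>F\<^esub> lm k (\<lambda>i. a i + b i)"
    unfolding step.IH e[symmetric] A.unit_int_pow_add[OF yk(1), symmetric]
    using step u ypow_unit A.Units_closed by (simp add: lm_step smult_mult_right)
  finally show ?case .
qed

definition LL :: "(nat \<Rightarrow> int) \<Rightarrow> (nat \<Rightarrow> int) \<Rightarrow> int" where
  "LL a b = (\<Sum>i\<in>positions S. \<Sum>j\<in>positions S. a i * b j * L i j)"

abbreviation "nm \<equiv> normalized_monomial K h F S"

lemma nm_eq: "nm a = pw (om 1 a a) \<odot>\<^bsub>F\<^esub> lm 1 a"
proof -
  have "(\<Sum>j\<in>positions S. \<Sum>i\<in>{i\<in>positions S. i < j}. a i * a j * L j i) =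
      (\<Sum>i\<in>positions S. \<Sum>j\<in>{j\<in>positions S. i < j}. a i * a j * L j i)"
    by (rule sum.swap_restrict) (auto simp: positions_def)
  also have "\<dots> = om 1 a a"
    unfolding om_def by (intro sum.cong) (auto simp: positions_def)
  finally show ?thesis
    by (simp add: normalized_monomial_def pw_def lm_laurent)
qed

text \<open>\<open>om\<close> is a triangular half of \<open>LL\<close>; skew-symmetry of
  \<open>L\<close> turns the other half into \<open>- om 1 b a\<close>.\<close>

lemma om_skew: "om 1 a b - om 1 b a = LL a b"
proof -
  have split: "(\<Sum>j\<in>positions S. f j) = (\<Sum>j\<in>{j\<in>positions S. j < i}. f j) + f i + (\<Sum>j\<in>{Suc i..r}. f j)"
    if "i \<in> positions S" for i and f :: "nat \<Rightarrow> int"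
  proof -
    have "positions S = {j\<in>positions S. j < i} \<union> {i} \<union> {Suc i..r}"
      using that by (auto simp: positions_def)
    then have "(\<Sum>j\<in>positions S. f j) = (\<Sum>j\<in>{j\<in>positions S. j < i} \<union> {i} \<union> {Suc i..r}. f j)"
      by simp
    also have "\<dots> = (\<Sum>j\<in>{j\<in>positions S. j < i} \<union> {i}. f j) + (\<Sum>j\<in>{Suc i..r}. f j)"
      by (rule sum.union_disjoint) (auto simp: positions_def)
    also have "(\<Sum>j\<in>{j\<in>positions S. j < i} \<union> {i}. f j) = (\<Sum>j\<in>{j\<in>positions S. j < i}. f j) + f i"
      by (subst sum.union_disjoint) (auto simp: positions_def)
    finally show ?thesis .
  qed
  have "LL a b = (\<Sum>i\<in>positions S. (\<Sum>j\<in>{j\<in>positions S. j < i}. a i * b j * L i j) + (\<Sum>j\<in>{Suc i..r}. a i * b j * L i j))"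
    unfolding LL_def
  proof (intro sum.cong refl)
    fix i assume i: "i \<in> positions S"
    have "L i i = 0"
      using L_skew[OF i i] by simp
    then show "(\<Sum>j\<in>positions S. a i * b j * L i j) =
       (\<Sum>j\<in>{j\<in>positions S. j < i}. a i * b j * L i j) + (\<Sum>j\<in>{Suc i..r}. a i * b j * L i j)"
      by (simp add: split[OF i])
  qed
  also have "\<dots> = (\<Sum>i\<in>positions S. \<Sum>j\<in>{j\<in>positions S. j < i}. a i * b j * L i j) +
      (\<Sum>i\<in>positions S. \<Sum>j\<in>{Suc i..r}. a i * b j * L i j)"
    by (rule sum.distrib)
  also have "(\<Sum>i\<in>positions S. \<Sum>j\<in>{j\<in>positions S. j < i}. a i * b j * L i j) =
      (\<Sum>j\<in>positions S. \<Sum>i\<in>{i\<in>positions S. j < i}. a i * b j * L i j)"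
    by (rule sum.swap_restrict) (auto simp: positions_def)
  also have "\<dots> = om 1 a b"
    unfolding om_def by (intro sum.cong) (auto simp: positions_def)
  also have "(\<Sum>i\<in>positions S. \<Sum>j\<in>{Suc i..r}. a i * b j * L i j) = - om 1 b a"
    unfolding om_def sum_negf[symmetric]
  proof (intro sum.cong)
    fix i j assume "i \<in> {1..r}" "j \<in> {Suc i..r}"
    then show "a i * b j * L i j = - (b j * a i * L j i)"
      using L_skew[of i j] by (simp add: positions_def)
  qed (auto simp: positions_def)
  finally show ?thesis by simp
qed

lemma om_add: "om k (\<lambda>i. a i + a' i) b = om k a b + om k a' b" "om k b (\<lambda>i. a i + a' i) = om k b a + om k b a'"
  by (simp_all add: om_def algebra_simps sum.distrib)

lemma LL_add: "LL (\<lambda>i. a i + a' i) b = LL a b + LL a' b" "LL b (\<lambda>i. a i + a' i) = LL b a + LL b a'"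
  by (simp_all add: LL_def algebra_simps sum.distrib)

lemma LL_uminus: "LL (\<lambda>i. - a i) b = - LL a b" "LL b (\<lambda>i. - a i) = - LL b a"
  by (simp_all add: LL_def sum_negf)

lemma nm_unit: "nm a \<in> Units F"
  unfolding nm_eq by (rule smult_unit) (simp_all add: lm_unit)

lemma nm_closed [simp]: "nm a \<in> carrier F"
  using nm_unit A.Units_closed by blast

text \<open>The normalisation trades the triangular form \<open>om\<close> for the skew form
  \<open>LL\<close>. The \<open>nm a\<close> thus multiply like the monomials \<open>M\<close> of
  the torus, with \<open>L\<close> in the role of \<open>Lam\<close>, which makes the scalars of
  mutation comparable with those of \<open>exchange_identity\<close>.\<close>

lemma nm_mult: "nm a \<otimes>\<^bsub>F\<^esub> nm b = pw (LL a b) \<odot>\<^bsub>F\<^esub> nm (\<lambda>i. a i + b i)"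
proof -
  have "om 1 a a + om 1 b b + 2 * om 1 a b = LL a b + om 1 (\<lambda>i. a i + b i) (\<lambda>i. a i + b i)"
    by (simp add: om_add om_skew[symmetric])
  then show ?thesis
    by (simp add: nm_eq smult_mult_left smult_mult_right lm_mult lm_closed algebra_simps)
qed

lemma LL_skew: "LL a b = - LL b a"
  using om_skew[of a b] om_skew[of b a] by simp

lemma nm_comm: "nm a \<otimes>\<^bsub>F\<^esub> nm b = pw (2 * LL a b) \<odot>\<^bsub>F\<^esub> (nm b \<otimes>\<^bsub>F\<^esub> nm a)"
  by (simp add: nm_mult add.commute[of "b _"] LL_skew[of b a])

lemma nm_cong: "(\<And>i. i \<in> positions S \<Longrightarrow> a i = b i) \<Longrightarrow> nm a = nm b"
proof -
  assume *: "\<And>i. i \<in> positions S \<Longrightarrow> a i = b i"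
  have "lm 1 a = lm 1 b"
    using * by (intro lm_cong) (auto simp: pos_iff)
  moreover have "om 1 a a = om 1 b b"
    unfolding om_def using * by (intro sum.cong refl) (auto simp: pos_iff)
  ultimately show ?thesis by (simp add: nm_eq)
qed

definition uv :: "nat \<Rightarrow> nat \<Rightarrow> int" where "uv k i = (if i = k then 1 else 0)"

lemma nm_zero: "nm (\<lambda>i. 0) = \<one>\<^bsub>F\<^esub>"
proof -
  have "lm k (\<lambda>i. 0) = \<one>\<^bsub>F\<^esub>" if "1 \<le> k" for k
    using that by (induction k rule: pos_induct) (simp_all add: lm_end lm_step)
  then show ?thesis by (simp add: nm_eq om_def)
qed

lemma nm_uv:
  assumes "k \<in> positions S"
  shows "nm (uv k) = y k"
proof -
  have yc: "y k \<in> carrier F"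
    using Y_unit[OF assms] A.Units_closed by blast
  have "lm j (uv k) = (if j \<le> k then y k else \<one>\<^bsub>F\<^esub>)" if "1 \<le> j" for j
    using that
  proof (induction j rule: pos_induct)
    case (le j)
    then show ?case using assms by (simp add: lm_end pos_iff)
  next
    case (step j)
    then show ?case
      using yc A.unit_int_pow_one[OF Y_unit[OF assms]]
      by (cases j k rule: linorder_cases) (simp_all add: lm_step uv_def)
  qed
  then have "lm 1 (uv k) = y k"
    using assms by (simp add: pos_iff)
  moreover have "om 1 (uv k) (uv k) = 0"
    unfolding om_def by (intro sum.neutral ballI) (auto simp: uv_def)
  ultimately show ?thesis
    using yc by (simp add: nm_eq)
qed

lemma LL_uv: "k \<in> positions S \<Longrightarrow> LL a (uv k) = (\<Sum>i\<in>positions S. a i * L i k)"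
  unfolding LL_def
proof (intro sum.cong refl)
  fix i assume "k \<in> positions S"
  have "(\<Sum>j\<in>positions S. a i * uv k j * L i j) = (\<Sum>j\<in>positions S. if j = k then a i * L i k else 0)"
    by (intro sum.cong refl) (simp add: uv_def)
  then show "(\<Sum>j\<in>positions S. a i * uv k j * L i j) = a i * L i k"
    using \<open>k \<in> positions S\<close> by (simp add: positions_def)
qed

end

section \<open>Seeds labelled by triangulations, and their mutation\<close>

section \<open>The seeds of triangulations\<close>

locale cell_fractions = schubert_cell K h m s t for K (structure) and h and m s t +
  fixes F :: "('a, 'f, 'n) module_scheme" (structure) and j :: "((int \<Rightarrow>\<^sub>0 int) \<Rightarrow> 'a) \<Rightarrow> 'f"
  assumes F_algebra: "assoc_algebra K F" and F_skew: "skew_field F"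
    and j_hom: "j \<in> algebra_hom K R.T F" and j_inj: "inj_on j (carrier R.T)"
begin

sublocale F: skew_algebra K F
  by (intro skew_algebra.intro skew_algebra_axioms.intro F_algebra F_skew)

sublocale J: algebra_morphism K R.T F j
  by unfold_locales (rule j_hom)

lemma F_pw [simp]: "x \<in> carrier F \<Longrightarrow> pw a \<odot>\<^bsub>F\<^esub> (pw b \<odot>\<^bsub>F\<^esub> x) = pw (a + b) \<odot>\<^bsub>F\<^esub> x"
  by (rule pw_smult[OF F_algebra])

text \<open>
  Vertices are the columns \<open>0, \<dots>, s\<close> and the additional vertex \<open>Suc t\<close>; the pairs \<open>(p, Suc t)\<close> with
  \<open>s < p \<le> t\<close> stand for the generators of the first row that are isolated coefficients, and the side
  \<open>(0, Suc t)\<close> of the polygon for the element \<open>1\<close>.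
\<close>

definition va :: "nat \<times> nat \<Rightarrow> bool" where
  "va \<alpha> \<longleftrightarrow> fst \<alpha> < snd \<alpha> \<and> (snd \<alpha> \<le> s \<or> snd \<alpha> = Suc t)"

definition nn :: "nat \<times> nat \<Rightarrow> 'f" where "nn \<alpha> = j (N s (fst \<alpha>) (snd \<alpha>))"

definition gg :: "nat \<times> nat \<Rightarrow> (int \<Rightarrow>\<^sub>0 int)" where "gg \<alpha> = g s (fst \<alpha>) (snd \<alpha>)"

lemma va_N: "va \<alpha> \<Longrightarrow> N s (fst \<alpha>) (snd \<alpha>) \<in> carrier R.T"
  by (intro N_R) (auto simp: va_def)

lemma N_ne:
  assumes "a < b"
  shows "N s a b \<noteq> \<zero>\<^bsub>T\<^esub>"
proof (cases "b \<le> s")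
  case False
  then show ?thesis by (simp add: N_def Q.delta_ne)
next
  case True
  let ?e = "E a + E b"
  have "W ?e a b (?e + U b) = (\<Oplus>\<^bsub>K\<^esub>k\<in>{a<..b}. M (?e + U k) (?e + U b))"
    unfolding W_def by (rule Q.finsum_T_apply) auto
  also have "\<dots> = (\<Oplus>\<^bsub>K\<^esub>k\<in>{a<..b}. if b = k then \<one>\<^bsub>K\<^esub> else \<zero>\<^bsub>K\<^esub>)"
  proof (intro K.add.finprod_cong' refl)
    show "M (?e + U k) (?e + U b) = (if b = k then \<one>\<^bsub>K\<^esub> else \<zero>\<^bsub>K\<^esub>)" if "k \<in> {a<..b}" for k
    proof (cases "k = b")
      case False
      then have "U k < U b"
        using that by (intro U_less) auto
      then show ?thesis
        using False by (auto simp: Q.delta_def)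
    qed (simp add: Q.delta_def)
  qed auto
  also have "\<dots> = \<one>\<^bsub>K\<^esub>"
    using assms by (intro K.finsum_singleton) auto
  finally have "W ?e a b (?e + U b) \<noteq> \<zero>\<^bsub>K\<^esub>"
    by simp
  then show ?thesis
    using True by (auto simp: N_def Q.T_ops)
qed

lemma nn_unit:
  assumes "va \<alpha>"
  shows "nn \<alpha> \<in> Units F"
proof -
  have N: "N s (fst \<alpha>) (snd \<alpha>) \<in> carrier R.T" "N s (fst \<alpha>) (snd \<alpha>) \<noteq> \<zero>\<^bsub>R.T\<^esub>"
    using va_N[OF assms] N_ne[of "fst \<alpha>" "snd \<alpha>"] assms unfolding R_ops va_def by blast+
  have "nn \<alpha> \<noteq> \<zero>\<^bsub>F\<^esub>"
    using inj_onD[OF j_inj, of "N s (fst \<alpha>) (snd \<alpha>)" "\<zero>\<^bsub>R.T\<^esub>"] N J.hom_zero R.T.M.zero_closed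
    unfolding nn_def by metis
  then show ?thesis
    unfolding F.unit_iff using J.hom_simps(1)[OF N(1)] by (simp add: nn_def)
qed

lemma nn_closed: "va \<alpha> \<Longrightarrow> nn \<alpha> \<in> carrier F"
  using nn_unit F.A.Units_closed by blast

lemma nn_top: "nn (0, Suc t) = \<one>\<^bsub>F\<^esub>" "gg (0, Suc t) = 0"
proof -
  have "N s 0 (Suc t) = \<one>\<^bsub>R.T\<^esub>"
    using s_le by (simp add: N_def E_def R_ops Q.T_ops)
  then show "nn (0, Suc t) = \<one>\<^bsub>F\<^esub>"
    by (simp add: nn_def J.hom_simps)
  show "gg (0, Suc t) = 0"
    using s_le by (simp add: gg_def g_def E_def)
qed

definition qd :: "nat \<Rightarrow> nat \<Rightarrow> nat \<Rightarrow> nat \<Rightarrow> bool" where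
  "qd a b c d \<longleftrightarrow> a < b \<and> b < c \<and> c < d \<and> c \<le> s \<and> (d \<le> s \<or> d = Suc t)"

lemma qd_va:
  assumes "qd a b c d"
  shows "va (a, b)" "va (b, c)" "va (c, d)" "va (a, d)" "va (a, c)" "va (b, d)"
  using assms by (auto simp: qd_def va_def)

lemma exchange:
  assumes "qd a b c d"
  shows "nn (a, c) \<otimes>\<^bsub>F\<^esub> nn (b, d) =
    pw (Lam m (gg (a, c)) (gg (a, b) + gg (c, d)) - Lam m (gg (a, b)) (gg (c, d))) \<odot>\<^bsub>F\<^esub> (nn (a, b) \<otimes>\<^bsub>F\<^esub> nn (c, d)) \<oplus>\<^bsub>F\<^esub>
    pw (Lam m (gg (a, c)) (gg (a, d) + gg (b, c)) - Lam m (gg (a, d)) (gg (b, c))) \<odot>\<^bsub>F\<^esub> (nn (a, d) \<otimes>\<^bsub>F\<^esub> nn (b, c))"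
proof -
  note NR = qd_va[OF assms, THEN va_N, unfolded fst_conv snd_conv]
  have "N s a c \<otimes>\<^bsub>R.T\<^esub> N s b d =
    pw (Lam m (g s a c) (g s a b + g s c d) - Lam m (g s a b) (g s c d)) \<odot>\<^bsub>R.T\<^esub> (N s a b \<otimes>\<^bsub>R.T\<^esub> N s c d) \<oplus>\<^bsub>R.T\<^esub>
    pw (Lam m (g s a c) (g s a d + g s b c) - Lam m (g s a d) (g s b c)) \<odot>\<^bsub>R.T\<^esub> (N s a d \<otimes>\<^bsub>R.T\<^esub> N s b c)"
    unfolding R_ops by (rule exchange_identity) (use assms s_le t_le in \<open>auto simp: qd_def\<close>)
  from arg_cong[OF this, of j] show ?thesis
    unfolding nn_def gg_def fst_conv snd_conv
    using NR by (simp only: J.hom_simps R.T.A.m_closed R.T.smult_closed pw_in)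
qed

text \<open>Of the two terms of the exchange relation, the one of \<open>(a, d)\<close> and
  \<open>(b, c)\<close> carries the leading exponent; the other differs from it by
  \<open>U b - U c\<close>, which is negative by \<open>U_less\<close>.\<close>

lemma gg_flip:
  assumes "qd a b c d"
  shows "gg (a, c) + gg (b, d) = gg (a, d) + gg (b, c)"
    and "gg (a, b) + gg (c, d) = gg (a, d) + gg (b, c) + (U b - U c)"
  using assms s_le by (auto simp: qd_def gg_def g_def algebra_simps)

text \<open>Up to sign, \<open>U b - U c\<close> is the exponent of the exchange column of the
  diagonal, so this is the vanishing part of compatibility. Its form value on \<open>E x\<close> is
  \<open>- 2\<close> for \<open>b \<le> x < c\<close> and \<open>0\<close> otherwise; not crossing
  excludes that range or forces these values to cancel against that of \<open>U y\<close>.\<close>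

lemma compat_zero:
  assumes qd: "qd a b c d" and \<alpha>: "va \<alpha>"
    and nc: "\<not> cross \<alpha> (a, c)" "\<not> cross \<alpha> (b, d)" "\<not> cross \<alpha> (a, b)" "\<not> cross \<alpha> (b, c)"
  shows "Lam m (U b - U c) (gg \<alpha>) = 0"
proof -
  obtain x y where xy: "\<alpha> = (x, y)" by (cases \<alpha>)
  have abc: "0 < b" "0 < c" "b < c" "a < b" "c < d" "b \<le> m" "c \<le> m" "b \<le> s" "c \<le> s"
    using qd s_le t_le by (auto simp: qd_def)
  have xy': "x < y" "y \<le> s \<or> y = Suc t"
    using \<alpha> by (auto simp: va_def xy)
  have xm: "x \<le> m" using xy' s_le t_le by auto
  have f: "Lam m (U b - U c) (E z) = (if b \<le> z \<and> z < c then - 2 else 0)" if "z \<le> m" for z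
    using that abc by (auto simp: Lam_simps)
  note nc' = nc[unfolded xy cross_def fst_conv snd_conv]
  show ?thesis
  proof (cases "y \<le> s")
    case False
    then have "\<not> (b \<le> x \<and> x < c)"
      using nc'(1) xy' abc s_le by auto
    then show ?thesis
      using False f[OF xm] by (simp add: xy gg_def g_def)
  next
    case True
    then have ym: "y \<le> m" "0 < y" using s_le t_le xy' by auto
    have u: "Lam m (U b - U c) (U y) = 2 * sgn (int y - int b) - 2 * sgn (int y - int c)"
      using ym abc by (simp add: Lam_simps)
    have eq: "Lam m (U b - U c) (gg \<alpha>) = (if b \<le> x \<and> x < c then - 2 else 0) +
        (if b \<le> y \<and> y < c then - 2 else 0) + (2 * sgn (int y - int b) - 2 * sgn (int y - int c))"
      using True by (simp add: xy gg_def g_def Lam_add f[OF xm] f[OF ym(1)] u)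
    consider "y < b" | "y = b" | "b < y" "y < c" | "y = c" | "c < y"
      by linarith
    then show ?thesis
    proof cases
      case 3
      have "b \<le> x"
      proof (rule ccontr)
        assume "\<not> b \<le> x"
        then show False
          using nc' 3 abc by (cases x a rule: linorder_cases) auto
      qed
      then show ?thesis using eq 3 xy' by simp
    next
      case 4
      have "b \<le> x"
        using nc'(2) 4 abc by auto
      then show ?thesis using eq 4 xy' abc by simp
    next
      case 5
      have "\<not> (b \<le> x \<and> x < c)"
        using nc'(1) 5 abc by auto
      then show ?thesis using eq 5 abc by auto
    qed (use eq xy' abc in auto)
  qed
qed

text \<open>The value \<open>2\<close> becomes the diagonal entry in the compatibility of
  \<open>B\<close> and \<open>L\<close>; its sign changes with the diagonal, as does that of the
  column.\<close>

lemma compat_diag: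
  assumes qd: "qd a b c d"
  shows "Lam m (U b - U c) (gg (a, c)) = 2" "Lam m (U b - U c) (gg (b, d)) = - 2"
  using assms s_le t_le by (auto simp: qd_def gg_def g_def Lam_simps)

text \<open>The fan at the vertex \<open>Suc t\<close>: positions below \<open>s\<close> are its
  diagonals, \<open>s\<close> is the side at its end, \<open>s + 1, ..., t\<close> are isolated
  coefficients, and \<open>t + l\<close> is the side \<open>(l - 1, l)\<close>.\<close>

definition P0 :: "nat \<Rightarrow> nat \<times> nat" where
  "P0 i = (if i \<le> t then (i, Suc t) else (i - t - 1, i - t))"

definition quad :: "'f seed \<Rightarrow> (nat \<Rightarrow> nat \<times> nat) \<Rightarrow> nat \<Rightarrow> nat \<Rightarrow> nat \<Rightarrow> nat \<Rightarrow> nat \<Rightarrow> int \<Rightarrow> nat \<times> nat \<Rightarrow> bool" where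
  "quad S P k a b c d \<sigma> \<kappa>' \<longleftrightarrow> qd a b c d \<and> diag a b c d \<sigma> (P k) \<kappa>' \<and>
     sides a b c d \<subseteq> insert (0, Suc t) (P ` {1..t + s}) \<and>
     (\<forall>i\<in>{1..t + s}. sd_exch S i k = \<sigma> * col a b c d (P i))"

text \<open>
  The positions of a seed \<open>S\<close> are labelled by the sides and diagonals of a triangulation of the
  polygon, and the column of its exchange matrix at a diagonal is read off the surrounding quadrilateral.
\<close>

definition tri :: "'f seed \<Rightarrow> (nat \<Rightarrow> nat \<times> nat) \<Rightarrow> bool" where
  "tri S P \<longleftrightarrow> sd_rank S = t + s \<and> sd_mutable S = {1..<s} \<and>
     (\<forall>i\<in>{1..t + s}. sd_cluster S i = nn (P i)) \<and>
     (\<forall>i\<in>{1..t + s}. \<forall>k\<in>{1..t + s}. sd_quasi S i k = Lam m (gg (P i)) (gg (P k))) \<and>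
     (\<forall>i\<in>{s..t + s}. P i = P0 i) \<and>
     (\<forall>i\<in>{1..t + s}. va (P i) \<and> P i \<noteq> (0, Suc t)) \<and> inj_on P {1..t + s} \<and>
     (\<forall>i\<in>{1..t + s}. \<forall>k\<in>{1..t + s}. \<not> cross (P i) (P k)) \<and>
     (\<forall>k\<in>{1..<s}. \<exists>a b c d \<sigma> \<kappa>'. quad S P k a b c d \<sigma> \<kappa>') \<and>
     (\<forall>i\<in>{1..<s}. \<forall>k\<in>{1..<s}. sd_exch S i k = - sd_exch S k i) \<and>
     (\<forall>i\<in>{1..t + s}. \<forall>k\<in>{1..t + s}. sd_cluster S i \<otimes>\<^bsub>F\<^esub> sd_cluster S k =
        pw (2 * sd_quasi S i k) \<odot>\<^bsub>F\<^esub> (sd_cluster S k \<otimes>\<^bsub>F\<^esub> sd_cluster S i))"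

context
  fixes S P assumes tri: "tri S P"
begin

lemma triD:
  "sd_rank S = t + s" "sd_mutable S = {1..<s}"
  "\<And>i. i \<in> {1..t + s} \<Longrightarrow> sd_cluster S i = nn (P i)"
  "\<And>i k. i \<in> {1..t + s} \<Longrightarrow> k \<in> {1..t + s} \<Longrightarrow> sd_quasi S i k = Lam m (gg (P i)) (gg (P k))"
  "\<And>i. i \<in> {s..t + s} \<Longrightarrow> P i = P0 i"
  "\<And>i. i \<in> {1..t + s} \<Longrightarrow> va (P i)" "\<And>i. i \<in> {1..t + s} \<Longrightarrow> P i \<noteq> (0, Suc t)"
  "inj_on P {1..t + s}"
  "\<And>i k. i \<in> {1..t + s} \<Longrightarrow> k \<in> {1..t + s} \<Longrightarrow> \<not> cross (P i) (P k)"
  "\<And>k. k \<in> {1..<s} \<Longrightarrow> \<exists>a b c d \<sigma> \<kappa>'. quad S P k a b c d \<sigma> \<kappa>'"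
  "\<And>i k. i \<in> {1..<s} \<Longrightarrow> k \<in> {1..<s} \<Longrightarrow> sd_exch S i k = - sd_exch S k i"
  "\<And>i k. i \<in> {1..t + s} \<Longrightarrow> k \<in> {1..t + s} \<Longrightarrow> sd_cluster S i \<otimes>\<^bsub>F\<^esub> sd_cluster S k =
        pw (2 * sd_quasi S i k) \<odot>\<^bsub>F\<^esub> (sd_cluster S k \<otimes>\<^bsub>F\<^esub> sd_cluster S i)"
  using tri unfolding tri_def by blast+

lemma positions_tri: "positions S = {1..t + s}"
  by (simp add: positions_def triD(1))

interpretation quantum_cluster K F h S
proof unfold_locales
  fix i k
  assume "i \<in> positions S"
  then have i: "i \<in> {1..t + s}" unfolding positions_tri .
  show "sd_cluster S i \<in> Units F"
    unfolding triD(3)[OF i] by (rule nn_unit[OF triD(6)[OF i]])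
  assume "k \<in> positions S"
  then have k: "k \<in> {1..t + s}" unfolding positions_tri .
  show "sd_quasi S i k = - sd_quasi S k i"
    unfolding triD(4)[OF i k] triD(4)[OF k i] by (rule Lam_skew)
  show "sd_cluster S i \<otimes>\<^bsub>F\<^esub> sd_cluster S k = pw (2 * sd_quasi S i k) \<odot>\<^bsub>F\<^esub> (sd_cluster S k \<otimes>\<^bsub>F\<^esub> sd_cluster S i)"
    by (rule triD(12)[OF i k])
qed

text \<open>The exponent vector of a label in the cluster. No position carries
  \<open>(0, Suc t)\<close>, so its vector is \<open>0\<close>, in accordance with the element
  \<open>1\<close>.\<close>

definition ep :: "nat \<times> nat \<Rightarrow> nat \<Rightarrow> int" where
  "ep \<alpha> i = (if i \<in> {1..t + s} \<and> P i = \<alpha> then 1 else 0)"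

definition lab :: "(nat \<times> nat) set" where "lab = insert (0, Suc t) (P ` {1..t + s})"

lemma ep_P: "i \<in> {1..t + s} \<Longrightarrow> ep (P i) = uv i"
proof
  fix k assume i: "i \<in> {1..t + s}"
  have "k = i" if "k \<in> {1..t + s}" "P k = P i"
    using inj_onD[OF triD(8) that(2) that(1) i] .
  then have "k \<in> {1..t + s} \<and> P k = P i \<longleftrightarrow> k = i"
    using i by blast
  then show "ep (P i) k = uv i k"
    unfolding ep_def uv_def by (rule if_cong) (rule refl)+
qed

lemma lab_cases:
  assumes "\<alpha> \<in> lab"
  obtains "\<alpha> = (0, Suc t)" "ep \<alpha> = (\<lambda>i. 0)" | i where "i \<in> {1..t + s}" "\<alpha> = P i" "ep \<alpha> = uv i"
proof -
  have 0: "ep (0, Suc t) = (\<lambda>i. 0)"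
  proof
    fix i
    show "ep (0, Suc t) i = 0"
      using triD(7)[of i] by (simp add: ep_def)
  qed
  from assms consider "\<alpha> = (0, Suc t)" | i where "i \<in> {1..t + s}" "\<alpha> = P i"
    unfolding lab_def by blast
  then show thesis
  proof cases
    case 1
    show thesis by (rule that(1)[OF 1]) (unfold 1, rule 0)
  next
    case (2 i)
    show thesis by (rule that(2)[OF 2]) (unfold 2(2), rule ep_P[OF 2(1)])
  qed
qed

lemma sum_ep:
  assumes "\<alpha> \<in> lab" "\<And>i. i \<in> {1..t + s} \<Longrightarrow> f i = \<phi> (gg (P i))" "\<phi> 0 = 0"
  shows "(\<Sum>i\<in>{1..t + s}. ep \<alpha> i * f i) = \<phi> (gg \<alpha>)"
proof -
  from assms(1) show ?thesis
  proof (cases rule: lab_cases)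
    case 1
    show ?thesis
      unfolding 1(2) unfolding 1(1) nn_top(2) assms(3) by simp
  next
    case (2 i)
    have "(\<Sum>k\<in>{1..t + s}. ep \<alpha> k * f k) = (\<Sum>k\<in>{1..t + s}. if k = i then f k else 0)"
      unfolding 2(3) by (intro sum.cong refl) (simp add: uv_def)
    also have "\<dots> = f i"
      using 2(1) by simp
    finally show ?thesis
      unfolding 2(2) assms(2)[OF 2(1)] .
  qed
qed

lemma nm_ep: "\<alpha> \<in> lab \<Longrightarrow> nm (ep \<alpha>) = nn \<alpha>"
  by (erule lab_cases) (simp_all add: nm_zero nn_top nm_uv positions_tri triD(3))

lemma LL_zero: "LL (\<lambda>i. 0) b = 0" "LL b (\<lambda>i. 0) = 0"
  by (simp_all add: LL_def)

lemma LL_uv_uv: "i \<in> {1..t + s} \<Longrightarrow> k \<in> {1..t + s} \<Longrightarrow> LL (uv i) (uv k) = Lam m (gg (P i)) (gg (P k))"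
proof -
  assume ik: "i \<in> {1..t + s}" "k \<in> {1..t + s}"
  have "LL (uv i) (uv k) = (\<Sum>i'\<in>{1..t + s}. uv i i' * sd_quasi S i' k)"
    unfolding positions_tri[symmetric] by (rule LL_uv) (use ik in \<open>simp add: positions_tri\<close>)
  also have "\<dots> = (\<Sum>i'\<in>{1..t + s}. if i' = i then sd_quasi S i k else 0)"
    by (intro sum.cong refl) (simp add: uv_def)
  also have "\<dots> = sd_quasi S i k"
    using ik(1) by simp
  finally show ?thesis
    by (simp only: triD(4)[OF ik])
qed

lemma LL_ep: "\<alpha> \<in> lab \<Longrightarrow> \<beta> \<in> lab \<Longrightarrow> LL (ep \<alpha>) (ep \<beta>) = Lam m (gg \<alpha>) (gg \<beta>)"
  by (erule lab_cases; erule lab_cases) (simp_all add: LL_zero nn_top Lam_zero LL_uv_uv)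

lemma P_lab: "i \<in> {1..t + s} \<Longrightarrow> P i \<in> lab"
  by (simp add: lab_def)

lemma lab_va: "\<alpha> \<in> lab \<Longrightarrow> va \<alpha>"
  unfolding lab_def using triD(6) by (auto simp: va_def[of "(0, Suc t)"])

lemma lab_not_cross: "i \<in> {1..t + s} \<Longrightarrow> \<beta> \<in> lab \<Longrightarrow> \<not> cross (P i) \<beta>"
proof -
  assume i: "i \<in> {1..t + s}" and "\<beta> \<in> lab"
  then consider "\<beta> = (0, Suc t)" | k where "k \<in> {1..t + s}" "\<beta> = P k"
    by (auto simp: lab_def)
  then show ?thesis
  proof cases
    case 1
    then show ?thesis
      using triD(6)[OF i] s_le by (auto simp: cross_def va_def)
  next
    case 2
    then show ?thesis using triD(9)[OF i] by simp
  qed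
qed

context
  fixes k a b c d \<sigma> \<kappa>'
  assumes k: "k \<in> {1..<s}" and quad: "quad S P k a b c d \<sigma> \<kappa>'"
begin

lemma k_pos: "k \<in> {1..t + s}"
  using k by auto

lemma quadD: "qd a b c d" "diag a b c d \<sigma> (P k) \<kappa>'" "sides a b c d \<subseteq> lab"
  "\<And>i. i \<in> {1..t + s} \<Longrightarrow> sd_exch S i k = \<sigma> * col a b c d (P i)"
  using quad by (auto simp: quad_def lab_def)

lemma ord: "a < b" "b < c" "c < d" "c \<le> s" "d \<le> s \<or> d = Suc t"
  using quadD(1) by (auto simp: qd_def)

lemma sides_lab: "(a, b) \<in> lab" "(b, c) \<in> lab" "(c, d) \<in> lab" "(a, d) \<in> lab"
  using quadD(3) by (auto simp: sides_def)

lemma kappa_va: "va \<kappa>'"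
  using quadD(2) qd_va[OF quadD(1)] by (auto simp: diag_def)

lemma kappa_cross: "cross (P k) \<kappa>'" "cross \<kappa>' (P k)"
  using cross_diag[OF ord(1-3) quadD(2)] by auto

lemma kappa_not_lab: "\<kappa>' \<notin> lab"
  using lab_not_cross[OF k_pos] kappa_cross by blast

lemma not_cross_kappa:
  assumes "i \<in> {1..t + s}" "i \<noteq> k"
  shows "\<not> cross (P i) \<kappa>'"
proof (rule not_cross_flip[OF ord(1-3) quadD(2)])
  show "fst (P i) < snd (P i)"
    using triD(6)[OF assms(1)] by (simp add: va_def)
  show "P i \<noteq> P k"
    using inj_onD[OF triD(8)] assms k_pos by blast
  show "\<not> cross (P i) (P k)"
    using triD(9) assms k_pos by blast
  show "\<And>\<beta>. \<beta> \<in> sides a b c d \<Longrightarrow> \<not> cross (P i) \<beta>"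
    using lab_not_cross[OF assms(1)] quadD(3) by blast
qed

lemma Lam_compat:
  assumes i: "i \<in> {1..t + s}" "i \<noteq> k"
  shows "Lam m (U b - U c) (gg (P i)) = 0"
proof (rule compat_zero[OF quadD(1) triD(6)[OF i(1)]])
  have "\<not> cross (P i) (P k)" "\<not> cross (P i) \<kappa>'"
    using triD(9)[OF i(1) k_pos] not_cross_kappa[OF i] by auto
  then show "\<not> cross (P i) (a, c)" "\<not> cross (P i) (b, d)"
    using quadD(2) by (auto simp: diag_def)
  show "\<not> cross (P i) (a, b)" "\<not> cross (P i) (b, c)"
    using lab_not_cross[OF i(1)] sides_lab by auto
qed

lemma gg_diag: "gg (P k) + gg \<kappa>' = gg (a, d) + gg (b, c)"
  using quadD(2) gg_flip(1)[OF quadD(1)] by (auto simp: diag_def add.commute)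

text \<open>Both pairs of opposite sides have the same exponent sum as the two diagonals, up to
  \<open>U b - U c\<close>, which pairs to \<open>0\<close> with every label except that of position
  \<open>k\<close>.\<close>

lemma Lam_sides:
  assumes i: "i \<in> {1..t + s}" "i \<noteq> k"
  shows "Lam m (gg (a, b)) (gg (P i)) + Lam m (gg (c, d)) (gg (P i)) = Lam m (gg (P k)) (gg (P i)) + Lam m (gg \<kappa>') (gg (P i))"
    and "Lam m (gg (a, d)) (gg (P i)) + Lam m (gg (b, c)) (gg (P i)) = Lam m (gg (P k)) (gg (P i)) + Lam m (gg \<kappa>') (gg (P i))"
proof -
  show 1: "Lam m (gg (a, d)) (gg (P i)) + Lam m (gg (b, c)) (gg (P i)) = Lam m (gg (P k)) (gg (P i)) + Lam m (gg \<kappa>') (gg (P i))"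
    unfolding Lam_add(1)[symmetric] gg_diag ..
  have "Lam m (gg (a, b)) (gg (P i)) + Lam m (gg (c, d)) (gg (P i)) =
      Lam m (gg (a, d)) (gg (P i)) + Lam m (gg (b, c)) (gg (P i)) + Lam m (U b - U c) (gg (P i))"
    unfolding Lam_add(1)[symmetric] gg_flip(2)[OF quadD(1)] ..
  then show "Lam m (gg (a, b)) (gg (P i)) + Lam m (gg (c, d)) (gg (P i)) = Lam m (gg (P k)) (gg (P i)) + Lam m (gg \<kappa>') (gg (P i))"
    using Lam_compat[OF i] 1 by simp
qed

text \<open>The two pairs of opposite sides, sorted by the sign of the corresponding entries of the column.\<close>

definition \<alpha>1 where "\<alpha>1 = (if \<sigma> = 1 then (a, b) else (a, d))"
definition \<alpha>2 where "\<alpha>2 = (if \<sigma> = 1 then (c, d) else (b, c))"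
definition \<beta>1 where "\<beta>1 = (if \<sigma> = 1 then (a, d) else (a, b))"
definition \<beta>2 where "\<beta>2 = (if \<sigma> = 1 then (b, c) else (c, d))"

lemmas \<alpha>\<beta>_def = \<alpha>1_def \<alpha>2_def \<beta>1_def \<beta>2_def

lemma \<alpha>\<beta>_lab: "\<alpha>1 \<in> lab" "\<alpha>2 \<in> lab" "\<beta>1 \<in> lab" "\<beta>2 \<in> lab"
  using sides_lab by (auto simp: \<alpha>\<beta>_def)

lemma exch_sign:
  assumes i: "i \<in> {1..t + s}"
  shows "(if sd_exch S i k > 0 then sd_exch S i k else 0) = ep \<alpha>1 i + ep \<alpha>2 i"
    and "- (if sd_exch S i k < 0 then sd_exch S i k else 0) = ep \<beta>1 i + ep \<beta>2 i"
proof -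
  have \<sigma>: "\<sigma> = 1 \<or> \<sigma> = - 1"
    using quadD(2) by (auto simp: diag_def)
  consider "P i = (a, b)" | "P i = (b, c)" | "P i = (c, d)" | "P i = (a, d)" | "P i \<notin> sides a b c d"
    by (auto simp: sides_def)
  then have "(if sd_exch S i k > 0 then sd_exch S i k else 0) = ep \<alpha>1 i + ep \<alpha>2 i \<and>
     - (if sd_exch S i k < 0 then sd_exch S i k else 0) = ep \<beta>1 i + ep \<beta>2 i"
  proof cases
    case 5
    then have "sd_exch S i k = 0"
      using col_zero_iff[OF ord(1-3), of "P i"] quadD(4)[OF i] by simp
    then show ?thesis
      using 5 by (auto simp: ep_def \<alpha>\<beta>_def sides_def)
  qed (use \<sigma> i ord quadD(4)[OF i] col_side[OF ord(1-3)] in \<open>auto simp: ep_def \<alpha>\<beta>_def\<close>)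
  then show "(if sd_exch S i k > 0 then sd_exch S i k else 0) = ep \<alpha>1 i + ep \<alpha>2 i"
    "- (if sd_exch S i k < 0 then sd_exch S i k else 0) = ep \<beta>1 i + ep \<beta>2 i"
    by blast+
qed

definition mv :: "nat \<times> nat \<Rightarrow> nat \<times> nat \<Rightarrow> nat \<Rightarrow> int" where
  "mv \<alpha> \<beta> = (\<lambda>i. - uv k i + (ep \<alpha> i + ep \<beta> i))"

lemma mutate_variable_eq: "mutate_variable K h F k S = nm (mv \<alpha>1 \<alpha>2) \<oplus>\<^bsub>F\<^esub> nm (mv \<beta>1 \<beta>2)"
proof -
  have 1: "nm (\<lambda>i. - (if i = k then 1 else 0) + (if sd_exch S i k > 0 then sd_exch S i k else 0)) = nm (mv \<alpha>1 \<alpha>2)"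
  proof (rule nm_cong)
    fix i assume "i \<in> positions S"
    then show "- (if i = k then 1 else 0) + (if sd_exch S i k > 0 then sd_exch S i k else 0) = mv \<alpha>1 \<alpha>2 i"
      using exch_sign(1)[of i] unfolding mv_def positions_tri uv_def by simp
  qed
  have 2: "nm (\<lambda>i. - (if i = k then 1 else 0) - (if sd_exch S i k < 0 then sd_exch S i k else 0)) = nm (mv \<beta>1 \<beta>2)"
  proof (rule nm_cong)
    fix i assume "i \<in> positions S"
    then show "- (if i = k then 1 else 0) - (if sd_exch S i k < 0 then sd_exch S i k else 0) = mv \<beta>1 \<beta>2 i"
      using exch_sign(2)[of i] unfolding mv_def positions_tri uv_def by simp
  qed
  show ?thesis
    unfolding mutate_variable_def Let_def 1 2 ..
qed

lemma nm_pair: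
  assumes "\<alpha> \<in> lab" "\<beta> \<in> lab"
  shows "nm (\<lambda>i. ep \<alpha> i + ep \<beta> i) = pw (- Lam m (gg \<alpha>) (gg \<beta>)) \<odot>\<^bsub>F\<^esub> (nn \<alpha> \<otimes>\<^bsub>F\<^esub> nn \<beta>)"
  using nm_mult[of "ep \<alpha>" "ep \<beta>"] assms by (simp add: nm_ep LL_ep)

lemma LL_uv_pair:
  assumes "\<alpha> \<in> lab" "\<beta> \<in> lab" "i \<in> {1..t + s}"
  shows "LL (uv i) (\<lambda>i. ep \<alpha> i + ep \<beta> i) = Lam m (gg (P i)) (gg \<alpha> + gg \<beta>)"
  using assms LL_ep[OF P_lab[OF assms(3)]] by (simp add: LL_add Lam_add ep_P)

lemma nm_mv_left:
  assumes "\<alpha> \<in> lab" "\<beta> \<in> lab"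
  shows "nn (P k) \<otimes>\<^bsub>F\<^esub> nm (mv \<alpha> \<beta>) =
     pw (Lam m (gg (P k)) (gg \<alpha> + gg \<beta>) - Lam m (gg \<alpha>) (gg \<beta>)) \<odot>\<^bsub>F\<^esub> (nn \<alpha> \<otimes>\<^bsub>F\<^esub> nn \<beta>)"
proof -
  have 1: "(\<lambda>i. uv k i + mv \<alpha> \<beta> i) = (\<lambda>i. ep \<alpha> i + ep \<beta> i)"
    by (simp add: mv_def)
  have 2: "LL (uv k) (mv \<alpha> \<beta>) = Lam m (gg (P k)) (gg \<alpha> + gg \<beta>)"
    unfolding mv_def using LL_uv_pair[OF assms k_pos] LL_uv_uv[OF k_pos k_pos]
    by (simp only: LL_add(2) LL_uminus(2)) (simp add: Lam_self)
  have "nn (P k) = nm (uv k)"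
    using nm_uv[of k] k_pos triD(3) by (simp add: positions_tri)
  then show ?thesis
    using nm_mult[of "uv k" "mv \<alpha> \<beta>"] nm_pair[OF assms] lab_va[OF assms(1)] lab_va[OF assms(2)]
    unfolding 1 2 by (simp add: nn_closed)
qed

lemma nm_mv_right:
  assumes "\<alpha> \<in> lab" "\<beta> \<in> lab"
  shows "nm (mv \<alpha> \<beta>) \<otimes>\<^bsub>F\<^esub> nn (P k) =
     pw (Lam m (gg \<alpha> + gg \<beta>) (gg (P k)) - Lam m (gg \<alpha>) (gg \<beta>)) \<odot>\<^bsub>F\<^esub> (nn \<alpha> \<otimes>\<^bsub>F\<^esub> nn \<beta>)"
proof -
  have 1: "(\<lambda>i. mv \<alpha> \<beta> i + uv k i) = (\<lambda>i. ep \<alpha> i + ep \<beta> i)"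
    by (simp add: mv_def)
  have "LL (uv k) (mv \<alpha> \<beta>) = Lam m (gg (P k)) (gg \<alpha> + gg \<beta>)"
    unfolding mv_def using LL_uv_pair[OF assms k_pos] LL_uv_uv[OF k_pos k_pos]
    by (simp only: LL_add(2) LL_uminus(2)) (simp add: Lam_self)
  then have 2: "LL (mv \<alpha> \<beta>) (uv k) = Lam m (gg \<alpha> + gg \<beta>) (gg (P k))"
    using LL_skew[of "mv \<alpha> \<beta>" "uv k"] Lam_skew[of m "gg \<alpha> + gg \<beta>" "gg (P k)"] by simp
  have "nn (P k) = nm (uv k)"
    using nm_uv[of k] k_pos triD(3) by (simp add: positions_tri)
  then show ?thesis
    using nm_mult[of "mv \<alpha> \<beta>" "uv k"] nm_pair[OF assms] lab_va[OF assms(1)] lab_va[OF assms(2)]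
    unfolding 1 2 by (simp add: nn_closed)
qed

text \<open>Multiplied by the old variable, the mutation formula becomes the right-hand side of
  \<open>exchange\<close>, and the old variable cancels. It is multiplied on the left if it is
  \<open>(a, c)\<close> and on the right if it is \<open>(b, d)\<close>, as in the product of
  \<open>exchange\<close>.\<close>

lemma mutate_variable_nn: "mutate_variable K h F k S = nn \<kappa>'"
proof (cases "\<sigma> = 1")
  case True
  then have \<kappa>: "P k = (a, c)" "\<kappa>' = (b, d)"
    using quadD(2) by (auto simp: diag_def)
  have \<alpha>\<beta>: "\<alpha>1 = (a, b)" "\<alpha>2 = (c, d)" "\<beta>1 = (a, d)" "\<beta>2 = (b, c)"
    unfolding \<alpha>\<beta>_def unfolding True by simp_all
  have "nn (P k) \<otimes>\<^bsub>F\<^esub> mutate_variable K h F k S = nn (P k) \<otimes>\<^bsub>F\<^esub> nn \<kappa>'"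
    unfolding mutate_variable_eq F.A.r_distr[OF nm_closed nm_closed nn_closed[OF triD(6)[OF k_pos]]]
      nm_mv_left[OF \<alpha>\<beta>_lab(1,2)] nm_mv_left[OF \<alpha>\<beta>_lab(3,4)]
    unfolding \<kappa> \<alpha>\<beta> exchange[OF quadD(1)] ..
  moreover have "mutate_variable K h F k S \<in> carrier F"
    unfolding mutate_variable_eq by simp
  ultimately show ?thesis
    using F.A.Units_l_cancel[OF nn_unit[OF triD(6)[OF k_pos]]] nn_closed[OF kappa_va] by blast
next
  case False
  then have \<kappa>: "P k = (b, d)" "\<kappa>' = (a, c)" and "\<sigma> = - 1"
    using quadD(2) by (auto simp: diag_def)
  have \<alpha>\<beta>: "\<alpha>1 = (a, d)" "\<alpha>2 = (b, c)" "\<beta>1 = (a, b)" "\<beta>2 = (c, d)"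
    unfolding \<alpha>\<beta>_def using False by (simp_all only: if_False)
  let ?D = "gg (a, d) + gg (b, c)"
  have sum: "gg (a, c) + gg (b, d) = ?D" "gg (a, b) + gg (c, d) = ?D + (U b - U c)"
    using gg_flip[OF quadD(1)] by auto
  have UD: "Lam m (U b - U c) ?D = 0"
    using compat_diag[OF quadD(1)] unfolding sum(1)[symmetric] by (simp add: Lam_add)
  \<comment> \<open>The scalars of \<open>exchange\<close> come from pairing with
    \<open>(a, c)\<close>, those of right multiplication from pairing with \<open>(b, d)\<close>.
    They agree because the exponents of the two diagonals add up to \<open>?D\<close>.\<close>
  have e1: "Lam m ?D (gg (b, d)) = Lam m (gg (a, c)) ?D"
  proof -
    have "Lam m (gg (a, c)) ?D + Lam m (gg (b, d)) ?D = 0"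
      unfolding Lam_add(1)[symmetric] sum(1) by (rule Lam_self)
    then show ?thesis
      using Lam_skew[of m ?D "gg (b, d)"] by simp
  qed
  have e2: "Lam m (gg (a, b) + gg (c, d)) (gg (b, d)) = Lam m (gg (a, c)) (gg (a, b) + gg (c, d))"
  proof -
    have "Lam m (U b - U c) (gg (b, d)) = Lam m (gg (a, c)) (U b - U c)"
      using compat_diag[OF quadD(1)] Lam_skew[of m "gg (a, c)" "U b - U c"] by simp
    then show ?thesis
      unfolding sum(2) Lam_add(1)[of m ?D "U b - U c"] Lam_add(2)[of m _ ?D "U b - U c"] e1 by simp
  qed
  have cl: "nn (a, d) \<otimes>\<^bsub>F\<^esub> nn (b, c) \<in> carrier F" "nn (a, b) \<otimes>\<^bsub>F\<^esub> nn (c, d) \<in> carrier F"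
    using qd_va[OF quadD(1)] nn_closed by auto
  have "mutate_variable K h F k S \<otimes>\<^bsub>F\<^esub> nn (P k) = nn \<kappa>' \<otimes>\<^bsub>F\<^esub> nn (P k)"
    unfolding mutate_variable_eq F.A.l_distr[OF nm_closed nm_closed nn_closed[OF triD(6)[OF k_pos]]]
      nm_mv_right[OF \<alpha>\<beta>_lab(1,2)] nm_mv_right[OF \<alpha>\<beta>_lab(3,4)]
    unfolding \<kappa> \<alpha>\<beta> exchange[OF quadD(1)] e1 e2
    by (rule F.M.a_comm) (use cl in auto)
  moreover have "mutate_variable K h F k S \<in> carrier F"
    unfolding mutate_variable_eq by simp
  ultimately show ?thesis
    using F.unit_cancel_right[OF nn_unit[OF triD(6)[OF k_pos]]] nn_closed[OF kappa_va] by blast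
qed

text \<open>By \<open>Lam_sides\<close> both monomials of the mutated variable quasi-commute with
  the given cluster variable by the same exponent, so their sum does too.\<close>

lemma kappa_comm:
  assumes i: "i \<in> {1..t + s}" "i \<noteq> k"
  shows "nn \<kappa>' \<otimes>\<^bsub>F\<^esub> nn (P i) = pw (2 * Lam m (gg \<kappa>') (gg (P i))) \<odot>\<^bsub>F\<^esub> (nn (P i) \<otimes>\<^bsub>F\<^esub> nn \<kappa>')"
proof -
  have y: "nn (P i) = nm (uv i)"
    using nm_uv[of i] i triD(3) by (simp add: positions_tri)
  have L: "LL (mv \<alpha> \<beta>) (uv i) = Lam m (gg \<alpha>) (gg (P i)) + Lam m (gg \<beta>) (gg (P i)) - Lam m (gg (P k)) (gg (P i))"
    if "\<alpha> \<in> lab" "\<beta> \<in> lab" for \<alpha> \<beta>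
    unfolding mv_def LL_add(1) LL_uminus(1) LL_uv_uv[OF k_pos i(1)]
    using LL_ep[OF that(1) P_lab[OF i(1)]] LL_ep[OF that(2) P_lab[OF i(1)]] by (simp add: ep_P[OF i(1)])
  have L1: "LL (mv \<alpha>1 \<alpha>2) (uv i) = Lam m (gg \<kappa>') (gg (P i))" "LL (mv \<beta>1 \<beta>2) (uv i) = Lam m (gg \<kappa>') (gg (P i))"
    unfolding L[OF \<alpha>\<beta>_lab(1,2)] L[OF \<alpha>\<beta>_lab(3,4)] using Lam_sides[OF i] by (auto simp: \<alpha>\<beta>_def)
  have cl: "nm (mv \<alpha>1 \<alpha>2) \<in> carrier F" "nm (mv \<beta>1 \<beta>2) \<in> carrier F" "nm (uv i) \<in> carrier F"
    by simp_all
  show ?thesis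
    unfolding mutate_variable_nn[symmetric] mutate_variable_eq y F.A.l_distr[OF cl] F.A.r_distr[OF cl]
      nm_comm[of "mv \<alpha>1 \<alpha>2" "uv i"] nm_comm[of "mv \<beta>1 \<beta>2" "uv i"] L1
    by (rule F.smult_r_distr[symmetric]) (use cl in auto)
qed

end
end
end

section \<open>Mutation of triangulations\<close>

text \<open>Negation passes through \<open>div 2\<close> because the numerator is even: by the signs
  of the factors it is zero or plus or minus twice their product.\<close>

lemma mutate_exch_skew:
  assumes "b i k = - b k i" "b l k = - b k l" "b i l = - b l i"
  shows "mutate_exch k b i l = - mutate_exch k b l i"
proof (cases "i = k \<or> l = k")
  case False
  obtain n where n: "\<bar>b i k\<bar> * b k l + b i k * \<bar>b k l\<bar> = 2 * n"
  proof (cases "b i k \<ge> 0"; cases "b k l \<ge> 0")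
    assume "b i k \<ge> 0" "b k l \<ge> 0"
    then show thesis by (intro that[of "b i k * b k l"]) simp
  next
    assume "\<not> b i k \<ge> 0" "\<not> b k l \<ge> 0"
    then show thesis by (intro that[of "- (b i k * b k l)"]) simp
  qed (use that[of 0] in simp_all)
  have "\<bar>b l k\<bar> * b k i + b l k * \<bar>b k i\<bar> = 2 * (- n)"
    using n assms(1,2) by (simp add: algebra_simps)
  then show ?thesis
    using False assms(3) by (simp add: mutate_exch_def n)
qed (use assms in \<open>auto simp: mutate_exch_def\<close>)

context cell_fractions
begin

lemma cross_sym: "cross \<alpha> \<beta> \<longleftrightarrow> cross \<beta> \<alpha>"
  by (auto simp: cross_def)

lemma not_cross_self: "\<not> cross \<alpha> \<alpha>"
  by (simp add: cross_def)

context
  fixes S P k a b c d \<sigma> \<kappa>'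
  assumes tri: "tri S P" and k: "k \<in> {1..<s}" and quad: "quad S P k a b c d \<sigma> \<kappa>'"
begin

lemmas
  k_pos' = k_pos[OF tri k quad] and quad' = quadD[OF tri k quad] and ord' = ord[OF tri k quad] and
  lab' = sides_lab[OF tri k quad] \<alpha>\<beta>_lab[OF tri k quad] and
  kappa' = kappa_va[OF tri k quad] kappa_not_lab[OF tri k quad]

lemma Pk_not_side: "P k \<notin> sides a b c d"
  using col_zero_iff[OF ord'(1-3)] col_diag[OF ord'(1-3) quad'(2)] by blast

lemma lab_diff: "lab P - {P k} \<subseteq> insert (0, Suc t) (P(k := \<kappa>') ` {1..t + s})"
proof
  fix \<alpha> assume \<alpha>: "\<alpha> \<in> lab P - {P k}"
  show "\<alpha> \<in> insert (0, Suc t) (P(k := \<kappa>') ` {1..t + s})"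
  proof (cases "\<alpha> = (0, Suc t)")
    case False
    then obtain i where i: "i \<in> {1..t + s}" "\<alpha> = P i"
      using \<alpha> unfolding lab_def[OF tri] by blast
    then have "i \<noteq> k" using \<alpha> by blast
    then have "\<alpha> = (P(k := \<kappa>')) i" using i by simp
    then show ?thesis using i by blast
  qed simp
qed

text \<open>The positive part of the column picks one pair of opposite sides, which by
  \<open>Lam_sides\<close> pairs with \<open>P p\<close> like the two diagonals together;
  subtracting the old diagonal leaves the new one.\<close>

lemma quasi_sum:
  assumes p: "p \<in> {1..t + s}" "p \<noteq> k"
  shows "- sd_quasi S p k + (\<Sum>i\<in>{i\<in>positions S. sd_exch S i k > 0}. sd_exch S i k * sd_quasi S p i) =
    Lam m (gg (P p)) (gg \<kappa>')"
proof -
  let ?\<alpha> = "\<alpha>1 a b d \<sigma>" and ?\<beta> = "\<alpha>2 b c d \<sigma>"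
  have "(\<Sum>i\<in>{i\<in>positions S. sd_exch S i k > 0}. sd_exch S i k * sd_quasi S p i) =
      (\<Sum>i\<in>{1..t + s}. (if sd_exch S i k > 0 then sd_exch S i k else 0) * sd_quasi S p i)"
    unfolding positions_tri[OF tri]
    by (subst sum.inter_filter) (auto intro!: sum.cong)
  also have "\<dots> = (\<Sum>i\<in>{1..t + s}. ep P ?\<alpha> i * sd_quasi S p i + ep P ?\<beta> i * sd_quasi S p i)"
    by (intro sum.cong refl) (simp only: exch_sign(1)[OF tri k quad] distrib_right)
  also have "\<dots> = Lam m (gg (P p)) (gg ?\<alpha>) + Lam m (gg (P p)) (gg ?\<beta>)"
    unfolding sum.distrib
    using sum_ep[OF tri lab'(5), of "sd_quasi S p" "Lam m (gg (P p))"]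
      sum_ep[OF tri lab'(6), of "sd_quasi S p" "Lam m (gg (P p))"] triD(4)[OF tri p(1)] Lam_zero by simp
  also have "\<dots> = Lam m (gg (P p)) (gg (P k)) + Lam m (gg (P p)) (gg \<kappa>')"
  proof -
    have "Lam m (gg ?\<alpha>) (gg (P p)) + Lam m (gg ?\<beta>) (gg (P p)) = Lam m (gg (P k)) (gg (P p)) + Lam m (gg \<kappa>') (gg (P p))"
      unfolding \<alpha>1_def[OF tri k quad] \<alpha>2_def[OF tri k quad] using Lam_sides[OF tri k quad p] by simp
    then show ?thesis
      using Lam_skew[of m "gg (P p)"] by (metis add_uminus_conv_diff minus_add_distrib)
  qed
  finally show ?thesis
    using triD(4)[OF tri p(1) k_pos'] by simp
qed

text \<open>The column combines the exponents of the sides to \<open>\<sigma>\<close> times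
  \<open>U b - U c\<close>; the values then come from \<open>Lam_compat\<close> and
  \<open>compat_diag\<close>.\<close>

lemma compatible_sum:
  assumes p: "p \<in> {1..t + s}"
  shows "(\<Sum>i\<in>positions S. sd_exch S i k * sd_quasi S i p) = (if p = k then 2 else 0)"
proof -
  let ?l = "\<lambda>\<alpha>. Lam m (gg \<alpha>) (gg (P p))"
  let ?\<alpha> = "\<alpha>1 a b d \<sigma>" and ?\<beta> = "\<alpha>2 b c d \<sigma>" and ?\<gamma> = "\<beta>1 a b d \<sigma>" and ?\<delta> = "\<beta>2 b c d \<sigma>"
  have \<sigma>: "\<sigma> = 1 \<and> P k = (a, c) \<or> \<sigma> = - 1 \<and> P k = (b, d)"
    using quad'(2) by (auto simp: diag_def)
  have B: "sd_exch S i k = (ep P ?\<alpha> i + ep P ?\<beta> i) - (ep P ?\<gamma> i + ep P ?\<delta> i)" if "i \<in> {1..t + s}" for i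
    using exch_sign[OF tri k quad that] by (simp split: if_splits)
  have "(\<Sum>i\<in>positions S. sd_exch S i k * sd_quasi S i p) =
     (\<Sum>i\<in>{1..t + s}. (ep P ?\<alpha> i * sd_quasi S i p + ep P ?\<beta> i * sd_quasi S i p) -
        (ep P ?\<gamma> i * sd_quasi S i p + ep P ?\<delta> i * sd_quasi S i p))"
    unfolding positions_tri[OF tri] by (intro sum.cong refl) (simp only: B distrib_right left_diff_distrib)
  also have "\<dots> = (?l ?\<alpha> + ?l ?\<beta>) - (?l ?\<gamma> + ?l ?\<delta>)"
  proof -
    have "(\<Sum>i\<in>{1..t + s}. ep P \<alpha> i * sd_quasi S i p) = ?l \<alpha>" if "\<alpha> \<in> lab P" for \<alpha>
      by (rule sum_ep[OF tri that, of _ "\<lambda>x. Lam m x (gg (P p))"]) (use triD(4)[OF tri _ p] Lam_zero in auto)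
    then show ?thesis
      using lab'(5-8) by (simp only: sum.distrib sum_subtractf)
  qed
  also have "\<dots> = \<sigma> * Lam m (gg (a, b) + gg (c, d) - (gg (a, d) + gg (b, c))) (gg (P p))"
    unfolding Lam_diff(1) Lam_add(1) \<alpha>1_def[OF tri k quad] \<alpha>2_def[OF tri k quad] \<beta>1_def[OF tri k quad] \<beta>2_def[OF tri k quad]
    using \<sigma> by auto
  also have "gg (a, b) + gg (c, d) - (gg (a, d) + gg (b, c)) = U b - U c"
    unfolding gg_flip(2)[OF quad'(1)] by simp
  also have "\<sigma> * Lam m (U b - U c) (gg (P p)) = (if p = k then 2 else 0)"
    using \<sigma> compat_diag[OF quad'(1)] Lam_compat[OF tri k quad p] by auto
  finally show ?thesis .
qed

lemma quad_mutate_self: "quad (mutate K h F k S) (P(k := \<kappa>')) k a b c d (- \<sigma>) (P k)"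
proof -
  have "sd_exch (mutate K h F k S) i k = - \<sigma> * col a b c d ((P(k := \<kappa>')) i)" if "i \<in> {1..t + s}" for i
    using quad'(4)[OF that] quad'(4)[OF k_pos'] col_diag[OF ord'(1-3) quad'(2)]
    by (simp add: mutate_def mutate_exch_def)
  moreover have "sides a b c d \<subseteq> insert (0, Suc t) (P(k := \<kappa>') ` {1..t + s})"
    using quad'(3) Pk_not_side lab_diff by blast
  ultimately show ?thesis
    unfolding quad_def using quad'(1) diag_swap[OF quad'(2)] by simp
qed

text \<open>Without an arrow between the two positions, the old diagonal is no side of the other
  quadrilateral, which survives the flip. With an arrow, each diagonal is a side of the other's
  quadrilateral, and \<open>flip_adjacent\<close> supplies the new one.\<close>

lemma quad_mutate_other:
  assumes l: "l \<in> {1..<s}" "l \<noteq> k"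
  shows "\<exists>a b c d \<sigma> \<iota>'. quad (mutate K h F k S) (P(k := \<kappa>')) l a b c d \<sigma> \<iota>'"
proof -
  obtain a' b' c' d' \<sigma>' \<iota>' where ql: "quad S P l a' b' c' d' \<sigma>' \<iota>'"
    using triD(10)[OF tri l(1)] by blast
  note ql' = quadD[OF tri l(1) ql] and ordl = ord[OF tri l(1) ql]
  have Pk: "P i \<noteq> P k" "P i \<noteq> \<kappa>'" if "i \<in> {1..t + s}" "i \<noteq> k" for i
    using inj_onD[OF triD(8)[OF tri] _ that(1) k_pos'] that P_lab[OF tri that(1)] kappa'(2) by blast+
  have \<kappa>'k: "\<kappa>' \<noteq> P k"
    using P_lab[OF tri k_pos'] kappa'(2) by blast
  show ?thesis
  proof (cases "sd_exch S k l = 0")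
    case True
    then have "\<sigma>' \<noteq> 0 \<and> \<sigma>' * col a' b' c' d' (P k) = 0"
      using ql'(4)[OF k_pos'] ql'(2) by (auto simp: diag_def)
    then have Pkl: "P k \<notin> sides a' b' c' d'"
      using col_zero_iff[OF ordl(1-3)] by auto
    have \<kappa>l: "col a' b' c' d' \<kappa>' = 0"
      using col_zero_iff[OF ordl(1-3)] ql'(3) kappa'(2) by blast
    have "sd_exch (mutate K h F k S) i l = \<sigma>' * col a' b' c' d' ((P(k := \<kappa>')) i)" if "i \<in> {1..t + s}" for i
      using ql'(4)[OF that] True l(2) \<kappa>l by (simp add: mutate_def mutate_exch_def)
    moreover have "sides a' b' c' d' \<subseteq> insert (0, Suc t) (P(k := \<kappa>') ` {1..t + s})"
      using ql'(3) Pkl lab_diff by blast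
    ultimately have "quad (mutate K h F k S) (P(k := \<kappa>')) l a' b' c' d' \<sigma>' \<iota>'"
      unfolding quad_def using ql'(1,2) l(2) by simp
    then show ?thesis by blast
  next
    case False
    then have Pkl: "P k \<in> sides a' b' c' d'"
      using ql'(4)[OF k_pos'] col_zero_iff[OF ordl(1-3)] by auto
    have lpos: "l \<in> {1..t + s}" using l by auto
    have "sd_exch S l k \<noteq> 0"
      using False triD(11)[OF tri k l(1)] by simp
    then have Plk: "P l \<in> sides a b c d"
      using quad'(4)[OF lpos] col_zero_iff[OF ord'(1-3)] by auto
    obtain a'' b'' c'' d'' \<sigma>'' where f: "flip_ok a b c d \<sigma> (P k) \<kappa>' a' b' c' d' \<sigma>' (P l) a'' b'' c'' d'' \<sigma>''"
      using flip_adjacent[OF ord'(1-3) ordl(1-3) quad'(2) ql'(2) Plk Pkl] by blast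
    note f = f[unfolded flip_ok_def]
    obtain \<iota>'' where \<iota>'': "diag a'' b'' c'' d'' \<sigma>'' (P l) \<iota>''"
      using f by blast
    have o: "a'' < b''" "b'' < c''" "c'' < d''" and vs: "{a'', b'', c'', d''} \<subseteq> {a, b, c, d, a', b', c', d'}"
      using f by blast+
    have vert: "x \<le> s \<or> x = Suc t" if "x \<in> {a, b, c, d, a', b', c', d'}" for x
      using that ord' ordl by auto
    have "d'' \<le> s \<or> d'' = Suc t" "c'' \<le> s \<or> c'' = Suc t"
      using vert vs by blast+
    \<comment> \<open>\<open>Suc t\<close> is larger than all other vertices, so
      \<open>c'' < d''\<close> excludes it for \<open>c''\<close>.\<close>
    then have "qd a'' b'' c'' d''"
      using o s_le unfolding qd_def by auto
    moreover have "diag a'' b'' c'' d'' \<sigma>'' ((P(k := \<kappa>')) l) \<iota>''"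
      using \<iota>'' l(2) by simp
    moreover have "sides a'' b'' c'' d'' \<subseteq> insert (0, Suc t) (P(k := \<kappa>') ` {1..t + s})"
    proof -
      have "sides a'' b'' c'' d'' \<subseteq> (sides a b c d \<union> sides a' b' c' d' \<union> {\<kappa>'}) - {P k}"
        using f by blast
      also have "\<dots> \<subseteq> insert \<kappa>' (lab P - {P k})"
        using quad'(3) ql'(3) by blast
      also have "\<dots> \<subseteq> insert (0, Suc t) (P(k := \<kappa>') ` {1..t + s})"
      proof -
        have "\<kappa>' = (P(k := \<kappa>')) k" by simp
        then show ?thesis using k_pos' lab_diff by blast
      qed
      finally show ?thesis .
    qed
    moreover have "sd_exch (mutate K h F k S) i l = \<sigma>'' * col a'' b'' c'' d'' ((P(k := \<kappa>')) i)" if i: "i \<in> {1..t + s}" for i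
    proof (cases "i = k")
      case True
      have "\<sigma>'' * col a'' b'' c'' d'' \<kappa>' = - (\<sigma>' * col a' b' c' d' (P k))"
        using f by blast
      then show ?thesis
        using True ql'(4)[OF k_pos'] by (simp add: mutate_def mutate_exch_def)
    next
      case False
      have "\<sigma>'' * col a'' b'' c'' d'' (P i) = \<sigma>' * col a' b' c' d' (P i) +
        (\<bar>\<sigma> * col a b c d (P i)\<bar> * (\<sigma>' * col a' b' c' d' (P k)) + \<sigma> * col a b c d (P i) * \<bar>\<sigma>' * col a' b' c' d' (P k)\<bar>) div 2"
        using f Pk[OF i False] by blast
      then show ?thesis
        using False l(2) unfolding mutate_def mutate_exch_def
        by (simp only: seed.simps ql'(4)[OF k_pos'] ql'(4)[OF i] quad'(4)[OF i] fun_upd_other) simp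
    qed
    ultimately have "quad (mutate K h F k S) (P(k := \<kappa>')) l a'' b'' c'' d'' \<sigma>'' \<iota>''"
      unfolding quad_def by blast
    then show ?thesis by blast
  qed
qed

lemma kappa_comm_right:
  assumes i: "i \<in> {1..t + s}" "i \<noteq> k"
  shows "nn (P i) \<otimes>\<^bsub>F\<^esub> nn \<kappa>' = pw (2 * Lam m (gg (P i)) (gg \<kappa>')) \<odot>\<^bsub>F\<^esub> (nn \<kappa>' \<otimes>\<^bsub>F\<^esub> nn (P i))"
proof -
  have "nn (P i) \<in> carrier F" "nn \<kappa>' \<in> carrier F"
    using nn_closed triD(6)[OF tri i(1)] kappa'(1) by blast+
  moreover have "2 * Lam m (gg (P i)) (gg \<kappa>') + 2 * Lam m (gg \<kappa>') (gg (P i)) = 0"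
    using Lam_skew[of m "gg (P i)" "gg \<kappa>'"] by simp
  ultimately show ?thesis
    unfolding kappa_comm[OF tri k quad i] by simp
qed

text \<open>Propagating this invariant through all mutations is what makes every cluster variable a
  quantum minor.\<close>

lemma tri_mutate: "tri (mutate K h F k S) (P(k := \<kappa>'))"
  unfolding tri_def
proof (intro conjI ballI)
  let ?S = "mutate K h F k S" and ?P = "P(k := \<kappa>')"
  show "sd_rank ?S = t + s" "sd_mutable ?S = {1..<s}"
    using triD(1,2)[OF tri] by (simp_all add: mutate_def)
  have cl: "sd_cluster ?S i = nn (?P i)" if "i \<in> {1..t + s}" for i
    using triD(3)[OF tri that] mutate_variable_nn[OF tri k quad] by (simp add: mutate_def)
  then show "sd_cluster ?S i = nn (?P i)" if "i \<in> {1..t + s}" for i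
    using that by blast
  have qu: "sd_quasi ?S i l = Lam m (gg (?P i)) (gg (?P l))" if il: "i \<in> {1..t + s}" "l \<in> {1..t + s}" for i l
  proof -
    consider "i = k" "l = k" | "i = k" "l \<noteq> k" | "i \<noteq> k" "l = k" | "i \<noteq> k" "l \<noteq> k"
      by blast
    then show ?thesis
    proof cases
      case 1
      then show ?thesis by (simp add: mutate_def mutate_quasi_def Let_def Lam_self)
    next
      case 2
      have "sd_quasi ?S i l = - Lam m (gg (P l)) (gg \<kappa>')"
        unfolding quasi_sum[OF il(2) 2(2), symmetric] using 2 by (simp add: mutate_def mutate_quasi_def Let_def)
      then show ?thesis
        using 2 Lam_skew[of m "gg \<kappa>'" "gg (P l)"] by simp
    next
      case 3
      have "sd_quasi ?S i l = Lam m (gg (P i)) (gg \<kappa>')"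
        unfolding quasi_sum[OF il(1) 3(1), symmetric] using 3 by (simp add: mutate_def mutate_quasi_def Let_def)
      then show ?thesis
        using 3 by simp
    next
      case 4
      then show ?thesis using triD(4)[OF tri il] by (simp add: mutate_def mutate_quasi_def Let_def)
    qed
  qed
  then show "sd_quasi ?S i l = Lam m (gg (?P i)) (gg (?P l))" if "i \<in> {1..t + s}" "l \<in> {1..t + s}" for i l
    using that by blast
  show "?P i = P0 i" if "i \<in> {s..t + s}" for i
    using triD(5)[OF tri that] that k by simp
  show "va (?P i)" if "i \<in> {1..t + s}" for i
    using triD(6)[OF tri that] kappa'(1) by simp
  have \<kappa>: "\<kappa>' \<noteq> (0, Suc t)" "\<kappa>' \<notin> P ` {1..t + s}"
    using kappa'(2) unfolding lab_def[OF tri] by blast+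
  show "?P i \<noteq> (0, Suc t)" if "i \<in> {1..t + s}" for i
    using triD(7)[OF tri that] \<kappa> by simp
  show "inj_on ?P {1..t + s}"
    using triD(8)[OF tri] \<kappa>(2) by (rule inj_on_fun_updI)
  show "\<not> cross (?P i) (?P l)" if il: "i \<in> {1..t + s}" "l \<in> {1..t + s}" for i l
    using not_cross_kappa[OF tri k quad] il triD(9)[OF tri il] not_cross_self cross_sym by simp
  show "\<exists>a b c d \<sigma> \<iota>'. quad ?S ?P l a b c d \<sigma> \<iota>'" if "l \<in> {1..<s}" for l
  proof (cases "l = k")
    case True
    then show ?thesis using quad_mutate_self by blast
  next
    case False
    then show ?thesis using quad_mutate_other[OF that] by blast
  qed
  show "sd_exch ?S i l = - sd_exch ?S l i" if "i \<in> {1..<s}" "l \<in> {1..<s}" for i l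
  proof -
    have "mutate_exch k (sd_exch S) i l = - mutate_exch k (sd_exch S) l i"
      by (rule mutate_exch_skew) (rule triD(11)[OF tri]; use that k in simp)+
    then show ?thesis by (simp add: mutate_def)
  qed
  show "sd_cluster ?S i \<otimes>\<^bsub>F\<^esub> sd_cluster ?S l = pw (2 * sd_quasi ?S i l) \<odot>\<^bsub>F\<^esub> (sd_cluster ?S l \<otimes>\<^bsub>F\<^esub> sd_cluster ?S i)"
    if il: "i \<in> {1..t + s}" "l \<in> {1..t + s}" for i l
    unfolding cl[OF il(1)] cl[OF il(2)] qu[OF il]
  proof -
    consider "i = k" "l = k" | "i = k" "l \<noteq> k" | "i \<noteq> k" "l = k" | "i \<noteq> k" "l \<noteq> k"
      by blast
    then show "nn (?P i) \<otimes>\<^bsub>F\<^esub> nn (?P l) = pw (2 * Lam m (gg (?P i)) (gg (?P l))) \<odot>\<^bsub>F\<^esub> (nn (?P l) \<otimes>\<^bsub>F\<^esub> nn (?P i))"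
    proof cases
      case 1
      then show ?thesis using nn_closed[OF kappa'(1)] by (simp add: Lam_self)
    next
      case 2
      then show ?thesis using kappa_comm[OF tri k quad il(2)] by simp
    next
      case 3
      then show ?thesis using kappa_comm_right[OF il(1)] by simp
    next
      case 4
      then show ?thesis
        using triD(12)[OF tri il] unfolding triD(3)[OF tri il(1)] triD(3)[OF tri il(2)] triD(4)[OF tri il] by simp
    qed
  qed
qed

end

lemma mutation_class_tri:
  assumes "tri S P" "S' \<in> mutation_class K h F S"
  shows "\<exists>P. tri S' P"
  using assms(2)
proof induction
  case initial
  show ?case using assms(1) by blast
next
  case (step S' k)
  then obtain P where P: "tri S' P" by blast
  then have k: "k \<in> {1..<s}"
    using triD(2)[OF P] step.hyps(2) by simp
  obtain a b c d \<sigma> \<kappa>' where "quad S' P k a b c d \<sigma> \<kappa>'"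
    using triD(10)[OF P k] by blast
  from tri_mutate[OF P k this] show ?case by blast
qed

end

section \<open>The initial seed, generation, and the cluster type\<close>

section \<open>The initial seed\<close>

lemma generated_algebra_ops_mono:
  assumes "\<one>\<^bsub>A\<^esub> = \<one>\<^bsub>B\<^esub>" "\<And>x y. x \<otimes>\<^bsub>A\<^esub> y = x \<otimes>\<^bsub>B\<^esub> y" "\<And>x y. x \<oplus>\<^bsub>A\<^esub> y = x \<oplus>\<^bsub>B\<^esub> y" "\<And>c x. c \<odot>\<^bsub>A\<^esub> x = c \<odot>\<^bsub>B\<^esub> x"
  shows "generated_algebra K A S \<subseteq> generated_algebra K B S"
proof
  fix x assume "x \<in> generated_algebra K A S"
  then show "x \<in> generated_algebra K B S"
    by induction (simp_all add: assms generated_algebra.intros)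
qed

lemma generated_algebra_skew_field:
  assumes "S \<subseteq> generated_skew_field K F S'"
  shows "generated_algebra K F S \<subseteq> generated_skew_field K F S'"
proof
  fix x assume "x \<in> generated_algebra K F S"
  then show "x \<in> generated_skew_field K F S'"
  proof induction
    case (incl x)
    then show ?case using assms by (rule subsetD[rotated])
  next
    case one
    show ?case by (rule generated_skew_field.one)
  next
    case (add x y)
    then show ?case by (blast intro: generated_skew_field.add)
  next
    case (mult x y)
    then show ?case by (blast intro: generated_skew_field.mult)
  next
    case (smult c x)
    then show ?case by (blast intro: generated_skew_field.smult)
  qed
qed

context cell_fractions
begin

lemma jM_in: "w \<in> HH \<Longrightarrow> j (M w) \<in> carrier F"
  by (rule J.hom_simps(1)[OF M_R])

lemma jM_mult: "v \<in> HH \<Longrightarrow> w \<in> HH \<Longrightarrow> j (M v) \<otimes>\<^bsub>F\<^esub> j (M w) = pw (Lam m v w) \<odot>\<^bsub>F\<^esub> j (M (v + w))"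
proof -
  assume vw: "v \<in> HH" "w \<in> HH"
  have "M v \<otimes>\<^bsub>R.T\<^esub> M w = pw (Lam m v w) \<odot>\<^bsub>R.T\<^esub> M (v + w)"
    unfolding R_ops by (rule M_mult)
  from arg_cong[OF this, of j] show ?thesis
    using vw by (simp only: J.hom_simps M_R HH_add pw_in)
qed

lemma jM_zero: "j (M 0) = \<one>\<^bsub>F\<^esub>"
  using J.hom_simps(4) unfolding R_ops Q.T_ops(1) .

lemma jM_unit:
  assumes "w \<in> HH"
  shows "j (M w) \<in> Units F" "inv\<^bsub>F\<^esub> j (M w) = j (M (- w))"
proof -
  have w: "- w \<in> HH" "j (M w) \<in> carrier F" "j (M (- w)) \<in> carrier F"
    using assms HH_uminus jM_in by blast+
  have 1: "j (M w) \<otimes>\<^bsub>F\<^esub> j (M (- w)) = \<one>\<^bsub>F\<^esub>" "j (M (- w)) \<otimes>\<^bsub>F\<^esub> j (M w) = \<one>\<^bsub>F\<^esub>"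
    using assms w(1) by (simp_all add: jM_mult Lam_uminus Lam_self jM_zero)
  show "j (M w) \<in> Units F"
    unfolding Units_def using w 1 by blast
  show "inv\<^bsub>F\<^esub> j (M w) = j (M (- w))"
    by (rule F.A.inv_unique'[symmetric, OF w(2,3) 1])
qed

text \<open>The scalar is left unspecified: for linear independence it is enough that it is a power
  of \<open>h\<close>, hence nonzero.\<close>

lemma jM_pow:
  assumes "w \<in> HH"
  shows "\<exists>z. \<exists>v\<in>HH. j (M w) [^]\<^bsub>F\<^esub> (n :: int) = pw z \<odot>\<^bsub>F\<^esub> j (M v) \<and>
    (\<forall>x. Poly_Mapping.lookup v x = n * Poly_Mapping.lookup w x)"
proof -
  have nat: "\<exists>z. \<exists>v\<in>HH. j (M w) [^]\<^bsub>F\<^esub> (n :: nat) = pw z \<odot>\<^bsub>F\<^esub> j (M v) \<and>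
    (\<forall>x. Poly_Mapping.lookup v x = int n * Poly_Mapping.lookup w x)" for n
  proof (induction n)
    case 0
    show ?case
      by (rule exI[of _ 0], rule bexI[of _ 0]) (simp_all add: jM_zero HH_zero)
  next
    case (Suc n)
    then obtain z v where v: "v \<in> HH" "j (M w) [^]\<^bsub>F\<^esub> n = pw z \<odot>\<^bsub>F\<^esub> j (M v)"
      "\<forall>x. Poly_Mapping.lookup v x = int n * Poly_Mapping.lookup w x"
      by blast
    show ?case
    proof (rule exI[of _ "z + Lam m v w"], rule bexI[of _ "v + w"], rule conjI)
      have "j (M w) [^]\<^bsub>F\<^esub> Suc n = pw z \<odot>\<^bsub>F\<^esub> (j (M v) \<otimes>\<^bsub>F\<^esub> j (M w))"
        using v jM_in assms by (simp add: F.smult_mult_left)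
      then show "j (M w) [^]\<^bsub>F\<^esub> Suc n = pw (z + Lam m v w) \<odot>\<^bsub>F\<^esub> j (M (v + w))"
        using v(1) assms by (simp only: jM_mult F_pw jM_in HH_add)
      show "\<forall>x. Poly_Mapping.lookup (v + w) x = int (Suc n) * Poly_Mapping.lookup w x"
        using v(3) by (simp add: lookup_add algebra_simps)
      show "v + w \<in> HH"
        using v(1) assms by (rule HH_add)
    qed
  qed
  show ?thesis
  proof (cases "n \<ge> 0")
    case True
    then show ?thesis
      using nat[of "nat n"] int_pow_int[of F "j (M w)" "nat n"] by simp
  next
    case False
    obtain z v where v: "v \<in> HH" "j (M w) [^]\<^bsub>F\<^esub> nat (- n) = pw z \<odot>\<^bsub>F\<^esub> j (M v)"
      "\<forall>x. Poly_Mapping.lookup v x = int (nat (- n)) * Poly_Mapping.lookup w x"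
      using nat[of "nat (- n)"] by blast
    have "j (M w) [^]\<^bsub>F\<^esub> n = inv\<^bsub>F\<^esub> (j (M w) [^]\<^bsub>F\<^esub> nat (- n))"
      using int_pow_def2[of F "j (M w)" n] False by auto
    also have "\<dots> = pw (- z) \<odot>\<^bsub>F\<^esub> j (M (- v))"
      unfolding v(2) F.smult_unit(2)[OF pw_in pw_ne jM_unit(1)[OF v(1)]] jM_unit(2)[OF v(1)] pw_inv ..
    finally have "j (M w) [^]\<^bsub>F\<^esub> n = pw (- z) \<odot>\<^bsub>F\<^esub> j (M (- v))" .
    moreover have "\<forall>x. Poly_Mapping.lookup (- v) x = n * Poly_Mapping.lookup w x"
      using v(3) False by simp
    ultimately show ?thesis
      using HH_uminus[OF v(1)] by blast
  qed
qed

lemma gg_P0: "gg (P0 i) = (if i \<le> t then E i else E (i - t - 1) + Y (i - t))" if "i \<le> t + s"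
  using that s_le by (auto simp: gg_def g_def P0_def U_def)

lemma nn_P0:
  assumes "i \<in> {1..t + s}"
  shows "nn (P0 i) = j (M (gg (P0 i)))" "gg (P0 i) \<in> HH"
proof -
  show "nn (P0 i) = j (M (gg (P0 i)))"
  proof (cases "i \<le> t")
    case True
    then show ?thesis using s_le by (simp add: nn_def gg_def P0_def N_def g_def)
  next
    case False
    then have "N s (i - t - 1) (i - t) = M (E (i - t - 1) + E (i - t) + U (i - t))"
      using assms unfolding N_def by (subst W_single) auto
    moreover have "i - t \<le> s"
      using assms by auto
    ultimately show ?thesis
      using False assms by (simp add: nn_def gg_def P0_def g_def)
  qed
  show "gg (P0 i) \<in> HH"
    using assms s_le by (auto simp: gg_P0 intro!: HH_add E_HH Y_HH)
qed

text \<open>The quadrilateral around the diagonal \<open>(k, Suc t)\<close> has the vertices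
  \<open>k - 1, k, k + 1, Suc t\<close>; the diagonal joins the second and the fourth of them, hence
  the minus sign.\<close>

definition S0 :: "'f seed" where
  "S0 = \<lparr>sd_rank = t + s, sd_mutable = {1..<s}, sd_cluster = (\<lambda>i. nn (P0 i)),
     sd_exch = (\<lambda>i k. - col (k - 1) k (k + 1) (Suc t) (P0 i)),
     sd_quasi = (\<lambda>i k. Lam m (gg (P0 i)) (gg (P0 k)))\<rparr>"

lemma S0_simps: "positions S0 = {1..t + s}" "sd_rank S0 = t + s" "sd_mutable S0 = {1..<s}" "sd_cluster S0 i = nn (P0 i)"
  "sd_exch S0 i k = - col (k - 1) k (k + 1) (Suc t) (P0 i)" "sd_quasi S0 i k = Lam m (gg (P0 i)) (gg (P0 k))"
  by (simp_all add: S0_def positions_def)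

text \<open>The principal part is the linearly oriented path, so the cluster type can be read off
  the initial seed itself.\<close>

lemma S0_exch:
  assumes "i \<in> {1..<s}" "k \<in> {1..<s}"
  shows "sd_exch S0 i k = of_bool (k = Suc i) - of_bool (i = Suc k)"
  using assms s_le by (auto simp: S0_simps col_def P0_def of_bool_def)

lemma P0_cases:
  assumes "i \<in> {1..t + s}"
  obtains "1 \<le> i" "i \<le> t" "P0 i = (i, Suc t)" | l where "1 \<le> l" "l \<le> s" "i = t + l" "P0 i = (l - 1, l)"
proof (cases "i \<le> t")
  case True
  then show ?thesis using assms that(1) by (simp add: P0_def)
next
  case False
  then show ?thesis using assms that(2)[of "i - t"] by (simp add: P0_def)
qed

lemma quad_S0:
  assumes "k \<in> {1..<s}"
  shows "quad S0 P0 k (k - 1) k (k + 1) (Suc t) (- 1) (k - 1, k + 1)"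
proof -
  have "(k - 1, k) = P0 (t + k)" "(k, k + 1) = P0 (t + (k + 1))" "(k + 1, Suc t) = P0 (k + 1)"
    "k - 1 \<noteq> 0 \<Longrightarrow> (k - 1, Suc t) = P0 (k - 1)"
    using assms s_le by (auto simp: P0_def)
  moreover have "t + k \<in> {1..t + s}" "t + (k + 1) \<in> {1..t + s}" "k + 1 \<in> {1..t + s}" "k - 1 \<noteq> 0 \<Longrightarrow> k - 1 \<in> {1..t + s}"
    using assms by auto
  ultimately have "sides (k - 1) k (k + 1) (Suc t) \<subseteq> insert (0, Suc t) (P0 ` {1..t + s})"
    unfolding sides_def by (cases "k - 1 = 0") auto
  moreover have "P0 k = (k, Suc t)"
    using assms s_le by (simp add: P0_def)
  ultimately show ?thesis
    using assms s_le unfolding quad_def qd_def diag_def by (auto simp: S0_simps)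
qed

lemma tri_S0: "tri S0 P0"
  unfolding tri_def
proof (intro conjI ballI)
  show "sd_rank S0 = t + s" "sd_mutable S0 = {1..<s}"
    by (simp_all add: S0_simps)
  show "sd_cluster S0 i = nn (P0 i)" "sd_quasi S0 i k = Lam m (gg (P0 i)) (gg (P0 k))" "P0 i = P0 i" for i k
    by (simp_all add: S0_simps)
  show "va (P0 i)" if "i \<in> {1..t + s}" for i
    using that by (cases rule: P0_cases) (auto simp: va_def)
  show "P0 i \<noteq> (0, Suc t)" if "i \<in> {1..t + s}" for i
    using that s_le by (cases rule: P0_cases) auto
  show "inj_on P0 {1..t + s}"
  proof (rule inj_onI)
    fix i k assume "i \<in> {1..t + s}" "k \<in> {1..t + s}" "P0 i = P0 k"
    then show "i = k"
      using s_le by (elim P0_cases) auto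
  qed
  show "\<not> cross (P0 i) (P0 k)" if "i \<in> {1..t + s}" "k \<in> {1..t + s}" for i k
    using that s_le by (elim P0_cases) (auto simp: cross_def)
  show "\<exists>a b c d \<sigma> \<kappa>'. quad S0 P0 k a b c d \<sigma> \<kappa>'" if "k \<in> {1..<s}" for k
    using quad_S0[OF that] by blast
  show "sd_exch S0 i k = - sd_exch S0 k i" if "i \<in> {1..<s}" "k \<in> {1..<s}" for i k
    using S0_exch[OF that] S0_exch[OF that(2,1)] by simp
  show "sd_cluster S0 i \<otimes>\<^bsub>F\<^esub> sd_cluster S0 k = pw (2 * sd_quasi S0 i k) \<odot>\<^bsub>F\<^esub> (sd_cluster S0 k \<otimes>\<^bsub>F\<^esub> sd_cluster S0 i)"
    if i: "i \<in> {1..t + s}" and k: "k \<in> {1..t + s}" for i k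
  proof -
    have "M (gg (P0 i)) \<otimes>\<^bsub>R.T\<^esub> M (gg (P0 k)) = pw (2 * Lam m (gg (P0 i)) (gg (P0 k))) \<odot>\<^bsub>R.T\<^esub> (M (gg (P0 k)) \<otimes>\<^bsub>R.T\<^esub> M (gg (P0 i)))"
      unfolding R_ops by (rule M_comm)
    from arg_cong[OF this, of j] show ?thesis
      unfolding S0_simps nn_P0(1)[OF i] nn_P0(1)[OF k]
      using M_R[OF nn_P0(2)[OF i]] M_R[OF nn_P0(2)[OF k]] by (simp only: J.hom_simps R.T.A.m_closed pw_in)
  qed
qed

text \<open>Scalar and exponent are packed into one pair so that a single use of choice provides
  both as functions of \<open>a\<close>.\<close>

lemma laurent_S0:
  "\<exists>p. snd p \<in> HH \<and> laurent_monomial F S0 a = pw (fst p) \<odot>\<^bsub>F\<^esub> j (M (snd p)) \<and>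
     (\<forall>x. Poly_Mapping.lookup (snd p) x = (\<Sum>i\<in>{1..t + s}. a i * Poly_Mapping.lookup (gg (P0 i)) x))"
proof -
  have mono: "\<exists>z. \<exists>v\<in>HH. foldr (\<lambda>i z. (sd_cluster S0 i [^]\<^bsub>F\<^esub> a i) \<otimes>\<^bsub>F\<^esub> z) xs \<one>\<^bsub>F\<^esub> = pw z \<odot>\<^bsub>F\<^esub> j (M v) \<and>
     (\<forall>x. Poly_Mapping.lookup v x = (\<Sum>i\<leftarrow>xs. a i * Poly_Mapping.lookup (gg (P0 i)) x))"
    if "set xs \<subseteq> {1..t + s}" for xs
    using that
  proof (induction xs)
    case Nil
    show ?case
      by (rule exI[of _ 0], rule bexI[of _ 0]) (simp_all add: jM_zero HH_zero)
  next
    case (Cons i xs)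
    then obtain z v where v: "v \<in> HH" "foldr (\<lambda>i z. (sd_cluster S0 i [^]\<^bsub>F\<^esub> a i) \<otimes>\<^bsub>F\<^esub> z) xs \<one>\<^bsub>F\<^esub> = pw z \<odot>\<^bsub>F\<^esub> j (M v)"
        "\<forall>x. Poly_Mapping.lookup v x = (\<Sum>i\<leftarrow>xs. a i * Poly_Mapping.lookup (gg (P0 i)) x)"
      by auto
    have i: "i \<in> {1..t + s}"
      using Cons.prems by simp
    obtain y u where u: "u \<in> HH" "j (M (gg (P0 i))) [^]\<^bsub>F\<^esub> a i = pw y \<odot>\<^bsub>F\<^esub> j (M u)"
        "\<forall>x. Poly_Mapping.lookup u x = a i * Poly_Mapping.lookup (gg (P0 i)) x"
      using jM_pow[OF nn_P0(2)[OF i], of "a i"] by blast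
    show ?case
    proof (rule exI[of _ "z + (y + Lam m u v)"], rule bexI[of _ "u + v"], rule conjI)
      have "foldr (\<lambda>i z. (sd_cluster S0 i [^]\<^bsub>F\<^esub> a i) \<otimes>\<^bsub>F\<^esub> z) (i # xs) \<one>\<^bsub>F\<^esub> =
          (pw y \<odot>\<^bsub>F\<^esub> j (M u)) \<otimes>\<^bsub>F\<^esub> (pw z \<odot>\<^bsub>F\<^esub> j (M v))"
        by (simp only: foldr_Cons comp_apply v(2)) (simp only: S0_simps nn_P0(1)[OF i] u(2))
      also have "\<dots> = pw z \<odot>\<^bsub>F\<^esub> (pw y \<odot>\<^bsub>F\<^esub> (j (M u) \<otimes>\<^bsub>F\<^esub> j (M v)))"
        using jM_in[OF u(1)] jM_in[OF v(1)] by (simp only: F.smult_mult_left F.smult_mult_right pw_in F.smult_closed)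
      also have "\<dots> = pw (z + (y + Lam m u v)) \<odot>\<^bsub>F\<^esub> j (M (u + v))"
        using u(1) v(1) by (simp only: jM_mult F_pw jM_in HH_add)
      finally show "foldr (\<lambda>i z. (sd_cluster S0 i [^]\<^bsub>F\<^esub> a i) \<otimes>\<^bsub>F\<^esub> z) (i # xs) \<one>\<^bsub>F\<^esub> = pw (z + (y + Lam m u v)) \<odot>\<^bsub>F\<^esub> j (M (u + v))" .
      show "\<forall>x. Poly_Mapping.lookup (u + v) x = (\<Sum>i\<leftarrow>i # xs. a i * Poly_Mapping.lookup (gg (P0 i)) x)"
        using u(3) v(3) by (simp add: lookup_add)
      show "u + v \<in> HH"
        using u(1) v(1) by (rule HH_add)
    qed
  qed
  have set: "set [1..<Suc (t + s)] = {1..t + s}"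
    by auto
  from mono[OF equalityD1[OF set]] obtain z v where v: "v \<in> HH" "laurent_monomial F S0 a = pw z \<odot>\<^bsub>F\<^esub> j (M v)"
    "\<forall>x. Poly_Mapping.lookup v x = (\<Sum>i\<leftarrow>[1..<Suc (t + s)]. a i * Poly_Mapping.lookup (gg (P0 i)) x)"
    unfolding laurent_monomial_def S0_simps(2) by blast
  then show ?thesis
    using set by (intro exI[of _ "(z, v)"]) (simp only: interv_sum_list_conv_sum_set_nat fst_conv snd_conv simp_thms)
qed

text \<open>The system is triangular: the key \<open>- l\<close> occurs only at position
  \<open>t + l\<close>, and once these coefficients vanish, the key \<open>i\<close> is left only at
  position \<open>i\<close>.\<close>

lemma weights_independent:
  assumes d: "\<And>x. (\<Sum>i\<in>{1..t + s}. d i * Poly_Mapping.lookup (gg (P0 i)) x) = 0" and i: "i \<in> {1..t + s}"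
  shows "d i = 0"
proof -
  have 1: "d i = 0" if "i \<in> {1..t + s}" "\<not> i \<le> t" for i
  proof -
    have "(\<Sum>k\<in>{1..t + s}. d k * Poly_Mapping.lookup (gg (P0 k)) (- int (i - t))) =
        (\<Sum>k\<in>{1..t + s}. if k = i then d k else 0)"
      using that by (intro sum.cong refl) (auto simp: gg_P0 lookup_EYU lookup_add)
    then show ?thesis
      using d[of "- int (i - t)"] that by simp
  qed
  show ?thesis
  proof (cases "i \<le> t")
    case True
    have "(\<Sum>k\<in>{1..t + s}. d k * Poly_Mapping.lookup (gg (P0 k)) (int i)) = (\<Sum>k\<in>{1..t + s}. if k = i then d k else 0)"
    proof (intro sum.cong refl)
      fix k assume k: "k \<in> {1..t + s}"
      show "d k * Poly_Mapping.lookup (gg (P0 k)) (int i) = (if k = i then d k else 0)"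
        using k i True 1[OF k] by (cases "k \<le> t") (auto simp: gg_P0 lookup_EYU)
    qed
    then show ?thesis
      using d[of "int i"] i by simp
  qed (use 1[OF i] in simp)
qed

text \<open>By \<open>weights_independent\<close>, different exponent vectors give nonzero multiples
  of different torus monomials, which are linearly independent, and \<open>j\<close> is
  injective.\<close>

lemma laurent_independent_S0: "laurent_independent K F S0"
proof -
  have "\<forall>a. \<exists>p. snd p \<in> HH \<and> laurent_monomial F S0 a = pw (fst p) \<odot>\<^bsub>F\<^esub> j (M (snd p)) \<and>
     (\<forall>x. Poly_Mapping.lookup (snd p) x = (\<Sum>i\<in>{1..t + s}. a i * Poly_Mapping.lookup (gg (P0 i)) x))"
    by (rule allI) (rule laurent_S0)
  from choice[OF this] obtain p where p: "\<forall>a. snd (p a) \<in> HH \<and> laurent_monomial F S0 a = pw (fst (p a)) \<odot>\<^bsub>F\<^esub> j (M (snd (p a))) \<and>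
     (\<forall>x. Poly_Mapping.lookup (snd (p a)) x = (\<Sum>i\<in>{1..t + s}. a i * Poly_Mapping.lookup (gg (P0 i)) x))"
    by blast
  define wt where "wt a = snd (p a)" for a
  have wt: "wt a \<in> HH" "laurent_monomial F S0 a = pw (fst (p a)) \<odot>\<^bsub>F\<^esub> j (M (wt a))"
    "Poly_Mapping.lookup (wt a) x = (\<Sum>i\<in>{1..t + s}. a i * Poly_Mapping.lookup (gg (P0 i)) x)" for a x
    using p unfolding wt_def by blast+
  have inj: "a = b" if "a \<in> exponents S0" "b \<in> exponents S0" "wt a = wt b" for a b
  proof
    fix i
    show "a i = b i"
    proof (cases "i \<in> {1..t + s}")
      case True
      have "(\<Sum>i\<in>{1..t + s}. (a i - b i) * Poly_Mapping.lookup (gg (P0 i)) x) = 0" for x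
        unfolding left_diff_distrib sum_subtractf wt(3)[symmetric] that(3) by simp
      then show ?thesis
        using weights_independent[of "\<lambda>i. a i - b i" i] True by simp
    next
      case False
      then show ?thesis
        using that(1,2) by (simp add: exponents_def S0_simps)
    qed
  qed
  show ?thesis
    unfolding laurent_independent_def
  proof (intro allI impI ballI)
    fix D c a0
    assume *: "finite D \<and> D \<subseteq> exponents S0 \<and> c \<in> D \<rightarrow> carrier K \<and>
        (\<Oplus>\<^bsub>F\<^esub>a\<in>D. c a \<odot>\<^bsub>F\<^esub> laurent_monomial F S0 a) = \<zero>\<^bsub>F\<^esub>" and a0: "a0 \<in> D"
    then have D: "finite D" "D \<subseteq> exponents S0" "\<And>a. a \<in> D \<Longrightarrow> c a \<in> carrier K"
      "(\<Oplus>\<^bsub>F\<^esub>a\<in>D. c a \<odot>\<^bsub>F\<^esub> laurent_monomial F S0 a) = \<zero>\<^bsub>F\<^esub>"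
      by auto
    define f where "f a = (c a \<otimes>\<^bsub>K\<^esub> pw (fst (p a))) \<odot>\<^bsub>R.T\<^esub> M (wt a)" for a
    have f: "f \<in> D \<rightarrow> carrier R.T"
      using D(3) M_R[OF wt(1)] unfolding f_def by (intro Pi_I R.T.smult_closed K.m_closed) simp_all
    have "j (finsum R.T f D) = (\<Oplus>\<^bsub>F\<^esub>a\<in>D. j (f a))"
      by (rule J.hom_finsum[OF D(1) f])
    also have "\<dots> = (\<Oplus>\<^bsub>F\<^esub>a\<in>D. c a \<odot>\<^bsub>F\<^esub> laurent_monomial F S0 a)"
    proof (intro F.M.add.finprod_cong' refl)
      show jf: "j (f a) = c a \<odot>\<^bsub>F\<^esub> laurent_monomial F S0 a" if "a \<in> D" for a
        unfolding f_def wt(2) using D(3)[OF that] M_R[OF wt(1)] jM_in[OF wt(1)]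
        by (simp only: J.hom_simps K.m_closed pw_in F.smult_assoc1)
      show "(\<lambda>a. c a \<odot>\<^bsub>F\<^esub> laurent_monomial F S0 a) \<in> D \<rightarrow> carrier F"
        unfolding wt(2) using D(3) jM_in[OF wt(1)] by (intro Pi_I F.smult_closed) simp_all
    qed
    finally have "j (finsum R.T f D) = j \<zero>\<^bsub>R.T\<^esub>"
      unfolding D(4) J.hom_zero .
    then have "finsum R.T f D = \<zero>\<^bsub>R.T\<^esub>"
      by (rule inj_onD[OF j_inj _ R.T.M.finsum_closed[OF f] R.T.M.zero_closed])
    then have "\<zero>\<^bsub>K\<^esub> = finsum R.T f D (wt a0)"
      by (simp add: R.T_ops)
    also have "\<dots> = (\<Oplus>\<^bsub>K\<^esub>a\<in>D. f a (wt a0))"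
      by (rule R.finsum_T_apply[OF D(1) f])
    also have "\<dots> = (\<Oplus>\<^bsub>K\<^esub>a\<in>D. if a0 = a then c a \<otimes>\<^bsub>K\<^esub> pw (fst (p a)) else \<zero>\<^bsub>K\<^esub>)"
    proof (intro K.add.finprod_cong' refl)
      show "f a (wt a0) = (if a0 = a then c a \<otimes>\<^bsub>K\<^esub> pw (fst (p a)) else \<zero>\<^bsub>K\<^esub>)" if "a \<in> D" for a
        using inj[of a0 a] D(2) D(3)[OF that] a0 that by (auto simp: f_def R.T_ops Q.delta_def)
      show "(\<lambda>a. if a0 = a then c a \<otimes>\<^bsub>K\<^esub> pw (fst (p a)) else \<zero>\<^bsub>K\<^esub>) \<in> D \<rightarrow> carrier K"
        using D(3) by (intro Pi_I) simp
    qed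
    also have "\<dots> = c a0 \<otimes>\<^bsub>K\<^esub> pw (fst (p a0))"
      by (rule K.finsum_singleton[OF a0 D(1)]) (use D(3) in \<open>intro Pi_I, simp\<close>)
    finally have e: "\<zero>\<^bsub>K\<^esub> = c a0 \<otimes>\<^bsub>K\<^esub> pw (fst (p a0))" .
    show "c a0 = \<zero>\<^bsub>K\<^esub>"
      using K.integral[OF e[symmetric] D(3)[OF a0] pw_in] pw_ne by blast
  qed
qed

section \<open>Generators of the image of the cell and of the skew field\<close>

lemma psi_z_image: "psi ` z ` {1..t + s} = X 1 ` {1..t} \<union> X 2 ` {1..s}"
proof -
  have z: "psi (z i) = X 1 i" if "i \<in> {1..t}" for i
    using that psi(2)[of 1 i] t_le by (simp add: z_def)
  have z': "psi (z (t + l)) = X 2 l" if "l \<in> {1..s}" for l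
    using that psi(2)[of 2 l] s_le t_le by (simp add: z_def)
  have "{1..t + s} = {1..t} \<union> (+) t ` {1..s}"
    by (auto simp: image_add_atLeastAtMost)
  then show ?thesis
    using z z' by (simp only: image_Un image_image) (simp cong: image_cong_simp)
qed

abbreviation "gens \<equiv> X 1 ` {1..t} \<union> X 2 ` {1..s}"

lemma gens_R: "gens \<subseteq> carrier R.T"
proof -
  have "img \<subseteq> carrier R.T"
    unfolding img_def using psi_R by blast
  moreover have "X 1 i \<in> img" if "i \<in> {1..t}" for i
    using X_img(1)[of i] that by simp
  moreover have "X 2 i \<in> img" if "i \<in> {1..s}" for i
    using X_img(2)[of i] that by simp
  ultimately show ?thesis by blast
qed

lemma img_generated: "j ` img = generated_algebra K F (j ` gens)"
proof -
  have "img = generated_algebra K T gens"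
    unfolding img_def psi_z_image[symmetric] A_simps(1) by (rule psi.hom_generated_algebra[OF z_sub])
  also have "\<dots> = generated_algebra K R.T gens"
    by (intro equalityI generated_algebra_ops_mono) (simp_all only: R_ops)
  finally show ?thesis
    using J.hom_generated_algebra[OF gens_R] by simp
qed

abbreviation "GS \<equiv> generated_skew_field K F (sd_cluster S0 ` positions S0)"

lemma nn_GS: "i \<in> {1..t + s} \<Longrightarrow> nn (P0 i) \<in> GS"
  by (rule generated_skew_field.incl) (auto simp: S0_simps)

lemma GS_closed: "x \<in> GS \<Longrightarrow> x \<in> carrier F"
proof (induction rule: generated_skew_field.induct)
  case (incl x)
  then show ?case
    using nn_closed triD(6)[OF tri_S0] unfolding S0_simps by blast
next
  case (inverse x)
  then show ?case
    using F.A.Units_inv_closed F.unit_iff by blast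
qed (simp_all add: F.A.m_closed)

lemma jM_GS_add: "v \<in> HH \<Longrightarrow> w \<in> HH \<Longrightarrow> j (M v) \<in> GS \<Longrightarrow> j (M w) \<in> GS \<Longrightarrow> j (M (v + w)) \<in> GS"
proof -
  assume vw: "v \<in> HH" "w \<in> HH" "j (M v) \<in> GS" "j (M w) \<in> GS"
  have "j (M (v + w)) = pw (- Lam m v w) \<odot>\<^bsub>F\<^esub> (j (M v) \<otimes>\<^bsub>F\<^esub> j (M w))"
    using vw(1,2) by (simp add: jM_mult jM_in HH_add)
  then show ?thesis
    using generated_skew_field.smult[OF pw_in generated_skew_field.mult[OF vw(3,4)]] by simp
qed

lemma jM_GS_uminus: "w \<in> HH \<Longrightarrow> j (M w) \<in> GS \<Longrightarrow> j (M (- w)) \<in> GS"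
  using generated_skew_field.inverse[of "j (M w)" K F] jM_unit[of w] F.unit_iff by metis

lemma jE_GS: "i \<le> t \<Longrightarrow> j (M (E i)) \<in> GS"
  using nn_GS[of i] nn_P0(1)[of i] gg_P0[of i] generated_skew_field.one[of F K]
  by (cases "i = 0") (auto simp: E_def jM_zero)

lemma jM_GS:
  assumes "w \<in> HH"
  shows "w \<in> HH \<and> j (M w) \<in> GS"
  using assms
proof (induction rule: HH_induct)
  case zero
  show ?case using generated_skew_field.one[of F K] by (simp add: HH_zero jM_zero)
next
  case (add a b)
  then show ?case using jM_GS_add HH_add by blast
next
  case (uminus a)
  then show ?case using jM_GS_uminus HH_uminus by blast
next
  case (E i)
  then show ?case using jE_GS E_HH by blast
next
  case (Y l)
  \<comment> \<open>The exponent of the minor of columns \<open>l - 1\<close> and \<open>l\<close>,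
    minus that of the first-row entry of column \<open>l - 1\<close>.\<close>
  have e: "Y l = gg (P0 (t + l)) + (- E (l - 1))"
    using Y by (simp add: gg_P0)
  have P: "j (M (gg (P0 (t + l)))) \<in> GS" "gg (P0 (t + l)) \<in> HH"
    using nn_GS[of "t + l"] nn_P0[of "t + l"] Y by simp_all
  have l: "l - 1 \<le> t" using Y s_le by simp
  have "j (M (gg (P0 (t + l)) + (- E (l - 1)))) \<in> GS"
    by (rule jM_GS_add[OF P(2) HH_uminus[OF E_HH[OF l]] P(1) jM_GS_uminus[OF E_HH[OF l] jE_GS[OF l]]])
  then show ?case
    unfolding e[symmetric] using Y_HH[OF Y] by blast
qed

lemma nn_first: "nn (0, l) = pw (- 1) \<odot>\<^bsub>F\<^esub> j (X 2 l)" "j (X 2 l) = pw 1 \<odot>\<^bsub>F\<^esub> nn (0, l)" if "l \<in> {1..s}"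
proof -
  have X: "X 2 l \<in> carrier R.T"
    using gens_R that by blast
  have "N s 0 l = pw (- 1) \<odot>\<^bsub>R.T\<^esub> X 2 l"
    unfolding R_ops by (rule first_row_two) (use that in simp)
  then show 1: "nn (0, l) = pw (- 1) \<odot>\<^bsub>F\<^esub> j (X 2 l)"
    unfolding nn_def fst_conv snd_conv using X by (simp only: J.hom_simps pw_in)
  show "j (X 2 l) = pw 1 \<odot>\<^bsub>F\<^esub> nn (0, l)"
    unfolding 1 using J.hom_simps(1)[OF X] by simp
qed

lemma nn_row: "i \<in> {1..t} \<Longrightarrow> nn (i, Suc t) = j (X 1 i)"
  using s_le by (simp add: nn_def N_def X_def)

lemma gens_GS: "j ` gens \<subseteq> GS"
proof -
  \<comment> \<open>A second-row entry is a multiple of a block and is assembled column by column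
    from torus monomials, which \<open>jM_GS\<close> provides.\<close>
  have W: "j (W e 0 l) \<in> GS" if "e \<in> HH" "l \<le> s" for e l
    using that(2)
  proof (induction l)
    case 0
    have "W e 0 0 = \<zero>\<^bsub>R.T\<^esub>"
      by (simp add: W_def R_ops)
    then have "j (W e 0 0) = \<zero>\<^bsub>K\<^esub> \<odot>\<^bsub>F\<^esub> \<one>\<^bsub>F\<^esub>"
      by (simp add: J.hom_zero)
    then show ?case
      using generated_skew_field.smult[OF K.zero_closed generated_skew_field.one] by metis
  next
    case (Suc l)
    have w: "e + U (Suc l) \<in> HH"
      using that(1) Suc.prems by (intro HH_add U_HH) auto
    have "W e 0 (Suc l) = W e 0 l \<oplus>\<^bsub>R.T\<^esub> M (e + U (Suc l))"
      unfolding R_ops using W_split[of 0 l "Suc l" e] W_single[of l "Suc l" e] by simp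
    then have "j (W e 0 (Suc l)) = j (W e 0 l) \<oplus>\<^bsub>F\<^esub> j (M (e + U (Suc l)))"
      using J.hom_simps(3)[OF W_R[OF that(1)] M_R[OF w]] Suc.prems by simp
    then show ?case
      using generated_skew_field.add[OF Suc.IH] jM_GS[OF w] Suc.prems by simp
  qed
  have "j (X 2 l) \<in> GS" if "l \<in> {1..s}" for l
  proof -
    have l: "l \<le> s" "E 0 + E l \<in> HH"
      using that s_le by (auto intro!: HH_add E_HH)
    then have "nn (0, l) = j (W (E 0 + E l) 0 l)"
      by (simp add: nn_def N_def)
    then have "nn (0, l) \<in> GS"
      using W[OF l(2,1)] by simp
    then show ?thesis
      unfolding nn_first(2)[OF that] by (rule generated_skew_field.smult[OF pw_in])
  qed
  moreover have "j (X 1 i) \<in> GS" if "i \<in> {1..t}" for i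
    using nn_GS[of i] nn_row[OF that] that by (simp add: P0_def)
  ultimately show ?thesis by blast
qed

lemma GS_full:
  assumes "skew_field_of_fractions K A F (j \<circ> psi)"
  shows "GS = carrier F"
proof
  show "GS \<subseteq> carrier F" using GS_closed by blast
  have img: "(j \<circ> psi) a \<in> GS" if "a \<in> carrier A" for a
    using generated_algebra_skew_field[OF gens_GS] that unfolding img_generated[symmetric] img_def comp_def by blast
  show "carrier F \<subseteq> GS"
  proof
    fix x assume "x \<in> carrier F"
    then obtain a b where ab: "a \<in> carrier A" "b \<in> carrier A" "b \<noteq> \<zero>\<^bsub>A\<^esub>" "x = (j \<circ> psi) a \<otimes>\<^bsub>F\<^esub> inv\<^bsub>F\<^esub> ((j \<circ> psi) b)"
      using assms unfolding skew_field_of_fractions_def by blast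
    have "psi b \<noteq> \<zero>\<^bsub>R.T\<^esub>"
      using psi_zero_iff[OF ab(2)] ab(3) unfolding R_ops by blast
    then have "(j \<circ> psi) b \<noteq> \<zero>\<^bsub>F\<^esub>"
      unfolding comp_def J.hom_zero[symmetric] using inj_onD[OF j_inj _ psi_R[OF ab(2)] R.T.M.zero_closed] by blast
    then show "x \<in> GS"
      unfolding ab(4) by (intro generated_skew_field.mult generated_skew_field.inverse img ab(1,2))
  qed
qed

lemma quantum_seed_S0:
  assumes "skew_field_of_fractions K A F (j \<circ> psi)"
  shows "quantum_seed K (h \<otimes>\<^bsub>K\<^esub> h) F S0"
  unfolding quantum_seed_def
proof (intro conjI ballI)
  show "sd_cluster S0 ` positions S0 \<subseteq> carrier F - {\<zero>\<^bsub>F\<^esub>}"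
  proof
    fix x assume "x \<in> sd_cluster S0 ` positions S0"
    then obtain i where i: "i \<in> {1..t + s}" "x = nn (P0 i)"
      unfolding S0_simps by blast
    show "x \<in> carrier F - {\<zero>\<^bsub>F\<^esub>}"
      using nn_unit[OF triD(6)[OF tri_S0 i(1)]] unfolding i(2) F.unit_iff by blast
  qed
  show "GS = carrier F" by (rule GS_full[OF assms])
  show "laurent_independent K F S0" by (rule laurent_independent_S0)
  show "sd_mutable S0 \<subseteq> positions S0" by (auto simp: S0_simps)
  show "sd_exch S0 i k = - sd_exch S0 k i" if "i \<in> sd_mutable S0" "k \<in> sd_mutable S0" for i k
    by (rule triD(11)[OF tri_S0 that[unfolded S0_simps(3)]])
  show "sd_quasi S0 i k = - sd_quasi S0 k i" for i k
    unfolding S0_simps by (rule Lam_skew)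
  show "sd_cluster S0 i \<otimes>\<^bsub>F\<^esub> sd_cluster S0 k = (h \<otimes>\<^bsub>K\<^esub> h) [^]\<^bsub>K\<^esub> sd_quasi S0 i k \<odot>\<^bsub>F\<^esub> (sd_cluster S0 k \<otimes>\<^bsub>F\<^esub> sd_cluster S0 i)"
    if "i \<in> positions S0" "k \<in> positions S0" for i k
    unfolding q_pw pw_pow by (rule triD(12)[OF tri_S0]) (use that in \<open>simp_all add: S0_simps(1)\<close>)
  show "compatible S0"
    unfolding compatible_def
  proof (intro ballI)
    fix k i assume "k \<in> sd_mutable S0" "i \<in> positions S0"
    then have k: "k \<in> {1..<s}" and i: "i \<in> {1..t + s}"
      unfolding S0_simps(1,3) .
    show "(i \<noteq> k \<longrightarrow> (\<Sum>p\<in>positions S0. sd_exch S0 p k * sd_quasi S0 p i) = 0) \<and>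
        (i = k \<longrightarrow> (\<Sum>p\<in>positions S0. sd_exch S0 p k * sd_quasi S0 p i) > 0)"
      unfolding compatible_sum[OF tri_S0 k quad_S0[OF k] i] by simp
  qed
qed

text \<open>Mutating at \<open>1, 2, \<dots>\<close> turns the fan at the vertex \<open>Suc t\<close> into the fan at \<open>0\<close>.\<close>

lemma fan_flip:
  assumes tri: "tri S P" and P: "\<And>i. i \<in> {1..t + s} \<Longrightarrow> P i = (if i \<le> k then (0, Suc i) else P0 i)"
    and k: "Suc k < s" and quad: "quad S P (Suc k) a b c d \<sigma> \<kappa>'"
  shows "\<kappa>' = (0, Suc (Suc k))"
proof -
  have k': "Suc k \<in> {1..<s}" "Suc k \<in> {1..t + s}" using k by auto
  note qD = quadD[OF tri k'(1) quad] and o = ord[OF tri k'(1) quad] and sl = sides_lab[OF tri k'(1) quad]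
  have "P (Suc k) = (Suc k, Suc t)"
    using P[OF k'(2)] k s_le by (simp add: P0_def)
  then have bd: "b = Suc k" "d = Suc t" "\<kappa>' = (a, c)"
    using qD(2) o s_le by (auto simp: diag_def)
  have lab: "\<alpha> = (0, Suc t) \<or> fst \<alpha> = 0 \<and> 2 \<le> snd \<alpha> \<and> snd \<alpha> \<le> Suc k \<or> (k < fst \<alpha> \<and> snd \<alpha> = Suc t) \<or> (snd \<alpha> = Suc (fst \<alpha>) \<and> snd \<alpha> \<le> s)"
    if "\<alpha> \<in> lab P" for \<alpha>
  proof (cases "\<alpha> = (0, Suc t)")
    case False
    with that have "\<alpha> \<in> P ` {1..t + s}"
      unfolding lab_def[OF tri] by blast
    then obtain i where i: "i \<in> {1..t + s}" "\<alpha> = P i"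
      by blast
    show ?thesis
    proof (cases "i \<le> k")
      case True
      then show ?thesis using i P[OF i(1)] by simp
    next
      case nk: False
      then have "\<alpha> = P0 i" using i P[OF i(1)] by simp
      with i(1) nk show ?thesis
        by (elim P0_cases) auto
    qed
  qed simp
  \<comment> \<open>At this stage the only label from \<open>Suc k\<close> to a later column is the
    side to the next one, and the only label that joins a column before \<open>Suc k\<close> to
    \<open>Suc t\<close> is \<open>(0, Suc t)\<close>.\<close>
  have "c = Suc (Suc k)"
    using lab[OF sl(2)] o s_le k bd by auto
  moreover have "a = 0"
    using lab[OF sl(4)] o s_le k bd by auto
  ultimately show ?thesis
    using bd by simp
qed

text \<open>Position \<open>i\<close> receives \<open>(0, i + 1)\<close> because
  \<open>(0, 1)\<close> is a side of the polygon, present from the start at position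
  \<open>t + 1\<close>.\<close>

lemma fan_seed:
  assumes "k < s"
  shows "\<exists>S\<in>mutation_class K h F S0. \<exists>P. tri S P \<and> (\<forall>i\<in>{1..t + s}. P i = (if i \<le> k then (0, Suc i) else P0 i))"
  using assms
proof (induction k)
  case 0
  show ?case
    by (rule bexI[OF _ mutation_class.initial], rule exI[of _ P0]) (use tri_S0 in auto)
next
  case (Suc k)
  then obtain S P where S: "S \<in> mutation_class K h F S0" "tri S P"
      and P: "\<And>i. i \<in> {1..t + s} \<Longrightarrow> P i = (if i \<le> k then (0, Suc i) else P0 i)"
    by auto
  have k: "Suc k \<in> {1..<s}" using Suc.prems by simp
  obtain a b c d \<sigma> \<kappa>' where q: "quad S P (Suc k) a b c d \<sigma> \<kappa>'"
    using triD(10)[OF S(2) k] by blast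
  have \<kappa>': "\<kappa>' = (0, Suc (Suc k))"
    using fan_flip[OF S(2) P Suc.prems q] .
  have "mutate K h F (Suc k) S \<in> mutation_class K h F S0"
    by (rule mutation_class.step[OF S(1)]) (use k triD(2)[OF S(2)] in simp)
  moreover have "tri (mutate K h F (Suc k) S) (P(Suc k := \<kappa>'))"
    by (rule tri_mutate[OF S(2) k q])
  moreover have "(P(Suc k := \<kappa>')) i = (if i \<le> Suc k then (0, Suc i) else P0 i)" if "i \<in> {1..t + s}" for i
    using P[OF that] \<kappa>' by auto
  ultimately show ?case by blast
qed

section \<open>The cluster variables generate exactly the cell\<close>

abbreviation "cv \<equiv> cluster_variables K h F S0"

lemma cv_intro: "S \<in> mutation_class K h F S0 \<Longrightarrow> tri S P \<Longrightarrow> i \<in> {1..t + s} \<Longrightarrow> nn (P i) \<in> cv"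
  unfolding cluster_variables_def
proof (rule UN_I)
  assume "tri S P" "i \<in> {1..t + s}"
  then show "nn (P i) \<in> sd_cluster S ` positions S"
    using triD(3)[of S P i] positions_tri[of S P] by (metis imageI)
qed

text \<open>Labels ending in \<open>Suc t\<close> start at a positive column because
  \<open>(0, Suc t)\<close> labels no position, so \<open>N_img\<close> applies to every
  label.\<close>

lemma cv_img: "cv \<subseteq> j ` img"
proof
  fix x assume "x \<in> cv"
  then obtain S i where S: "S \<in> mutation_class K h F S0" "i \<in> positions S" "x = sd_cluster S i"
    unfolding cluster_variables_def by blast
  obtain P where P: "tri S P"
    using mutation_class_tri[OF tri_S0 S(1)] by blast
  have i: "i \<in> {1..t + s}"
    using S(2) unfolding positions_tri[OF P] .
  have "N s (fst (P i)) (snd (P i)) \<in> img"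
  proof (rule N_img)
    show "fst (P i) < snd (P i)"
      using triD(6)[OF P i] by (simp add: va_def)
    show "snd (P i) \<le> s \<or> 1 \<le> fst (P i) \<and> fst (P i) \<le> t"
      using triD(6)[OF P i] triD(7)[OF P i] by (cases "P i") (auto simp: va_def)
  qed
  then show "x \<in> j ` img"
    unfolding S(3) triD(3)[OF P i] nn_def by blast
qed

text \<open>Up to a scalar, \<open>X 2 1\<close> is the side \<open>(0, 1)\<close> of the initial
  seed, and for \<open>l \<ge> 2\<close> the label \<open>(0, l)\<close> sits at position
  \<open>l - 1\<close> of the seed reached after \<open>l - 1\<close> flips.\<close>

lemma gens_cv: "j ` gens \<subseteq> generated_algebra K F cv"
proof -
  have 1: "j (X 1 i) \<in> generated_algebra K F cv" if "i \<in> {1..t}" for i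
  proof -
    have "nn (P0 i) \<in> cv"
      by (rule cv_intro[OF mutation_class.initial tri_S0]) (use that in simp)
    then show ?thesis
      unfolding nn_row[OF that, symmetric] using that by (intro generated_algebra.incl) (simp add: P0_def)
  qed
  have 2: "j (X 2 l) \<in> generated_algebra K F cv" if l: "l \<in> {1..s}" for l
  proof -
    have "nn (0, l) \<in> cv"
    proof (cases "l = 1")
      case True
      have "nn (P0 (t + 1)) \<in> cv"
        by (rule cv_intro[OF mutation_class.initial tri_S0]) (use s_pos in simp)
      then show ?thesis using True by (simp add: P0_def)
    next
      case False
      then have "l - 1 < s" "l - 1 \<in> {1..t + s}" using l by auto
      then obtain S P where S: "S \<in> mutation_class K h F S0" "tri S P"
        and P: "\<forall>i\<in>{1..t + s}. P i = (if i \<le> l - 1 then (0, Suc i) else P0 i)"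
        using fan_seed by blast
      have "nn (P (l - 1)) \<in> cv"
        by (rule cv_intro[OF S]) fact
      moreover have "P (l - 1) = (0, l)"
        using P \<open>l - 1 \<in> {1..t + s}\<close> l by simp
      ultimately show ?thesis by simp
    qed
    then show ?thesis
      unfolding nn_first(2)[OF l] by (intro generated_algebra.smult generated_algebra.incl pw_in)
  qed
  show ?thesis using 1 2 by blast
qed

lemma generated_cv: "generated_algebra K F cv = (j \<circ> psi) ` carrier A"
proof -
  have "generated_algebra K F cv = generated_algebra K F (j ` gens)"
  proof
    show "generated_algebra K F cv \<subseteq> generated_algebra K F (j ` gens)"
      by (rule F.generated_algebra_mono_closed) (use cv_img img_generated in simp)
    show "generated_algebra K F (j ` gens) \<subseteq> generated_algebra K F cv"
      by (rule F.generated_algebra_mono_closed[OF gens_cv])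
  qed
  also have "\<dots> = (j \<circ> psi) ` carrier A"
    unfolding img_generated[symmetric] img_def image_comp ..
  finally show ?thesis .
qed

lemma type_S0: "has_cluster_type S0 (s - 1) dynkin_A"
  unfolding has_cluster_type_def
proof (rule bexI[OF _ exch_mutation_class.initial])
  have e: "{1..s - 1} = {1..<s}" by auto
  show "is_orientation (sd_mutable S0) (sd_exch S0) (s - 1) dynkin_A"
    unfolding is_orientation_def e S0_simps(3)
  proof (intro exI[of _ id] conjI ballI)
    fix i k assume ik: "i \<in> {1..<s}" "k \<in> {1..<s}"
    show "arrows (sd_exch S0) (id i) (id k) + arrows (sd_exch S0) (id k) (id i) = (if dynkin_A i k then 1 else 0)"
      unfolding arrows_def id_apply S0_exch[OF ik] S0_exch[OF ik(2,1)] dynkin_A_def by auto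
  qed simp
qed

end

context schubert_cell
begin

lemma cluster_structure: "quantum_cluster_algebra_of_type K (h \<otimes>\<^bsub>K\<^esub> h) h A (s - 1) dynkin_A"
proof -
  obtain F :: "('a, (((nat \<times> nat) list \<Rightarrow> 'a) set \<times> ((nat \<times> nat) list \<Rightarrow> 'a) set) set) module" and j
    where F: "assoc_algebra K F" "skew_field F" "j \<in> algebra_hom K R.T F" "inj_on j (carrier R.T)"
      "skew_field_of_fractions K A F (j \<circ> psi)"
    by (rule fraction_field) blast
  interpret cell_fractions K h m s t F j
    by (intro cell_fractions.intro cell_fractions_axioms.intro schubert_cell_axioms F)
  interpret D: domain_algebra K A
    by (rule V.domain)
  have domain: "noncomm_domain A"
    unfolding noncomm_domain_def
  proof (rule conjI[OF A.A.ring_axioms], rule conjI[OF D.one_not_zero_A], rule ballI, rule ballI, rule impI)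
    fix a b assume "a \<in> carrier A" "b \<in> carrier A" "a \<otimes>\<^bsub>A\<^esub> b = \<zero>\<^bsub>A\<^esub>"
    then show "a = \<zero>\<^bsub>A\<^esub> \<or> b = \<zero>\<^bsub>A\<^esub>" by (rule D.integral_A)
  qed
  have seed: "skew_field_of_fractions K A F (j \<circ> psi) \<and> quantum_seed K (h \<otimes>\<^bsub>K\<^esub> h) F S0 \<and>
      generated_algebra K F (cluster_variables K h F S0) = (j \<circ> psi) ` carrier A \<and> has_cluster_type S0 (s - 1) dynkin_A"
    by (rule conjI[OF F(5) conjI[OF quantum_seed_S0[OF F(5)] conjI[OF generated_cv type_S0]]])
  have "\<exists>(F :: ('a, (((nat \<times> nat) list \<Rightarrow> 'a) set \<times> ((nat \<times> nat) list \<Rightarrow> 'a) set) set) module) \<iota> S.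
      skew_field_of_fractions K A F \<iota> \<and> quantum_seed K (h \<otimes>\<^bsub>K\<^esub> h) F S \<and>
      generated_algebra K F (cluster_variables K h F S) = \<iota> ` carrier A \<and> has_cluster_type S (s - 1) dynkin_A"
    by (rule exI[of _ F], rule exI[of _ "j \<circ> psi"], rule exI[of _ S0], rule seed)
  then show ?thesis
    unfolding quantum_cluster_algebra_of_type_def
    by (rule conjI[OF A_algebra conjI[OF domain conjI[OF V.noetherian]]])
qed

end

theorem theorem12:
  fixes K :: "('k, 'm) ring_scheme" and q h :: 'k and n s t :: nat
  assumes "field K"
    and "q \<in> carrier K" and "q \<noteq> \<zero>\<^bsub>K\<^esub>"
    and "h \<in> carrier K" and "h \<otimes>\<^bsub>K\<^esub> h = q"
    and "1 \<le> s" and "s \<le> t" and "t \<le> n - 2"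
  shows "quantum_cluster_algebra_of_type K q h (quantum_schubert_cell K q n (t, s)) (s - 1) dynkin_A"
proof -
  interpret K: field K by fact
  have "h \<noteq> \<zero>\<^bsub>K\<^esub>"
    using assms by auto
  then interpret schubert_cell K h "n - 2" s t
    using assms by unfold_locales auto
  \<comment> \<open>\<open>n - 2\<close> is a subtraction of natural numbers; it is exact because it
    is at least \<open>1\<close>.\<close>
  have n: "n - 2 + 2 = n"
    using assms by simp
  show ?thesis
    unfolding schubert_eq[unfolded n assms(5)] by (rule cluster_structure[unfolded assms(5)])
qed

end
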